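(* Let $N>4$ and let $\Omega\subset\mathbb{R}^N$ be a bounded smooth domain with $0\in\Omega$. Let $\mathcal{K}\subset\mathbb{R}^N$ be a fixed compact set and, for all $\varepsilon>0$, let $K_\varepsilon=\varepsilon\mathcal{K}$. Let $\lambda_J$ be an eigenvalue of $\Delta^2$ in $\Omega$ with Navier boundary conditions and let $u_J\in H^2_\vartheta(\Omega)$ be a corresponding eigenfunction normalized in $L^2(\Omega)$. Let $\gamma$ and $U_0$ be the vanishing order and the limiting homogeneous polynomial of $u_J$ at $0$ (as defined in the context). Then $$\mathrm{cap}_{2,\vartheta,\Omega}(K_\varepsilon,u_J)=\varepsilon^{N-4+2\gamma}\big(\mathrm{cap}_{2,\mathbb{R}^N}(\mathcal{K},U_0)+o(1)\big)\qquad\text{as }\varepsilon\to0.$$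
   Context: Functions are real valued. $H^2_\vartheta(\Omega)=H^2(\Omega)\cap H^1_0(\Omega)$. For $K\subset\Omega$ compact, $H^2_{\vartheta,0}(\Omega\setminus K)$ is the closure in $H^2_\vartheta(\Omega)$ (with the $H^2$ norm) of the set of $u\in C^2(\overline\Omega)$ with $u|_{\partial\Omega}=0$ whose support is disjoint from some open neighbourhood of $K$. Eigenpair (Navier, i.e. $\Delta^2u=\lambda u$ in $\Omega$, $u=\Delta u=0$ on $\partial\Omega$): $u_J\in H^2_\vartheta(\Omega)\setminus\{0\}$ and $\int_\Omega\Delta u_J\,\Delta\varphi=\lambda_J\int_\Omega u_J\varphi$ for all $\varphi\in H^2_\vartheta(\Omega)$. Capacity in $\Omega$: for $K\subset\Omega$ compact and $u\in H^2_\vartheta(\Omega)$, $\mathrm{cap}_{2,\vartheta,\Omega}(K,u):=\inf\{\int_\Omega|\Delta f|^2: f\in H^2_\vartheta(\Omega),\ f-u\in H^2_{\vartheta,0}(\Omega\setminus K)\}$. (Note $K_\varepsilon\subset\Omega$ for $\varepsilon$ small.) Capacity in $\mathbb{R}^N$ ($N>4$): $D^{2,2}_0(\mathbb{R}^N)$ is the completion of $C_0^\infty(\mathbb{R}^N)$ for the norm $\|\Delta\cdot\|_{L^2(\mathbb{R}^N)}$ (a space of functions, embedded in $L^{2N/(N-4)}(\mathbb{R}^N)$), and $D^{2,2}_0(\mathbb{R}^N\setminus\mathcal{K})$ is the closure in it of $C_0^\infty(\mathbb{R}^N\setminus\mathcal{K})$. For $u\in H^2_{loc}(\mathbb{R}^N)$,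 $\mathrm{cap}_{2,\mathbb{R}^N}(\mathcal{K},u):=\inf\{\int_{\mathbb{R}^N}|\Delta f|^2: f\in D^{2,2}_0(\mathbb{R}^N),\ f-\eta u\in D^{2,2}_0(\mathbb{R}^N\setminus\mathcal{K})\}$, where $\eta\in C_0^\infty(\mathbb{R}^N)$ is any function equal to $1$ in a neighbourhood of $\mathcal{K}$ (the value does not depend on $\eta$). $\gamma$ and $U_0$: since $u_J$ is analytic and nontrivial near $0$, there exist $\gamma\in\mathbb{N}$ (possibly $0$) and a $\gamma$-homogeneous polynomial $U_0\not\equiv0$ with $\Delta^2U_0=0$ such that $u_J(\varepsilon\,\cdot)/\varepsilon^\gamma\to U_0$ in $H^2(B_R(0))$ as $\varepsilon\to0$, for all $R>0$. *)

theory Defs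
  imports "HOL-Analysis.Analysis" "HOL-Library.Landau_Symbols"
begin

section \<open>Classical derivatives and smooth functions\<close>

text \<open>A multi-index is encoded as a list of coordinate directions, so that a mixed derivative is
  represented once for every order of differentiation.\<close>

definition dirs :: "nat \<Rightarrow> 'a::euclidean_space list set" where
  "dirs k = {bs. set bs \<subseteq> Basis \<and> length bs \<le> k}"

primrec partial_deriv :: "'a::euclidean_space list \<Rightarrow> ('a \<Rightarrow> real) \<Rightarrow> 'a \<Rightarrow> real" where
  "partial_deriv [] f = f"
| "partial_deriv (b # bs) f = (\<lambda>x. frechet_derivative (partial_deriv bs f) (at x) b)"

definition laplacian :: "('a::euclidean_space \<Rightarrow> real) \<Rightarrow> 'a \<Rightarrow> real" where
  "laplacian f x = (\<Sum>b\<in>Basis. partial_deriv [b, b] f x)"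

text \<open>Intended for open \<open>S\<close> only.\<close>

definition Ck_on :: "nat \<Rightarrow> 'a::euclidean_space set \<Rightarrow> ('a \<Rightarrow> real) \<Rightarrow> bool" where
  "Ck_on k S f \<longleftrightarrow>
     (\<forall>bs\<in>dirs k. continuous_on S (partial_deriv bs f)) \<and>
     (\<forall>bs\<in>dirs k. length bs < k \<longrightarrow> partial_deriv bs f differentiable_on S)"

definition smooth_on :: "'a::euclidean_space set \<Rightarrow> ('a \<Rightarrow> real) \<Rightarrow> bool" where
  "smooth_on S f \<longleftrightarrow> (\<forall>k. Ck_on k S f)"

text \<open>\<open>C\<^sup>k\<close> up to the boundary: the derivatives in the open set \<open>S\<close> extend continuously to the closure.\<close>

definition Ck_closure :: "nat \<Rightarrow> 'a::euclidean_space set \<Rightarrow> ('a \<Rightarrow> real) \<Rightarrow> bool" where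
  "Ck_closure k S f \<longleftrightarrow>
     Ck_on k S f \<and> continuous_on (closure S) f \<and>
     (\<forall>bs\<in>dirs k. \<exists>g. continuous_on (closure S) g \<and> (\<forall>x\<in>S. g x = partial_deriv bs f x))"

definition test_functions :: "'a::euclidean_space set \<Rightarrow> ('a \<Rightarrow> real) set" where
  "test_functions S =
     {\<phi>. smooth_on UNIV \<phi> \<and> compact (closure {x. \<phi> x \<noteq> 0}) \<and> closure {x. \<phi> x \<noteq> 0} \<subseteq> S}"

text \<open>Near each boundary point the domain is, in suitable orthonormal coordinates with \<open>\<nu>\<close> as last
  axis, the part above the graph of a smooth function of the coordinates orthogonal to \<open>\<nu>\<close>.\<close>

definition smooth_bounded_domain :: "'a::euclidean_space set \<Rightarrow> bool" where
  "smooth_bounded_domain \<Omega> \<longleftrightarrow>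
     open \<Omega> \<and> connected \<Omega> \<and> \<Omega> \<noteq> {} \<and> bounded \<Omega> \<and>
     (\<forall>p\<in>frontier \<Omega>. \<exists>r>0. \<exists>\<nu> g. norm \<nu> = 1 \<and> smooth_on UNIV g \<and>
        \<Omega> \<inter> ball p r = {x \<in> ball p r. x \<bullet> \<nu> > g (x - (x \<bullet> \<nu>) *\<^sub>R \<nu>)})"

section \<open>Lebesgue and Sobolev spaces\<close>

text \<open>Elements of the spaces over \<open>S\<close> are represented by functions on the whole space; only their
  values almost everywhere in \<open>S\<close> matter.\<close>

definition Lp :: "real \<Rightarrow> 'a::euclidean_space set \<Rightarrow> ('a \<Rightarrow> real) set" where
  "Lp p S = {u. u \<in> borel_measurable (lebesgue_on S) \<and>
                integrable (lebesgue_on S) (\<lambda>x. \<bar>u x\<bar> powr p)}"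

definition Lp_norm :: "real \<Rightarrow> 'a::euclidean_space set \<Rightarrow> ('a \<Rightarrow> real) \<Rightarrow> real" where
  "Lp_norm p S u = (LINT x|lebesgue_on S. \<bar>u x\<bar> powr p) powr (1 / p)"

definition locally_integrable_on :: "('a::euclidean_space \<Rightarrow> real) \<Rightarrow> 'a set \<Rightarrow> bool" where
  "locally_integrable_on u S \<longleftrightarrow> (\<forall>C. compact C \<and> C \<subseteq> S \<longrightarrow> u absolutely_integrable_on C)"

definition has_weak_deriv ::
    "'a::euclidean_space set \<Rightarrow> 'a list \<Rightarrow> ('a \<Rightarrow> real) \<Rightarrow> ('a \<Rightarrow> real) \<Rightarrow> bool" where
  "has_weak_deriv S bs u v \<longleftrightarrow>
     locally_integrable_on u S \<and> locally_integrable_on v S \<and>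
     (\<forall>\<phi>\<in>test_functions S.
        (LINT x|lebesgue_on S. u x * partial_deriv bs \<phi> x) =
        (-1) ^ length bs * (LINT x|lebesgue_on S. v x * \<phi> x))"

text \<open>The choice is unique up to null sets, whenever a weak derivative exists.\<close>

definition weak_deriv ::
    "'a::euclidean_space set \<Rightarrow> 'a list \<Rightarrow> ('a \<Rightarrow> real) \<Rightarrow> 'a \<Rightarrow> real" where
  "weak_deriv S bs u = (SOME v. has_weak_deriv S bs u v)"

definition has_weak_laplacian ::
    "'a::euclidean_space set \<Rightarrow> ('a \<Rightarrow> real) \<Rightarrow> ('a \<Rightarrow> real) \<Rightarrow> bool" where
  "has_weak_laplacian S u v \<longleftrightarrow>
     locally_integrable_on u S \<and> locally_integrable_on v S \<and>
     (\<forall>\<phi>\<in>test_functions S.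
        (LINT x|lebesgue_on S. u x * laplacian \<phi> x) = (LINT x|lebesgue_on S. v x * \<phi> x))"

definition weak_laplacian ::
    "'a::euclidean_space set \<Rightarrow> ('a \<Rightarrow> real) \<Rightarrow> 'a \<Rightarrow> real" where
  "weak_laplacian S u = (SOME v. has_weak_laplacian S u v)"

definition Hk :: "nat \<Rightarrow> 'a::euclidean_space set \<Rightarrow> ('a \<Rightarrow> real) set" where
  "Hk k S = {u \<in> Lp 2 S. \<forall>bs\<in>dirs k. \<exists>v\<in>Lp 2 S. has_weak_deriv S bs u v}"

definition Hk_norm :: "nat \<Rightarrow> 'a::euclidean_space set \<Rightarrow> ('a \<Rightarrow> real) \<Rightarrow> real" where
  "Hk_norm k S u = sqrt (\<Sum>bs\<in>dirs k. LINT x|lebesgue_on S. (weak_deriv S bs u x)\<^sup>2)"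

definition tendsto_Hk ::
    "nat \<Rightarrow> 'a::euclidean_space set \<Rightarrow> ('b \<Rightarrow> 'a \<Rightarrow> real) \<Rightarrow> ('a \<Rightarrow> real) \<Rightarrow> 'b filter \<Rightarrow> bool" where
  "tendsto_Hk k S v u F \<longleftrightarrow>
     u \<in> Hk k S \<and> (\<forall>\<^sub>F i in F. v i \<in> Hk k S) \<and>
     ((\<lambda>i. Hk_norm k S (\<lambda>x. v i x - u x)) \<longlongrightarrow> 0) F"

definition H10 :: "'a::euclidean_space set \<Rightarrow> ('a \<Rightarrow> real) set" where
  "H10 S = {u \<in> Hk 1 S. \<forall>e>0. \<exists>\<phi>\<in>test_functions S. Hk_norm 1 S (\<lambda>x. u x - \<phi> x) < e}"

definition H2_theta :: "'a::euclidean_space set \<Rightarrow> ('a \<Rightarrow> real) set" where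
  "H2_theta \<Omega> = Hk 2 \<Omega> \<inter> H10 \<Omega>"

text \<open>\<open>H2_theta_0 \<Omega> K\<close> is the space written \<open>H\<^sup>2\<close> with subscripts \<open>\<vartheta>,0\<close> over \<open>\<Omega> - K\<close>.\<close>

definition H2_theta_0 :: "'a::euclidean_space set \<Rightarrow> 'a set \<Rightarrow> ('a \<Rightarrow> real) set" where
  "H2_theta_0 \<Omega> K =
     {u \<in> H2_theta \<Omega>. \<forall>e>0. \<exists>v.
        Ck_closure 2 \<Omega> v \<and> (\<forall>x\<in>frontier \<Omega>. v x = 0) \<and>
        (\<exists>V. open V \<and> K \<subseteq> V \<and> closure {x \<in> closure \<Omega>. v x \<noteq> 0} \<inter> V = {}) \<and>
        Hk_norm 2 \<Omega> (\<lambda>x. u x - v x) < e}"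

section \<open>Navier eigenpairs and capacities\<close>

definition navier_eigenpair :: "'a::euclidean_space set \<Rightarrow> real \<Rightarrow> ('a \<Rightarrow> real) \<Rightarrow> bool" where
  "navier_eigenpair \<Omega> lam u \<longleftrightarrow>
     u \<in> H2_theta \<Omega> \<and> \<not> (AE x in lebesgue_on \<Omega>. u x = 0) \<and>
     (\<forall>\<phi>\<in>H2_theta \<Omega>.
        (LINT x|lebesgue_on \<Omega>. weak_laplacian \<Omega> u x * weak_laplacian \<Omega> \<phi> x) =
        lam * (LINT x|lebesgue_on \<Omega>. u x * \<phi> x))"

definition cap_theta :: "'a::euclidean_space set \<Rightarrow> 'a set \<Rightarrow> ('a \<Rightarrow> real) \<Rightarrow> real" where
  "cap_theta \<Omega> K u =
     Inf {LINT x|lebesgue_on \<Omega>. (weak_laplacian \<Omega> f x)\<^sup>2 | f.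
            f \<in> H2_theta \<Omega> \<and> (\<lambda>x. f x - u x) \<in> H2_theta_0 \<Omega> K}"

text \<open>For dimension \<open>N > 4\<close> the completion of the test functions in the norm \<open>\<parallel>\<Delta>\<phi>\<parallel>\<^sub>2\<close> is realised as a
  function space inside \<open>L\<^sup>p\<close> with \<open>p = 2N/(N-4)\<close>: its elements are the \<open>L\<^sup>p\<close> limits of sequences
  that are Cauchy in that norm.\<close>

definition D22 :: "('a::euclidean_space \<Rightarrow> real) set" where
  "D22 = (let p = 2 * real DIM('a) / (real DIM('a) - 4) in
     {f \<in> Lp p UNIV. \<exists>\<phi> :: nat \<Rightarrow> 'a \<Rightarrow> real.
        (\<forall>n. \<phi> n \<in> test_functions UNIV) \<and>
        (\<forall>e>0. \<exists>M. \<forall>m\<ge>M. \<forall>n\<ge>M. Lp_norm 2 UNIV (laplacian (\<lambda>x. \<phi> m x - \<phi> n x)) < e) \<and>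
        (\<lambda>n. Lp_norm p UNIV (\<lambda>x. \<phi> n x - f x)) \<longlonglongrightarrow> 0})"

definition D22_norm :: "('a::euclidean_space \<Rightarrow> real) \<Rightarrow> real" where
  "D22_norm f = Lp_norm 2 UNIV (weak_laplacian UNIV f)"

text \<open>\<open>D22_0 K\<close> is the closure of the test functions on the complement of \<open>K\<close>.\<close>

definition D22_0 :: "'a::euclidean_space set \<Rightarrow> ('a \<Rightarrow> real) set" where
  "D22_0 K = {f \<in> D22. \<forall>e>0. \<exists>\<phi>\<in>test_functions (- K). D22_norm (\<lambda>x. f x - \<phi> x) < e}"

definition cutoff :: "'a::euclidean_space set \<Rightarrow> ('a \<Rightarrow> real) \<Rightarrow> bool" where
  "cutoff K \<eta> \<longleftrightarrow> \<eta> \<in> test_functions UNIV \<and> (\<exists>V. open V \<and> K \<subseteq> V \<and> (\<forall>x\<in>V. \<eta> x = 1))"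

text \<open>The capacity does not depend on the cutoff \<open>\<eta>\<close>, which is kept as a parameter.\<close>

definition cap_space ::
    "('a::euclidean_space \<Rightarrow> real) \<Rightarrow> 'a set \<Rightarrow> ('a \<Rightarrow> real) \<Rightarrow> real" where
  "cap_space \<eta> K u =
     Inf {LINT x|lebesgue. (weak_laplacian UNIV f x)\<^sup>2 | f.
            f \<in> D22 \<and> (\<lambda>x. f x - \<eta> x * u x) \<in> D22_0 K}"

definition homogeneous_polynomial :: "nat \<Rightarrow> ('a::euclidean_space \<Rightarrow> real) \<Rightarrow> bool" where
  "homogeneous_polynomial d P \<longleftrightarrow>
     real_polynomial_function P \<and> (\<forall>t x. P (t *\<^sub>R x) = t ^ d * P x)"

text \<open>\<open>vanishing_profile u \<gamma> U\<close>: \<open>\<gamma>\<close> is the vanishing order of \<open>u\<close> at the origin and \<open>U\<close> its blow-up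
  limit, a nontrivial biharmonic homogeneous polynomial.\<close>

definition vanishing_profile ::
    "('a::euclidean_space \<Rightarrow> real) \<Rightarrow> nat \<Rightarrow> ('a \<Rightarrow> real) \<Rightarrow> bool" where
  "vanishing_profile u \<gamma> U \<longleftrightarrow>
     homogeneous_polynomial \<gamma> U \<and> (\<exists>x. U x \<noteq> 0) \<and>
     (\<forall>x. laplacian (laplacian U) x = 0) \<and>
     (\<forall>R>0. tendsto_Hk 2 (ball 0 R) (\<lambda>\<epsilon> x. u (\<epsilon> *\<^sub>R x) / \<epsilon> ^ \<gamma>) U (at_right (0::real)))"

end

theory Submission
  imports Defs
begin

text \<open>A dilation by \<open>\<epsilon>\<close> multiplies the energy \<open>\<integral>\<bar>\<Delta>f\<bar>\<^sup>2\<close> by a power of \<open>\<epsilon>\<close>, so both capacities are compared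
  on the blow-up scale, where \<open>u(\<epsilon>x)/\<epsilon>\<^sup>\<gamma>\<close> is close to \<open>U\<^sub>0\<close> near \<open>\<K>\<close>. Almost optimal competitors in the whole
  space are compactly supported corrections of the cut-off \<open>U\<^sub>0\<close> and transplant to \<open>\<Omega>\<close>; that the transplanted
  functions are admissible rests on approximating \<open>u\<close> by functions that are smooth up to the boundary and vanish
  on it, which an odd reflection across the boundary and a mollification provide.

  Conversely, a competitor in \<open>\<Omega>\<close> vanishes on the boundary only to first order and cannot be extended by zero.
  It is multiplied by one of \<open>m\<close> cutoffs whose gradients live on disjoint annuli between the scales \<open>\<epsilon>\<close> and \<open>1\<close>.
  Testing \<open>\<Delta>f\<close> with \<open>f/(\<bar>x\<bar>\<^sup>2+\<delta>\<^sup>2)\<close> gives a Hardy inequality for \<open>N > 4\<close> under Navier conditions, which bounds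
  the sum of all the cutoff errors by the energy; hence one of the cutoffs increases the energy norm at most by
  the factor \<open>1 + \<surd>(C/m)\<close>, and \<open>m\<close> is arbitrary.\<close>

text \<open>A cutoff at one single scale is not enough: the Hardy inequality is scale invariant, so
  it bounds the commutator terms by a constant times the energy, and the two capacities would be
  comparable only up to a fixed factor. The factor tends to 1 because the \<open>m\<close> annuli
  share one and the same weighted integral. The number \<open>m\<close> is fixed before \<epsilon>,
  since the outermost annulus has a radius of order \<open>4 ^ m\<close> times \<epsilon> and must
  still fit into the domain.

  All comparisons are made between square roots of energies.

  Odd reflection preserves second order regularity because the tangential derivatives of a function
  that vanishes on the boundary vanish there too, while the derivative across the boundary becomes
  even and does not jump. Mollification destroys the oddness, which is restored by antisymmetrising
  once more.\<close>

section \<open>Directional derivatives and smooth functions on the whole space\<close>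

definition dir_deriv :: "'a::euclidean_space \<Rightarrow> ('a \<Rightarrow> real) \<Rightarrow> 'a \<Rightarrow> real" where
  "dir_deriv e f x = frechet_derivative f (at x) e"

text \<open>Differentiation is peeled off next to \<open>f\<close>, so the sum, product and chain
  rules become inductions over \<open>n\<close> with \<open>f\<close> arbitrary. The lists of
  directions in \<open>Ck_on\<close> would require a product rule for every list;
  \<open>cdiff_iff_partial\<close> identifies the two notions on the whole space.\<close>

primrec cdiff :: "nat \<Rightarrow> ('a::euclidean_space \<Rightarrow> real) \<Rightarrow> bool" where
  "cdiff 0 f \<longleftrightarrow> continuous_on UNIV f"
| "cdiff (Suc n) f \<longleftrightarrow> (\<forall>x. f differentiable (at x)) \<and> (\<forall>b\<in>Basis. cdiff n (dir_deriv b f))"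

definition smooth :: "('a::euclidean_space \<Rightarrow> real) \<Rightarrow> bool" where
  "smooth f \<longleftrightarrow> (\<forall>n. cdiff n f)"

lemma partial_deriv_Cons: "partial_deriv (b # bs) f = dir_deriv b (partial_deriv bs f)"
  by (simp add: dir_deriv_def fun_eq_iff)

text \<open>\<open>partial_deriv\<close> keeps the derivative taken last at the head of the list,
  while \<open>cdiff\<close> removes the one taken first; splitting a list at its end reconciles the
  two recursions.\<close>

lemma partial_deriv_snoc: "partial_deriv (bs @ [b]) f = partial_deriv bs (dir_deriv b f)"
  by (induction bs) (simp_all add: dir_deriv_def[abs_def])

lemma dir_deriv_eqI: "(f has_derivative f') (at x) \<Longrightarrow> dir_deriv e f x = f' e"
  unfolding dir_deriv_def using frechet_derivative_at by metis

lemma has_derivative_dir_deriv: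
  "f differentiable (at x) \<Longrightarrow> (f has_derivative (\<lambda>e. dir_deriv e f x)) (at x)"
  unfolding dir_deriv_def using frechet_derivative_works by auto

lemma dir_deriv_expand:
  assumes "f differentiable (at x)"
  shows "dir_deriv e f x = (\<Sum>b\<in>Basis. (e \<bullet> b) * dir_deriv b f x)"
proof -
  interpret bounded_linear "\<lambda>e. dir_deriv e f x"
    using has_derivative_dir_deriv[OF assms] by (rule has_derivative_bounded_linear)
  have "dir_deriv e f x = dir_deriv (\<Sum>b\<in>Basis. (e \<bullet> b) *\<^sub>R b) f x"
    by (simp add: euclidean_representation)
  also have "\<dots> = (\<Sum>b\<in>Basis. (e \<bullet> b) * dir_deriv b f x)"
    by (subst sum) (simp add: scaleR)
  finally show ?thesis .
qed

lemma dir_deriv_cong_open: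
  assumes "open V" "x \<in> V" "\<And>y. y \<in> V \<Longrightarrow> f y = g y"
  shows "dir_deriv e f x = dir_deriv e g x"
proof -
  have "(f has_derivative D) (at x) \<longleftrightarrow> (g has_derivative D) (at x)" for D
    using assms by (metis has_derivative_transform_within_open)
  then show ?thesis unfolding dir_deriv_def frechet_derivative_def by simp
qed

lemma dir_deriv_const [simp]: "dir_deriv e (\<lambda>x. c) x = 0"
  using dir_deriv_eqI[OF has_derivative_const] by auto

lemma dir_deriv_zero_outside:
  assumes "x \<notin> closure {x. f x \<noteq> 0}"
  shows "dir_deriv e f x = 0"
proof -
  have "dir_deriv e f x = dir_deriv e (\<lambda>x. 0) x"
    by (rule dir_deriv_cong_open[of "- closure {x. f x \<noteq> 0}"])
       (use assms closure_subset[of "{x. f x \<noteq> 0}"] in \<open>auto simp: open_Compl\<close>)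
  then show ?thesis by simp
qed

lemma dir_deriv_add:
  "f differentiable (at x) \<Longrightarrow> g differentiable (at x) \<Longrightarrow>
    dir_deriv e (\<lambda>x. f x + g x) x = dir_deriv e f x + dir_deriv e g x"
  using dir_deriv_eqI[OF has_derivative_add[OF has_derivative_dir_deriv has_derivative_dir_deriv]] by auto

lemma dir_deriv_mult:
  "f differentiable (at x) \<Longrightarrow> g differentiable (at x) \<Longrightarrow>
    dir_deriv e (\<lambda>x. f x * g x) x = f x * dir_deriv e g x + dir_deriv e f x * g x"
  using dir_deriv_eqI[OF has_derivative_mult[OF has_derivative_dir_deriv has_derivative_dir_deriv]] by auto

lemma dir_deriv_cmult:
  "f differentiable (at x) \<Longrightarrow> dir_deriv e (\<lambda>x. c * f x) x = c * dir_deriv e f x"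
  by (subst dir_deriv_mult) auto

lemma dir_deriv_diff:
  "f differentiable (at x) \<Longrightarrow> g differentiable (at x) \<Longrightarrow>
    dir_deriv e (\<lambda>x. f x - g x) x = dir_deriv e f x - dir_deriv e g x"
  using dir_deriv_eqI[OF has_derivative_diff[OF has_derivative_dir_deriv has_derivative_dir_deriv]] by auto

lemma dir_deriv_minus:
  "f differentiable (at x) \<Longrightarrow> dir_deriv e (\<lambda>x. - f x) x = - dir_deriv e f x"
  using dir_deriv_cmult[of f x e "-1"] by simp

lemma dir_deriv_linear:
  "bounded_linear f \<Longrightarrow> dir_deriv e f x = f e"
  by (rule dir_deriv_eqI) (simp add: bounded_linear_imp_has_derivative)

lemma dir_deriv_compose_real:
  assumes "f differentiable (at x)" "(h has_real_derivative h') (at (f x))"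
  shows "dir_deriv e (\<lambda>x. h (f x)) x = h' * dir_deriv e f x"
proof -
  have "(h has_derivative (*) h') (at (f x))" using assms(2) by (simp add: has_field_derivative_def)
  from has_derivative_compose[OF has_derivative_dir_deriv[OF assms(1)] this]
  show ?thesis by (rule dir_deriv_eqI)
qed

lemma dir_deriv_compose:
  fixes \<tau> :: "'a::euclidean_space \<Rightarrow> 'b::euclidean_space"
  assumes "\<And>b. b \<in> Basis \<Longrightarrow> (\<lambda>x. \<tau> x \<bullet> b) differentiable (at x)" "f differentiable (at (\<tau> x))"
  shows "(\<lambda>x. f (\<tau> x)) differentiable (at x)"
    and "dir_deriv e (\<lambda>x. f (\<tau> x)) x =
           (\<Sum>b\<in>Basis. dir_deriv b f (\<tau> x) * dir_deriv e (\<lambda>x. \<tau> x \<bullet> b) x)"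
proof -
  define D where "D = (\<lambda>e. \<Sum>b\<in>Basis. dir_deriv e (\<lambda>x. \<tau> x \<bullet> b) x *\<^sub>R b)"
  have D: "(\<tau> has_derivative D) (at x)"
  proof (subst has_derivative_componentwise_within, intro ballI)
    fix b :: 'b assume b: "b \<in> Basis"
    have "D h \<bullet> b = dir_deriv h (\<lambda>x. \<tau> x \<bullet> b) x" for h
      using b by (simp add: D_def inner_sum_left inner_Basis if_distrib cong: if_cong)
    then show "((\<lambda>x. \<tau> x \<bullet> b) has_derivative (\<lambda>h. D h \<bullet> b)) (at x)"
      using has_derivative_dir_deriv[OF assms(1)[OF b]] by simp
  qed
  have c: "((\<lambda>x. f (\<tau> x)) has_derivative (\<lambda>h. dir_deriv (D h) f (\<tau> x))) (at x)"
    by (rule has_derivative_compose[OF D has_derivative_dir_deriv[OF assms(2)]])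
  then show "(\<lambda>x. f (\<tau> x)) differentiable (at x)" unfolding differentiable_def by blast
  have "dir_deriv (D e) f (\<tau> x) = (\<Sum>b\<in>Basis. (D e \<bullet> b) * dir_deriv b f (\<tau> x))"
    by (rule dir_deriv_expand[OF assms(2)])
  also have "\<dots> = (\<Sum>b\<in>Basis. dir_deriv b f (\<tau> x) * dir_deriv e (\<lambda>x. \<tau> x \<bullet> b) x)"
    by (intro sum.cong refl) (simp add: D_def inner_sum_left inner_Basis if_distrib cong: if_cong)
  finally show "dir_deriv e (\<lambda>x. f (\<tau> x)) x =
           (\<Sum>b\<in>Basis. dir_deriv b f (\<tau> x) * dir_deriv e (\<lambda>x. \<tau> x \<bullet> b) x)"
    using dir_deriv_eqI[OF c] by metis
qed

lemma cdiff_SucD: "cdiff (Suc n) f \<Longrightarrow> cdiff n f"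
proof (induction n arbitrary: f)
  case 0
  then show ?case
    by (auto intro!: continuous_at_imp_continuous_on differentiable_imp_continuous_within)
next
  case (Suc n)
  have "\<forall>b\<in>Basis. cdiff (Suc n) (dir_deriv b f)" using Suc.prems by (metis cdiff.simps(2))
  then have "\<forall>b\<in>Basis. cdiff n (dir_deriv b f)" using Suc.IH by blast
  then show ?case using Suc.prems by (metis cdiff.simps(2))
qed

lemma cdiff_differentiable: "cdiff (Suc n) f \<Longrightarrow> f differentiable (at x)"
  by simp

lemma cdiff_continuous: "cdiff n f \<Longrightarrow> continuous_on UNIV f"
  proof (induction n)
  case (Suc n)
  then show ?case using cdiff_SucD by blast
qed simp

lemma cdiff_const [simp]: "cdiff n (\<lambda>x. c)"
proof (induction n arbitrary: c)
  case (Suc n)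
  have "dir_deriv b (\<lambda>x. c) = (\<lambda>x. 0)" for b :: 'a by (simp add: fun_eq_iff)
  then show ?case using Suc by simp
qed simp

lemma cdiff_add: "cdiff n f \<Longrightarrow> cdiff n g \<Longrightarrow> cdiff n (\<lambda>x. f x + g x)"
proof (induction n arbitrary: f g)
  case (Suc n)
  have "dir_deriv b (\<lambda>x. f x + g x) = (\<lambda>x. dir_deriv b f x + dir_deriv b g x)" for b
    using Suc.prems by (auto simp: fun_eq_iff intro!: dir_deriv_add)
  then show ?case using Suc by auto
qed (auto intro: continuous_intros)

lemma cdiff_mult: "cdiff n f \<Longrightarrow> cdiff n g \<Longrightarrow> cdiff n (\<lambda>x. f x * g x)"
proof (induction n arbitrary: f g)
  case (Suc n)
  have "dir_deriv b (\<lambda>x. f x * g x) = (\<lambda>x. f x * dir_deriv b g x + dir_deriv b f x * g x)" for b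
    using Suc.prems by (auto simp: fun_eq_iff intro!: dir_deriv_mult)
  moreover have "cdiff n f" "cdiff n g" using Suc.prems cdiff_SucD by blast+
  ultimately show ?case using Suc by (auto intro!: cdiff_add)
qed (auto intro: continuous_intros)

lemma cdiff_sum: "(\<And>i. i \<in> I \<Longrightarrow> cdiff n (f i)) \<Longrightarrow> cdiff n (\<lambda>x. \<Sum>i\<in>I. f i x)"
  by (induction I rule: infinite_finite_induct) (auto intro: cdiff_add)

lemma cdiff_dir_deriv:
  assumes "cdiff (Suc n) f"
  shows "cdiff n (dir_deriv e f)"
proof -
  have "dir_deriv e f = (\<lambda>x. \<Sum>b\<in>Basis. (e \<bullet> b) * dir_deriv b f x)"
    using assms dir_deriv_expand by (auto simp: fun_eq_iff)
  then show ?thesis using assms by (auto intro!: cdiff_sum cdiff_mult)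
qed

lemma cdiff_linear: "bounded_linear f \<Longrightarrow> cdiff n f"
proof (cases n)
  case 0
  then show "bounded_linear f \<Longrightarrow> ?thesis" by (simp add: linear_continuous_on)
next
  case (Suc m)
  assume f: "bounded_linear f"
  have "dir_deriv b f = (\<lambda>x. f b)" for b by (auto simp: fun_eq_iff dir_deriv_linear f)
  then show ?thesis using Suc f by (auto simp: bounded_linear_imp_differentiable)
qed

lemma cdiff_inverse:
  assumes "\<And>x. f x \<noteq> 0"
  shows "cdiff n f \<Longrightarrow> cdiff n (\<lambda>x. inverse (f x))"
proof (induction n)
  case 0
  then show ?case using assms by (auto intro!: continuous_intros)
next
  case (Suc n)
  have "dir_deriv b (\<lambda>x. inverse (f x)) x = (- inverse (f x) * inverse (f x)) * dir_deriv b f x" for b x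
    using Suc.prems assms
    by (intro dir_deriv_compose_real) (auto intro!: derivative_eq_intros simp: power2_eq_square)
  then have "dir_deriv b (\<lambda>x. inverse (f x)) =
      (\<lambda>x. ((-1) * (inverse (f x) * inverse (f x))) * dir_deriv b f x)" for b by (simp add: fun_eq_iff)
  moreover have "cdiff n (\<lambda>x. inverse (f x))" using Suc cdiff_SucD by blast
  moreover have "(\<lambda>x. inverse (f x)) differentiable (at x)" for x
    using Suc.prems assms by (auto intro!: differentiable_inverse)
  ultimately show ?case using Suc.prems
    by (simp only: cdiff.simps) (intro conjI allI ballI cdiff_mult cdiff_const; blast)
qed

lemma cdiff_compose:
  fixes \<tau> :: "'a::euclidean_space \<Rightarrow> 'b::euclidean_space"
  assumes "\<And>b. b \<in> Basis \<Longrightarrow> cdiff n (\<lambda>x. \<tau> x \<bullet> b)" "cdiff n f"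
  shows "cdiff n (\<lambda>x. f (\<tau> x))"
  using assms
proof (induction n arbitrary: f)
  case 0
  have "continuous_on UNIV \<tau>"
    by (subst continuous_on_componentwise) (use 0 in auto)
  then show ?case using 0 continuous_on_compose2[of UNIV f UNIV \<tau>] by simp
next
  case (Suc n)
  have d: "(\<lambda>x. \<tau> x \<bullet> b) differentiable (at x)" if "b \<in> Basis" for b x
    using Suc.prems(1)[OF that] by simp
  have f: "f differentiable (at x)" for x using Suc.prems(2) by simp
  have "dir_deriv e (\<lambda>x. f (\<tau> x)) =
      (\<lambda>x. \<Sum>b\<in>Basis. dir_deriv b f (\<tau> x) * dir_deriv e (\<lambda>x. \<tau> x \<bullet> b) x)" for e
    using dir_deriv_compose(2)[OF d f] by (auto simp: fun_eq_iff)
  moreover have "cdiff n (\<lambda>x. dir_deriv b f (\<tau> x))" if "b \<in> Basis" for b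
    using Suc that by (metis cdiff_SucD cdiff_dir_deriv)
  ultimately show ?case
    using Suc.prems dir_deriv_compose(1)[OF d f]
    by (auto intro!: cdiff_sum cdiff_mult)
qed

lemma cdiff_iff_partial:
  "cdiff k f \<longleftrightarrow> (\<forall>bs\<in>dirs k. continuous_on UNIV (partial_deriv bs f)) \<and>
     (\<forall>bs\<in>dirs k. length bs < k \<longrightarrow> partial_deriv bs f differentiable_on UNIV)" (is "_ \<longleftrightarrow> ?P k f \<and> ?Q k f")
proof (induction k arbitrary: f)
  case 0
  then show ?case by (auto simp: dirs_def)
next
  case (Suc k)
  have dirs: "dirs (Suc k) = insert [] {bs @ [b] |bs b. bs \<in> dirs k \<and> (b::'a) \<in> Basis}"
  proof -
    have "x = [] \<or> (\<exists>bs b. x = bs @ [b] \<and> bs \<in> dirs k \<and> b \<in> Basis)" if "x \<in> dirs (Suc k)" for x :: "'a list"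
      using that by (cases x rule: rev_cases) (auto simp: dirs_def)
    then show ?thesis by (auto simp: dirs_def)
  qed
  have P: "?P (Suc k) f \<longleftrightarrow> continuous_on UNIV f \<and> (\<forall>b\<in>Basis. ?P k (dir_deriv b f))"
    unfolding dirs by (auto simp flip: partial_deriv_snoc)
  have Q: "?Q (Suc k) f \<longleftrightarrow> f differentiable_on UNIV \<and> (\<forall>b\<in>Basis. ?Q k (dir_deriv b f))"
    unfolding dirs by (auto simp flip: partial_deriv_snoc)
  have "cdiff (Suc k) f \<longleftrightarrow> f differentiable_on UNIV \<and> (\<forall>b\<in>Basis. ?P k (dir_deriv b f) \<and> ?Q k (dir_deriv b f))"
    using Suc by (auto simp: differentiable_on_def)
  also have "\<dots> \<longleftrightarrow> ?P (Suc k) f \<and> ?Q (Suc k) f"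
    unfolding P Q using differentiable_imp_continuous_on by blast
  finally show ?case .
qed

lemma Ck_on_UNIV_iff: "Ck_on k UNIV f \<longleftrightarrow> cdiff k f"
  unfolding Ck_on_def cdiff_iff_partial ..

lemma smooth_on_UNIV_iff: "smooth_on UNIV f \<longleftrightarrow> smooth f"
  by (simp add: smooth_on_def smooth_def Ck_on_UNIV_iff)

lemma smooth_cdiff: "smooth f \<Longrightarrow> cdiff n f"
  by (simp add: smooth_def)

lemma smooth_differentiable: "smooth f \<Longrightarrow> f differentiable (at x)"
  using cdiff_differentiable smooth_cdiff by blast

lemma smooth_continuous: "smooth f \<Longrightarrow> continuous_on S f"
  using cdiff_continuous continuous_on_subset smooth_cdiff by blast

lemma smooth_const [simp]: "smooth (\<lambda>x. c)" by (simp add: smooth_def)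
lemma smooth_add: "smooth f \<Longrightarrow> smooth g \<Longrightarrow> smooth (\<lambda>x. f x + g x)" by (simp add: smooth_def cdiff_add)
lemma smooth_mult: "smooth f \<Longrightarrow> smooth g \<Longrightarrow> smooth (\<lambda>x. f x * g x)" by (simp add: smooth_def cdiff_mult)
lemma smooth_minus: "smooth f \<Longrightarrow> smooth (\<lambda>x. - f x)"
  using smooth_mult[OF smooth_const[of "-1"]] by simp
lemma smooth_diff: "smooth f \<Longrightarrow> smooth g \<Longrightarrow> smooth (\<lambda>x. f x - g x)"
  using smooth_add[OF _ smooth_minus] by simp
lemma smooth_sum: "(\<And>i. i \<in> I \<Longrightarrow> smooth (f i)) \<Longrightarrow> smooth (\<lambda>x. \<Sum>i\<in>I. f i x)"
  by (simp add: smooth_def cdiff_sum)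
lemma smooth_prod: "(\<And>i. i \<in> I \<Longrightarrow> smooth (f i)) \<Longrightarrow> smooth (\<lambda>x. \<Prod>i\<in>I. f i x)"
  by (induction I rule: infinite_finite_induct) (auto intro: smooth_mult)
lemma smooth_linear: "bounded_linear f \<Longrightarrow> smooth f" by (simp add: smooth_def cdiff_linear)
lemma smooth_inverse: "smooth f \<Longrightarrow> (\<And>x. f x \<noteq> 0) \<Longrightarrow> smooth (\<lambda>x. inverse (f x))"
  by (simp add: smooth_def cdiff_inverse)
lemma smooth_divide: "smooth f \<Longrightarrow> smooth g \<Longrightarrow> (\<And>x. g x \<noteq> 0) \<Longrightarrow> smooth (\<lambda>x. f x / g x)"
  by (simp add: divide_inverse smooth_mult smooth_inverse)
lemma smooth_dir_deriv: "smooth f \<Longrightarrow> smooth (dir_deriv e f)"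
  unfolding smooth_def using cdiff_dir_deriv by blast
lemma smooth_compose:
  fixes \<tau> :: "'a::euclidean_space \<Rightarrow> 'b::euclidean_space"
  shows "(\<And>b. b \<in> Basis \<Longrightarrow> smooth (\<lambda>x. \<tau> x \<bullet> b)) \<Longrightarrow> smooth f \<Longrightarrow> smooth (\<lambda>x. f (\<tau> x))"
  unfolding smooth_def using cdiff_compose by blast
lemma smooth_inner_left: "smooth (\<lambda>x. x \<bullet> c)"
  by (intro smooth_linear bounded_linear_inner_left)
lemma smooth_polynomial: "real_polynomial_function p \<Longrightarrow> smooth p"
  by (induction p rule: real_polynomial_function.induct) (auto intro: smooth_linear smooth_add smooth_mult)

lemma smooth_norm_sq: "smooth (\<lambda>x::'a::euclidean_space. x \<bullet> x)"
proof -
  have "(\<lambda>x::'a. x \<bullet> x) = (\<lambda>x. \<Sum>b\<in>Basis. (x \<bullet> b) * (x \<bullet> b))"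
    by (rule ext) (rule euclidean_inner)
  then show ?thesis by (simp only:) (intro smooth_sum smooth_mult smooth_inner_left)
qed

lemma smooth_compose_affine:
  fixes f :: "'a::euclidean_space \<Rightarrow> real"
  assumes "smooth f" shows "smooth (\<lambda>x. f (c *\<^sub>R x + t))"
  by (rule smooth_compose[OF _ assms])
     (simp add: inner_add_left, intro smooth_add smooth_mult smooth_const smooth_inner_left)

lemma dir_deriv_affine:
  fixes f :: "'a::euclidean_space \<Rightarrow> real"
  assumes "f differentiable (at (c *\<^sub>R x + t))"
  shows "dir_deriv e (\<lambda>x. f (c *\<^sub>R x + t)) x = c * dir_deriv e f (c *\<^sub>R x + t)"
proof -
  have "((\<lambda>x. c *\<^sub>R x + t) has_derivative (\<lambda>h. c *\<^sub>R h)) (at x)" by (auto intro!: derivative_eq_intros)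
  from dir_deriv_eqI[OF has_derivative_compose[OF this has_derivative_dir_deriv[OF assms]], of e]
  have "dir_deriv e (\<lambda>x. f (c *\<^sub>R x + t)) x = dir_deriv (c *\<^sub>R e) f (c *\<^sub>R x + t)" .
  also have "\<dots> = c * dir_deriv e f (c *\<^sub>R x + t)"
    using linear_scale[OF has_derivative_linear[OF has_derivative_dir_deriv[OF assms]], of c e] by simp
  finally show ?thesis .
qed

section \<open>Bump functions\<close>

text \<open>The family t^(-k) exp(-1/t), continued by 0 for t <= 0, is closed under differentiation
  up to linear combinations. Smoothness of the member \<open>k = 0\<close> is therefore proved for
  all \<open>k\<close> at once.\<close>

definition expinv :: "nat \<Rightarrow> real \<Rightarrow> real" where
  "expinv k t = (if t > 0 then inverse t ^ k * exp (- inverse t) else 0)"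

lemma expinv_tendsto_0: "(expinv k \<longlongrightarrow> 0) (at 0)"
proof -
  have "((\<lambda>x. x ^ k / exp x) \<longlongrightarrow> (0::real)) at_top" by (rule tendsto_power_div_exp_0)
  then have "((\<lambda>t. inverse t ^ k / exp (inverse t)) \<longlongrightarrow> (0::real)) (at_right 0)"
    by (rule filterlim_compose) (rule filterlim_inverse_at_top_right)
  then have r: "(expinv k \<longlongrightarrow> 0) (at_right 0)"
    by (rule Lim_transform_eventually)
       (auto simp: eventually_at_filter expinv_def exp_minus divide_inverse intro!: always_eventually)
  have l: "(expinv k \<longlongrightarrow> 0) (at_left 0)"
    by (rule Lim_transform_eventually[OF tendsto_const])
       (auto simp: eventually_at_filter expinv_def intro!: always_eventually)
  show ?thesis using l r by (simp add: filterlim_split_at)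
qed

lemma expinv_deriv:
  "(expinv k has_real_derivative (expinv (k + 2) t - real k * expinv (k + 1) t)) (at t)"
proof -
  consider "t > 0" | "t < 0" | "t = 0" by linarith
  then show ?thesis
  proof cases
    case 1
    have "((\<lambda>t. inverse t ^ k * exp (- inverse t)) has_real_derivative
        (expinv (k + 2) t - real k * expinv (k + 1) t)) (at t)"
      using 1
      by (auto intro!: derivative_eq_intros simp: expinv_def power2_eq_square algebra_simps)
         (cases k; simp add: field_simps)
    then show ?thesis
      by (rule has_field_derivative_transform_within_open[of _ _ _ "{0<..}"]) (use 1 in \<open>auto simp: expinv_def\<close>)
  next
    case 2
    have "((\<lambda>t. 0) has_real_derivative (expinv (k + 2) t - real k * expinv (k + 1) t)) (at t)"
      using 2 by (auto simp: expinv_def)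
    then show ?thesis
      by (rule has_field_derivative_transform_within_open[of _ _ _ "{..<0}"]) (use 2 in \<open>auto simp: expinv_def\<close>)
  next
    case 3
    \<comment> \<open>The difference quotient at 0 is again a member of the family, since the
      additional factor 1/h raises \<open>k\<close> by one.\<close>
    have "((\<lambda>h. (expinv k (0 + h) - expinv k 0) / h) \<longlongrightarrow> 0) (at 0)"
    proof (rule Lim_transform_eventually[OF expinv_tendsto_0[of "Suc k"]])
      show "\<forall>\<^sub>F h in at 0. expinv (Suc k) h = (expinv k (0 + h) - expinv k 0) / h"
        by (auto simp: expinv_def divide_inverse intro!: always_eventually)
    qed
    then show ?thesis using 3 by (simp add: DERIV_def expinv_def)
  qed
qed

lemma cdiff_expinv: "cdiff n q \<Longrightarrow> cdiff n (\<lambda>x. expinv k (q x))"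
proof (induction n arbitrary: k)
  case 0
  have "continuous_on UNIV (expinv k)"
    using expinv_deriv by (meson DERIV_isCont continuous_at_imp_continuous_on)
  then show ?case using 0 continuous_on_compose2[of UNIV "expinv k" UNIV q] by simp
next
  case (Suc n)
  have q: "q differentiable (at x)" for x using Suc.prems by simp
  have "dir_deriv b (\<lambda>x. expinv k (q x)) =
      (\<lambda>x. (expinv (k + 2) (q x) + (- real k) * expinv (k + 1) (q x)) * dir_deriv b q x)" for b
    using dir_deriv_compose_real[OF q expinv_deriv] by (simp add: fun_eq_iff)
  moreover have "cdiff n (\<lambda>x. expinv j (q x))" for j using Suc cdiff_SucD by blast
  moreover have "(\<lambda>x. expinv k (q x)) differentiable (at x)" for x
    using has_derivative_compose[OF has_derivative_dir_deriv[OF q]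
        expinv_deriv[unfolded has_field_derivative_def]] unfolding differentiable_def by blast
  ultimately show ?case using Suc.prems
    by (simp only: cdiff.simps) (intro conjI allI ballI cdiff_mult cdiff_add cdiff_const, auto)
qed

definition smooth_step :: "real \<Rightarrow> real" where
  "smooth_step t = expinv 0 t / (expinv 0 t + expinv 0 (1 - t))"

text \<open>The numbers t and 1 - t cannot both be nonpositive.\<close>

lemma smooth_step_denom: "expinv 0 t + expinv 0 (1 - t) > 0"
  by (auto simp: expinv_def add_pos_nonneg)

lemma smooth_step_0: "t \<le> 0 \<Longrightarrow> smooth_step t = 0"
  by (simp add: smooth_step_def expinv_def)

lemma smooth_step_1: "t \<ge> 1 \<Longrightarrow> smooth_step t = 1"
  by (simp add: smooth_step_def expinv_def)

lemma smooth_step_range: "0 \<le> smooth_step t" "smooth_step t \<le> 1"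
  using smooth_step_denom[of t] by (auto simp: smooth_step_def expinv_def field_simps)

lemma smooth_step_compose: "smooth q \<Longrightarrow> smooth (\<lambda>x. smooth_step (q x))"
proof -
  assume q: "smooth q"
  have e: "smooth (\<lambda>x. expinv 0 (p x))" if "smooth p" for p :: "'a \<Rightarrow> real"
    using that cdiff_expinv by (auto simp: smooth_def)
  have "smooth (\<lambda>x. expinv 0 (q x) + expinv 0 (1 - q x))"
    by (intro smooth_add e q smooth_diff smooth_const)
  then show ?thesis unfolding smooth_step_def
    using smooth_step_denom by (intro smooth_divide e q) (auto simp: less_le)
qed

section \<open>Test functions and smooth cutoffs\<close>

lemma test_functions_iff:
  "\<phi> \<in> test_functions S \<longleftrightarrow> smooth \<phi> \<and> compact (closure {x. \<phi> x \<noteq> 0}) \<and> closure {x. \<phi> x \<noteq> 0} \<subseteq> S"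
  by (simp add: test_functions_def smooth_on_UNIV_iff)

lemma test_functionsI:
  assumes "smooth \<phi>" "compact C" "C \<subseteq> S" "\<And>x. x \<notin> C \<Longrightarrow> \<phi> x = 0"
  shows "\<phi> \<in> test_functions S"
proof -
  have "closure {x. \<phi> x \<noteq> 0} \<subseteq> C"
    by (rule closure_minimal) (use assms compact_imp_closed in auto)
  moreover from this have "compact (closure {x. \<phi> x \<noteq> 0})"
    by (metis Int_absorb1 assms(2) closed_closure compact_Int_closed)
  ultimately show ?thesis using assms by (auto simp: test_functions_iff)
qed

lemma test_functionsE:
  assumes "\<phi> \<in> test_functions S"
  obtains C where "compact C" "C \<subseteq> S" "\<And>x. x \<notin> C \<Longrightarrow> \<phi> x = 0" "\<And>x e. x \<notin> C \<Longrightarrow> dir_deriv e \<phi> x = 0"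
proof
  show "compact (closure {x. \<phi> x \<noteq> 0})" "closure {x. \<phi> x \<noteq> 0} \<subseteq> S" using assms by (auto simp: test_functions_iff)
  show "\<phi> x = 0" if "x \<notin> closure {x. \<phi> x \<noteq> 0}" for x
    using that closure_subset[of "{x. \<phi> x \<noteq> 0}"] by auto
  show "dir_deriv e \<phi> x = 0" if "x \<notin> closure {x. \<phi> x \<noteq> 0}" for x e
    by (rule dir_deriv_zero_outside[OF that])
qed

lemma test_smooth: "\<phi> \<in> test_functions S \<Longrightarrow> smooth \<phi>" by (simp add: test_functions_iff)

lemma test_mono: "\<phi> \<in> test_functions S \<Longrightarrow> S \<subseteq> T \<Longrightarrow> \<phi> \<in> test_functions T"
  by (auto simp: test_functions_iff)

lemma test_zero_outside: "\<phi> \<in> test_functions S \<Longrightarrow> x \<notin> S \<Longrightarrow> \<phi> x = 0"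
  by (erule test_functionsE) blast

lemma test_zero: "(\<lambda>x. 0) \<in> test_functions S"
  by (rule test_functionsI[of _ "{}"]) auto

lemma test_mult:
  assumes "smooth a" "\<phi> \<in> test_functions S" shows "(\<lambda>x. a x * \<phi> x) \<in> test_functions S"
proof -
  obtain C where "compact C" "C \<subseteq> S" "\<And>x. x \<notin> C \<Longrightarrow> \<phi> x = 0" using test_functionsE[OF assms(2)] by metis
  then show ?thesis using assms by (intro test_functionsI[of _ C] smooth_mult) (auto simp: test_smooth)
qed

lemma test_cmult: "\<phi> \<in> test_functions S \<Longrightarrow> (\<lambda>x. c * \<phi> x) \<in> test_functions S"
  by (intro test_mult) auto

lemma test_add:
  assumes "\<psi> \<in> test_functions S" "\<phi> \<in> test_functions S" shows "(\<lambda>x. \<psi> x + \<phi> x) \<in> test_functions S"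
proof -
  obtain C where C: "compact C" "C \<subseteq> S" "\<And>x. x \<notin> C \<Longrightarrow> \<phi> x = 0" using test_functionsE[OF assms(2)] by metis
  obtain D where D: "compact D" "D \<subseteq> S" "\<And>x. x \<notin> D \<Longrightarrow> \<psi> x = 0" using test_functionsE[OF assms(1)] by metis
  show ?thesis using C D assms by (intro test_functionsI[of _ "C \<union> D"] smooth_add) (auto simp: test_smooth)
qed

lemma test_diff:
  assumes "\<psi> \<in> test_functions S" "\<phi> \<in> test_functions S" shows "(\<lambda>x. \<psi> x - \<phi> x) \<in> test_functions S"
  using test_add[OF assms(1) test_cmult[OF assms(2), of "-1"]] by simp

lemma test_dir_deriv:
  assumes "\<phi> \<in> test_functions S" shows "dir_deriv e \<phi> \<in> test_functions S"
proof -
  obtain C where "compact C" "C \<subseteq> S" "\<And>x e. x \<notin> C \<Longrightarrow> dir_deriv e \<phi> x = 0" using test_functionsE[OF assms] by metis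
  then show ?thesis using assms by (intro test_functionsI[of _ C] smooth_dir_deriv) (auto simp: test_smooth)
qed

lemma test_bounded:
  assumes "\<phi> \<in> test_functions S" obtains M where "M > 0" "\<And>x. \<bar>\<phi> x\<bar> \<le> M"
proof -
  obtain C where C: "compact C" "\<And>x. x \<notin> C \<Longrightarrow> \<phi> x = 0" using test_functionsE[OF assms] by metis
  have "bounded (\<phi> ` C)"
    by (intro compact_imp_bounded compact_continuous_image C smooth_continuous test_smooth[OF assms])
  then obtain B where "\<And>x. x \<in> C \<Longrightarrow> norm (\<phi> x) \<le> B" by (auto simp: bounded_iff)
  then have "\<bar>\<phi> x\<bar> \<le> \<bar>B\<bar> + 1" for x using C(2)[of x] by (cases "x \<in> C") force+
  then show ?thesis using that[of "\<bar>B\<bar> + 1"] by auto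
qed

lemma ball_bump:
  assumes "0 < r" "r < s"
  obtains \<psi> where "smooth \<psi>" "\<And>x. \<psi> x \<in> {0..1}" "\<And>x. dist p x \<le> r \<Longrightarrow> \<psi> x = 1"
    "\<And>x::'a::euclidean_space. dist p x \<ge> s \<Longrightarrow> \<psi> x = 0"
proof
  \<comment> \<open>An affine function of the squared distance, equal to 1 at distance
    \<open>r\<close> and to 0 at distance \<open>s\<close>; the square keeps it smooth at the
    centre.\<close>
  define q where "q = (\<lambda>x. (s\<^sup>2 - (x - p) \<bullet> (x - p)) / (s\<^sup>2 - r\<^sup>2))"
  have d: "s\<^sup>2 - r\<^sup>2 > 0" using assms by (simp add: power_strict_mono)
  have "smooth (\<lambda>x::'a. (1 *\<^sub>R x + (-p)) \<bullet> (1 *\<^sub>R x + (-p)))"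
    by (rule smooth_compose_affine[OF smooth_norm_sq])
  then have "smooth q" unfolding q_def using d by (intro smooth_divide smooth_diff) auto
  then show "smooth (\<lambda>x. smooth_step (q x))" by (rule smooth_step_compose)
  show "smooth_step (q x) \<in> {0..1}" for x using smooth_step_range by auto
  have n: "(x - p) \<bullet> (x - p) = (dist p x)\<^sup>2" for x by (simp add: dist_norm dot_square_norm norm_minus_commute)
  show "smooth_step (q x) = 1" if "dist p x \<le> r" for x
  proof (rule smooth_step_1)
    have "(dist p x)\<^sup>2 \<le> r\<^sup>2" using that by (intro power_mono) auto
    then show "1 \<le> q x" using d by (simp add: q_def n field_simps)
  qed
  show "smooth_step (q x) = 0" if "dist p x \<ge> s" for x
  proof (rule smooth_step_0)
    have "(dist p x)\<^sup>2 \<ge> s\<^sup>2" using that assms by (intro power_mono) auto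
    then show "q x \<le> 0" using d by (simp add: q_def n divide_le_0_iff)
  qed
qed

text \<open>The function is 1 on an open neighbourhood of \<open>C\<close> and not only on
  \<open>C\<close>, so its derivatives vanish there and a product with it agrees locally with the
  other factor.\<close>

lemma smooth_urysohn:
  fixes C :: "'a::euclidean_space set"
  assumes "compact C" "open U" "C \<subseteq> U"
  obtains \<phi> V where "\<phi> \<in> test_functions U" "\<And>x. \<phi> x \<in> {0..1}" "open V" "C \<subseteq> V" "\<And>x. x \<in> V \<Longrightarrow> \<phi> x = 1"
proof -
  have "\<exists>r>0. cball p (2 * r) \<subseteq> U" if p: "p \<in> C" for p
  proof -
    obtain e where "e > 0" "cball p e \<subseteq> U"
      using assms(2)[unfolded open_contains_cball] assms(3) p by (meson subsetD)
    then show ?thesis by (intro exI[of _ "e/2"]) auto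
  qed
  then obtain r where r: "\<And>p. p \<in> C \<Longrightarrow> r p > 0 \<and> cball p (2 * r p) \<subseteq> U" by metis
  have "\<exists>\<psi>. smooth \<psi> \<and> (\<forall>x. \<psi> x \<in> {0..1::real}) \<and> (\<forall>x. dist p x \<le> r p \<longrightarrow> \<psi> x = 1) \<and> (\<forall>x. dist p x \<ge> 2 * r p \<longrightarrow> \<psi> x = (0::real))"
    if "p \<in> C" for p
    by (rule ball_bump[of "r p" "2 * r p" p]) (use r[OF that] in auto)
  then obtain \<psi> where \<psi>: "\<And>p. p \<in> C \<Longrightarrow> smooth (\<psi> p)" "\<And>p x. p \<in> C \<Longrightarrow> \<psi> p x \<in> {0..1}"
    "\<And>p x. p \<in> C \<Longrightarrow> dist p x \<le> r p \<Longrightarrow> \<psi> p x = 1" "\<And>p x. p \<in> C \<Longrightarrow> dist p x \<ge> 2 * r p \<Longrightarrow> \<psi> p x = (0::real)"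
    by metis
  obtain D where D: "D \<subseteq> C" "finite D" "C \<subseteq> (\<Union>p\<in>D. ball p (r p))"
  proof (rule compactE_image[OF assms(1), of C "\<lambda>p. ball p (r p)"])
    show "C \<subseteq> (\<Union>p\<in>C. ball p (r p))" using r centre_in_ball by blast
  qed auto
  \<comment> \<open>One minus a product, instead of a sum of bumps, stays in [0, 1] and equals 1
    exactly wherever one of the bumps does.\<close>
  define \<phi> where "\<phi> = (\<lambda>x. 1 - (\<Prod>p\<in>D. 1 - \<psi> p x))"
  have p01: "(\<Prod>p\<in>D. 1 - \<psi> p x) \<in> {0..1}" for x
    using \<psi>(2) D(1) by (auto intro!: prod_nonneg prod_le_1 simp: subset_iff)
  show ?thesis
  proof (rule that)
    show "\<phi> \<in> test_functions U"
    proof (rule test_functionsI)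
      show "smooth \<phi>" unfolding \<phi>_def using \<psi>(1) D(1) by (intro smooth_diff smooth_prod smooth_const) auto
      show "compact (\<Union>p\<in>D. cball p (2 * r p))" using D by (intro compact_UN) auto
      show "(\<Union>p\<in>D. cball p (2 * r p)) \<subseteq> U" using D r by blast
      show "\<phi> x = 0" if "x \<notin> (\<Union>p\<in>D. cball p (2 * r p))" for x
      proof -
        have "\<psi> p x = 0" if "p \<in> D" for p using \<open>x \<notin> _\<close> that \<psi>(4)[of p x] D by force
        then show ?thesis by (simp add: \<phi>_def)
      qed
    qed
    show "\<phi> x \<in> {0..1}" for x using p01[of x] by (auto simp: \<phi>_def)
    show "open (\<Union>p\<in>D. ball p (r p))" by auto
    show "C \<subseteq> (\<Union>p\<in>D. ball p (r p))" by (rule D)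
    show "\<phi> x = 1" if "x \<in> (\<Union>p\<in>D. ball p (r p))" for x
    proof -
      obtain p where "p \<in> D" "dist p x \<le> r p" using \<open>x \<in> _\<close> by force
      then have "\<exists>p\<in>D. 1 - \<psi> p x = 0" using \<psi>(3) D by (metis diff_self subsetD)
      then show ?thesis using D by (simp add: \<phi>_def prod_zero)
    qed
  qed
qed

section \<open>Integration against Lebesgue measure\<close>

lemma continuous_lebesgue_measurable:
  fixes f :: "'a::euclidean_space \<Rightarrow> real"
  assumes "continuous_on UNIV f" shows "f \<in> borel_measurable lebesgue"
  using borel_measurable_continuous_onI[OF assms] by (simp add: measurable_completion)

lemma integrable_mult_bounded:
  fixes f \<phi> :: "'a \<Rightarrow> real"
  assumes "integrable M f" "\<phi> \<in> borel_measurable M" "\<And>x. \<bar>\<phi> x\<bar> \<le> B"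
  shows "integrable M (\<lambda>x. f x * \<phi> x)"
proof (rule Bochner_Integration.integrable_bound[of M "\<lambda>x. B * f x"])
  show "integrable M (\<lambda>x. B * f x)" using assms(1) by simp
  show "(\<lambda>x. f x * \<phi> x) \<in> borel_measurable M" using assms by measurable
  show "AE x in M. norm (f x * \<phi> x) \<le> norm (B * f x)"
  proof (intro AE_I2)
    fix x show "norm (f x * \<phi> x) \<le> norm (B * f x)"
      using mult_right_mono[OF assms(3)[of x], of "\<bar>f x\<bar>"] assms(3)[of x]
      by (simp add: abs_mult mult.commute)
  qed
qed

lemma integrable_indicator_compact:
  fixes C :: "'a::euclidean_space set"
  assumes "compact C" shows "integrable lebesgue (indicator C :: 'a \<Rightarrow> real)"
  using lmeasurable_compact[OF assms] unfolding fmeasurable_def integrable_indicator_iff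
  by (simp del: emeasure_completion)

lemma integrable_bounded_compact_support:
  fixes f :: "'a::euclidean_space \<Rightarrow> real"
  assumes "f \<in> borel_measurable lebesgue" "compact C" "\<And>x. x \<notin> C \<Longrightarrow> f x = 0" "\<And>x. \<bar>f x\<bar> \<le> B"
  shows "integrable lebesgue f"
proof -
  have "integrable lebesgue (\<lambda>x. indicator C x * f x)"
    by (rule integrable_mult_bounded[OF integrable_indicator_compact]) (use assms in auto)
  moreover have "(\<lambda>x. indicator C x * f x) = f" using assms(3) by (auto simp: indicator_def fun_eq_iff)
  ultimately show ?thesis by simp
qed

lemma continuous_compact_support_bounded:
  fixes f :: "'a::euclidean_space \<Rightarrow> real"
  assumes "continuous_on UNIV f" "compact C" "\<And>x. x \<notin> C \<Longrightarrow> f x = 0"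
  obtains B where "B > 0" "\<And>x. \<bar>f x\<bar> \<le> B"
proof -
  have "bounded (f ` C)"
    using assms by (intro compact_imp_bounded compact_continuous_image) (auto intro: continuous_on_subset)
  then obtain B where "\<And>x. x \<in> C \<Longrightarrow> norm (f x) \<le> B" by (auto simp: bounded_iff)
  then have "\<bar>f x\<bar> \<le> \<bar>B\<bar> + 1" for x using assms(3)[of x] by (cases "x \<in> C") force+
  then show ?thesis using that[of "\<bar>B\<bar> + 1"] by auto
qed

lemma integrable_continuous_compact_support:
  fixes f :: "'a::euclidean_space \<Rightarrow> real"
  assumes "continuous_on UNIV f" "compact C" "\<And>x. x \<notin> C \<Longrightarrow> f x = 0"
  shows "integrable lebesgue f"
proof -
  obtain B where "\<And>x. \<bar>f x\<bar> \<le> B" using continuous_compact_support_bounded[OF assms] by blast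
  then show ?thesis
    using integrable_bounded_compact_support[OF continuous_lebesgue_measurable[OF assms(1)] assms(2,3)] by blast
qed

lemma continuous_on_mult_cutoff:
  fixes g \<phi> :: "'a::euclidean_space \<Rightarrow> real"
  assumes "open S" "continuous_on S g" "continuous_on UNIV \<phi>" "compact C" "C \<subseteq> S" "\<And>x. x \<notin> C \<Longrightarrow> \<phi> x = 0"
  shows "continuous_on UNIV (\<lambda>x. g x * \<phi> x)"
proof -
  have "continuous_on S (\<lambda>x. g x * \<phi> x)"
    using assms by (intro continuous_intros) (auto intro: continuous_on_subset)
  moreover have "continuous_on (- C) (\<lambda>x. g x * \<phi> x)"
    using assms(6) by (subst continuous_on_cong[of _ _ _ "\<lambda>x. 0"]) auto
  ultimately have "continuous_on (S \<union> - C) (\<lambda>x. g x * \<phi> x)"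
    using assms by (intro continuous_on_open_Un) (auto simp: open_Compl compact_imp_closed)
  moreover have "S \<union> - C = UNIV" using assms by auto
  ultimately show ?thesis by simp
qed

subsection \<open>Measure preserving maps\<close>

text \<open>Invariance is stated for \<open>lborel\<close>, where Fubini arguments apply. It makes
  preimages of null sets null, which is what lets it pass to the completion.\<close>

definition measure_pres :: "('a::euclidean_space \<Rightarrow> 'a) \<Rightarrow> bool" where
  "measure_pres \<tau> \<longleftrightarrow> \<tau> \<in> borel_measurable borel \<and> distr lborel borel \<tau> = lborel"

lemma measure_pres_measurable: "measure_pres \<tau> \<Longrightarrow> \<tau> \<in> lebesgue \<rightarrow>\<^sub>M lebesgue"
  and measure_pres_distr: "measure_pres \<tau> \<Longrightarrow> distr lebesgue lebesgue \<tau> = lebesgue"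
proof -
  assume m: "measure_pres \<tau>"
  have t: "\<tau> \<in> lborel \<rightarrow>\<^sub>M lborel" using m by (simp add: measure_pres_def)
  have d: "distr lborel lborel \<tau> = lborel"
    using m by (simp add: measure_pres_def cong: distr_cong)
  have tl: "\<tau> \<in> lebesgue \<rightarrow>\<^sub>M lborel" using t by (simp add: measurable_completion)
  have d2: "distr lebesgue lborel \<tau> = lborel"
    using distr_completion[OF t] d by simp
  show "\<tau> \<in> lebesgue \<rightarrow>\<^sub>M lebesgue"
    by (rule completion.measurable_completion2[OF tl]) (simp add: d2)
  have "completion (distr lebesgue lborel \<tau>) = distr lebesgue (completion lborel) \<tau>"
    by (rule completion.completion_distr_eq[OF tl]) (simp add: d2)
  then show "distr lebesgue lebesgue \<tau> = lebesgue" by (simp add: d2)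
qed

lemma measure_pres_compose_measurable:
  assumes "measure_pres \<tau>" "f \<in> borel_measurable lebesgue"
  shows "(\<lambda>x. f (\<tau> x)) \<in> borel_measurable lebesgue"
  using measurable_compose[OF measure_pres_measurable[OF assms(1)] assms(2)] .

lemma measure_pres_integrable:
  fixes f :: "'a::euclidean_space \<Rightarrow> real"
  assumes "measure_pres \<tau>" "integrable lebesgue f"
  shows "integrable lebesgue (\<lambda>x. f (\<tau> x))"
  using assms integrable_distr[OF measure_pres_measurable[OF assms(1)], of f]
  by (simp add: measure_pres_distr)

lemma measure_pres_integral:
  fixes f :: "'a::euclidean_space \<Rightarrow> real"
  assumes "measure_pres \<tau>" "f \<in> borel_measurable lebesgue"
  shows "(LINT x|lebesgue. f (\<tau> x)) = (LINT x|lebesgue. f x)"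
  using integral_distr[OF measure_pres_measurable[OF assms(1)] assms(2)]
  by (simp add: measure_pres_distr[OF assms(1)])

lemma measure_pres_translation: "measure_pres (\<lambda>x. c + x)"
  by (simp add: measure_pres_def lborel_distr_plus)

subsection \<open>Derivatives with compact support have mean zero\<close>

text \<open>Every difference quotient has integral zero by translation invariance, and dominated
  convergence carries this over to the derivative; no iterated integration is involved.\<close>

lemma integral_dir_deriv_eq_0:
  fixes F :: "'a::euclidean_space \<Rightarrow> real"
  assumes diff: "\<And>x. F differentiable (at x)" and cont: "continuous_on UNIV (dir_deriv e F)"
    and C: "compact C" "\<And>x. x \<notin> C \<Longrightarrow> F x = 0"
  shows "(LINT x|lebesgue. dir_deriv e F x) = 0"
proof -
  define t where "t = (\<lambda>n. inverse (real (Suc n)))"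
  have t: "0 < t n" "t n \<le> 1" for n by (auto simp: t_def inverse_le_1_iff)
  define g where "g = (\<lambda>n x. (F (t n *\<^sub>R e + x) - F x) / t n)"
  have cF: "continuous_on UNIV F"
    using diff by (intro continuous_at_imp_continuous_on) (simp add: differentiable_imp_continuous_within)
  have dz: "dir_deriv e F x = 0" if "x \<notin> C" for x
  proof -
    have "dir_deriv e F x = dir_deriv e (\<lambda>x. 0) x"
      by (rule dir_deriv_cong_open[of "-C"]) (use that C in \<open>auto simp: open_Compl compact_imp_closed\<close>)
    then show ?thesis by simp
  qed
  obtain M where M: "\<And>x. \<bar>dir_deriv e F x\<bar> \<le> M"
    using continuous_compact_support_bounded[OF cont C(1) dz] by blast
  have line: "((\<lambda>s. F (s *\<^sub>R e + x)) has_real_derivative dir_deriv e F (s *\<^sub>R e + x)) (at s)" for s x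
  proof -
    have "((\<lambda>s. s *\<^sub>R e + x) has_derivative (\<lambda>h. h *\<^sub>R e)) (at s)" by (auto intro!: derivative_eq_intros)
    from has_derivative_compose[OF this has_derivative_dir_deriv[OF diff]]
    have "((\<lambda>s. F (s *\<^sub>R e + x)) has_derivative (\<lambda>h. dir_deriv (h *\<^sub>R e) F (s *\<^sub>R e + x))) (at s)" .
    moreover have "dir_deriv (h *\<^sub>R e) F y = dir_deriv e F y * h" for h y
      using linear_scale[OF has_derivative_linear[OF has_derivative_dir_deriv[OF diff[of y]]], of h e] by simp
    ultimately show ?thesis by (simp add: has_field_derivative_def mult_commute_abs)
  qed
  have gb: "\<bar>g n x\<bar> \<le> M" for n x
  proof -
    \<comment> \<open>By the mean value theorem each quotient is a value of the derivative, hence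
      bounded by \<open>M\<close> uniformly in \<open>n\<close>.\<close>
    obtain z where "F (t n *\<^sub>R e + x) - F (0 *\<^sub>R e + x) = (t n - 0) * dir_deriv e F (z *\<^sub>R e + x)"
      using MVT2[OF t(1)[of n], of "\<lambda>s. F (s *\<^sub>R e + x)" "\<lambda>s. dir_deriv e F (s *\<^sub>R e + x)"] line by blast
    then have "g n x = dir_deriv e F (z *\<^sub>R e + x)" using t(1)[of n] by (simp add: g_def)
    then show ?thesis using M by simp
  qed
  obtain R where R: "\<And>x. x \<in> C \<Longrightarrow> norm x \<le> R" using C(1) compact_imp_bounded bounded_iff by metis
  have gz: "g n x = 0" if "x \<notin> cball 0 (R + norm e)" for n x
  proof -
    have nx: "norm x > R + norm e" using that by simp
    then have "x \<notin> C" using R[of x] norm_ge_zero[of e] by fastforce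
    moreover have "t n *\<^sub>R e + x \<notin> C"
    proof
      assume "t n *\<^sub>R e + x \<in> C"
      then have "norm (t n *\<^sub>R e + x) \<le> R" by (rule R)
      moreover have "norm x \<le> norm (t n *\<^sub>R e + x) + norm (t n *\<^sub>R e)"
        by (metis add.commute add_diff_cancel_left' norm_triangle_sub norm_minus_commute)
      moreover have "norm (t n *\<^sub>R e) \<le> norm e" using t[of n] by (simp add: mult_left_le_one_le)
      ultimately show False using nx by simp
    qed
    ultimately show ?thesis by (simp add: g_def C(2))
  qed
  have cg: "continuous_on UNIV (g n)" for n
    unfolding g_def using t(1)[of n]
    by (intro continuous_intros continuous_on_compose2[OF cF]) auto
  have iF: "integrable lebesgue F" by (rule integrable_continuous_compact_support[OF cF C])
  have int0: "(LINT x|lebesgue. g n x) = 0" for n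
  proof -
    have "(LINT x|lebesgue. F (t n *\<^sub>R e + x)) = (LINT x|lebesgue. F x)"
      by (rule measure_pres_integral[OF measure_pres_translation]) (use iF in auto)
    then show ?thesis unfolding g_def
      using iF measure_pres_integrable[OF measure_pres_translation iF, of "t n *\<^sub>R e"] by simp
  qed
  have "(\<lambda>n. LINT x|lebesgue. g n x) \<longlonglongrightarrow> (LINT x|lebesgue. dir_deriv e F x)"
  proof (rule integral_dominated_convergence[where w = "\<lambda>x. M * indicator (cball 0 (R + norm e)) x"])
    show "dir_deriv e F \<in> borel_measurable lebesgue" "\<And>i. g i \<in> borel_measurable lebesgue"
      by (intro continuous_lebesgue_measurable cont cg)+
    show "integrable lebesgue (\<lambda>x. M * indicator (cball 0 (R + norm e)) x)"
      by (intro integrable_mult_right integrable_indicator_compact compact_cball)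
    show "AE x in lebesgue. (\<lambda>i. g i x) \<longlonglongrightarrow> dir_deriv e F x"
    proof (intro AE_I2)
      fix x
      have "((\<lambda>h. (F ((0 + h) *\<^sub>R e + x) - F (0 *\<^sub>R e + x)) / h) \<longlongrightarrow> dir_deriv e F (0 *\<^sub>R e + x)) (at 0)"
        using line[of x 0] unfolding DERIV_def .
      moreover have "filterlim t (at 0) sequentially"
        unfolding t_def using LIMSEQ_inverse_real_of_nat by (auto simp: filterlim_at)
      ultimately show "(\<lambda>i. g i x) \<longlonglongrightarrow> dir_deriv e F x"
        unfolding g_def using filterlim_compose by fastforce
    qed
    show "AE x in lebesgue. norm (g i x) \<le> M * indicator (cball 0 (R + norm e)) x" for i
      using gb gz by (intro AE_I2) (auto simp: indicator_def)
  qed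
  then show ?thesis using int0 by (simp add: LIMSEQ_const_iff)
qed

subsection \<open>Weak directional derivatives\<close>

text \<open>A test function vanishes off \<open>S\<close>, so the integrals may run over the whole
  space. One direction at a time suffices, because second derivatives are treated as derivatives of
  first ones; the direction may lie outside the basis, which the reflection along a normal-like
  vector needs.\<close>

definition wderiv :: "'a::euclidean_space set \<Rightarrow> 'a \<Rightarrow> ('a \<Rightarrow> real) \<Rightarrow> ('a \<Rightarrow> real) \<Rightarrow> bool" where
  "wderiv S e u v \<longleftrightarrow> locally_integrable_on u S \<and> locally_integrable_on v S \<and>
     (\<forall>\<phi>\<in>test_functions S. (LINT x|lebesgue. u x * dir_deriv e \<phi> x) = - (LINT x|lebesgue. v x * \<phi> x))"

lemma locally_integrable_mult_integrable:
  assumes "locally_integrable_on u S" "compact C" "C \<subseteq> S" "\<And>x. x \<notin> C \<Longrightarrow> \<phi> x = 0" "continuous_on UNIV \<phi>"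
  shows "integrable lebesgue (\<lambda>x. u x * \<phi> x)"
proof -
  obtain B where "\<And>x. \<bar>\<phi> x\<bar> \<le> B" using continuous_compact_support_bounded[OF assms(5,2,4)] by blast
  then have "integrable lebesgue (\<lambda>x. (indicator C x * u x) * \<phi> x)"
    using assms continuous_lebesgue_measurable[OF assms(5)]
    by (rule_tac integrable_mult_bounded[of _ _ _ B]) (auto simp: locally_integrable_on_def set_integrable_def)
  moreover have "(\<lambda>x. (indicator C x * u x) * \<phi> x) = (\<lambda>x. u x * \<phi> x)"
    using assms(4) by (auto simp: fun_eq_iff indicator_def)
  ultimately show ?thesis by simp
qed

lemma locally_integrable_test_integrable:
  assumes "locally_integrable_on u S" "\<phi> \<in> test_functions S"
  shows "integrable lebesgue (\<lambda>x. u x * \<phi> x)"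
  by (rule test_functionsE[OF assms(2)], rule locally_integrable_mult_integrable[OF assms(1)])
     (use smooth_continuous[OF test_smooth[OF assms(2)]] in auto)

lemma locally_integrable_cong:
  assumes "\<And>x. x \<in> S \<Longrightarrow> u x = v x"
  shows "locally_integrable_on u S \<longleftrightarrow> locally_integrable_on v S"
proof -
  have "u absolutely_integrable_on C \<longleftrightarrow> v absolutely_integrable_on C" if "C \<subseteq> S" for C
    by (rule set_integrable_cong) (use assms that in auto)
  then show ?thesis by (auto simp: locally_integrable_on_def)
qed

lemma locally_integrable_subset:
  "locally_integrable_on u S \<Longrightarrow> T \<subseteq> S \<Longrightarrow> locally_integrable_on u T"
  by (auto simp: locally_integrable_on_def)

lemma locally_integrable_add:
  "locally_integrable_on u S \<Longrightarrow> locally_integrable_on v S \<Longrightarrow> locally_integrable_on (\<lambda>x. u x + v x) S"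
  by (auto simp: locally_integrable_on_def intro: set_integral_add)

lemma locally_integrable_mult_continuous:
  fixes u a :: "'a::euclidean_space \<Rightarrow> real"
  assumes "locally_integrable_on u S" "continuous_on UNIV a"
  shows "locally_integrable_on (\<lambda>x. a x * u x) S"
  unfolding locally_integrable_on_def
proof safe
  fix C assume C: "compact C" "C \<subseteq> S"
  have "bounded (a ` C)"
    using assms C by (intro compact_imp_bounded compact_continuous_image) (auto intro: continuous_on_subset)
  then obtain B where B: "\<And>x. x \<in> C \<Longrightarrow> \<bar>a x\<bar> \<le> B" by (auto simp: bounded_iff)
  have "integrable lebesgue (\<lambda>x. (indicator C x * u x) * (indicator C x * a x))"
  proof (rule integrable_mult_bounded[of _ _ _ "\<bar>B\<bar>"])
    show "integrable lebesgue (\<lambda>x. indicator C x * u x)"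
      using assms C by (auto simp: locally_integrable_on_def set_integrable_def)
    have "C \<in> sets lebesgue" using lmeasurable_compact[OF C(1)] by auto
    then show "(\<lambda>x. indicator C x * a x) \<in> borel_measurable lebesgue"
      using continuous_lebesgue_measurable[OF assms(2)] by measurable
    show "\<bar>indicator C x * a x\<bar> \<le> \<bar>B\<bar>" for x using B[of x] by (auto simp: indicator_def)
  qed
  moreover have "(\<lambda>x. (indicator C x * u x) * (indicator C x * a x)) = (\<lambda>x. indicator C x *\<^sub>R (a x * u x))"
    by (auto simp: fun_eq_iff indicator_def)
  ultimately show "(\<lambda>x. a x * u x) absolutely_integrable_on C" by (simp add: set_integrable_def)
qed

lemma locally_integrable_continuous:
  fixes u :: "'a::euclidean_space \<Rightarrow> real"
  assumes "continuous_on S u"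
  shows "locally_integrable_on u S"
  unfolding locally_integrable_on_def
proof safe
  fix C assume C: "compact C" "C \<subseteq> S"
  have c: "continuous_on C u" using assms C continuous_on_subset by blast
  then have "bounded (u ` C)" using C by (intro compact_imp_bounded compact_continuous_image)
  then obtain B where B: "\<And>x. x \<in> C \<Longrightarrow> \<bar>u x\<bar> \<le> B" by (auto simp: bounded_iff)
  have "(\<lambda>x. indicator C x * u x) \<in> borel_measurable lebesgue"
    using borel_measurable_continuous_on_indicator[OF _ c] C
    by (auto intro!: measurable_completion simp: compact_imp_closed borel_closed)
  then have "integrable lebesgue (\<lambda>x. indicator C x * u x)"
    by (rule integrable_bounded_compact_support[where B = "\<bar>B\<bar>", OF _ C(1)]) (use B in \<open>force simp: indicator_def\<close>)+
  then show "u absolutely_integrable_on C" by (simp add: set_integrable_def)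
qed

lemma locally_integrable_test_mult_UNIV:
  assumes "locally_integrable_on u S" "\<phi> \<in> test_functions S"
  shows "locally_integrable_on (\<lambda>x. \<phi> x * u x) UNIV"
proof -
  have i: "integrable lebesgue (\<lambda>x. \<phi> x * u x)"
    using locally_integrable_test_integrable[OF assms] by (simp add: mult.commute)
  show ?thesis unfolding locally_integrable_on_def set_integrable_def
    by (intro allI impI integrable_mult_indicator i) (use lmeasurable_compact in auto)
qed

lemma wderivD:
  "wderiv S e u v \<Longrightarrow> \<phi> \<in> test_functions S \<Longrightarrow>
    (LINT x|lebesgue. u x * dir_deriv e \<phi> x) = - (LINT x|lebesgue. v x * \<phi> x)"
  by (simp add: wderiv_def)

lemma wderiv_locally_integrable:
  "wderiv S e u v \<Longrightarrow> locally_integrable_on u S" "wderiv S e u v \<Longrightarrow> locally_integrable_on v S"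
  by (simp_all add: wderiv_def)

lemma wderiv_subset: "wderiv S e u v \<Longrightarrow> T \<subseteq> S \<Longrightarrow> wderiv T e u v"
  unfolding wderiv_def using locally_integrable_subset test_mono by blast

lemma wderiv_cong:
  assumes "\<And>x. x \<in> S \<Longrightarrow> u x = u' x" "\<And>x. x \<in> S \<Longrightarrow> v x = v' x"
  shows "wderiv S e u v \<longleftrightarrow> wderiv S e u' v'"
proof -
  have "(\<lambda>x. u x * dir_deriv e \<phi> x) = (\<lambda>x. u' x * dir_deriv e \<phi> x)"
       "(\<lambda>x. v x * \<phi> x) = (\<lambda>x. v' x * \<phi> x)" if "\<phi> \<in> test_functions S" for \<phi>
    using assms test_zero_outside[OF that] test_zero_outside[OF test_dir_deriv[OF that]]
    by (force simp: fun_eq_iff)+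
  moreover have "locally_integrable_on u S = locally_integrable_on u' S"
    "locally_integrable_on v S = locally_integrable_on v' S"
    by (intro locally_integrable_cong assms; assumption)+
  ultimately show ?thesis unfolding wderiv_def by simp
qed

lemma wderiv_add:
  assumes "wderiv S e u v" "wderiv S e u' v'"
  shows "wderiv S e (\<lambda>x. u x + u' x) (\<lambda>x. v x + v' x)"
  unfolding wderiv_def
proof safe
  show "locally_integrable_on (\<lambda>x. u x + u' x) S" "locally_integrable_on (\<lambda>x. v x + v' x) S"
    using assms by (auto simp: wderiv_def intro: locally_integrable_add)
  fix \<phi> assume \<phi>: "\<phi> \<in> test_functions S"
  note i = assms[THEN wderiv_locally_integrable(1), THEN locally_integrable_test_integrable, OF test_dir_deriv[OF \<phi>]]
    assms[THEN wderiv_locally_integrable(2), THEN locally_integrable_test_integrable, OF \<phi>]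
  show "(LINT x|lebesgue. (u x + u' x) * dir_deriv e \<phi> x) = - (LINT x|lebesgue. (v x + v' x) * \<phi> x)"
    using i wderivD[OF assms(1) \<phi>] wderivD[OF assms(2) \<phi>] by (simp add: distrib_right)
qed

lemma wderiv_cmult:
  assumes "wderiv S e u v" shows "wderiv S e (\<lambda>x. c * u x) (\<lambda>x. c * v x)"
  using assms locally_integrable_mult_continuous[of _ S "\<lambda>x. c"]
  by (simp add: wderiv_def mult.assoc)

lemma wderiv_0: "wderiv S e (\<lambda>x. 0) (\<lambda>x. 0)"
  by (simp add: wderiv_def locally_integrable_continuous)

lemma wderiv_diff:
  "wderiv S e u v \<Longrightarrow> wderiv S e u' v' \<Longrightarrow> wderiv S e (\<lambda>x. u x - u' x) (\<lambda>x. v x - v' x)"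
  using wderiv_add[OF _ wderiv_cmult[of S e u' v' "-1"]] by simp

lemma wderiv_sum:
  "(\<And>i. i \<in> I \<Longrightarrow> wderiv S e (u i) (v i)) \<Longrightarrow> wderiv S e (\<lambda>x. \<Sum>i\<in>I. u i x) (\<lambda>x. \<Sum>i\<in>I. v i x)"
  by (induction I rule: infinite_finite_induct) (auto intro: wderiv_add wderiv_0)

lemma wderiv_direction:
  assumes "\<And>b. b \<in> Basis \<Longrightarrow> wderiv S b u (v b)"
  shows "wderiv S e u (\<lambda>x. \<Sum>b\<in>Basis. (e \<bullet> b) * v b x)"
proof -
  obtain b0 :: 'a where b0: "b0 \<in> Basis" using nonempty_Basis by blast
  have l: "locally_integrable_on (\<lambda>x. \<Sum>b\<in>B. (e \<bullet> b) * v b x) S" if "B \<subseteq> Basis" for B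
  proof -
    have "finite B" using that finite_Basis finite_subset by blast
    then show ?thesis using that
    proof (induction B)
      case (insert b B)
      then show ?case
        by (auto intro!: locally_integrable_add locally_integrable_mult_continuous wderiv_locally_integrable(2)[OF assms])
    qed (simp add: locally_integrable_continuous)
  qed
  show ?thesis unfolding wderiv_def
  proof safe
    show "locally_integrable_on u S" using assms[OF b0] by (simp add: wderiv_def)
    show "locally_integrable_on (\<lambda>x. \<Sum>b\<in>Basis. (e \<bullet> b) * v b x) S" by (rule l) simp
    fix \<phi> assume \<phi>: "\<phi> \<in> test_functions S"
    have "(LINT x|lebesgue. u x * dir_deriv e \<phi> x) = (LINT x|lebesgue. (\<Sum>b\<in>Basis. (e \<bullet> b) * (u x * dir_deriv b \<phi> x)))"
      by (subst dir_deriv_expand[OF smooth_differentiable[OF test_smooth[OF \<phi>]]]) (simp add: sum_distrib_left mult_ac)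
    also have "\<dots> = (\<Sum>b\<in>Basis. (e \<bullet> b) * (LINT x|lebesgue. u x * dir_deriv b \<phi> x))"
      using locally_integrable_test_integrable[OF wderiv_locally_integrable(1)[OF assms[OF b0]] test_dir_deriv[OF \<phi>]]
      by (subst Bochner_Integration.integral_sum) auto
    also have "\<dots> = (\<Sum>b\<in>Basis. (e \<bullet> b) * - (LINT x|lebesgue. v b x * \<phi> x))"
      using wderivD[OF assms \<phi>] by simp
    also have "\<dots> = - (LINT x|lebesgue. (\<Sum>b\<in>Basis. (e \<bullet> b) * (v b x * \<phi> x)))"
      using locally_integrable_test_integrable[OF wderiv_locally_integrable(2)[OF assms] \<phi>]
      by (subst Bochner_Integration.integral_sum) (auto simp: sum_negf)
    finally show "(LINT x|lebesgue. u x * dir_deriv e \<phi> x) = - (LINT x|lebesgue. (\<Sum>b\<in>Basis. (e \<bullet> b) * v b x) * \<phi> x)"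
      by (simp add: sum_distrib_right mult.assoc)
  qed
qed

text \<open>Only the products have to be test functions on \<open>S\<close>. This covers a smooth
  multiplier with test functions on \<open>S\<close>, a multiplier supported in \<open>S\<close>
  with test functions on the whole space, and a multiplier supported in a ball, with the
  intersection of the domain and the ball in the place of \<open>S\<close>.\<close>

lemma wderiv_mult_aux:
  assumes w: "wderiv S e u v" and a: "smooth a" and \<psi>: "(\<lambda>x. a x * \<psi> x) \<in> test_functions S" "smooth \<psi>"
    and i: "(\<lambda>x. dir_deriv e a x * \<psi> x) \<in> test_functions S" "(\<lambda>x. a x * dir_deriv e \<psi> x) \<in> test_functions S"
  shows "(LINT x|lebesgue. (a x * u x) * dir_deriv e \<psi> x) = - (LINT x|lebesgue. (a x * v x + dir_deriv e a x * u x) * \<psi> x)"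
proof -
  have "dir_deriv e (\<lambda>x. a x * \<psi> x) = (\<lambda>x. a x * dir_deriv e \<psi> x + dir_deriv e a x * \<psi> x)"
    using a \<psi>(2) by (auto simp: fun_eq_iff dir_deriv_mult smooth_differentiable)
  with wderivD[OF w \<psi>(1)]
  have e: "(LINT x|lebesgue. u x * (a x * dir_deriv e \<psi> x) + u x * (dir_deriv e a x * \<psi> x)) = - (LINT x|lebesgue. v x * (a x * \<psi> x))"
    by (simp add: distrib_left)
  note u = wderiv_locally_integrable(1)[OF w] and v = wderiv_locally_integrable(2)[OF w]
  note I = locally_integrable_test_integrable[OF u i(1)] locally_integrable_test_integrable[OF u i(2)]
    locally_integrable_test_integrable[OF v \<psi>(1)]
  have "(LINT x|lebesgue. (a x * v x + dir_deriv e a x * u x) * \<psi> x)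
      = (LINT x|lebesgue. v x * (a x * \<psi> x) + u x * (dir_deriv e a x * \<psi> x))"
    by (simp add: algebra_simps)
  also have "\<dots> = (LINT x|lebesgue. v x * (a x * \<psi> x)) + (LINT x|lebesgue. u x * (dir_deriv e a x * \<psi> x))"
    using I by simp
  also have "\<dots> = - (LINT x|lebesgue. u x * (a x * dir_deriv e \<psi> x))"
    using e I by simp
  finally show ?thesis by (simp add: mult_ac)
qed

lemma wderiv_mult:
  assumes "wderiv S e u v" "smooth a"
  shows "wderiv S e (\<lambda>x. a x * u x) (\<lambda>x. a x * v x + dir_deriv e a x * u x)"
  unfolding wderiv_def
proof safe
  show "locally_integrable_on (\<lambda>x. a x * u x) S" "locally_integrable_on (\<lambda>x. a x * v x + dir_deriv e a x * u x) S"
    using assms by (auto intro!: locally_integrable_add locally_integrable_mult_continuous smooth_continuous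
        smooth_dir_deriv dest: wderiv_locally_integrable)
  fix \<psi> assume "\<psi> \<in> test_functions S"
  then show "(LINT x|lebesgue. (a x * u x) * dir_deriv e \<psi> x) = - (LINT x|lebesgue. (a x * v x + dir_deriv e a x * u x) * \<psi> x)"
    using assms by (intro wderiv_mult_aux[of S] test_mult smooth_dir_deriv test_dir_deriv) (auto simp: test_smooth)
qed

text \<open>A multiplier with compact support in \<open>S\<close> turns local derivatives into
  derivatives on the whole space, since whatever the functions do outside \<open>S\<close> is
  multiplied by zero.\<close>

lemma wderiv_mult_test:
  assumes "wderiv S e u v" "a \<in> test_functions S"
  shows "wderiv UNIV e (\<lambda>x. a x * u x) (\<lambda>x. a x * v x + dir_deriv e a x * u x)"
  unfolding wderiv_def
proof safe
  show "locally_integrable_on (\<lambda>x. a x * u x) UNIV" "locally_integrable_on (\<lambda>x. a x * v x + dir_deriv e a x * u x) UNIV"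
    using assms by (auto intro!: locally_integrable_add locally_integrable_test_mult_UNIV[of _ S]
        test_dir_deriv dest: wderiv_locally_integrable)
  fix \<psi> :: "'a \<Rightarrow> real" assume "\<psi> \<in> test_functions UNIV"
  then have \<psi>: "smooth \<psi>" by (rule test_smooth)
  have t: "(\<lambda>x. b x * c x) \<in> test_functions S" if "smooth c" "b \<in> test_functions S" for b c
    using test_mult[OF that] by (simp add: mult.commute)
  show "(LINT x|lebesgue. (a x * u x) * dir_deriv e \<psi> x) = - (LINT x|lebesgue. (a x * v x + dir_deriv e a x * u x) * \<psi> x)"
    using assms \<psi> by (intro wderiv_mult_aux[of S] t smooth_dir_deriv test_dir_deriv) (auto simp: test_smooth)
qed

text \<open>The product of \<open>v\<close> with a test function is differentiable on the whole
  space, being zero off a compact subset of \<open>S\<close>; its derivative has integral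
  zero.\<close>

lemma wderiv_classical:
  fixes v :: "'a::euclidean_space \<Rightarrow> real"
  assumes S: "open S" and d: "\<And>x. x \<in> S \<Longrightarrow> v differentiable (at x)" and c: "continuous_on S (dir_deriv e v)"
  shows "wderiv S e v (dir_deriv e v)"
  unfolding wderiv_def
proof safe
  have cv: "continuous_on S v"
    using d by (intro continuous_at_imp_continuous_on) (simp add: differentiable_imp_continuous_within)
  show "locally_integrable_on v S" "locally_integrable_on (dir_deriv e v) S"
    by (intro locally_integrable_continuous cv c)+
  fix \<phi> assume \<phi>: "\<phi> \<in> test_functions S"
  obtain C where C: "compact C" "C \<subseteq> S" "\<And>x. x \<notin> C \<Longrightarrow> \<phi> x = 0" "\<And>x e. x \<notin> C \<Longrightarrow> dir_deriv e \<phi> x = 0"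
    using test_functionsE[OF \<phi>] by metis
  have oC: "open (- C)" using C(1) by (simp add: open_Compl compact_imp_closed)
  define F where "F = (\<lambda>x. v x * \<phi> x)"
  have F0: "F x = 0" if "x \<notin> C" for x using C(3)[OF that] by (simp add: F_def)
  have Fd: "F differentiable (at x)" for x
  proof (cases "x \<in> S")
    case True then show ?thesis
      unfolding F_def using d smooth_differentiable[OF test_smooth[OF \<phi>]] by (intro differentiable_mult) auto
  next
    case False
    then have "(F has_derivative (\<lambda>h. 0)) (at x)"
      using C F0 by (intro has_derivative_transform_within_open[OF has_derivative_const[of 0] oC]) auto
    then show ?thesis unfolding differentiable_def by blast
  qed
  have dF: "dir_deriv e F = (\<lambda>x. v x * dir_deriv e \<phi> x + dir_deriv e v x * \<phi> x)"
  proof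
    fix x show "dir_deriv e F x = v x * dir_deriv e \<phi> x + dir_deriv e v x * \<phi> x"
    proof (cases "x \<in> S")
      case True then show ?thesis
        unfolding F_def using d smooth_differentiable[OF test_smooth[OF \<phi>]] by (intro dir_deriv_mult) auto
    next
      case False
      have "dir_deriv e F x = dir_deriv e (\<lambda>x. 0) x"
        by (rule dir_deriv_cong_open[OF oC]) (use False C F0 in auto)
      moreover have "x \<notin> C" using False C(2) by blast
      ultimately show ?thesis using C(3,4) by simp
    qed
  qed
  have c1: "continuous_on UNIV (\<lambda>x. v x * dir_deriv e \<phi> x)"
    by (rule continuous_on_mult_cutoff[OF S cv smooth_continuous[OF test_smooth[OF test_dir_deriv[OF \<phi>]]] C(1,2,4)])
  have c2: "continuous_on UNIV (\<lambda>x. dir_deriv e v x * \<phi> x)"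
    by (rule continuous_on_mult_cutoff[OF S c smooth_continuous[OF test_smooth[OF \<phi>]] C(1,2,3)])
  have "(LINT x|lebesgue. dir_deriv e F x) = 0"
    by (rule integral_dir_deriv_eq_0[OF Fd _ C(1) F0]) (auto simp: dF intro!: continuous_on_add c1 c2)
  then have "(LINT x|lebesgue. v x * dir_deriv e \<phi> x) + (LINT x|lebesgue. dir_deriv e v x * \<phi> x) = 0"
    unfolding dF
    using integrable_continuous_compact_support[OF c1 C(1)] integrable_continuous_compact_support[OF c2 C(1)] C
    by simp
  then show "(LINT x|lebesgue. v x * dir_deriv e \<phi> x) = - (LINT x|lebesgue. dir_deriv e v x * \<phi> x)" by simp
qed

lemma wderiv_smooth: "smooth v \<Longrightarrow> open S \<Longrightarrow> wderiv S e v (dir_deriv e v)"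
  by (intro wderiv_classical smooth_continuous smooth_dir_deriv smooth_differentiable)

subsection \<open>The fundamental lemma of the calculus of variations\<close>

text \<open>The common majorant \<open>\<psi>\<close> makes dominated convergence applicable to
  products with a merely locally integrable function.\<close>

lemma test_functions_approx_indicator:
  fixes C :: "'a::euclidean_space set"
  assumes "compact C" "open S" "C \<subseteq> S"
  obtains \<psi> \<phi> where "\<psi> \<in> test_functions S" "\<And>n. \<phi> n \<in> test_functions S" "\<And>n x. 0 \<le> \<phi> n x \<and> \<phi> n x \<le> \<psi> x"
    "\<And>x. \<psi> x \<le> 1" "\<And>x. (\<lambda>n::nat. \<phi> n x) \<longlonglongrightarrow> indicator C x"
proof -
  obtain \<psi> V where \<psi>: "\<psi> \<in> test_functions S" "\<And>x. \<psi> x \<in> {0..1}" "open V" "C \<subseteq> V" "\<And>x. x \<in> V \<Longrightarrow> \<psi> x = 1"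
    using smooth_urysohn[OF assms] by metis
  define U where "U = (\<lambda>n::nat. V \<inter> S \<inter> (\<Union>c\<in>C. ball c (inverse (real (Suc n)))))"
  have U: "open (U n)" "C \<subseteq> U n" for n using \<psi> assms by (auto simp: U_def)
  have "\<exists>\<phi>. \<phi> \<in> test_functions (U n) \<and> (\<forall>x. \<phi> x \<in> {0..1::real}) \<and> (\<forall>x\<in>C. \<phi> x = 1)" for n
  proof -
    obtain \<phi> W where "\<phi> \<in> test_functions (U n)" "\<And>x. \<phi> x \<in> {0..1}" "C \<subseteq> W" "\<And>x. x \<in> W \<Longrightarrow> \<phi> x = 1"
      using smooth_urysohn[OF assms(1) U] by metis
    then show ?thesis by (intro exI[of _ \<phi>]) auto
  qed
  then obtain \<phi> where \<phi>: "\<And>n. \<phi> n \<in> test_functions (U n)" "\<And>n x. \<phi> n x \<in> {0..1::real}" "\<And>n x. x \<in> C \<Longrightarrow> \<phi> n x = 1"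
    by metis
  have "(\<lambda>n. \<phi> n x) \<longlonglongrightarrow> indicator C x" for x
  proof (cases "x \<in> C")
    case True then show ?thesis using \<phi>(3) by simp
  next
    case False
    then obtain e where e: "e > 0" "ball x e \<inter> C = {}"
      using compact_imp_closed[OF assms(1)] by (metis disjoint_iff_not_equal separate_point_closed
          mem_ball not_less)
    obtain N where N: "inverse (real (Suc N)) < e" using reals_Archimedean e by blast
    have "\<phi> n x = 0" if "n \<ge> N" for n
    proof (rule test_zero_outside[OF \<phi>(1)])
      have "inverse (real (Suc n)) \<le> inverse (real (Suc N))" using that by simp
      then have "inverse (real (Suc n)) < e" using N by linarith
      show "x \<notin> U n"
      proof
        assume "x \<in> U n"
        then obtain c where "c \<in> C" "dist c x < inverse (real (Suc n))" by (auto simp: U_def)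
        then have "c \<in> ball x e \<inter> C" using \<open>inverse (real (Suc n)) < e\<close> by (auto simp: dist_commute)
        then show False using e by auto
      qed
    qed
    then have "\<forall>\<^sub>F n in sequentially. \<phi> n x = indicator C x"
      using False eventually_sequentially by auto
    then show ?thesis by (rule tendsto_eventually)
  qed
  moreover have "\<phi> n x \<le> \<psi> x" for n x
  proof (cases "x \<in> V")
    case True then show ?thesis using \<psi>(5) \<phi>(2)[of n x] by simp
  next
    case False
    then have "\<phi> n x = 0" by (intro test_zero_outside[OF \<phi>(1)]) (auto simp: U_def)
    then show ?thesis using \<psi>(2)[of x] by simp
  qed
  moreover have "\<phi> n \<in> test_functions S" for n by (rule test_mono[OF \<phi>(1)]) (auto simp: U_def)
  ultimately show ?thesis using that[of \<psi> \<phi>] \<psi>(1,2) \<phi>(2) by auto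
qed

text \<open>Inner regularity: the set where \<open>h\<close> is positive is exhausted, up to small
  measure, by closed sets. These are compact because they lie in \<open>C\<close>, and each is null
  because a positive function has integral zero over it. Only one sign is treated; the other follows
  by applying the lemma to the negative of the function.\<close>

lemma AE_zero_if_integral_compact_zero:
  fixes h :: "'a::euclidean_space \<Rightarrow> real"
  assumes h: "integrable lebesgue h" "\<And>x. x \<notin> C \<Longrightarrow> h x = 0" "compact C"
    and z: "\<And>D. compact D \<Longrightarrow> D \<subseteq> C \<Longrightarrow> (LINT x|lebesgue. indicator D x * h x) = 0"
  shows "AE x in lebesgue. h x \<le> 0"
proof -
  have hm: "h \<in> borel_measurable lebesgue" using h by auto
  define B where "B = {x. h x > 0}"
  have B: "B \<in> sets lebesgue" unfolding B_def using borel_measurable_less[OF borel_measurable_const hm, of 0] by simp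
  have "emeasure lebesgue B \<le> ennreal e" if e: "e > 0" for e
  proof -
    obtain T where T: "closed T" "T \<subseteq> B" "B - T \<in> lmeasurable" "emeasure lebesgue (B - T) < ennreal e"
      using sets_lebesgue_inner_closed[OF B e] by blast
    have TC: "T \<subseteq> C" using T(2) h(2) by (force simp: B_def)
    then have cT: "compact T" using T h(3) by (metis compact_Int_closed inf.absorb2)
    have Ts: "T \<in> sets lebesgue" using lmeasurable_compact[OF cT] by auto
    have "integrable lebesgue (\<lambda>x. indicator T x * h x)"
      using integrable_mult_indicator[OF Ts h(1)] by simp
    moreover have "AE x in lebesgue. 0 \<le> indicator T x * h x"
      using T(2) by (auto simp: B_def indicator_def intro!: AE_I2)
    ultimately have "AE x in lebesgue. indicator T x * h x = 0"
      using z[OF cT TC] integral_nonneg_eq_0_iff_AE by blast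
    then have "AE x in lebesgue. x \<notin> T"
      by eventually_elim (use T(2) in \<open>force simp: B_def indicator_def\<close>)
    then have "emeasure lebesgue T = 0"
      using Ts by (subst (asm) AE_iff_measurable[of T]) auto
    moreover have "emeasure lebesgue B = emeasure lebesgue (B - T) + emeasure lebesgue T"
      using T Ts B plus_emeasure[of "B - T" lebesgue T]
      by (simp add: Un_absorb2 Int_commute[of _ T] del: emeasure_completion)
    ultimately show ?thesis using T(4) by simp
  qed
  then have "emeasure lebesgue B = 0"
    by (metis ennreal_le_epsilon add_0 zero_le le_zero_eq)
  then have "B \<in> null_sets lebesgue" using B by auto
  then have "AE x in lebesgue. x \<notin> B" by (rule AE_not_in)
  then show ?thesis by eventually_elim (auto simp: B_def)
qed

text \<open>Approximating indicators by test functions extends the hypothesis to integrals over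
  compact sets, and countably many compact sets exhaust \<open>S\<close>.\<close>

lemma fundamental_lemma:
  fixes g :: "'a::euclidean_space \<Rightarrow> real"
  assumes S: "open S" and g: "locally_integrable_on g S"
    and z: "\<And>\<phi>. \<phi> \<in> test_functions S \<Longrightarrow> (LINT x|lebesgue. g x * \<phi> x) = 0"
  shows "AE x in lebesgue. x \<in> S \<longrightarrow> g x = 0"
proof -
  have c: "(LINT x|lebesgue. indicator C x * g x) = 0" if C: "compact C" "C \<subseteq> S" for C
  proof -
    obtain \<psi> \<phi> where \<psi>: "\<psi> \<in> test_functions S" "\<And>n. \<phi> n \<in> test_functions S" "\<And>n x. 0 \<le> \<phi> n x \<and> \<phi> n x \<le> \<psi> x"
    "\<And>x. (\<lambda>n::nat. \<phi> n x) \<longlonglongrightarrow> indicator C x"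
      using test_functions_approx_indicator[OF C(1) S C(2)] by metis
    have "(\<lambda>n. LINT x|lebesgue. g x * \<phi> n x) \<longlonglongrightarrow> (LINT x|lebesgue. indicator C x * g x)"
    proof (rule integral_dominated_convergence[where w = "\<lambda>x. \<bar>g x * \<psi> x\<bar>"])
      show "(\<lambda>x. indicator C x * g x) \<in> borel_measurable lebesgue"
        using g C by (auto simp: locally_integrable_on_def set_integrable_def)
      show "(\<lambda>x. g x * \<phi> i x) \<in> borel_measurable lebesgue" for i
        using locally_integrable_test_integrable[OF g \<psi>(2)] by auto
      show "integrable lebesgue (\<lambda>x. \<bar>g x * \<psi> x\<bar>)"
        using locally_integrable_test_integrable[OF g \<psi>(1)] by auto
      show "AE x in lebesgue. (\<lambda>i. g x * \<phi> i x) \<longlonglongrightarrow> indicator C x * g x"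
        using tendsto_mult_left[OF \<psi>(4)] by (auto simp: mult.commute)
      show "AE x in lebesgue. norm (g x * \<phi> i x) \<le> \<bar>g x * \<psi> x\<bar>" for i
        using \<psi>(3)[of i] by (auto simp: abs_mult intro!: AE_I2 mult_left_mono)
          (metis abs_of_nonneg order_trans)
    qed
    then show ?thesis using z[OF \<psi>(2)] by (simp add: LIMSEQ_const_iff)
  qed
  have ae: "AE x in lebesgue. x \<in> C \<longrightarrow> g x = 0" if C: "compact C" "C \<subseteq> S" for C
  proof -
    have i: "integrable lebesgue (\<lambda>x. indicator C x * g x)"
      using g C by (auto simp: locally_integrable_on_def set_integrable_def)
    have z: "(LINT x|lebesgue. indicator D x * (indicator C x * g x)) = 0" if "compact D" "D \<subseteq> C" for D
    proof -
      have "indicator D x * (indicator C x * g x) = indicator D x * g x" for x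
        using that by (auto simp: indicator_def)
      then show ?thesis using c[of D] that C by (metis (no_types, lifting) Bochner_Integration.integral_cong order_trans)
    qed
    have "AE x in lebesgue. indicator C x * g x \<le> 0"
      by (rule AE_zero_if_integral_compact_zero[of _ C]) (use i z C in simp_all)
    moreover have "AE x in lebesgue. - (indicator C x * g x) \<le> 0"
      by (rule AE_zero_if_integral_compact_zero[of _ C]) (use i z C in simp_all)
    ultimately show ?thesis by eventually_elim (auto simp: indicator_def split: if_splits)
  qed
  obtain K where K: "\<And>n::nat. compact (K n)" "\<And>n. K n \<subseteq> S" "\<Union> (range K) = S"
    using open_Union_compact_subsets[OF S] by metis
  have "AE x in lebesgue. \<forall>n. x \<in> K n \<longrightarrow> g x = 0"
    unfolding AE_all_countable using ae K by auto
  then show ?thesis by eventually_elim (use K(3) in auto)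
qed

section \<open>Square integrable functions\<close>

text \<open>Functions live on the whole space; a function on a domain enters through its extension
  \<open>zext\<close> by zero, so that the single norm \<open>n2\<close> serves all domains.\<close>

definition L2 :: "('a::euclidean_space \<Rightarrow> real) \<Rightarrow> bool" where
  "L2 f \<longleftrightarrow> f \<in> borel_measurable lebesgue \<and> integrable lebesgue (\<lambda>x. (f x)\<^sup>2)"

definition n2 :: "('a::euclidean_space \<Rightarrow> real) \<Rightarrow> real" where
  "n2 f = sqrt (LINT x|lebesgue. (f x)\<^sup>2)"

lemma L2_measurable: "L2 f \<Longrightarrow> f \<in> borel_measurable lebesgue" by (simp add: L2_def)

lemma L2_sq_integrable: "L2 f \<Longrightarrow> integrable lebesgue (\<lambda>x. (f x)\<^sup>2)" by (simp add: L2_def)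

lemma L2_mult_integrable:
  assumes "L2 f" "L2 g" shows "integrable lebesgue (\<lambda>x. f x * g x)"
proof (rule Bochner_Integration.integrable_bound[of _ "\<lambda>x. (f x)\<^sup>2 + (g x)\<^sup>2"])
  show "integrable lebesgue (\<lambda>x. (f x)\<^sup>2 + (g x)\<^sup>2)" using assms by (simp add: L2_def)
  show "(\<lambda>x. f x * g x) \<in> borel_measurable lebesgue"
    using assms by (intro borel_measurable_times L2_measurable)
  have "\<bar>a * b\<bar> \<le> \<bar>a\<^sup>2 + b\<^sup>2\<bar>" for a b :: real
  proof -
    have "2 * \<bar>a\<bar> * \<bar>b\<bar> \<le> a\<^sup>2 + b\<^sup>2" using sum_squares_bound[of "\<bar>a\<bar>" "\<bar>b\<bar>"] by simp
    moreover have "0 \<le> \<bar>a\<bar> * \<bar>b\<bar>" "\<bar>a\<^sup>2 + b\<^sup>2\<bar> = a\<^sup>2 + b\<^sup>2" by auto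
    ultimately show ?thesis unfolding abs_mult by linarith
  qed
  then show "AE x in lebesgue. norm (f x * g x) \<le> norm ((f x)\<^sup>2 + (g x)\<^sup>2)" by simp
qed

lemma L2_add:
  assumes "L2 f" "L2 g" shows "L2 (\<lambda>x. f x + g x)"
proof -
  have "integrable lebesgue (\<lambda>x. (f x)\<^sup>2 + (g x)\<^sup>2 + 2 * (f x * g x))"
    using assms L2_mult_integrable[OF assms] by (auto simp: L2_def)
  then show ?thesis using borel_measurable_add[OF assms[THEN L2_measurable]]
    by (simp add: L2_def power2_sum mult.assoc)
qed

lemma L2_zero [simp]: "L2 (\<lambda>x. 0)" by (simp add: L2_def)

lemma L2_cmult: "L2 f \<Longrightarrow> L2 (\<lambda>x. c * f x)"
  using borel_measurable_times[OF borel_measurable_const[of c] L2_measurable[of f]]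
  by (simp add: L2_def power_mult_distrib)

lemma L2_minus: "L2 f \<Longrightarrow> L2 (\<lambda>x. - f x)" by (simp add: L2_def)

lemma L2_diff: "L2 f \<Longrightarrow> L2 g \<Longrightarrow> L2 (\<lambda>x. f x - g x)"
  using L2_add[OF _ L2_minus, of f g] by simp

lemma L2_sum: "(\<And>i. i \<in> I \<Longrightarrow> L2 (f i)) \<Longrightarrow> L2 (\<lambda>x. \<Sum>i\<in>I. f i x)"
  by (induction I rule: infinite_finite_induct) (auto intro: L2_add)

lemma L2_bound:
  assumes "L2 f" "g \<in> borel_measurable lebesgue" "\<And>x. \<bar>g x\<bar> \<le> \<bar>f x\<bar>"
  shows "L2 g" "n2 g \<le> n2 f"
proof -
  have le: "(g x)\<^sup>2 \<le> (f x)\<^sup>2" for x using assms(3)[of x] by (simp add: abs_le_square_iff)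
  have i: "integrable lebesgue (\<lambda>x. (f x)\<^sup>2)" using assms by (simp add: L2_def)
  have ig: "integrable lebesgue (\<lambda>x. (g x)\<^sup>2)"
    by (rule Bochner_Integration.integrable_bound[OF i]) (use assms(2) le in auto)
  then show "L2 g" using assms by (simp add: L2_def)
  show "n2 g \<le> n2 f" unfolding n2_def
    by (intro real_sqrt_le_mono integral_mono i ig) (use le in auto)
qed

lemma n2_nonneg [simp]: "0 \<le> n2 f" by (simp add: n2_def)

lemma n2_sq: "(n2 f)\<^sup>2 = (LINT x|lebesgue. (f x)\<^sup>2)" by (simp add: n2_def)

lemma n2_zero [simp]: "n2 (\<lambda>x. 0) = 0" by (simp add: n2_def)

lemma n2_cmult: "n2 (\<lambda>x. c * f x) = \<bar>c\<bar> * n2 f"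
  by (simp add: n2_def power_mult_distrib real_sqrt_mult)

lemma n2_minus: "n2 (\<lambda>x. - f x) = n2 f" by (simp add: n2_def)

lemma n2_cong_AE:
  assumes "AE x in lebesgue. f x = g x" "f \<in> borel_measurable lebesgue" "g \<in> borel_measurable lebesgue"
  shows "n2 f = n2 g"
  unfolding n2_def by (intro arg_cong[where f = sqrt] integral_cong_AE) (use assms in auto)

lemma n2_cauchy_schwarz:
  assumes "L2 f" "L2 g" shows "\<bar>LINT x|lebesgue. f x * g x\<bar> \<le> n2 f * n2 g"
proof -
  define a where "a = (LINT x|lebesgue. (f x)\<^sup>2)"
  define b where "b = (LINT x|lebesgue. f x * g x)"
  define c where "c = (LINT x|lebesgue. (g x)\<^sup>2)"
  have q: "0 \<le> a + 2 * t * b + t\<^sup>2 * c" for t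
  proof -
    have "0 \<le> (LINT x|lebesgue. (f x + t * g x)\<^sup>2)" by simp
    also have "\<dots> = (LINT x|lebesgue. (f x)\<^sup>2 + 2 * t * (f x * g x) + t\<^sup>2 * (g x)\<^sup>2)"
      by (simp add: power2_sum power_mult_distrib algebra_simps)
    also have "\<dots> = a + 2 * t * b + t\<^sup>2 * c"
      using assms L2_mult_integrable[OF assms] by (simp add: L2_def a_def b_def c_def)
    finally show ?thesis .
  qed
  have c0: "c \<ge> 0" by (simp add: c_def)
  have "b\<^sup>2 \<le> a * c"
  proof (cases "c = 0")
    case True
    have "b = 0"
    proof (rule ccontr)
      assume "b \<noteq> 0"
      \<comment> \<open>At this value of \<open>t\<close> the expression, affine because
        \<open>c = 0\<close>, equals -1.\<close>
      then show False using q[of "- (a + 1) / (2 * b)"] True by (simp add: field_simps)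
    qed
    then show ?thesis using True by simp
  next
    case False
    then have c: "c > 0" using c0 by simp
    \<comment> \<open>The quadratic is evaluated at its minimiser.\<close>
    have "0 \<le> a + 2 * (- b / c) * b + (- b / c)\<^sup>2 * c" by (rule q)
    also have "\<dots> = a - b\<^sup>2 / c" using c by (simp add: field_simps power2_eq_square)
    finally show ?thesis using c by (simp add: field_simps)
  qed
  then have "sqrt (b\<^sup>2) \<le> sqrt (a * c)" by (rule real_sqrt_le_mono)
  then show ?thesis by (simp add: a_def b_def c_def n2_def real_sqrt_mult)
qed

lemma n2_triangle:
  assumes "L2 f" "L2 g" shows "n2 (\<lambda>x. f x + g x) \<le> n2 f + n2 g"
proof (rule power2_le_imp_le)
  have "(n2 (\<lambda>x. f x + g x))\<^sup>2 = (LINT x|lebesgue. (f x)\<^sup>2 + 2 * (f x * g x) + (g x)\<^sup>2)"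
    by (simp add: n2_sq power2_sum algebra_simps)
  also have "\<dots> = (n2 f)\<^sup>2 + 2 * (LINT x|lebesgue. f x * g x) + (n2 g)\<^sup>2"
    using assms L2_mult_integrable[OF assms] by (simp add: L2_def n2_sq)
  also have "\<dots> \<le> (n2 f)\<^sup>2 + 2 * (n2 f * n2 g) + (n2 g)\<^sup>2"
    using n2_cauchy_schwarz[OF assms] by simp
  finally show "(n2 (\<lambda>x. f x + g x))\<^sup>2 \<le> (n2 f + n2 g)\<^sup>2" by (simp add: power2_sum)
qed simp

lemma n2_triangle_diff:
  assumes "L2 f" "L2 g" shows "n2 (\<lambda>x. f x - g x) \<le> n2 f + n2 g"
  using n2_triangle[OF assms(1) L2_minus[OF assms(2)]] by (simp add: n2_minus)

lemma n2_sum: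
  assumes "\<And>i. i \<in> I \<Longrightarrow> L2 (f i)" shows "n2 (\<lambda>x. \<Sum>i\<in>I. f i x) \<le> (\<Sum>i\<in>I. n2 (f i))"
  using assms
proof (induction I rule: infinite_finite_induct)
  case (insert i I)
  then show ?case using n2_triangle[of "f i" "\<lambda>x. \<Sum>i\<in>I. f i x"] L2_sum[of I f] by force
qed auto

lemma L2_mult_bounded:
  assumes "L2 f" "a \<in> borel_measurable lebesgue" "\<And>x. \<bar>a x\<bar> \<le> B"
  shows "L2 (\<lambda>x. a x * f x)" "n2 (\<lambda>x. a x * f x) \<le> B * n2 f"
proof -
  have B: "B \<ge> 0" using assms(3)[of undefined] by simp
  have m: "(\<lambda>x. a x * f x) \<in> borel_measurable lebesgue"
    by (rule borel_measurable_times[OF assms(2) L2_measurable[OF assms(1)]])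
  have le: "\<bar>a x * f x\<bar> \<le> \<bar>B * f x\<bar>" for x
    using mult_right_mono[OF assms(3)[of x], of "\<bar>f x\<bar>"] B by (simp add: abs_mult)
  show "L2 (\<lambda>x. a x * f x)" by (rule L2_bound(1)[OF L2_cmult[OF assms(1)] m le])
  show "n2 (\<lambda>x. a x * f x) \<le> B * n2 f"
    using L2_bound(2)[OF L2_cmult[OF assms(1)] m le] B by (simp add: n2_cmult)
qed

lemma L2_continuous_compact_support:
  fixes f :: "'a::euclidean_space \<Rightarrow> real"
  assumes "continuous_on UNIV f" "compact C" "\<And>x. x \<notin> C \<Longrightarrow> f x = 0"
  shows "L2 f"
proof -
  have "integrable lebesgue (\<lambda>x. (f x)\<^sup>2)"
    by (rule integrable_continuous_compact_support[OF _ assms(2)]) (use assms in \<open>auto intro: continuous_intros\<close>)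
  then show ?thesis using continuous_lebesgue_measurable[OF assms(1)] by (simp add: L2_def)
qed

lemma L2_test:
  assumes "\<phi> \<in> test_functions S" shows "L2 \<phi>"
  by (rule test_functionsE[OF assms], rule L2_continuous_compact_support[OF smooth_continuous[OF test_smooth[OF assms]]])

lemma L2_locally_integrable:
  fixes f :: "'a::euclidean_space \<Rightarrow> real"
  assumes "L2 f" shows "locally_integrable_on f S"
  unfolding locally_integrable_on_def set_integrable_def
proof safe
  fix C :: "'a set" assume C: "compact C"
  have Cm: "C \<in> sets lebesgue" using lmeasurable_compact[OF C] by auto
  have "L2 (indicator C :: 'a \<Rightarrow> real)"
    using integrable_indicator_compact[OF C] Cm by (simp add: L2_def power2_eq_square flip: indicator_inter_arith)
  from L2_mult_integrable[OF this assms]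
  show "integrable lebesgue (\<lambda>x. indicat_real C x *\<^sub>R f x)" by simp
qed

lemma L2_tendsto_integral:
  assumes "\<And>n. L2 (f n)" "L2 g" "L2 h" "(\<lambda>n. n2 (\<lambda>x. f n x - g x)) \<longlonglongrightarrow> 0"
  shows "(\<lambda>n. LINT x|lebesgue. f n x * h x) \<longlonglongrightarrow> (LINT x|lebesgue. g x * h x)"
proof (rule LIM_zero_cancel, rule Lim_null_comparison)
  show "\<forall>\<^sub>F n in sequentially. norm ((LINT x|lebesgue. f n x * h x) - (LINT x|lebesgue. g x * h x)) \<le> n2 (\<lambda>x. f n x - g x) * n2 h"
  proof (intro always_eventually allI)
    fix n
    have "(LINT x|lebesgue. f n x * h x) - (LINT x|lebesgue. g x * h x) = (LINT x|lebesgue. (f n x - g x) * h x)"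
      using assms by (simp add: left_diff_distrib L2_mult_integrable)
    then show "norm ((LINT x|lebesgue. f n x * h x) - (LINT x|lebesgue. g x * h x)) \<le> n2 (\<lambda>x. f n x - g x) * n2 h"
      using n2_cauchy_schwarz[of "\<lambda>x. f n x - g x" h] assms by (simp add: L2_diff)
  qed
  show "(\<lambda>n. n2 (\<lambda>x. f n x - g x) * n2 h) \<longlonglongrightarrow> 0" using assms(4) by (rule tendsto_mult_left_zero)
qed

section \<open>Functions on a subset, extended by zero\<close>

definition zext :: "'a set \<Rightarrow> ('a \<Rightarrow> real) \<Rightarrow> 'a \<Rightarrow> real" where
  "zext S u = (\<lambda>x. indicator S x * u x)"

lemma zext_in [simp]: "x \<in> S \<Longrightarrow> zext S u x = u x" and zext_out [simp]: "x \<notin> S \<Longrightarrow> zext S u x = 0"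
  by (auto simp: zext_def)

lemma zext_id: "(\<And>x. x \<notin> S \<Longrightarrow> u x = 0) \<Longrightarrow> zext S u = u"
  by (auto simp: zext_def fun_eq_iff indicator_def)

lemma L2_zext:
  fixes f :: "'a::euclidean_space \<Rightarrow> real"
  assumes "L2 f" "S \<in> sets lebesgue" shows "L2 (zext S f)" "n2 (zext S f) \<le> n2 f"
proof -
  have m: "zext S f \<in> borel_measurable lebesgue"
    unfolding zext_def using assms by (intro borel_measurable_times borel_measurable_indicator L2_measurable)
  have le: "\<bar>zext S f x\<bar> \<le> \<bar>f x\<bar>" for x by (simp add: zext_def indicator_def)
  show "L2 (zext S f)" "n2 (zext S f) \<le> n2 f" using L2_bound[OF assms(1) m le] by auto
qed

lemma open_in_lebesgue: "open S \<Longrightarrow> S \<in> sets lebesgue"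
  by (simp add: borel_open)

lemma Lp2_iff:
  assumes "S \<in> sets lebesgue" shows "u \<in> Lp 2 S \<longleftrightarrow> L2 (zext S u)"
proof -
  have p: "\<bar>a\<bar> powr 2 = a\<^sup>2" for a :: real by simp
  have z: "(zext S u x)\<^sup>2 = indicator S x * (u x)\<^sup>2" for x by (simp add: zext_def indicator_def)
  show ?thesis unfolding Lp_def L2_def mem_Collect_eq p z unfolding zext_def using assms
    by (simp add: borel_measurable_restrict_space_iff integrable_restrict_space)
qed

lemma integral_sq_zext:
  assumes "S \<in> sets lebesgue" shows "(LINT x|lebesgue_on S. (u x)\<^sup>2) = (n2 (zext S u))\<^sup>2"
proof -
  have z: "(zext S u x)\<^sup>2 = indicator S x * (u x)\<^sup>2" for x by (simp add: zext_def indicator_def)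
  show ?thesis unfolding n2_sq z using assms by (simp add: integral_restrict_space)
qed

lemma Lp_norm_2: "Lp_norm 2 UNIV u = n2 u"
proof -
  have "\<bar>a\<bar> powr 2 = a\<^sup>2" for a :: real by simp
  then show ?thesis unfolding Lp_norm_def n2_def by (simp add: powr_half_sqrt lebesgue_on_UNIV_eq)
qed

section \<open>Weak derivatives\<close>

lemma integral_lebesgue_on_zero_outside:
  fixes f :: "'a::euclidean_space \<Rightarrow> real"
  assumes "S \<in> sets lebesgue" "\<And>x. x \<notin> S \<Longrightarrow> f x = 0"
  shows "(LINT x|lebesgue_on S. f x) = (LINT x|lebesgue. f x)"
proof -
  have "(\<lambda>x. indicator S x * f x) = f" using assms(2) by (auto simp: fun_eq_iff indicator_def)
  then show ?thesis using assms(1) by (simp add: integral_restrict_space)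
qed

lemma test_partial_deriv: "\<phi> \<in> test_functions S \<Longrightarrow> partial_deriv bs \<phi> \<in> test_functions S"
  by (induction bs) (auto simp only: partial_deriv.simps(1) partial_deriv_Cons test_dir_deriv)

lemma has_weak_deriv_iff:
  assumes "open S"
  shows "has_weak_deriv S bs u v \<longleftrightarrow> locally_integrable_on u S \<and> locally_integrable_on v S \<and>
    (\<forall>\<phi>\<in>test_functions S. (LINT x|lebesgue. u x * partial_deriv bs \<phi> x) =
        (-1) ^ length bs * (LINT x|lebesgue. v x * \<phi> x))"
proof -
  have 1: "(LINT x|lebesgue_on S. w x * \<phi> x) = (LINT x|lebesgue. w x * \<phi> x)" if "\<phi> \<in> test_functions S" for w \<phi>
    using integral_lebesgue_on_zero_outside[OF open_in_lebesgue[OF assms]] test_zero_outside[OF that] by simp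
  have 2: "(LINT x|lebesgue_on S. w x * partial_deriv bs \<phi> x) = (LINT x|lebesgue. w x * partial_deriv bs \<phi> x)"
    if "\<phi> \<in> test_functions S" for w \<phi>
    by (rule 1[OF test_partial_deriv[OF that]])
  show ?thesis unfolding has_weak_deriv_def using 1 2 by simp
qed

lemma has_weak_deriv_Nil: "has_weak_deriv S [] u v \<longleftrightarrow>  locally_integrable_on u S \<and> locally_integrable_on v S \<and>
    (\<forall>\<phi>\<in>test_functions S. (LINT x|lebesgue_on S. u x * \<phi> x) = (LINT x|lebesgue_on S. v x * \<phi> x))"
  by (simp add: has_weak_deriv_def)

lemma has_weak_deriv_single: "open S \<Longrightarrow> has_weak_deriv S [b] u v \<longleftrightarrow> wderiv S b u v"
  by (simp add: has_weak_deriv_iff wderiv_def partial_deriv_Cons del: partial_deriv.simps(2))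

text \<open>In \<open>partial_deriv [b, c] \<phi>\<close> the direction \<open>b\<close> is
  outermost, so it is the first to be moved to \<open>u\<close>; the signs of the two integrations
  by parts cancel.\<close>

lemma has_weak_deriv_pair:
  assumes "open S" "wderiv S b u v"
  shows "has_weak_deriv S [b, c] u w \<longleftrightarrow> wderiv S c v w"
proof -
  have "(LINT x|lebesgue. u x * partial_deriv [b, c] \<phi> x) = - (LINT x|lebesgue. v x * dir_deriv c \<phi> x)"
    if "\<phi> \<in> test_functions S" for \<phi>
    using wderivD[OF assms(2) test_dir_deriv[OF that]] by (simp only: partial_deriv_Cons partial_deriv.simps(1))
  then show ?thesis
    using assms wderiv_locally_integrable[OF assms(2)]
    by (auto simp: has_weak_deriv_iff wderiv_def simp del: partial_deriv.simps)
qed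

lemma locally_integrable_diff:
  "locally_integrable_on u S \<Longrightarrow> locally_integrable_on v S \<Longrightarrow> locally_integrable_on (\<lambda>x. u x - v x) S"
  by (auto simp: locally_integrable_on_def intro: set_integral_diff)

lemma has_weak_deriv_unique:
  assumes S: "open S" and "has_weak_deriv S bs u v" "has_weak_deriv S bs u v'"
  shows "AE x in lebesgue. x \<in> S \<longrightarrow> v x = v' x"
proof -
  note d = assms(2,3)[unfolded has_weak_deriv_iff[OF S]]
  have "AE x in lebesgue. x \<in> S \<longrightarrow> v x - v' x = 0"
  proof (rule fundamental_lemma[OF S])
    show "locally_integrable_on (\<lambda>x. v x - v' x) S" using d by (auto intro: locally_integrable_diff)
    fix \<phi> assume \<phi>: "\<phi> \<in> test_functions S"
    have "(-1) ^ length bs * (LINT x|lebesgue. v x * \<phi> x) = (-1) ^ length bs * (LINT x|lebesgue. v' x * \<phi> x)"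
      using d \<phi> by metis
    then have "(LINT x|lebesgue. v x * \<phi> x) = (LINT x|lebesgue. v' x * \<phi> x)" by simp
    then show "(LINT x|lebesgue. (v x - v' x) * \<phi> x) = 0"
      using d locally_integrable_test_integrable[OF _ \<phi>] by (simp add: left_diff_distrib)
  qed
  then show ?thesis by eventually_elim auto
qed

lemma L2_zext_cong_AE:
  assumes "AE x in lebesgue. x \<in> S \<longrightarrow> v x = v' x" "L2 (zext S v')"
  shows "L2 (zext S v)" "n2 (zext S v) = n2 (zext S v')"
proof -
  have ae: "AE x in lebesgue. zext S v' x = zext S v x" using assms(1) by eventually_elim (auto simp: zext_def indicator_def)
  have m': "zext S v' \<in> borel_measurable lebesgue" using assms(2) by (simp add: L2_def)
  have m: "zext S v \<in> borel_measurable lebesgue"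
    by (rule borel_measurable_AE[OF m' ae])
  show "n2 (zext S v) = n2 (zext S v')" by (rule n2_cong_AE) (use ae m m' in auto)
  have "integrable lebesgue (\<lambda>x. (zext S v x)\<^sup>2) = integrable lebesgue (\<lambda>x. (zext S v' x)\<^sup>2)"
    by (rule integrable_cong_AE) (use ae m m' in auto)
  then show "L2 (zext S v)" using m assms(2) by (simp add: L2_def)
qed

lemma finite_dirs: "finite (dirs k)"
  unfolding dirs_def by (rule finite_lists_length_le[OF finite_Basis])

text \<open>\<open>weak_deriv\<close> is a choice. All that is known of it comes from uniqueness: it
  agrees almost everywhere in \<open>S\<close> with any explicitly given derivative and thus has the
  same norm.\<close>

lemma weak_deriv_zext:
  assumes "open S" "has_weak_deriv S bs u v" "L2 (zext S v)"
  shows "L2 (zext S (weak_deriv S bs u))" "n2 (zext S (weak_deriv S bs u)) = n2 (zext S v)"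
proof -
  have "has_weak_deriv S bs u (weak_deriv S bs u)"
    unfolding weak_deriv_def using someI[of "has_weak_deriv S bs u", OF assms(2)] .
  from has_weak_deriv_unique[OF assms(1) this assms(2)]
  show "L2 (zext S (weak_deriv S bs u))" "n2 (zext S (weak_deriv S bs u)) = n2 (zext S v)"
    using L2_zext_cong_AE assms(3) by blast+
qed

lemma Hk_norm_eq:
  assumes S: "open S" and "\<And>bs. bs \<in> dirs k \<Longrightarrow> has_weak_deriv S bs u (V bs)" "\<And>bs. bs \<in> dirs k \<Longrightarrow> L2 (zext S (V bs))"
  shows "Hk_norm k S u = L2_set (\<lambda>bs. n2 (zext S (V bs))) (dirs k)"
  unfolding Hk_norm_def L2_set_def
  by (intro arg_cong[where f = sqrt] sum.cong refl)
     (use assms weak_deriv_zext integral_sq_zext[OF open_in_lebesgue[OF S]] in metis)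

text \<open>The weak derivatives of first and second order are explicit arguments. They are taken in \<open>S\<close> only, while
  square integrability is required on the whole space, for functions that are extended by zero.\<close>

definition H2s :: "'a::euclidean_space set \<Rightarrow> ('a \<Rightarrow> real) \<Rightarrow> ('a \<Rightarrow> 'a \<Rightarrow> real) \<Rightarrow> ('a \<Rightarrow> 'a \<Rightarrow> 'a \<Rightarrow> real) \<Rightarrow> bool" where
  "H2s S u v w \<longleftrightarrow> L2 u \<and> (\<forall>b\<in>Basis. L2 (v b) \<and> wderiv S b u (v b)) \<and>
     (\<forall>b\<in>Basis. \<forall>c\<in>Basis. L2 (w b c) \<and> wderiv S c (v b) (w b c))"

text \<open>A sum of norms instead of the root of a sum of squares: it serves only as an upper bound
  for \<open>Hk_norm\<close>.\<close>

definition H2n :: "('a::euclidean_space \<Rightarrow> real) \<Rightarrow> ('a \<Rightarrow> 'a \<Rightarrow> real) \<Rightarrow> ('a \<Rightarrow> 'a \<Rightarrow> 'a \<Rightarrow> real) \<Rightarrow> real" where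
  "H2n u v w = n2 u + (\<Sum>b\<in>Basis. n2 (v b)) + (\<Sum>b\<in>Basis. \<Sum>c\<in>Basis. n2 (w b c))"

lemma H2sD:
  assumes "H2s S u v w"
  shows "L2 u" "b \<in> Basis \<Longrightarrow> L2 (v b)" "b \<in> Basis \<Longrightarrow> wderiv S b u (v b)"
    "b \<in> Basis \<Longrightarrow> c \<in> Basis \<Longrightarrow> L2 (w b c)" "b \<in> Basis \<Longrightarrow> c \<in> Basis \<Longrightarrow> wderiv S c (v b) (w b c)"
  using assms by (auto simp: H2s_def)

lemma H2s_subset: "H2s S u v w \<Longrightarrow> T \<subseteq> S \<Longrightarrow> H2s T u v w"
  unfolding H2s_def using wderiv_subset by blast

lemma H2s_add: "H2s S u v w \<Longrightarrow> H2s S u' v' w' \<Longrightarrow>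
    H2s S (\<lambda>x. u x + u' x) (\<lambda>b x. v b x + v' b x) (\<lambda>b c x. w b c x + w' b c x)"
  by (auto simp: H2s_def intro!: L2_add wderiv_add)

lemma H2s_diff: "H2s S u v w \<Longrightarrow> H2s S u' v' w' \<Longrightarrow>
    H2s S (\<lambda>x. u x - u' x) (\<lambda>b x. v b x - v' b x) (\<lambda>b c x. w b c x - w' b c x)"
  by (auto simp: H2s_def intro!: L2_diff wderiv_diff)

lemma H2s_cmult: "H2s S u v w \<Longrightarrow> H2s S (\<lambda>x. k * u x) (\<lambda>b x. k * v b x) (\<lambda>b c x. k * w b c x)"
  by (auto simp: H2s_def intro!: L2_cmult wderiv_cmult)

lemma H2s_cong:
  assumes "H2s S u v w" "\<And>x. x \<in> S \<Longrightarrow> u x = u' x" "L2 u'"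
  shows "H2s S u' v w"
proof -
  have "wderiv S b u (v b) \<longleftrightarrow> wderiv S b u' (v b)" for b by (rule wderiv_cong) (use assms in auto)
  then show ?thesis using assms by (simp add: H2s_def)
qed

section \<open>Passage between Sobolev functions and explicit weak derivatives\<close>

lemma dirs_1: "dirs (Suc 0) = insert [] ((\<lambda>b. [b]) ` Basis)"
proof (rule set_eqI)
  fix bs :: "'a list"
  show "bs \<in> dirs (Suc 0) \<longleftrightarrow> bs \<in> insert [] ((\<lambda>b. [b]) ` Basis)" by (cases bs) (auto simp: dirs_def)
qed

lemma dirs_2: "dirs 2 = insert [] ((\<lambda>b. [b]) ` Basis \<union> (\<lambda>(b, c). [b, c]) ` (Basis \<times> Basis))"
proof (rule set_eqI)
  fix bs :: "'a list"
  show "bs \<in> dirs 2 \<longleftrightarrow> bs \<in> insert [] ((\<lambda>b. [b]) ` Basis \<union> (\<lambda>(b, c). [b, c]) ` (Basis \<times> Basis))"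
    by (cases bs rule: remdups_adj.cases) (auto simp: dirs_def image_iff)
qed

text \<open>Translates explicit derivatives into the list indexing of \<open>Hk\<close>; tails
  beyond two entries do not occur in \<open>dirs 2\<close>.\<close>

definition dlist :: "('a \<Rightarrow> real) \<Rightarrow> ('a \<Rightarrow> 'a \<Rightarrow> real) \<Rightarrow> ('a \<Rightarrow> 'a \<Rightarrow> 'a \<Rightarrow> real) \<Rightarrow> 'a list \<Rightarrow> 'a \<Rightarrow> real" where
  "dlist u v w bs = (case bs of [] \<Rightarrow> u | [b] \<Rightarrow> v b | b # c # _ \<Rightarrow> w b c)"

lemma H2s_weak_deriv:
  assumes "open S" "H2s S u v w" "bs \<in> dirs 2"
  shows "has_weak_deriv S bs u (dlist u v w bs)" "L2 (dlist u v w bs)" "L2 (zext S (dlist u v w bs))"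
proof -
  note H = H2sD[OF assms(2)]
  from assms(3) consider "bs = []" | b where "b \<in> Basis" "bs = [b]" | b c where "b \<in> Basis" "c \<in> Basis" "bs = [b, c]"
    by (auto simp: dirs_2)
  then have "has_weak_deriv S bs u (dlist u v w bs) \<and> L2 (dlist u v w bs)"
  proof cases
    case 1 then show ?thesis using H(1) L2_locally_integrable by (auto simp: dlist_def has_weak_deriv_Nil)
  next
    case 2 then show ?thesis using H(2,3) by (auto simp: dlist_def has_weak_deriv_single[OF assms(1)])
  next
    case 3 then show ?thesis
      using H(4)[OF 3(1,2)] H(5)[OF 3(1,2)] has_weak_deriv_pair[OF assms(1) H(3)[OF 3(1)], of c "w b c"]
      by (auto simp: dlist_def)
  qed
  then show "has_weak_deriv S bs u (dlist u v w bs)" "L2 (dlist u v w bs)" by auto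
  then show "L2 (zext S (dlist u v w bs))" by (intro L2_zext(1) open_in_lebesgue assms)
qed

lemma has_weak_deriv_cong:
  assumes "open S" "\<And>x. x \<in> S \<Longrightarrow> u x = u' x"
  shows "has_weak_deriv S bs u v \<longleftrightarrow> has_weak_deriv S bs u' v"
proof -
  have "(\<lambda>x. u x * partial_deriv bs \<phi> x) = (\<lambda>x. u' x * partial_deriv bs \<phi> x)" if "\<phi> \<in> test_functions S" for \<phi>
    using assms(2) test_zero_outside[OF test_partial_deriv[OF that]] by (force simp: fun_eq_iff)
  moreover have "locally_integrable_on u S = locally_integrable_on u' S"
    by (rule locally_integrable_cong) (rule assms)
  ultimately show ?thesis by (simp add: has_weak_deriv_iff[OF assms(1)])
qed

lemma H2s_imp_Hk:
  assumes S: "open S" and H: "H2s S u' v w" and e: "\<And>x. x \<in> S \<Longrightarrow> u x = u' x"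
  shows "u \<in> Hk 2 S" "Hk_norm 2 S u \<le> H2n u' v w"
proof -
  have w: "has_weak_deriv S bs u (dlist u' v w bs)" if "bs \<in> dirs 2" for bs
    by (subst has_weak_deriv_cong[OF S e]) (assumption, rule H2s_weak_deriv(1)[OF S H that])
  have "zext S u = zext S u'" using e by (auto simp: fun_eq_iff zext_def indicator_def)
  then have "u \<in> Lp 2 S" using H2sD(1)[OF H] by (simp add: Lp2_iff open_in_lebesgue S L2_zext)
  moreover have "\<exists>v\<in>Lp 2 S. has_weak_deriv S bs u v" if "bs \<in> dirs 2" for bs
    using w[OF that] H2s_weak_deriv(3)[OF S H that] Lp2_iff[OF open_in_lebesgue[OF S]] by blast
  ultimately show "u \<in> Hk 2 S" by (simp add: Hk_def)
  have "Hk_norm 2 S u = L2_set (\<lambda>bs. n2 (zext S (dlist u' v w bs))) (dirs 2)"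
    by (rule Hk_norm_eq[OF S w H2s_weak_deriv(3)[OF S H]])
  also have "\<dots> \<le> (\<Sum>bs\<in>dirs 2. n2 (zext S (dlist u' v w bs)))" by (rule L2_set_le_sum) simp
  also have "\<dots> \<le> (\<Sum>bs\<in>dirs 2. n2 (dlist u' v w bs))"
    by (intro sum_mono L2_zext(2) H2s_weak_deriv(2)[OF S H] open_in_lebesgue S)
  also have "\<dots> = H2n u' v w"
  proof -
    have "(\<Sum>bs\<in>dirs 2. n2 (dlist u' v w bs)) = n2 u' + ((\<Sum>bs\<in>(\<lambda>b. [b]) ` Basis. n2 (dlist u' v w bs))
        + (\<Sum>bs\<in>(\<lambda>(b, c). [b, c]) ` (Basis \<times> Basis). n2 (dlist u' v w bs)))"
      unfolding dirs_2 by (subst sum.insert) (auto simp: dlist_def intro!: sum.union_disjoint)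
    also have "(\<Sum>bs\<in>(\<lambda>b. [b]) ` Basis. n2 (dlist u' v w bs)) = (\<Sum>b\<in>Basis. n2 (v b))"
      by (subst sum.reindex) (auto simp: inj_on_def dlist_def)
    also have "(\<Sum>bs\<in>(\<lambda>(b, c). [b, c]) ` (Basis \<times> Basis). n2 (dlist u' v w bs)) = (\<Sum>b\<in>Basis. \<Sum>c\<in>Basis. n2 (w b c))"
      by (subst sum.reindex) (auto simp: inj_on_def dlist_def sum.cartesian_product case_prod_beta)
    finally show ?thesis by (simp add: H2n_def)
  qed
  finally show "Hk_norm 2 S u \<le> H2n u' v w" .
qed

text \<open>The derivatives are cut to zero outside \<open>S\<close>. This leaves the weak
  identities on \<open>S\<close> intact and lets later integrals and norms run over the whole
  space.\<close>

lemma Hk_imp_H2s: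
  assumes S: "open S" and u: "u \<in> Hk 2 S"
  obtains v w where "H2s S (zext S u) v w" "\<And>b x. x \<notin> S \<Longrightarrow> v b x = 0" "\<And>b c x. x \<notin> S \<Longrightarrow> w b c x = 0"
    "n2 (zext S u) \<le> Hk_norm 2 S u" "\<And>b. b \<in> Basis \<Longrightarrow> n2 (v b) \<le> Hk_norm 2 S u"
    "\<And>b c. b \<in> Basis \<Longrightarrow> c \<in> Basis \<Longrightarrow> n2 (w b c) \<le> Hk_norm 2 S u"
proof -
  have "\<exists>v. has_weak_deriv S bs u v \<and> L2 (zext S v)" if "bs \<in> dirs 2" for bs
    using u that Lp2_iff[OF open_in_lebesgue[OF S]] unfolding Hk_def by blast
  then obtain V where V: "\<And>bs. bs \<in> dirs 2 \<Longrightarrow> has_weak_deriv S bs u (V bs)" "\<And>bs. bs \<in> dirs 2 \<Longrightarrow> L2 (zext S (V bs))"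
    by metis
  have E: "Hk_norm 2 S u = L2_set (\<lambda>bs. n2 (zext S (V bs))) (dirs 2)" by (rule Hk_norm_eq[OF S V])
  have N: "n2 (zext S (V bs)) \<le> Hk_norm 2 S u" if "bs \<in> dirs 2" for bs
    using member_le_L2_set[OF finite_dirs that, of "\<lambda>bs. n2 (zext S (V bs))"] unfolding E .
  define v where "v = (\<lambda>b. zext S (V [b]))"
  define w where "w = (\<lambda>b c. zext S (V [b, c]))"
  have u2: "L2 (zext S u)" using u by (simp add: Hk_def Lp2_iff[OF open_in_lebesgue[OF S]])
  have z: "wderiv S e (zext S f) (zext S g) \<longleftrightarrow> wderiv S e f g" for e f g by (rule wderiv_cong) auto
  have d: "[] \<in> dirs 2" "\<And>b. b \<in> Basis \<Longrightarrow> [b] \<in> dirs 2" "\<And>b c. b \<in> Basis \<Longrightarrow> c \<in> Basis \<Longrightarrow> [b, c] \<in> dirs 2"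
    by (auto simp: dirs_2)
  have vd: "wderiv S b u (V [b])" if "b \<in> Basis" for b
    using V(1)[of "[b]"] that by (simp add: dirs_2 has_weak_deriv_single[OF S])
  have wd: "wderiv S c (V [b]) (V [b, c])" if "b \<in> Basis" "c \<in> Basis" for b c
    using V(1)[OF d(3)[OF that]] has_weak_deriv_pair[OF S vd[OF that(1)]] by simp
  have n0: "n2 (zext S u) = n2 (zext S (V []))"
  proof -
    have "has_weak_deriv S [] u u"
      using V(1)[OF d(1)] by (simp add: has_weak_deriv_Nil)
    from has_weak_deriv_unique[OF S this V(1)[OF d(1)]] show ?thesis
      using L2_zext_cong_AE(2) V(2)[OF d(1)] by blast
  qed
  show ?thesis
  proof (rule that)
    show "H2s S (zext S u) v w"
      using u2 V(2) d vd wd by (auto simp: H2s_def v_def w_def z)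
  qed (use N d n0 in \<open>auto simp: v_def w_def\<close>)
qed

lemma Hk1_imp_deriv:
  assumes S: "open S" and u: "u \<in> Hk 1 S" and b: "b \<in> Basis"
  obtains v where "L2 (zext S v)" "wderiv S b u v" "n2 (zext S v) \<le> Hk_norm 1 S u"
proof -
  have "\<exists>v. has_weak_deriv S bs u v \<and> L2 (zext S v)" if "bs \<in> dirs 1" for bs
    using u that Lp2_iff[OF open_in_lebesgue[OF S]] unfolding Hk_def by blast
  then obtain V where V: "\<And>bs. bs \<in> dirs 1 \<Longrightarrow> has_weak_deriv S bs u (V bs)" "\<And>bs. bs \<in> dirs 1 \<Longrightarrow> L2 (zext S (V bs))"
    by metis
  have d: "[b] \<in> dirs 1" using b by (auto simp: dirs_1 One_nat_def)
  have E: "Hk_norm 1 S u = L2_set (\<lambda>bs. n2 (zext S (V bs))) (dirs 1)" by (rule Hk_norm_eq[OF S V])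
  have "n2 (zext S (V [b])) \<le> Hk_norm 1 S u"
    using member_le_L2_set[OF finite_dirs d, of "\<lambda>bs. n2 (zext S (V bs))"] unfolding E .
  then show ?thesis using that[of "V [b]"] V[OF d] by (simp add: has_weak_deriv_single[OF S])
qed

lemma Hk1_norm_ge:
  assumes S: "open S" and u: "u \<in> Hk 1 S"
  shows "n2 (zext S u) \<le> Hk_norm 1 S u"
proof -
  have "\<exists>v. has_weak_deriv S bs u v \<and> L2 (zext S v)" if "bs \<in> dirs 1" for bs
    using u that Lp2_iff[OF open_in_lebesgue[OF S]] unfolding Hk_def by blast
  then obtain V where V: "\<And>bs. bs \<in> dirs 1 \<Longrightarrow> has_weak_deriv S bs u (V bs)" "\<And>bs. bs \<in> dirs 1 \<Longrightarrow> L2 (zext S (V bs))"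
    by metis
  have d: "[] \<in> dirs 1" by (auto simp: dirs_1 One_nat_def)
  have E: "Hk_norm 1 S u = L2_set (\<lambda>bs. n2 (zext S (V bs))) (dirs 1)" by (rule Hk_norm_eq[OF S V])
  have N: "n2 (zext S (V [])) \<le> Hk_norm 1 S u"
    using member_le_L2_set[OF finite_dirs d, of "\<lambda>bs. n2 (zext S (V bs))"] unfolding E .
  have "has_weak_deriv S [] u u"
    using V(1)[OF d] by (simp add: has_weak_deriv_Nil)
  from has_weak_deriv_unique[OF S this V(1)[OF d]] show ?thesis
    using L2_zext_cong_AE(2) V(2)[OF d] N by metis
qed

lemma Hk1I:
  assumes S: "open S" and u: "L2 (zext S u)" and v: "\<And>b. b \<in> Basis \<Longrightarrow> L2 (zext S (v b))" "\<And>b. b \<in> Basis \<Longrightarrow> wderiv S b u (v b)"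
  shows "u \<in> Hk 1 S" "Hk_norm 1 S u \<le> n2 (zext S u) + (\<Sum>b\<in>Basis. n2 (zext S (v b)))"
proof -
  obtain b0 :: 'a where b0: "b0 \<in> Basis" using nonempty_Basis by blast
  have l: "locally_integrable_on u S" using wderiv_locally_integrable(1)[OF v(2)[OF b0]] .
  define V where "V = dlist u v (\<lambda>_ _ _. 0)"
  have 1: "has_weak_deriv S bs u (V bs)" "L2 (zext S (V bs))" if "bs \<in> dirs 1" for bs
    using that u v l by (auto simp: V_def dlist_def dirs_1 One_nat_def has_weak_deriv_single[OF S] has_weak_deriv_Nil)
  show "u \<in> Hk 1 S"
    using 1 u Lp2_iff[OF open_in_lebesgue[OF S]] unfolding Hk_def by blast
  have "Hk_norm 1 S u = L2_set (\<lambda>bs. n2 (zext S (V bs))) (dirs 1)" by (rule Hk_norm_eq[OF S 1])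
  also have "\<dots> \<le> (\<Sum>bs\<in>dirs 1. n2 (zext S (V bs)))" by (rule L2_set_le_sum) simp
  also have "\<dots> = n2 (zext S u) + (\<Sum>b\<in>Basis. n2 (zext S (v b)))"
    unfolding One_nat_def dirs_1 by (subst sum.insert) (auto simp: V_def dlist_def sum.reindex inj_on_def)
  finally show "Hk_norm 1 S u \<le> n2 (zext S u) + (\<Sum>b\<in>Basis. n2 (zext S (v b)))" .
qed

subsection \<open>The weak Laplacian\<close>

lemma laplacian_eq: "laplacian \<phi> = (\<lambda>x. \<Sum>b\<in>Basis. dir_deriv b (dir_deriv b \<phi>) x)"
  by (simp add: laplacian_def partial_deriv_Cons fun_eq_iff del: partial_deriv.simps(2))

lemma smooth_laplacian: "smooth \<phi> \<Longrightarrow> smooth (laplacian \<phi>)"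
  unfolding laplacian_eq by (intro smooth_sum smooth_dir_deriv)

lemma test_sum: "finite I \<Longrightarrow> (\<And>i. i \<in> I \<Longrightarrow> f i \<in> test_functions S) \<Longrightarrow> (\<lambda>x. \<Sum>i\<in>I. f i x) \<in> test_functions S"
  by (induction I rule: finite_induct) (auto intro: test_zero test_add)

lemma test_laplacian: "\<phi> \<in> test_functions S \<Longrightarrow> laplacian \<phi> \<in> test_functions S"
  unfolding laplacian_eq by (intro test_sum test_dir_deriv finite_Basis)

text \<open>\<open>F\<close> itself is not asked to be square integrable: elements of
  \<open>D22\<close> are controlled in another Lebesgue space, and only their Laplacian is in
  L^2.\<close>

definition wlap :: "('a::euclidean_space \<Rightarrow> real) \<Rightarrow> ('a \<Rightarrow> real) \<Rightarrow> bool" where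
  "wlap F L \<longleftrightarrow> L2 L \<and> has_weak_laplacian UNIV F L"

definition lap_norm :: "('a::euclidean_space \<Rightarrow> real) \<Rightarrow> real" where
  "lap_norm F = n2 (weak_laplacian UNIV F)"

lemma has_weak_laplacian_iff:
  assumes "open S"
  shows "has_weak_laplacian S u v \<longleftrightarrow> locally_integrable_on u S \<and> locally_integrable_on v S \<and>
    (\<forall>\<phi>\<in>test_functions S. (LINT x|lebesgue. u x * laplacian \<phi> x) = (LINT x|lebesgue. v x * \<phi> x))"
proof -
  have 1: "(LINT x|lebesgue_on S. w x * \<phi> x) = (LINT x|lebesgue. w x * \<phi> x)" if "\<phi> \<in> test_functions S" for w \<phi>
    using integral_lebesgue_on_zero_outside[OF open_in_lebesgue[OF assms]] test_zero_outside[OF that] by simp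
  have 2: "(LINT x|lebesgue_on S. w x * laplacian \<phi> x) = (LINT x|lebesgue. w x * laplacian \<phi> x)"
    if "\<phi> \<in> test_functions S" for w \<phi>
    by (rule 1[OF test_laplacian[OF that]])
  show ?thesis unfolding has_weak_laplacian_def using 1 2 by simp
qed

lemma weak_laplacian_unique:
  assumes S: "open S" and "has_weak_laplacian S u v"
  shows "AE x in lebesgue. x \<in> S \<longrightarrow> weak_laplacian S u x = v x"
proof -
  have v': "has_weak_laplacian S u (weak_laplacian S u)"
    unfolding weak_laplacian_def using someI[of "has_weak_laplacian S u", OF assms(2)] .
  note d = assms(2)[unfolded has_weak_laplacian_iff[OF S]] v'[unfolded has_weak_laplacian_iff[OF S]]
  have "AE x in lebesgue. x \<in> S \<longrightarrow> weak_laplacian S u x - v x = 0"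
  proof (rule fundamental_lemma[OF S])
    show "locally_integrable_on (\<lambda>x. weak_laplacian S u x - v x) S" using d by (auto intro: locally_integrable_diff)
    fix \<phi> assume \<phi>: "\<phi> \<in> test_functions S"
    have "(LINT x|lebesgue. weak_laplacian S u x * \<phi> x) = (LINT x|lebesgue. v x * \<phi> x)"
      using d \<phi> by metis
    then show "(LINT x|lebesgue. (weak_laplacian S u x - v x) * \<phi> x) = 0"
      using d locally_integrable_test_integrable[OF _ \<phi>] by (simp add: left_diff_distrib)
  qed
  then show ?thesis by eventually_elim auto
qed

lemma zext_UNIV [simp]: "zext UNIV f = f" by (simp add: zext_def)

lemma wlap_lap_norm:
  assumes "wlap F L" shows "L2 (weak_laplacian UNIV F)" "lap_norm F = n2 L" "AE x in lebesgue. weak_laplacian UNIV F x = L x"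
proof -
  have ae: "AE x in lebesgue. x \<in> UNIV \<longrightarrow> weak_laplacian UNIV F x = L x"
    using weak_laplacian_unique[of UNIV F L] assms by (simp add: wlap_def)
  then show "AE x in lebesgue. weak_laplacian UNIV F x = L x" by simp
  show "L2 (weak_laplacian UNIV F)" "lap_norm F = n2 L"
    using L2_zext_cong_AE[OF ae] assms by (simp_all add: wlap_def lap_norm_def)
qed

lemma wlap_add:
  assumes "wlap F L" "wlap G M" shows "wlap (\<lambda>x. F x + G x) (\<lambda>x. L x + M x)"
proof -
  note d = assms[unfolded wlap_def has_weak_laplacian_iff[OF open_UNIV]]
  have "(LINT x|lebesgue. (F x + G x) * laplacian \<phi> x) = (LINT x|lebesgue. (L x + M x) * \<phi> x)"
    if \<phi>: "\<phi> \<in> test_functions UNIV" for \<phi>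
    using d locally_integrable_test_integrable[OF _ \<phi>] locally_integrable_test_integrable[OF _ test_laplacian[OF \<phi>]] \<phi>
    by (simp add: distrib_right)
  then show ?thesis using d
    by (auto simp: wlap_def has_weak_laplacian_iff[OF open_UNIV] intro: locally_integrable_add L2_add)
qed

lemma wlap_cmult:
  assumes "wlap F L" shows "wlap (\<lambda>x. c * F x) (\<lambda>x. c * L x)"
  using assms locally_integrable_mult_continuous[of _ UNIV "\<lambda>x. c"]
  by (auto simp: wlap_def has_weak_laplacian_iff[OF open_UNIV] L2_cmult mult.assoc)

lemma wlap_diff:
  "wlap F L \<Longrightarrow> wlap G M \<Longrightarrow> wlap (\<lambda>x. F x - G x) (\<lambda>x. L x - M x)"
  using wlap_add[OF _ wlap_cmult[of G M "-1"]] by simp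

lemma lap_norm_triangle:
  assumes "wlap F L" "wlap G M"
  shows "lap_norm (\<lambda>x. F x + G x) \<le> lap_norm F + lap_norm G" "lap_norm (\<lambda>x. F x - G x) \<le> lap_norm F + lap_norm G"
  using assms n2_triangle[of L M] n2_triangle_diff[of L M] wlap_lap_norm(2)[OF wlap_add[OF assms]]
    wlap_lap_norm(2)[OF wlap_diff[OF assms]] wlap_lap_norm(2)[OF assms(1)] wlap_lap_norm(2)[OF assms(2)]
  by (auto simp: wlap_def)

lemma lap_norm_nonneg [simp]: "0 \<le> lap_norm F" by (simp add: lap_norm_def)

lemma H2s_has_weak_laplacian:
  assumes "H2s S u v w" "open S" shows "has_weak_laplacian S u (\<lambda>x. \<Sum>b\<in>Basis. w b b x)"
proof -
  note H = H2sD[OF assms(1)]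
  have "(LINT x|lebesgue. u x * laplacian \<phi> x) = (LINT x|lebesgue. (\<Sum>b\<in>Basis. w b b x) * \<phi> x)"
    if \<phi>: "\<phi> \<in> test_functions S" for \<phi>
  proof -
    have i: "integrable lebesgue (\<lambda>x. f x * \<psi> x)" if "L2 f" "\<psi> \<in> test_functions S" for f \<psi>
      using L2_mult_integrable[OF that(1) L2_test[OF that(2)]] .
    have "(LINT x|lebesgue. u x * laplacian \<phi> x) = (\<Sum>b\<in>Basis. LINT x|lebesgue. u x * dir_deriv b (dir_deriv b \<phi>) x)"
      unfolding laplacian_eq sum_distrib_left using H(1) \<phi>
      by (intro Bochner_Integration.integral_sum i test_dir_deriv)
    also have "\<dots> = (\<Sum>b\<in>Basis. LINT x|lebesgue. w b b x * \<phi> x)"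
      using wderivD[OF H(3) test_dir_deriv[OF \<phi>]] wderivD[OF H(5) \<phi>] by (intro sum.cong refl) simp
    also have "\<dots> = (LINT x|lebesgue. (\<Sum>b\<in>Basis. w b b x) * \<phi> x)"
      unfolding sum_distrib_right using H(4) \<phi>
      by (intro Bochner_Integration.integral_sum[symmetric] i)
    finally show ?thesis .
  qed
  moreover have "L2 (\<lambda>x. \<Sum>b\<in>Basis. w b b x)" by (intro L2_sum H(4))
  ultimately show ?thesis using H(1) L2_locally_integrable by (auto simp: has_weak_laplacian_iff[OF assms(2)])
qed

lemma H2s_wlap: "H2s UNIV u v w \<Longrightarrow> wlap u (\<lambda>x. \<Sum>b\<in>Basis. w b b x)"
  using H2s_has_weak_laplacian[of UNIV] H2sD(4) by (auto simp: wlap_def intro!: L2_sum)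

lemma H2s_lap_norm_le:
  assumes "H2s UNIV u v w" shows "lap_norm u \<le> (\<Sum>b\<in>Basis. n2 (w b b))"
  using wlap_lap_norm(2)[OF H2s_wlap[OF assms]] n2_sum[of Basis "\<lambda>b. w b b"] H2sD(4)[OF assms] by simp

text \<open>The energy in the capacity uses a chosen weak Laplacian on \<open>S\<close>. Uniqueness
  replaces it by the explicit one, whose vanishing outside \<open>S\<close> turns the integral into
  a norm over the whole space.\<close>

lemma H2s_weak_laplacian_energy:
  assumes S: "open S" and H: "H2s S u' v w" and e: "\<And>x. x \<in> S \<Longrightarrow> u x = u' x" and z: "\<And>b x. b \<in> Basis \<Longrightarrow> x \<notin> S \<Longrightarrow> w b b x = 0"
  shows "(LINT x|lebesgue_on S. (weak_laplacian S u x)\<^sup>2) = (n2 (\<lambda>x. \<Sum>b\<in>Basis. w b b x))\<^sup>2"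
proof -
  have "(\<lambda>x. u x * laplacian \<phi> x) = (\<lambda>x. u' x * laplacian \<phi> x)" if "\<phi> \<in> test_functions S" for \<phi>
    using e test_zero_outside[OF test_laplacian[OF that]] by (force simp: fun_eq_iff)
  moreover have "locally_integrable_on u S = locally_integrable_on u' S" by (rule locally_integrable_cong) (rule e)
  ultimately have "has_weak_laplacian S u (\<lambda>x. \<Sum>b\<in>Basis. w b b x)"
    using H2s_has_weak_laplacian[OF H S] by (simp add: has_weak_laplacian_iff[OF S])
  from weak_laplacian_unique[OF S this]
  have "n2 (zext S (weak_laplacian S u)) = n2 (zext S (\<lambda>x. \<Sum>b\<in>Basis. w b b x))"
    by (rule L2_zext_cong_AE(2)) (use H2sD(4)[OF H] in \<open>auto intro!: L2_zext(1) L2_sum open_in_lebesgue S\<close>)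
  also have "zext S (\<lambda>x. \<Sum>b\<in>Basis. w b b x) = (\<lambda>x. \<Sum>b\<in>Basis. w b b x)"
    by (rule zext_id) (use z in \<open>auto intro: sum.neutral\<close>)
  finally show ?thesis using integral_sq_zext[OF open_in_lebesgue[OF S]] by simp
qed

lemma H2s_test:
  assumes "\<phi> \<in> test_functions S" "open T"
  shows "H2s T \<phi> (\<lambda>b. dir_deriv b \<phi>) (\<lambda>b c. dir_deriv c (dir_deriv b \<phi>))"
  using assms by (auto simp: H2s_def test_smooth intro!: L2_test test_dir_deriv wderiv_smooth smooth_dir_deriv)

lemma wlap_test: "\<phi> \<in> test_functions S \<Longrightarrow> wlap \<phi> (laplacian \<phi>)"
  using H2s_wlap[OF H2s_test[OF _ open_UNIV]] by (simp add: laplacian_eq)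

section \<open>Density of regular functions\<close>

lemma dir_deriv_abs_le:
  assumes "f differentiable (at x)" "\<And>b. b \<in> Basis \<Longrightarrow> \<bar>dir_deriv b f x\<bar> \<le> B"
  shows "\<bar>dir_deriv h f x\<bar> \<le> real DIM('a) * B * norm (h::'a::euclidean_space)"
proof -
  have "\<bar>dir_deriv h f x\<bar> \<le> (\<Sum>b\<in>Basis. \<bar>(h \<bullet> b) * dir_deriv b f x\<bar>)"
    unfolding dir_deriv_expand[OF assms(1), of h] by (rule sum_abs)
  also have "\<dots> \<le> (\<Sum>b\<in>(Basis::'a set). norm h * B)"
    by (intro sum_mono) (auto simp: abs_mult intro!: mult_mono assms(2) Basis_le_norm)
  finally show ?thesis by (simp add: mult_ac)
qed

lemma test_deriv_bounded:
  fixes \<phi> :: "'a::euclidean_space \<Rightarrow> real"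
  assumes "\<phi> \<in> test_functions S"
  obtains B where "B \<ge> 0" "\<And>h x. \<bar>dir_deriv h \<phi> x\<bar> \<le> B * norm h"
proof -
  have "\<exists>B. \<forall>x. \<bar>dir_deriv b \<phi> x\<bar> \<le> B" for b
    using test_bounded[OF test_dir_deriv[OF assms, of b]] by metis
  then obtain B where B: "\<And>b x. \<bar>dir_deriv b \<phi> x\<bar> \<le> B b" by metis
  have B0: "0 \<le> B b" for b using B[of b undefined] by simp
  define M where "M = (\<Sum>b\<in>Basis. B b)"
  have "\<bar>dir_deriv b \<phi> x\<bar> \<le> M" if "b \<in> Basis" for b x
    using B[of b x] member_le_sum[OF that, of B] B0 unfolding M_def by fastforce
  then have "\<bar>dir_deriv h \<phi> x\<bar> \<le> real DIM('a) * M * norm h" for h x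
    by (rule dir_deriv_abs_le[OF smooth_differentiable[OF test_smooth[OF assms]]])
  moreover have "M \<ge> 0" unfolding M_def using B0 by (simp add: sum_nonneg)
  ultimately show ?thesis using that[of "real DIM('a) * M"] by auto
qed

lemma test_lipschitz:
  fixes \<phi> :: "'a::euclidean_space \<Rightarrow> real"
  assumes "\<phi> \<in> test_functions S"
  obtains L where "L \<ge> 0" "\<And>x y. \<bar>\<phi> x - \<phi> y\<bar> \<le> L * norm (x - y)"
proof -
  obtain B where B: "B \<ge> 0" "\<And>h x. \<bar>dir_deriv h \<phi> x\<bar> \<le> B * norm h" using test_deriv_bounded[OF assms] by metis
  have "norm (\<phi> x - \<phi> y) \<le> B * norm (x - y)" for x y
    by (rule differentiable_bound[of UNIV \<phi> "\<lambda>x h. dir_deriv h \<phi> x"])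
       (use B has_derivative_dir_deriv[OF smooth_differentiable[OF test_smooth[OF assms]]]
         in \<open>auto intro!: onorm_bound\<close>)
  then show ?thesis using that B by auto
qed

text \<open>The constant is uniform in the base point, as differentiation of a convolution requires.
  The remainder is estimated by the variation of the derivative over the ball of radius
  \<open>norm h\<close>, which is itself of order \<open>norm h\<close>.\<close>

lemma test_taylor:
  fixes \<phi> :: "'a::euclidean_space \<Rightarrow> real"
  assumes "\<phi> \<in> test_functions S"
  obtains M where "M \<ge> 0" "\<And>z h. \<bar>\<phi> (z + h) - \<phi> z - dir_deriv h \<phi> z\<bar> \<le> M * (norm h)\<^sup>2"
proof -
  have d: "\<phi> differentiable (at x)" for x by (rule smooth_differentiable[OF test_smooth[OF assms]])
  have "\<exists>L\<ge>0. \<forall>x y. \<bar>dir_deriv b \<phi> x - dir_deriv b \<phi> y\<bar> \<le> L * norm (x - y)" for b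
    using test_lipschitz[OF test_dir_deriv[OF assms, of b]] by metis
  then obtain L where L: "\<And>b. L b \<ge> 0" "\<And>b x y. \<bar>dir_deriv b \<phi> x - dir_deriv b \<phi> y\<bar> \<le> L b * norm (x - y)" by metis
  define M where "M = (\<Sum>b\<in>Basis. L b)"
  have M0: "M \<ge> 0" unfolding M_def using L by (simp add: sum_nonneg)
  have D: "\<bar>dir_deriv k \<phi> x - dir_deriv k \<phi> y\<bar> \<le> M * norm (x - y) * norm k" for k x y
  proof -
    have "dir_deriv k \<phi> x - dir_deriv k \<phi> y = (\<Sum>b\<in>Basis. (k \<bullet> b) * (dir_deriv b \<phi> x - dir_deriv b \<phi> y))"
      using dir_deriv_expand[OF d, of k] by (simp add: right_diff_distrib sum_subtractf)
    also have "\<bar>\<dots>\<bar> \<le> (\<Sum>b\<in>Basis. \<bar>(k \<bullet> b) * (dir_deriv b \<phi> x - dir_deriv b \<phi> y)\<bar>)" by (rule sum_abs)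
    also have "\<dots> \<le> (\<Sum>b\<in>Basis. norm k * (L b * norm (x - y)))"
      by (intro sum_mono) (auto simp: abs_mult intro!: mult_mono L Basis_le_norm)
    also have "\<dots> = M * norm (x - y) * norm k" by (simp add: M_def sum_distrib_left sum_distrib_right mult_ac)
    finally show ?thesis .
  qed
  have "\<bar>\<phi> (z + h) - \<phi> z - dir_deriv h \<phi> z\<bar> \<le> M * (norm h)\<^sup>2" for z h
  proof -
    define g where "g = (\<lambda>k. \<phi> (z + k) - dir_deriv k \<phi> z)"
    have lin: "bounded_linear (\<lambda>k. dir_deriv k \<phi> z)"
      using has_derivative_dir_deriv[OF d] by (rule has_derivative_bounded_linear)
    have "norm (g h - g 0) \<le> (M * norm h) * norm (h - 0)"
    proof (rule differentiable_bound[of "cball 0 (norm h)" g "\<lambda>y k. dir_deriv k \<phi> (z + y) - dir_deriv k \<phi> z"])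
      fix y :: 'a assume y: "y \<in> cball 0 (norm h)"
      have "((\<lambda>k. z + k) has_derivative (\<lambda>k. k)) (at y within cball 0 (norm h))" by (auto intro!: derivative_eq_intros)
      from has_derivative_compose[OF this has_derivative_dir_deriv[OF d]]
      show "(g has_derivative (\<lambda>k. dir_deriv k \<phi> (z + y) - dir_deriv k \<phi> z)) (at y within cball 0 (norm h))"
        unfolding g_def by (intro has_derivative_diff bounded_linear_imp_has_derivative lin)
      show "onorm (\<lambda>k. dir_deriv k \<phi> (z + y) - dir_deriv k \<phi> z) \<le> M * norm h"
      proof (rule onorm_bound)
        fix k
        have "\<bar>dir_deriv k \<phi> (z + y) - dir_deriv k \<phi> z\<bar> \<le> M * norm (z + y - z) * norm k" by (rule D)
        also have "\<dots> \<le> M * norm h * norm k" using y M0 by (intro mult_right_mono mult_left_mono) auto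
        finally show "norm (dir_deriv k \<phi> (z + y) - dir_deriv k \<phi> z) \<le> M * norm h * norm k" by simp
      qed (use M0 in auto)
    qed auto
    moreover have "dir_deriv 0 \<phi> z = 0" using linear_0[OF bounded_linear.linear[OF lin]] .
    ultimately show ?thesis by (simp add: g_def power2_eq_square algebra_simps)
  qed
  then show ?thesis using that M0 by blast
qed

lemma test_integrable: "\<phi> \<in> test_functions S \<Longrightarrow> integrable lebesgue \<phi>"
  using locally_integrable_test_integrable[of "\<lambda>x. 1" S \<phi>] by (simp add: locally_integrable_continuous)

lemma n2_tendsto_dominated:
  assumes f: "\<And>n::nat. f n \<in> borel_measurable lebesgue" and w: "L2 w" "\<And>n x. \<bar>f n x\<bar> \<le> \<bar>w x\<bar>"
    and l: "AE x in lebesgue. (\<lambda>n. f n x) \<longlonglongrightarrow> 0"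
  shows "(\<lambda>n. n2 (f n)) \<longlonglongrightarrow> 0"
proof -
  have "(\<lambda>n. LINT x|lebesgue. (f n x)\<^sup>2) \<longlonglongrightarrow> (LINT x|(lebesgue::'a measure). (0::real))"
  proof (rule integral_dominated_convergence[where w = "\<lambda>x. (w x)\<^sup>2"])
    show "AE x in lebesgue. (\<lambda>n. (f n x)\<^sup>2) \<longlonglongrightarrow> 0"
      using l by eventually_elim (use tendsto_power[of _ 0 _ 2] in fastforce)
    show "AE x in lebesgue. norm ((f n x)\<^sup>2) \<le> (w x)\<^sup>2" for n
      using w(2) by (intro AE_I2) (simp add: abs_le_square_iff)
  qed (use f w(1) in \<open>auto simp: L2_def\<close>)
  then show ?thesis unfolding n2_def using tendsto_real_sqrt by fastforce
qed

text \<open>Lebesgue measurable functions are almost everywhere limits of continuous functions; truncating in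
  the range and in the domain turns this into density in \<open>L\<^sup>2\<close>.\<close>

lemma L2_approx_continuous:
  fixes f :: "'a::euclidean_space \<Rightarrow> real"
  assumes f: "L2 f" and e: "e > 0"
  obtains g C where "compact C" "\<And>x. x \<notin> C \<Longrightarrow> g x = 0" "continuous_on UNIV g" "n2 (\<lambda>x. f x - g x) < e"
proof -
  define T where "T k g = (\<lambda>x. max (- real k) (min (real k) (g x)) * max 0 (min 1 (real k + 1 - norm x)))" for k and g :: "'a \<Rightarrow> real"
  note fm = L2_measurable[OF f]
  have nc: "(\<lambda>x::'a. max 0 (min 1 (real k + 1 - norm x))) \<in> borel_measurable lebesgue" for k
    by (intro continuous_lebesgue_measurable continuous_intros)
  have Tm: "T k g \<in> borel_measurable lebesgue" if "g \<in> borel_measurable lebesgue" for k g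
    unfolding T_def using that by (intro borel_measurable_times borel_measurable_max borel_measurable_min nc) auto
  have Tb: "\<bar>T k g x\<bar> \<le> \<bar>real k * max 0 (min 1 (real k + 1 - norm x))\<bar>" for k g x
    unfolding T_def abs_mult by (intro mult_right_mono) auto
  have Tf: "\<bar>f x - T k f x\<bar> \<le> \<bar>f x\<bar>" for k x
  proof -
    define m where "m = max (- real k) (min (real k) (f x))"
    define b where "b = max 0 (min 1 (real k + 1 - norm x))"
    have b: "0 \<le> b" "b \<le> 1" and m: "0 \<le> f x \<and> 0 \<le> m \<and> m \<le> f x \<or> f x \<le> 0 \<and> m \<le> 0 \<and> f x \<le> m" by (auto simp: b_def m_def)
    have "0 \<le> m \<Longrightarrow> 0 \<le> m * b \<and> m * b \<le> m" "m \<le> 0 \<Longrightarrow> m * b \<le> 0 \<and> m \<le> m * b"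
      using b mult_left_le[of b m] mult_left_le[of b "- m"] by (auto simp: mult_nonpos_nonneg)
    then have "\<bar>f x - m * b\<bar> \<le> \<bar>f x\<bar>" using m by linarith
    then show ?thesis by (simp add: T_def m_def b_def)
  qed
  have T0: "T k g x = 0" if "x \<notin> cball 0 (real k + 1)" for k g x using that by (simp add: T_def)
  have "(\<lambda>k. n2 (\<lambda>x. f x - T k f x)) \<longlonglongrightarrow> 0"
  proof (rule n2_tendsto_dominated[OF _ f Tf])
    show "(\<lambda>x. f x - T k f x) \<in> borel_measurable lebesgue" for k using fm Tm[OF fm] by (rule borel_measurable_diff)
    show "AE x in lebesgue. (\<lambda>k. f x - T k f x) \<longlonglongrightarrow> 0"
    proof (intro AE_I2 tendsto_eventually)
      fix x :: 'a
      obtain N where N: "\<bar>f x\<bar> + norm x \<le> real N" using real_arch_simple by blast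
      have "f x - T n f x = 0" if "n \<ge> N" for n
      proof -
        have "\<bar>f x\<bar> \<le> real n" "norm x \<le> real n" using N of_nat_mono[OF that, where 'a=real] norm_ge_zero[of x] abs_ge_zero[of "f x"] by linarith+
        then show ?thesis by (auto simp: T_def max_def min_def abs_le_iff)
      qed
      then show "\<forall>\<^sub>F n in sequentially. f x - T n f x = 0" unfolding eventually_sequentially by blast
    qed
  qed
  then have "\<forall>\<^sub>F k in sequentially. n2 (\<lambda>x. f x - T k f x) < e / 2" using e by (intro order_tendstoD(2)) auto
  then obtain k where k: "n2 (\<lambda>x. f x - T k f x) < e / 2" using eventually_happens'[OF sequentially_bot] by blast
  obtain N g where g: "negligible N" "\<And>n::nat. continuous_on UNIV (g n)" "\<And>x. x \<notin> N \<Longrightarrow> (\<lambda>n. g n x) \<longlonglongrightarrow> f x"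
    using lebesgue_measurable_imp_measurable_on_real[OF fm, of UNIV] unfolding measurable_on_def by auto
  have Tc: "continuous_on UNIV (T k (g n))" for n unfolding T_def by (intro continuous_intros g(2))
  have c2: "L2 (T k (g n))" for n by (rule L2_continuous_compact_support[OF Tc compact_cball T0])
  have w: "L2 (\<lambda>x::'a. real k * max 0 (min 1 (real k + 1 - norm x)))"
    by (rule L2_continuous_compact_support[of _ "cball 0 (real k + 1)"]) (auto intro!: continuous_intros)
  have f2: "L2 (T k f)" by (rule L2_bound(1)[OF w Tm[OF fm] Tb])
  have "(\<lambda>n. n2 (\<lambda>x. T k f x - T k (g n) x)) \<longlonglongrightarrow> 0"
  proof (rule n2_tendsto_dominated[OF L2_measurable[OF L2_diff[OF f2 c2]] L2_cmult[OF w, of 2]])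
    show "\<bar>T k f x - T k (g n) x\<bar> \<le> \<bar>2 * (real k * max 0 (min 1 (real k + 1 - norm x)))\<bar>" for n x
      using Tb[of k f x] Tb[of k "g n" x] by linarith
    have "AE x in lebesgue. x \<notin> N" using g(1) by (simp add: negligible_iff_null_sets AE_not_in)
    then show "AE x in lebesgue. (\<lambda>n. T k f x - T k (g n) x) \<longlonglongrightarrow> 0"
    proof eventually_elim
      case (elim x)
      have "(\<lambda>n. T k f x - T k (g n) x) \<longlonglongrightarrow> T k f x - T k f x" unfolding T_def by (intro tendsto_intros g(3) elim)
      then show ?case by simp
    qed
  qed
  then have "\<forall>\<^sub>F n in sequentially. n2 (\<lambda>x. T k f x - T k (g n) x) < e / 2" using e by (intro order_tendstoD(2)) auto
  then obtain n where n: "n2 (\<lambda>x. T k f x - T k (g n) x) < e / 2" using eventually_happens'[OF sequentially_bot] by blast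
  have "n2 (\<lambda>x. f x - T k (g n) x) \<le> n2 (\<lambda>x. f x - T k f x) + n2 (\<lambda>x. T k f x - T k (g n) x)"
    using n2_triangle[OF L2_diff[OF f f2] L2_diff[OF f2 c2[of n]]] by simp
  then have "n2 (\<lambda>x. f x - T k (g n) x) < e" using k n by linarith
  then show ?thesis by (intro that[of "cball 0 (real k + 1)" "T k (g n)"] Tc T0 compact_cball)
qed

section \<open>Mollification\<close>

definition conv :: "('a::euclidean_space \<Rightarrow> real) \<Rightarrow> ('a \<Rightarrow> real) \<Rightarrow> 'a \<Rightarrow> real" where
  "conv f \<rho> x = (LINT y|lebesgue. f y * \<rho> (x - y))"

lemma test_reflect:
  assumes "\<rho> \<in> test_functions UNIV" shows "(\<lambda>y. \<rho> (x - y)) \<in> test_functions UNIV"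
proof -
  obtain C where C: "compact C" "\<And>x. x \<notin> C \<Longrightarrow> \<rho> x = 0" using test_functionsE[OF assms] by metis
  show ?thesis
  proof (rule test_functionsI)
    show "smooth (\<lambda>y. \<rho> (x - y))" using smooth_compose_affine[OF test_smooth[OF assms], of "-1" x] by simp
    show "compact ((\<lambda>z. x - z) ` C)" by (intro compact_continuous_image C continuous_intros)
    show "\<rho> (x - y) = 0" if "y \<notin> (\<lambda>z. x - z) ` C" for y
      by (rule C(2)) (use that in \<open>metis diff_diff_eq2 add_diff_cancel_left' image_eqI diff_add_cancel add.commute\<close>)
  qed auto
qed

lemma dir_deriv_reflect:
  assumes "smooth \<rho>" shows "dir_deriv e (\<lambda>y. \<rho> (x - y)) = (\<lambda>y. - dir_deriv e \<rho> (x - y))"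
  using dir_deriv_affine[of \<rho> "-1" _ x e] smooth_differentiable[OF assms] by (simp add: fun_eq_iff)

lemma conv_integrable:
  assumes "locally_integrable_on f UNIV" "\<rho> \<in> test_functions UNIV"
  shows "integrable lebesgue (\<lambda>y. f y * \<rho> (x - y))"
  by (rule locally_integrable_test_integrable[OF assms(1) test_reflect[OF assms(2)]])

text \<open>The quadratic Taylor remainder of the kernel is integrated against the absolute value of
  \<open>f\<close> over a fixed ball, which leaves an error of second order in the
  increment.\<close>

lemma conv_has_derivative:
  fixes f :: "'a::euclidean_space \<Rightarrow> real"
  assumes f: "locally_integrable_on f UNIV" and \<rho>: "\<rho> \<in> test_functions UNIV"
  shows "(conv f \<rho> has_derivative (\<lambda>h. conv f (dir_deriv h \<rho>) x)) (at x)"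
proof -
  have d: "\<rho> differentiable (at z)" for z by (rule smooth_differentiable[OF test_smooth[OF \<rho>]])
  obtain M where M: "M \<ge> 0" "\<And>z h. \<bar>\<rho> (z + h) - \<rho> z - dir_deriv h \<rho> z\<bar> \<le> M * (norm h)\<^sup>2" using test_taylor[OF \<rho>] by metis
  obtain C where C: "compact C" "\<And>x. x \<notin> C \<Longrightarrow> \<rho> x = 0" "\<And>x e. x \<notin> C \<Longrightarrow> dir_deriv e \<rho> x = 0"
    using test_functionsE[OF \<rho>] by metis
  obtain R where R: "\<And>x. x \<in> C \<Longrightarrow> norm x \<le> R" using C(1) compact_imp_bounded bounded_iff by metis
  \<comment> \<open>Large enough to contain the supports of the kernels centred at \<open>x\<close>
    and at \<open>x + h\<close> for every \<open>h\<close> of norm at most 1.\<close>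
  define Q where "Q = cball x (\<bar>R\<bar> + 1)"
  have iQ: "integrable lebesgue (\<lambda>y. indicator Q y * f y)"
    using f compact_cball unfolding locally_integrable_on_def set_integrable_def Q_def by auto
  define A where "A = (LINT y|lebesgue. \<bar>indicator Q y * f y\<bar>)"
  have lin: "bounded_linear (\<lambda>h. conv f (dir_deriv h \<rho>) x)"
  proof -
    have "conv f (dir_deriv h \<rho>) x = (\<Sum>b\<in>Basis. (h \<bullet> b) * conv f (dir_deriv b \<rho>) x)" for h
    proof -
      have "conv f (dir_deriv h \<rho>) x = (LINT y|lebesgue. (\<Sum>b\<in>Basis. (h \<bullet> b) * (f y * dir_deriv b \<rho> (x - y))))"
        unfolding conv_def dir_deriv_expand[OF d, of h] by (simp add: sum_distrib_left mult_ac)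
      also have "\<dots> = (\<Sum>b\<in>Basis. (h \<bullet> b) * conv f (dir_deriv b \<rho>) x)"
        unfolding conv_def using conv_integrable[OF f test_dir_deriv[OF \<rho>]]
        by (subst Bochner_Integration.integral_sum) auto
      finally show ?thesis .
    qed
    then have "(\<lambda>h. conv f (dir_deriv h \<rho>) x) = (\<lambda>h. \<Sum>b\<in>Basis. (h \<bullet> b) * conv f (dir_deriv b \<rho>) x)" by (rule ext)
    then show ?thesis
      by (rule ssubst) (intro bounded_linear_sum bounded_linear_mult_const bounded_linear_inner_left)
  qed
  have est: "\<bar>conv f \<rho> (x + h) - conv f \<rho> x - conv f (dir_deriv h \<rho>) x\<bar> \<le> M * A * (norm h)\<^sup>2" if h: "norm h \<le> 1" for h
  proof -
    have e: "f y * (\<rho> (x - y + h) - \<rho> (x - y) - dir_deriv h \<rho> (x - y)) =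
        f y * \<rho> (x + h - y) - f y * \<rho> (x - y) - f y * dir_deriv h \<rho> (x - y)" for y
      by (simp add: algebra_simps)
    have eq: "conv f \<rho> (x + h) - conv f \<rho> x - conv f (dir_deriv h \<rho>) x =
        (LINT y|lebesgue. f y * (\<rho> (x - y + h) - \<rho> (x - y) - dir_deriv h \<rho> (x - y)))"
      unfolding conv_def e
      using conv_integrable[OF f \<rho>, of "x + h"] conv_integrable[OF f \<rho>, of x] conv_integrable[OF f test_dir_deriv[OF \<rho>], of h x]
      by simp
    have "\<bar>conv f \<rho> (x + h) - conv f \<rho> x - conv f (dir_deriv h \<rho>) x\<bar> \<le> (LINT y|lebesgue. \<bar>f y * (\<rho> (x - y + h) - \<rho> (x - y) - dir_deriv h \<rho> (x - y))\<bar>)"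
      unfolding eq by (rule integral_abs_bound)
    also have "\<dots> \<le> (LINT y|lebesgue. (M * (norm h)\<^sup>2) * \<bar>indicator Q y * f y\<bar>)"
    proof (rule integral_mono)
      have "integrable lebesgue (\<lambda>y. f y * (\<rho> (x - y + h) - \<rho> (x - y) - dir_deriv h \<rho> (x - y)))"
        unfolding e
        using conv_integrable[OF f \<rho>, of "x + h"] conv_integrable[OF f \<rho>, of x] conv_integrable[OF f test_dir_deriv[OF \<rho>], of h x]
        by simp
      then show "integrable lebesgue (\<lambda>y. \<bar>f y * (\<rho> (x - y + h) - \<rho> (x - y) - dir_deriv h \<rho> (x - y))\<bar>)" by auto
      show "integrable lebesgue (\<lambda>y. (M * (norm h)\<^sup>2) * \<bar>indicator Q y * f y\<bar>)" using iQ by auto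
      fix y
      show "\<bar>f y * (\<rho> (x - y + h) - \<rho> (x - y) - dir_deriv h \<rho> (x - y))\<bar> \<le> (M * (norm h)\<^sup>2) * \<bar>indicator Q y * f y\<bar>"
      proof (cases "y \<in> Q")
        case True
        then show ?thesis using mult_right_mono[OF M(2)[of "x - y" h], of "\<bar>f y\<bar>"] by (simp add: abs_mult mult.commute)
      next
        case False
        then have n: "norm (x - y) > \<bar>R\<bar> + 1" by (simp add: Q_def dist_norm)
        then have "x - y \<notin> C" using R[of "x - y"] by force
        moreover have "x - y + h \<notin> C"
        proof
          assume "x - y + h \<in> C"
          then have "norm (x - y + h) \<le> R" by (rule R)
          moreover have "norm (x - y) \<le> norm (x - y + h) + norm h" using norm_triangle_ineq4[of "x - y + h" h] by simp
          ultimately show False using n h by linarith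
        qed
        ultimately show ?thesis using C M(1) by simp
      qed
    qed
    also have "\<dots> = M * A * (norm h)\<^sup>2" by (simp add: A_def)
    finally show ?thesis .
  qed
  show ?thesis unfolding has_derivative_at
  proof (intro conjI lin)
    show "(\<lambda>h. norm (conv f \<rho> (x + h) - conv f \<rho> x - conv f (dir_deriv h \<rho>) x) / norm h) \<midarrow>0\<rightarrow> 0"
    proof (rule Lim_null_comparison)
      show "\<forall>\<^sub>F h in at 0. norm (norm (conv f \<rho> (x + h) - conv f \<rho> x - conv f (dir_deriv h \<rho>) x) / norm h) \<le> M * A * norm h"
      proof -
        have "\<forall>\<^sub>F h in at (0::'a). norm h < 1" 
          using eventually_at_ball[of 1 "0::'a" UNIV] by (auto elim: eventually_mono)
        then show ?thesis
        proof eventually_elim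
          case (elim h)
          have "\<bar>conv f \<rho> (x + h) - conv f \<rho> x - conv f (dir_deriv h \<rho>) x\<bar> \<le> (M * A * norm h) * norm h"
            using est[of h] elim by (simp add: power2_eq_square mult.assoc)
          then have "\<bar>conv f \<rho> (x + h) - conv f \<rho> x - conv f (dir_deriv h \<rho>) x\<bar> / norm h \<le> M * A * norm h"
            using M(1) by (cases "h = 0") (auto simp: divide_le_eq)
          then show ?case by simp
        qed
      qed
      show "((\<lambda>h::'a. M * A * norm h) \<longlongrightarrow> 0) (at 0)" by (intro tendsto_mult_right_zero tendsto_norm_zero tendsto_ident_at)
    qed
  qed
qed

lemma dir_deriv_conv:
  assumes "locally_integrable_on f UNIV" "\<rho> \<in> test_functions UNIV"
  shows "dir_deriv e (conv f \<rho>) = conv f (dir_deriv e \<rho>)"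
  using dir_deriv_eqI[OF conv_has_derivative[OF assms]] by (simp add: fun_eq_iff)

lemma smooth_conv:
  assumes f: "locally_integrable_on f UNIV" and \<rho>: "\<rho> \<in> test_functions UNIV"
  shows "smooth (conv f \<rho>)"
proof -
  have "cdiff n (conv f \<rho>)" for n
    using \<rho>
  proof (induction n arbitrary: \<rho>)
    case 0
    then show ?case using conv_has_derivative[OF f]
      by (auto intro!: continuous_at_imp_continuous_on has_derivative_continuous)
  next
    case (Suc n)
    then show ?case using conv_has_derivative[OF f Suc.prems] dir_deriv_conv[OF f Suc.prems]
      by (auto simp: differentiable_def test_dir_deriv)
  qed
  then show ?thesis by (simp add: smooth_def)
qed

text \<open>The reflected kernel is a test function, and the sign produced by the reflection cancels
  that of the integration by parts.\<close>

lemma conv_wderiv: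
  assumes w: "wderiv UNIV e f g" and \<rho>: "\<rho> \<in> test_functions UNIV"
  shows "dir_deriv e (conv f \<rho>) = conv g \<rho>"
proof
  fix x
  have "dir_deriv e (conv f \<rho>) x = (LINT y|lebesgue. f y * dir_deriv e \<rho> (x - y))"
    by (simp add: dir_deriv_conv[OF wderiv_locally_integrable(1)[OF w] \<rho>] conv_def)
  also have "\<dots> = - (LINT y|lebesgue. f y * dir_deriv e (\<lambda>y. \<rho> (x - y)) y)"
    by (simp add: dir_deriv_reflect[OF test_smooth[OF \<rho>]])
  also have "\<dots> = conv g \<rho> x" using wderivD[OF w test_reflect[OF \<rho>]] by (simp add: conv_def)
  finally show "dir_deriv e (conv f \<rho>) x = conv g \<rho> x" .
qed

lemma laplacian_conv:
  assumes w: "wlap F L" and \<rho>: "\<rho> \<in> test_functions UNIV"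
  shows "laplacian (conv F \<rho>) = conv L \<rho>"
proof
  fix x
  note d = w[unfolded wlap_def has_weak_laplacian_iff[OF open_UNIV]]
  have F: "locally_integrable_on F UNIV" using d by simp
  have "laplacian (conv F \<rho>) x = (\<Sum>b\<in>Basis. conv F (dir_deriv b (dir_deriv b \<rho>)) x)"
    by (simp add: laplacian_eq dir_deriv_conv[OF F] test_dir_deriv \<rho>)
  also have "\<dots> = (LINT y|lebesgue. F y * laplacian \<rho> (x - y))"
    unfolding conv_def laplacian_eq sum_distrib_left
    by (intro Bochner_Integration.integral_sum[symmetric] conv_integrable F test_dir_deriv \<rho>)
  also have "(\<lambda>y. laplacian \<rho> (x - y)) = laplacian (\<lambda>y. \<rho> (x - y))"
  proof -
    have "dir_deriv b (dir_deriv b (\<lambda>y. \<rho> (x - y))) y = dir_deriv b (dir_deriv b \<rho>) (x - y)" for b y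
    proof -
      have "dir_deriv b (dir_deriv b (\<lambda>y. \<rho> (x - y))) y = - dir_deriv b (\<lambda>y. dir_deriv b \<rho> (x - y)) y"
        unfolding dir_deriv_reflect[OF test_smooth[OF \<rho>]]
        by (intro dir_deriv_minus smooth_differentiable test_smooth[OF test_reflect[OF test_dir_deriv[OF \<rho>]]])
      then show ?thesis by (simp add: dir_deriv_reflect[OF smooth_dir_deriv[OF test_smooth[OF \<rho>]]])
    qed
    then show ?thesis by (simp add: laplacian_eq fun_eq_iff)
  qed
  then have "(LINT y|lebesgue. F y * laplacian \<rho> (x - y)) = (LINT y|lebesgue. F y * laplacian (\<lambda>y. \<rho> (x - y)) y)"
    by (simp add: fun_eq_iff)
  also have "\<dots> = conv L \<rho> x" using d test_reflect[OF \<rho>, of x] by (simp add: conv_def)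
  finally show "laplacian (conv F \<rho>) x = conv L \<rho> x" .
qed

lemma conv_diff:
  assumes "locally_integrable_on f UNIV" "locally_integrable_on g UNIV" "\<rho> \<in> test_functions UNIV"
  shows "conv (\<lambda>x. f x - g x) \<rho> x = conv f \<rho> x - conv g \<rho> x"
  unfolding conv_def using conv_integrable[OF assms(1,3)] conv_integrable[OF assms(2,3)]
  by (simp add: left_diff_distrib)

lemma conv_support:
  assumes "\<And>x. x \<notin> C \<Longrightarrow> f x = 0" "\<And>z. norm z \<ge> \<delta> \<Longrightarrow> \<rho> z = 0" "\<And>y. y \<in> C \<Longrightarrow> dist x y \<ge> \<delta>"
  shows "conv f \<rho> x = 0"
proof -
  have "(\<lambda>y. f y * \<rho> (x - y)) = (\<lambda>y. 0)"
  proof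
    fix y show "f y * \<rho> (x - y) = 0"
      using assms(1)[of y] assms(2)[of "x - y"] assms(3)[of y] by (cases "y \<in> C") (auto simp: dist_norm)
  qed
  then show ?thesis unfolding conv_def by simp
qed

lemma measure_pres_reflect: "measure_pres (\<lambda>y::'a::euclidean_space. x - y)"
proof -
  have "lborel = density (distr lborel borel (\<lambda>y::'a. x - y)) (\<lambda>_. 1)"
    using lborel_affine[of "-1" x] by simp
  then show ?thesis by (simp add: measure_pres_def density_1)
qed

text \<open>Young's inequality for a kernel of mass 1: Cauchy-Schwarz, with the kernel split into
  two square roots, gives a pointwise Jensen inequality, which Tonelli's theorem integrates.\<close>

lemma conv_n2_le:
  fixes f :: "'a::euclidean_space \<Rightarrow> real"
  assumes f: "L2 f" and \<rho>: "\<rho> \<in> test_functions UNIV" "\<And>x. \<rho> x \<ge> 0" "(LINT x|lebesgue. \<rho> x) = 1"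
  shows "L2 (conv f \<rho>)" "n2 (conv f \<rho>) \<le> n2 f"
proof -
  have fl: "locally_integrable_on f UNIV" by (rule L2_locally_integrable[OF f])
  have f2l: "locally_integrable_on (\<lambda>x. (f x)\<^sup>2) UNIV"
    using L2_sq_integrable[OF f] lmeasurable_compact unfolding locally_integrable_on_def set_integrable_def
    by (auto intro!: integrable_mult_indicator simp del: scaleR_conv_of_real real_scaleR_def)
  have \<rho>c: "continuous_on UNIV \<rho>" by (rule smooth_continuous[OF test_smooth[OF \<rho>(1)]])
  have \<rho>i: "(LINT y|lebesgue. \<rho> (x - y)) = 1" for x
    using measure_pres_integral[OF measure_pres_reflect continuous_lebesgue_measurable[OF \<rho>c], of x] \<rho>(3) by simp
  have cm: "conv f \<rho> \<in> borel_measurable borel"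
    by (rule borel_measurable_continuous_onI[OF smooth_continuous[OF smooth_conv[OF fl \<rho>(1)]]])
  \<comment> \<open>Tonelli's theorem is applied to a product of Borel measures, so the square of
    \<open>f\<close> is replaced by a Borel function equal to it almost everywhere.\<close>
  obtain G where G: "G \<in> borel_measurable lborel" "AE x in lborel. (f x)\<^sup>2 = G x"
    using completion_ex_borel_measurable_real[of "\<lambda>x. (f x)\<^sup>2" lborel] L2_sq_integrable[OF f] by blast
  have Gl: "AE x in lebesgue. (f x)\<^sup>2 = G x" using G(2) by (rule AE_completion)
  have jensen: "ennreal ((conv f \<rho> x)\<^sup>2) \<le> (\<integral>\<^sup>+y. ennreal (G y) * ennreal (\<rho> (x - y)) \<partial>lborel)" for x
  proof -
    have sq: "sqrt (\<rho> z) * sqrt (\<rho> z) = \<rho> z" for z using \<rho>(2) by simp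
    have m1: "(\<lambda>y. sqrt (\<rho> (x - y))) \<in> borel_measurable lebesgue"
      by (intro continuous_lebesgue_measurable continuous_intros continuous_on_compose2[OF \<rho>c]) auto
    have a: "L2 (\<lambda>y. f y * sqrt (\<rho> (x - y)))"
      unfolding L2_def using conv_integrable[OF f2l \<rho>(1), of x] \<rho>(2)
      by (auto simp: power_mult_distrib intro: borel_measurable_times[OF L2_measurable[OF f] m1])
    have b: "L2 (\<lambda>y. sqrt (\<rho> (x - y)))"
      unfolding L2_def using test_integrable[OF test_reflect[OF \<rho>(1)], of x] m1 \<rho>(2) by simp
    have "conv f \<rho> x = (LINT y|lebesgue. (f y * sqrt (\<rho> (x - y))) * sqrt (\<rho> (x - y)))"
      by (simp add: conv_def mult.assoc sq abs_of_nonneg[OF \<rho>(2)])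
    then have "\<bar>conv f \<rho> x\<bar> \<le> n2 (\<lambda>y. f y * sqrt (\<rho> (x - y))) * n2 (\<lambda>y. sqrt (\<rho> (x - y)))"
      using n2_cauchy_schwarz[OF a b] by simp
    also have "n2 (\<lambda>y. sqrt (\<rho> (x - y))) = 1" using \<rho>(2) \<rho>i by (simp add: n2_def)
    finally have "\<bar>conv f \<rho> x\<bar>\<^sup>2 \<le> (n2 (\<lambda>y. f y * sqrt (\<rho> (x - y))))\<^sup>2" by (intro power_mono) auto
    also have "\<dots> = (LINT y|lebesgue. (f y)\<^sup>2 * \<rho> (x - y))" using \<rho>(2) by (simp add: n2_sq power_mult_distrib)
    finally have "ennreal ((conv f \<rho> x)\<^sup>2) \<le> ennreal (LINT y|lebesgue. (f y)\<^sup>2 * \<rho> (x - y))" by (simp add: ennreal_leI)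
    also have "\<dots> = (\<integral>\<^sup>+y. ennreal ((f y)\<^sup>2 * \<rho> (x - y)) \<partial>lebesgue)"
      using \<rho>(2) by (intro nn_integral_eq_integral[symmetric] conv_integrable f2l \<rho>) auto
    also have "\<dots> = (\<integral>\<^sup>+y. ennreal (G y) * ennreal (\<rho> (x - y)) \<partial>lebesgue)"
      by (intro nn_integral_cong_AE, use Gl in eventually_elim) (metis ennreal_mult'' \<rho>(2))
    also have "\<dots> = (\<integral>\<^sup>+y. ennreal (G y) * ennreal (\<rho> (x - y)) \<partial>lborel)"
      by (simp add: nn_integral_completion)
    finally show ?thesis .
  qed
  have \<rho>m: "\<rho> \<in> borel_measurable borel" by (rule borel_measurable_continuous_onI[OF \<rho>c])
  have "(\<integral>\<^sup>+x. ennreal ((conv f \<rho> x)\<^sup>2) \<partial>lborel) \<le> (\<integral>\<^sup>+x. (\<integral>\<^sup>+y. ennreal (G y) * ennreal (\<rho> (x - y)) \<partial>lborel) \<partial>lborel)"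
    by (intro nn_integral_mono jensen)
  also have "\<dots> = (\<integral>\<^sup>+y. (\<integral>\<^sup>+x. ennreal (G y) * ennreal (\<rho> (x - y)) \<partial>lborel) \<partial>lborel)"
  proof (rule lborel_pair.Fubini'[symmetric])
    show "(\<lambda>(x, y). ennreal (G y) * ennreal (\<rho> (x - y))) \<in> borel_measurable (lborel \<Otimes>\<^sub>M lborel)"
      using G(1) \<rho>m by measurable
  qed
  also have "\<dots> = (\<integral>\<^sup>+y. ennreal (G y) * 1 \<partial>lborel)"
  proof (intro nn_integral_cong)
    fix y :: 'a
    have "(\<integral>\<^sup>+x. ennreal (\<rho> (x - y)) \<partial>lborel) = (\<integral>\<^sup>+x. ennreal (\<rho> x) \<partial>distr lborel borel ((+) (- y)))"
      using \<rho>m by (subst nn_integral_distr) auto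
    also have "\<dots> = (\<integral>\<^sup>+x. ennreal (\<rho> x) \<partial>lborel)" by (simp add: lborel_distr_plus)
    also have "\<dots> = (\<integral>\<^sup>+x. ennreal (\<rho> x) \<partial>lebesgue)" by (simp add: nn_integral_completion)
    also have "\<dots> = ennreal 1"
      using \<rho>(2) test_integrable[OF \<rho>(1)] \<rho>(3) by (subst nn_integral_eq_integral) auto
    finally have e: "(\<integral>\<^sup>+x. ennreal (\<rho> (x - y)) \<partial>lborel) = 1" by simp
    have [measurable]: "(\<lambda>x. \<rho> (x - y)) \<in> borel_measurable borel"
      by (intro borel_measurable_continuous_onI continuous_on_compose2[OF \<rho>c] continuous_intros) auto
    have "(\<integral>\<^sup>+x. ennreal (G y) * ennreal (\<rho> (x - y)) \<partial>lborel) = ennreal (G y) * (\<integral>\<^sup>+x. ennreal (\<rho> (x - y)) \<partial>lborel)"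
      by (intro nn_integral_cmult) measurable
    then show "(\<integral>\<^sup>+x. ennreal (G y) * ennreal (\<rho> (x - y)) \<partial>lborel) = ennreal (G y) * 1" by (simp add: e)
  qed
  also have "\<dots> = (\<integral>\<^sup>+y. ennreal (G y) \<partial>lebesgue)" by (simp add: nn_integral_completion)
  also have "\<dots> = (\<integral>\<^sup>+y. ennreal ((f y)\<^sup>2) \<partial>lebesgue)"
    by (intro nn_integral_cong_AE, use Gl in eventually_elim) simp
  also have "\<dots> = ennreal ((n2 f)\<^sup>2)"
    unfolding n2_sq by (intro nn_integral_eq_integral L2_sq_integrable f) auto
  finally have le: "(\<integral>\<^sup>+x. ennreal ((conv f \<rho> x)\<^sup>2) \<partial>lebesgue) \<le> ennreal ((n2 f)\<^sup>2)" by (simp add: nn_integral_completion)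
  have cl: "conv f \<rho> \<in> borel_measurable lebesgue" using cm by (simp add: measurable_completion)
  have i: "integrable lebesgue (\<lambda>x. (conv f \<rho> x)\<^sup>2)"
    unfolding integrable_iff_bounded using cl le by (auto intro: le_less_trans)
  then show "L2 (conv f \<rho>)" using cl by (simp add: L2_def)
  have "ennreal ((n2 (conv f \<rho>))\<^sup>2) \<le> ennreal ((n2 f)\<^sup>2)"
    unfolding n2_sq[of "conv f \<rho>"] using le nn_integral_eq_integral[OF i] by simp
  then have "(n2 (conv f \<rho>))\<^sup>2 \<le> (n2 f)\<^sup>2" by simp
  then show "n2 (conv f \<rho>) \<le> n2 f" by (rule power2_le_imp_le) simp
qed

lemma mollifier_exists:
  assumes "\<delta> > 0"
  obtains \<rho> :: "'a::euclidean_space \<Rightarrow> real" where "\<rho> \<in> test_functions UNIV" "\<And>x. \<rho> x \<ge> 0" "(LINT x|lebesgue. \<rho> x) = 1"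
    "\<And>x. norm x \<ge> \<delta> \<Longrightarrow> \<rho> x = 0"
proof -
  obtain \<psi> :: "'a \<Rightarrow> real" where \<psi>: "smooth \<psi>" "\<And>x. \<psi> x \<in> {0..1}" "\<And>x. dist 0 x \<le> \<delta>/2 \<Longrightarrow> \<psi> x = 1" "\<And>x. dist 0 x \<ge> \<delta> \<Longrightarrow> \<psi> x = 0"
    using ball_bump[of "\<delta>/2" \<delta> "0::'a"] assms by auto
  have t: "\<psi> \<in> test_functions UNIV" by (rule test_functionsI[OF \<psi>(1) compact_cball[of 0 \<delta>]]) (use \<psi>(4) in auto)
  define I where "I = (LINT x|lebesgue. \<psi> x)"
  have "measure lebesgue (cball (0::'a) (\<delta>/2)) \<le> I"
  proof -
    have "(LINT x|lebesgue. indicator (cball (0::'a) (\<delta>/2)) x) \<le> I"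
      unfolding I_def
      by (intro integral_mono integrable_indicator_compact compact_cball test_integrable[OF t])
         (use \<psi>(2,3) in \<open>auto simp: indicator_def\<close>)
    then show ?thesis by simp
  qed
  moreover have "measure lebesgue (cball (0::'a) (\<delta>/2)) > 0" using assms by (simp add: content_cball_pos)
  ultimately have I: "I > 0" by linarith
  show ?thesis
  proof (rule that[of "\<lambda>x. inverse I * \<psi> x"])
    show "(\<lambda>x. inverse I * \<psi> x) \<in> test_functions UNIV" by (rule test_cmult[OF t])
    show "(LINT x|lebesgue. inverse I * \<psi> x) = 1" using I by (simp add: I_def)
  qed (use \<psi> I in auto)
qed

definition mollifier :: "real \<Rightarrow> ('a::euclidean_space \<Rightarrow> real) \<Rightarrow> bool" where
  "mollifier \<delta> \<rho> \<longleftrightarrow> \<rho> \<in> test_functions UNIV \<and> (\<forall>x. \<rho> x \<ge> 0) \<and> (LINT x|lebesgue. \<rho> x) = 1 \<and>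
     (\<forall>x. norm x \<ge> \<delta> \<longrightarrow> \<rho> x = 0)"

definition moll :: "nat \<Rightarrow> 'a::euclidean_space \<Rightarrow> real" where
  "moll n = (SOME \<rho>. mollifier (inverse (real (Suc n))) \<rho>)"

lemma mollifier_moll: "mollifier (inverse (real (Suc n))) (moll n :: 'a::euclidean_space \<Rightarrow> real)"
proof -
  have "\<exists>\<rho> :: 'a \<Rightarrow> real. mollifier (inverse (real (Suc n))) \<rho>"
    by (rule mollifier_exists[of "inverse (real (Suc n))"]) (auto simp: mollifier_def)
  then show ?thesis unfolding moll_def by (rule someI_ex)
qed

lemma moll:
  "moll n \<in> test_functions UNIV" "\<And>x. moll n x \<ge> 0" "(LINT x|lebesgue. moll n x) = 1"
  "\<And>x. norm x \<ge> inverse (real (Suc n)) \<Longrightarrow> moll n x = 0"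
  using mollifier_moll[of n] unfolding mollifier_def by blast+

text \<open>For continuous functions with compact support the convergence is uniform. They are
  dense, and the bound \<open>conv_n2_le\<close> does not depend on \<open>n\<close>.\<close>

lemma conv_moll_tendsto:
  fixes f :: "'a::euclidean_space \<Rightarrow> real"
  assumes f: "L2 f"
  shows "(\<lambda>n. n2 (\<lambda>x. conv f (moll n) x - f x)) \<longlonglongrightarrow> 0"
proof (rule LIMSEQ_I)
  fix e :: real assume e: "e > 0"
  obtain g C where g: "compact C" "\<And>x. x \<notin> C \<Longrightarrow> g x = 0" "continuous_on UNIV g" "n2 (\<lambda>x. f x - g x) < e / 4"
    by (rule L2_approx_continuous[OF f, of "e/4"]) (use e in auto)
  have g2: "L2 g" by (rule L2_continuous_compact_support[OF g(3,1,2)])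
  have gl: "locally_integrable_on g UNIV" and fl: "locally_integrable_on f UNIV"
    using g2 f by (auto intro: L2_locally_integrable)
  obtain R where R: "\<And>x. x \<in> C \<Longrightarrow> norm x \<le> R" using g(1) compact_imp_bounded bounded_iff by metis
  \<comment> \<open>The mollifiers have radius at most 1, so the mollifications of \<open>g\<close>
    all vanish outside \<open>Q\<close>.\<close>
  define Q where "Q = cball (0::'a) (\<bar>R\<bar> + 1)"
  have i2: "L2 (indicator Q :: 'a \<Rightarrow> real)"
    using integrable_indicator_compact[of Q] by (simp add: L2_def Q_def power2_eq_square flip: indicator_inter_arith)
  define \<delta> where "\<delta> = (\<lambda>n. inverse (real (Suc n)))"
  have d1: "\<delta> n \<le> 1" "\<delta> n > 0" for n by (auto simp: \<delta>_def inverse_le_1_iff)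
  \<comment> \<open>Uniform closeness \<open>K\<close> on \<open>Q\<close> costs at most
    \<open>e / 4\<close> in norm; the summand 1 keeps the denominator positive.\<close>
  define K where "K = e / (4 * (n2 (indicator Q :: 'a \<Rightarrow> real) + 1))"
  have q: "n2 (indicator Q :: 'a \<Rightarrow> real) + 1 > 0" by (rule add_nonneg_pos) auto
  have K: "K > 0" using e q by (simp add: K_def)
  have "uniformly_continuous_on (cball 0 (\<bar>R\<bar> + 2)) g"
    by (rule compact_uniformly_continuous[OF continuous_on_subset[OF g(3)]]) auto
  then obtain d where d: "d > 0" "\<And>x y. x \<in> cball 0 (\<bar>R\<bar> + 2) \<Longrightarrow> y \<in> cball 0 (\<bar>R\<bar> + 2) \<Longrightarrow> dist y x < d \<Longrightarrow> dist (g y) (g x) < K"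
    unfolding uniformly_continuous_on_def using K by meson
  have "\<forall>\<^sub>F n in sequentially. \<delta> n < d"
    unfolding \<delta>_def using LIMSEQ_inverse_real_of_nat d(1) by (rule order_tendstoD(2))
  then obtain N where N: "\<And>n. n \<ge> N \<Longrightarrow> \<delta> n < d" unfolding eventually_sequentially by blast
  have gn: "\<bar>conv g (moll n) x - g x\<bar> \<le> \<bar>K * indicator Q x\<bar>" if nN: "n \<ge> N" for n x
  proof (cases "x \<in> Q")
    case True
    have mi: "integrable lebesgue (\<lambda>y. moll n (x - y))" by (rule test_integrable[OF test_reflect[OF moll(1)]])
    have m1: "(LINT y|lebesgue. moll n (x - y)) = 1"
      using measure_pres_integral[OF measure_pres_reflect[of x]
          continuous_lebesgue_measurable[OF smooth_continuous[OF test_smooth[OF moll(1)[of n]]]]] moll(3)[of n] by simp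
    have eq: "conv g (moll n) x - g x = (LINT y|lebesgue. g y * moll n (x - y) - g x * moll n (x - y))"
      unfolding conv_def using m1 mi conv_integrable[OF gl moll(1)[of n], of x] by simp
    have "\<bar>conv g (moll n) x - g x\<bar> \<le> (LINT y|lebesgue. \<bar>g y * moll n (x - y) - g x * moll n (x - y)\<bar>)"
      unfolding eq by (rule integral_abs_bound)
    also have "\<dots> \<le> (LINT y|lebesgue. K * moll n (x - y))"
    proof (rule integral_mono)
      show "integrable lebesgue (\<lambda>y. \<bar>g y * moll n (x - y) - g x * moll n (x - y)\<bar>)"
        using mi conv_integrable[OF gl moll(1)[of n], of x] by auto
      show "integrable lebesgue (\<lambda>y. K * moll n (x - y))" using mi by auto
      fix y
      have "\<bar>g y * moll n (x - y) - g x * moll n (x - y)\<bar> = \<bar>g y - g x\<bar> * moll n (x - y)"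
        using moll(2)[of n "x - y"] by (simp add: abs_mult flip: left_diff_distrib)
      also have "\<dots> \<le> K * moll n (x - y)"
      proof (cases "norm (x - y) \<ge> \<delta> n")
        case True then show ?thesis using moll(4)[of n "x - y"] by (simp add: \<delta>_def)
      next
        case False
        then have "norm (x - y) < d" "norm (x - y) \<le> 1" using N[OF nN] d1(1)[of n] by linarith+
        moreover have "norm y \<le> norm x + norm (x - y)" using norm_triangle_ineq4[of x "x - y"] by simp
        ultimately have "dist (g y) (g x) < K" using \<open>x \<in> Q\<close> by (intro d(2)) (auto simp: Q_def dist_norm norm_minus_commute)
        then show ?thesis by (intro mult_right_mono moll(2)) (simp add: dist_norm)
      qed
      finally show "\<bar>g y * moll n (x - y) - g x * moll n (x - y)\<bar> \<le> K * moll n (x - y)" .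
    qed
    also have "\<dots> = K" using m1 by simp
    finally show ?thesis using True K by simp
  next
    case False
    then have n: "norm x > \<bar>R\<bar> + 1" by (simp add: Q_def)
    then have "x \<notin> C" using R[of x] by force
    moreover have "conv g (moll n) x = 0"
    proof (rule conv_support[of C g "\<delta> n", OF g(2)])
      show "moll n z = 0" if "norm z \<ge> \<delta> n" for z using moll(4) that by (simp add: \<delta>_def)
      show "\<delta> n \<le> dist x y" if "y \<in> C" for y
        using R[OF that] n d1(1)[of n] norm_triangle_ineq2[of x y] by (simp add: dist_norm)
    qed
    ultimately show ?thesis using g(2) by simp
  qed
  have cg: "L2 (conv g (moll n))" "L2 (conv f (moll n))" for n
    using conv_n2_le(1)[OF g2 moll(1,2,3)] conv_n2_le(1)[OF f moll(1,2,3)] by auto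
  have gn2: "n2 (\<lambda>x. conv g (moll n) x - g x) \<le> e / 4" if "n \<ge> N" for n
  proof -
    have "n2 (\<lambda>x. conv g (moll n) x - g x) \<le> K * n2 (indicator Q :: 'a \<Rightarrow> real)"
      using L2_bound(2)[OF L2_cmult[OF i2] L2_measurable[OF L2_diff[OF cg(1)[of n] g2]] gn[OF that]] K by (simp add: n2_cmult)
    also have "\<dots> \<le> K * (n2 (indicator Q :: 'a \<Rightarrow> real) + 1)" using K by (intro mult_left_mono) auto
    also have "\<dots> = e / 4"
    proof -
      have "e / (4 * t) * t = e / 4" if "t > 0" for t using that by simp
      then show ?thesis unfolding K_def using q .
    qed
    finally show ?thesis .
  qed
  have "n2 (\<lambda>x. conv f (moll n) x - f x) < e" if "n \<ge> N" for n
  proof -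
    have "(\<lambda>x. conv f (moll n) x - f x) = (\<lambda>x. (conv (\<lambda>x. f x - g x) (moll n) x + (conv g (moll n) x - g x)) - (f x - g x))"
      by (simp add: conv_diff[OF fl gl moll(1)] fun_eq_iff)
    then have "n2 (\<lambda>x. conv f (moll n) x - f x) \<le> n2 (\<lambda>x. conv (\<lambda>x. f x - g x) (moll n) x + (conv g (moll n) x - g x)) + n2 (\<lambda>x. f x - g x)"
      using n2_triangle_diff[OF L2_add[OF conv_n2_le(1)[OF L2_diff[OF f g2] moll(1,2,3)[of n]] L2_diff[OF cg(1)[of n] g2]] L2_diff[OF f g2]] by metis
    also have "n2 (\<lambda>x. conv (\<lambda>x. f x - g x) (moll n) x + (conv g (moll n) x - g x))
        \<le> n2 (conv (\<lambda>x. f x - g x) (moll n)) + n2 (\<lambda>x. conv g (moll n) x - g x)"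
      by (rule n2_triangle[OF conv_n2_le(1)[OF L2_diff[OF f g2] moll(1,2,3)[of n]] L2_diff[OF cg(1)[of n] g2]])
    also have "n2 (conv (\<lambda>x. f x - g x) (moll n)) \<le> n2 (\<lambda>x. f x - g x)"
      by (rule conv_n2_le(2)[OF L2_diff[OF f g2] moll(1,2,3)])
    finally show ?thesis using gn2[OF that] g(4) e by linarith
  qed
  then show "\<exists>N. \<forall>n\<ge>N. norm (n2 (\<lambda>x. conv f (moll n) x - f x) - 0) < e" by auto
qed

text \<open>A compact subset of \<open>U\<close> keeps a positive distance to the complement, and a
  mollification of smaller radius keeps its support in \<open>U\<close>.\<close>

lemma conv_moll_test:
  fixes f :: "'a::euclidean_space \<Rightarrow> real"
  assumes f: "locally_integrable_on f UNIV" and C: "compact C" "\<And>x. x \<notin> C \<Longrightarrow> f x = 0" and U: "open U" "C \<subseteq> U"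
  shows "\<forall>\<^sub>F n in sequentially. conv f (moll n) \<in> test_functions U"
proof -
  obtain d where d: "d > 0" "(\<Union>c\<in>C. cball c d) \<subseteq> U"
  proof (cases "C = {}")
    case True then show ?thesis using that[of 1] by auto
  next
    case False
    have cl: "closed (- U)" by (rule closed_Compl[OF U(1)])
    show ?thesis
    proof (cases "U = UNIV")
      case True then show ?thesis using that[of 1] by auto
    next
      case U': False
      obtain e where e: "e > 0" "\<And>x y. x \<in> C \<Longrightarrow> y \<in> - U \<Longrightarrow> e \<le> dist x y"
        using separate_compact_closed[OF C(1) cl] U by (metis Compl_disjoint disjoint_eq_subset_Compl double_complement inf_commute)
      show ?thesis
      proof (rule that[of "e/2"])
        show "(\<Union>c\<in>C. cball c (e/2)) \<subseteq> U"
        proof safe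
          fix x c assume "c \<in> C" "x \<in> cball c (e/2)"
          then show "x \<in> U" using e(2)[of c x] e(1) by (cases "x \<in> U") auto
        qed
      qed (use e in auto)
    qed
  qed
  have cp: "compact (\<Union>c\<in>C. cball c d)"
  proof -
    have eq: "(\<Union>c\<in>C. cball c d) = {x + y |x y. x \<in> C \<and> y \<in> cball 0 d}"
    proof safe
      fix c x assume "c \<in> C" "x \<in> cball c d"
      then show "\<exists>xa y. x = xa + y \<and> xa \<in> C \<and> y \<in> cball 0 d"
        by (intro exI[of _ c] exI[of _ "x - c"]) (auto simp: dist_norm norm_minus_commute)
    next
      fix x y assume "x \<in> C" "y \<in> cball (0::'a) d"
      then show "x + y \<in> (\<Union>c\<in>C. cball c d)" by (intro UN_I[of x]) (auto simp: dist_norm)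
    qed
    show ?thesis unfolding eq by (rule compact_sums[OF C(1) compact_cball])
  qed
  obtain N where N: "inverse (real (Suc N)) < d" using reals_Archimedean d(1) by blast
  have "conv f (moll n) \<in> test_functions U" if "n \<ge> N" for n
  proof (rule test_functionsI[OF smooth_conv[OF f moll(1)] cp d(2)])
    fix x assume x: "x \<notin> (\<Union>c\<in>C. cball c d)"
    show "conv f (moll n) x = 0"
    proof (rule conv_support[OF C(2) moll(4)])
      fix y assume "y \<in> C"
      then have "dist x y > d" using x by (auto simp: dist_commute not_le)
      moreover have "inverse (real (Suc n)) \<le> inverse (real (Suc N))" using that by simp
      ultimately show "inverse (real (Suc n)) \<le> dist x y" using N by linarith
    qed
  qed
  then show ?thesis by (auto simp: eventually_sequentially)
qed

section \<open>Null sequences in the second order Sobolev space\<close>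

definition bsmooth :: "('a::euclidean_space \<Rightarrow> real) \<Rightarrow> bool" where
  "bsmooth a \<longleftrightarrow> smooth a \<and> (\<exists>B. \<forall>x. \<bar>a x\<bar> \<le> B \<and> (\<forall>b\<in>Basis. \<bar>dir_deriv b a x\<bar> \<le> B) \<and>
     (\<forall>b\<in>Basis. \<forall>c\<in>Basis. \<bar>dir_deriv c (dir_deriv b a) x\<bar> \<le> B))"

lemma bsmoothI:
  assumes "smooth a" "\<And>x. \<bar>a x\<bar> \<le> B" "\<And>b. b \<in> Basis \<Longrightarrow> \<exists>B. \<forall>x. \<bar>dir_deriv b a x\<bar> \<le> B"
    "\<And>b c. b \<in> Basis \<Longrightarrow> c \<in> Basis \<Longrightarrow> \<exists>B. \<forall>x. \<bar>dir_deriv c (dir_deriv b a) x\<bar> \<le> B"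
  shows "bsmooth a"
proof -
  obtain B1 where B1: "\<And>b x. b \<in> Basis \<Longrightarrow> \<bar>dir_deriv b a x\<bar> \<le> B1 b" using assms(3) by metis
  obtain B2 where B2: "\<And>b c x. b \<in> Basis \<Longrightarrow> c \<in> Basis \<Longrightarrow> \<bar>dir_deriv c (dir_deriv b a) x\<bar> \<le> B2 b c" using assms(4) by metis
  define M where "M = \<bar>B\<bar> + (\<Sum>b\<in>Basis. \<bar>B1 b\<bar>) + (\<Sum>b\<in>Basis. \<Sum>c\<in>Basis. \<bar>B2 b c\<bar>)"
  have s: "0 \<le> (\<Sum>b\<in>Basis. \<bar>B1 b\<bar>)" "0 \<le> (\<Sum>b\<in>Basis. \<Sum>c\<in>Basis. \<bar>B2 b c\<bar>)" by (auto intro!: sum_nonneg)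
  have "\<bar>a x\<bar> \<le> M" for x using assms(2)[of x] s unfolding M_def by linarith
  moreover have "\<bar>dir_deriv b a x\<bar> \<le> M" if "b \<in> Basis" for b x
  proof -
    have "\<bar>B1 b\<bar> \<le> (\<Sum>b\<in>Basis. \<bar>B1 b\<bar>)" by (rule member_le_sum[OF that]) auto
    then show ?thesis using B1[OF that, of x] s unfolding M_def by linarith
  qed
  moreover have "\<bar>dir_deriv c (dir_deriv b a) x\<bar> \<le> M" if "b \<in> Basis" "c \<in> Basis" for b c x
  proof -
    have "\<bar>B2 b c\<bar> \<le> (\<Sum>c\<in>Basis. \<bar>B2 b c\<bar>)" by (rule member_le_sum[OF that(2)]) auto
    also have "\<dots> \<le> (\<Sum>b\<in>Basis. \<Sum>c\<in>Basis. \<bar>B2 b c\<bar>)" by (rule member_le_sum[OF that(1)]) (auto intro!: sum_nonneg)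
    finally show ?thesis using B2[OF that, of x] s unfolding M_def by linarith
  qed
  ultimately show ?thesis unfolding bsmooth_def using assms(1) by blast
qed

lemma bsmooth_smooth: "bsmooth a \<Longrightarrow> smooth a" by (simp add: bsmooth_def)

lemma bsmooth_bounds:
  assumes "bsmooth a"
  obtains B where "\<And>x. \<bar>a x\<bar> \<le> B" "\<And>b x. b \<in> Basis \<Longrightarrow> \<bar>dir_deriv b a x\<bar> \<le> B"
    "\<And>b c x. b \<in> Basis \<Longrightarrow> c \<in> Basis \<Longrightarrow> \<bar>dir_deriv c (dir_deriv b a) x\<bar> \<le> B"
  using assms unfolding bsmooth_def by blast

lemma test_bsmooth: assumes "\<phi> \<in> test_functions S" shows "bsmooth \<phi>"
proof -
  obtain B where "\<And>x. \<bar>\<phi> x\<bar> \<le> B" using test_bounded[OF assms] by metis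
  then show ?thesis
    using test_bounded[OF test_dir_deriv[OF assms]] test_bounded[OF test_dir_deriv[OF test_dir_deriv[OF assms]]]
    by (intro bsmoothI[of \<phi> B] test_smooth[OF assms]) metis+
qed

lemma bsmooth_const: "bsmooth (\<lambda>x. c)"
proof -
  have "dir_deriv b (\<lambda>x. c) = (\<lambda>x. 0)" for b :: 'a by (simp add: fun_eq_iff)
  then show ?thesis by (intro bsmoothI[of _ "\<bar>c\<bar>"]) auto
qed

lemma bsmooth_diff:
  assumes "bsmooth a" "bsmooth a'" shows "bsmooth (\<lambda>x. a x - a' x)"
proof -
  obtain B where B: "\<And>x. \<bar>a x\<bar> \<le> B" "\<And>b x. b \<in> Basis \<Longrightarrow> \<bar>dir_deriv b a x\<bar> \<le> B"
    "\<And>b c x. b \<in> Basis \<Longrightarrow> c \<in> Basis \<Longrightarrow> \<bar>dir_deriv c (dir_deriv b a) x\<bar> \<le> B" using bsmooth_bounds[OF assms(1)] by metis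
  obtain B' where B': "\<And>x. \<bar>a' x\<bar> \<le> B'" "\<And>b x. b \<in> Basis \<Longrightarrow> \<bar>dir_deriv b a' x\<bar> \<le> B'"
    "\<And>b c x. b \<in> Basis \<Longrightarrow> c \<in> Basis \<Longrightarrow> \<bar>dir_deriv c (dir_deriv b a') x\<bar> \<le> B'" using bsmooth_bounds[OF assms(2)] by metis
  note s = assms[THEN bsmooth_smooth]
  have d: "dir_deriv b (\<lambda>x. a x - a' x) = (\<lambda>x. dir_deriv b a x - dir_deriv b a' x)" for b
    using s by (auto simp: fun_eq_iff intro!: dir_deriv_diff smooth_differentiable)
  have dd: "dir_deriv c (\<lambda>x. dir_deriv b a x - dir_deriv b a' x) = (\<lambda>x. dir_deriv c (dir_deriv b a) x - dir_deriv c (dir_deriv b a') x)" for b c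
    using s by (auto simp: fun_eq_iff intro!: dir_deriv_diff smooth_differentiable smooth_dir_deriv)
  have t: "\<bar>p - q\<bar> \<le> B + B'" if "\<bar>p\<bar> \<le> B" "\<bar>q\<bar> \<le> B'" for p q :: real using that by linarith
  show ?thesis
    by (rule bsmoothI[of _ "B + B'"]) (use s B B' t in \<open>auto simp: d dd intro!: smooth_diff exI[of _ "B + B'"]\<close>)
qed

definition null2 :: "(nat \<Rightarrow> 'a::euclidean_space \<Rightarrow> real) \<Rightarrow> bool" where
  "null2 f \<longleftrightarrow> (\<forall>n. L2 (f n)) \<and> (\<lambda>n. n2 (f n)) \<longlonglongrightarrow> 0"

lemma null2_le:
  assumes "\<And>n. L2 (g n)" "\<And>n. n2 (g n) \<le> h n" "h \<longlonglongrightarrow> 0" shows "null2 g"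
  unfolding null2_def using assms by (auto intro!: Lim_null_comparison[of "\<lambda>n. n2 (g n)" h])

lemma null2_add: "null2 f \<Longrightarrow> null2 g \<Longrightarrow> null2 (\<lambda>n x. f n x + g n x)"
  by (rule null2_le[where h = "\<lambda>n. n2 (f n) + n2 (g n)"])
     (auto simp: null2_def intro: L2_add n2_triangle intro!: tendsto_add_zero)

lemma null2_mult_bounded:
  assumes "null2 f" "a \<in> borel_measurable lebesgue" "\<And>x. \<bar>a x\<bar> \<le> B"
  shows "null2 (\<lambda>n x. a x * f n x)"
  by (rule null2_le[where h = "\<lambda>n. B * n2 (f n)"])
     (use assms L2_mult_bounded[OF _ assms(2,3)] in \<open>auto simp: null2_def intro!: tendsto_mult_right_zero\<close>)

lemma null2_mult_smooth:
  assumes "null2 f" "smooth a" "\<And>x. \<bar>a x\<bar> \<le> B" shows "null2 (\<lambda>n x. a x * f n x)"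
  by (rule null2_mult_bounded[OF assms(1) continuous_lebesgue_measurable[OF smooth_continuous[OF assms(2)]] assms(3)])

lemma null2_cmult: "null2 f \<Longrightarrow> null2 (\<lambda>n x. c * f n x)"
  by (rule null2_mult_bounded[of f "\<lambda>x. c" "\<bar>c\<bar>"]) auto

lemma null2_diff: "null2 f \<Longrightarrow> null2 g \<Longrightarrow> null2 (\<lambda>n x. f n x - g n x)"
  using null2_add[OF _ null2_cmult[of g "-1"]] by simp

lemma null2_zero: "null2 (\<lambda>n x. 0)" by (simp add: null2_def)

lemma null2_sum: "(\<And>i. i \<in> I \<Longrightarrow> null2 (f i)) \<Longrightarrow> null2 (\<lambda>n x. \<Sum>i\<in>I. f i n x)"
  by (induction I rule: infinite_finite_induct) (auto intro: null2_add null2_zero)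

lemma null2_zext: "null2 f \<Longrightarrow> S \<in> sets lebesgue \<Longrightarrow> null2 (\<lambda>n. zext S (f n))"
  by (rule null2_le[where h = "\<lambda>n. n2 (f n)"]) (auto simp: null2_def intro: L2_zext)

lemma null2_measure_pres:
  assumes "null2 f" "measure_pres \<tau>" shows "null2 (\<lambda>n x. f n (\<tau> x))"
proof -
  have "L2 (\<lambda>x. f n (\<tau> x)) \<and> n2 (\<lambda>x. f n (\<tau> x)) = n2 (f n)" for n
  proof -
    have f: "L2 (f n)" using assms(1) by (simp add: null2_def)
    have "(\<lambda>x. (f n x)\<^sup>2) \<in> borel_measurable lebesgue" using L2_sq_integrable[OF f] by auto
    then show ?thesis
      using measure_pres_compose_measurable[OF assms(2) L2_measurable[OF f]]
        measure_pres_integrable[OF assms(2) L2_sq_integrable[OF f]] measure_pres_integral[OF assms(2)]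
      by (simp add: L2_def n2_def)
  qed
  then show ?thesis using assms(1) by (simp add: null2_def)
qed

text \<open>Convergence is recorded for differences that tend to zero, with their derivatives hidden
  by the quantifier. Such sequences are stable under sums, bounded smooth multipliers, restriction
  and reflection, and the derivatives of a limit never have to be named.\<close>

definition H2null :: "'a::euclidean_space set \<Rightarrow> (nat \<Rightarrow> 'a \<Rightarrow> real) \<Rightarrow> bool" where
  "H2null S u \<longleftrightarrow> (\<exists>v w. (\<forall>n. H2s S (u n) (v n) (w n)) \<and> null2 u \<and> (\<forall>b\<in>Basis. null2 (\<lambda>n. v n b)) \<and>
     (\<forall>b\<in>Basis. \<forall>c\<in>Basis. null2 (\<lambda>n. w n b c)))"

lemma H2nullE:
  assumes "H2null S u"
  obtains v w where "\<And>n. H2s S (u n) (v n) (w n)" "null2 u" "\<And>b. b \<in> Basis \<Longrightarrow> null2 (\<lambda>n. v n b)"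
    "\<And>b c. b \<in> Basis \<Longrightarrow> c \<in> Basis \<Longrightarrow> null2 (\<lambda>n. w n b c)"
  using assms unfolding H2null_def by blast

lemma H2nullI:
  assumes "\<And>n. H2s S (u n) (v n) (w n)" "null2 u" "\<And>b. b \<in> Basis \<Longrightarrow> null2 (\<lambda>n. v n b)"
    "\<And>b c. b \<in> Basis \<Longrightarrow> c \<in> Basis \<Longrightarrow> null2 (\<lambda>n. w n b c)"
  shows "H2null S u"
  using assms unfolding H2null_def by blast

lemma H2null_add:
  assumes "H2null S u" "H2null S u'" shows "H2null S (\<lambda>n x. u n x + u' n x)"
proof -
  obtain v w where 1: "\<And>n. H2s S (u n) (v n) (w n)" "null2 u" "\<And>b. b \<in> Basis \<Longrightarrow> null2 (\<lambda>n. v n b)"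
    "\<And>b c. b \<in> Basis \<Longrightarrow> c \<in> Basis \<Longrightarrow> null2 (\<lambda>n. w n b c)" using H2nullE[OF assms(1)] by metis
  obtain v' w' where 2: "\<And>n. H2s S (u' n) (v' n) (w' n)" "null2 u'" "\<And>b. b \<in> Basis \<Longrightarrow> null2 (\<lambda>n. v' n b)"
    "\<And>b c. b \<in> Basis \<Longrightarrow> c \<in> Basis \<Longrightarrow> null2 (\<lambda>n. w' n b c)" using H2nullE[OF assms(2)] by metis
  show ?thesis
    by (rule H2nullI[OF H2s_add[OF 1(1) 2(1)]]) (use 1 2 in \<open>auto intro!: null2_add\<close>)
qed

lemma H2null_cmult:
  assumes "H2null S u" shows "H2null S (\<lambda>n x. k * u n x)"
proof -
  obtain v w where 1: "\<And>n. H2s S (u n) (v n) (w n)" "null2 u" "\<And>b. b \<in> Basis \<Longrightarrow> null2 (\<lambda>n. v n b)"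
    "\<And>b c. b \<in> Basis \<Longrightarrow> c \<in> Basis \<Longrightarrow> null2 (\<lambda>n. w n b c)" using H2nullE[OF assms(1)] by metis
  show ?thesis
    by (rule H2nullI[OF H2s_cmult[OF 1(1)]]) (use 1 in \<open>auto intro!: null2_cmult\<close>)
qed

lemma H2null_diff: "H2null S u \<Longrightarrow> H2null S u' \<Longrightarrow> H2null S (\<lambda>n x. u n x - u' n x)"
  using H2null_add[OF _ H2null_cmult[of S u' "-1"]] by simp

lemma H2null_subset: "H2null S u \<Longrightarrow> T \<subseteq> S \<Longrightarrow> H2null T u"
  unfolding H2null_def by (elim exE conjE) (intro exI conjI allI, erule allE, erule (1) H2s_subset, assumption+)

lemma H2null_cong:
  assumes "H2null S u" "\<And>n x. x \<in> S \<Longrightarrow> u n x = u' n x" "null2 u'" shows "H2null S u'"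
proof -
  obtain v w where 1: "\<And>n. H2s S (u n) (v n) (w n)" "null2 u" "\<And>b. b \<in> Basis \<Longrightarrow> null2 (\<lambda>n. v n b)"
    "\<And>b c. b \<in> Basis \<Longrightarrow> c \<in> Basis \<Longrightarrow> null2 (\<lambda>n. w n b c)" using H2nullE[OF assms(1)] by metis
  show ?thesis
    by (rule H2nullI[of S u' v w]) (use 1 assms(3) H2s_cong[OF 1(1) assms(2)] in \<open>auto simp: null2_def\<close>)
qed

lemma H2null_zext:
  assumes "H2null S u" "open S" shows "H2null S (\<lambda>n. zext S (u n))"
  by (rule H2null_cong[OF assms(1)])
     (use assms null2_zext[OF _ open_in_lebesgue[OF assms(2)]] in \<open>auto simp: H2null_def\<close>)

section \<open>Products with smooth functions\<close>

definition mult_d :: "('a::euclidean_space \<Rightarrow> real) \<Rightarrow> ('a \<Rightarrow> real) \<Rightarrow> ('a \<Rightarrow> 'a \<Rightarrow> real) \<Rightarrow> 'a \<Rightarrow> 'a \<Rightarrow> real" where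
  "mult_d a u v b = (\<lambda>x. a x * v b x + dir_deriv b a x * u x)"

text \<open>Leibniz rule of second order, grouped as \<open>wderiv_add\<close> and
  \<open>wderiv_mult\<close> produce it from \<open>mult_d\<close>.\<close>

definition mult_dd :: "('a::euclidean_space \<Rightarrow> real) \<Rightarrow> ('a \<Rightarrow> real) \<Rightarrow> ('a \<Rightarrow> 'a \<Rightarrow> real) \<Rightarrow> ('a \<Rightarrow> 'a \<Rightarrow> 'a \<Rightarrow> real) \<Rightarrow> 'a \<Rightarrow> 'a \<Rightarrow> 'a \<Rightarrow> real" where
  "mult_dd a u v w b c = (\<lambda>x. (a x * w b c x + dir_deriv c a x * v b x) +
     (dir_deriv b a x * v c x + dir_deriv c (dir_deriv b a) x * u x))"

lemma mult_null2:
  assumes "bsmooth a" "null2 u" "\<And>b. b \<in> Basis \<Longrightarrow> null2 (\<lambda>n. v n b)"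
    "\<And>b c. b \<in> Basis \<Longrightarrow> c \<in> Basis \<Longrightarrow> null2 (\<lambda>n. w n b c)"
  shows "null2 (\<lambda>n x. a x * u n x)" "b \<in> Basis \<Longrightarrow> null2 (\<lambda>n. mult_d a (u n) (v n) b)"
    "b \<in> Basis \<Longrightarrow> c \<in> Basis \<Longrightarrow> null2 (\<lambda>n. mult_dd a (u n) (v n) (w n) b c)"
proof -
  obtain B where B: "\<And>x. \<bar>a x\<bar> \<le> B" "\<And>b x. b \<in> Basis \<Longrightarrow> \<bar>dir_deriv b a x\<bar> \<le> B"
    "\<And>b c x. b \<in> Basis \<Longrightarrow> c \<in> Basis \<Longrightarrow> \<bar>dir_deriv c (dir_deriv b a) x\<bar> \<le> B" using bsmooth_bounds[OF assms(1)] by metis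
  note s = bsmooth_smooth[OF assms(1)]
  show "null2 (\<lambda>n x. a x * u n x)" by (rule null2_mult_smooth[OF assms(2) s B(1)])
  show "null2 (\<lambda>n. mult_d a (u n) (v n) b)" if "b \<in> Basis"
    unfolding mult_d_def using that assms s B
    by (intro null2_add null2_mult_smooth[where B = B] smooth_dir_deriv) auto
  show "null2 (\<lambda>n. mult_dd a (u n) (v n) (w n) b c)" if "b \<in> Basis" "c \<in> Basis"
    unfolding mult_dd_def using that assms s B
    by (intro null2_add null2_mult_smooth[where B = B] smooth_dir_deriv) auto
qed

lemma mult_L2:
  assumes "bsmooth a" "L2 u" "\<And>b. b \<in> Basis \<Longrightarrow> L2 (v b)" "\<And>b c. b \<in> Basis \<Longrightarrow> c \<in> Basis \<Longrightarrow> L2 (w b c)"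
  shows "L2 (\<lambda>x. a x * u x)" "b \<in> Basis \<Longrightarrow> L2 (mult_d a u v b)" "b \<in> Basis \<Longrightarrow> c \<in> Basis \<Longrightarrow> L2 (mult_dd a u v w b c)"
proof -
  obtain B where B: "\<And>x. \<bar>a x\<bar> \<le> B" "\<And>b x. b \<in> Basis \<Longrightarrow> \<bar>dir_deriv b a x\<bar> \<le> B"
    "\<And>b c x. b \<in> Basis \<Longrightarrow> c \<in> Basis \<Longrightarrow> \<bar>dir_deriv c (dir_deriv b a) x\<bar> \<le> B" using bsmooth_bounds[OF assms(1)] by metis
  have m: "L2 (\<lambda>x. g x * f x)" if "L2 f" "smooth g" "\<And>x. \<bar>g x\<bar> \<le> B" for f g
    by (rule L2_mult_bounded(1)[OF that(1) continuous_lebesgue_measurable[OF smooth_continuous[OF that(2)]] that(3)])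
  note s = bsmooth_smooth[OF assms(1)]
  show "L2 (\<lambda>x. a x * u x)" by (rule m[OF assms(2) s B(1)])
  show "L2 (mult_d a u v b)" if "b \<in> Basis"
    unfolding mult_d_def using that assms s B by (intro L2_add m smooth_dir_deriv) auto
  show "L2 (mult_dd a u v w b c)" if "b \<in> Basis" "c \<in> Basis"
    unfolding mult_dd_def using that assms s B by (intro L2_add m smooth_dir_deriv) auto
qed

lemma H2s_mult:
  assumes "H2s S u v w" "bsmooth a" shows "H2s S (\<lambda>x. a x * u x) (mult_d a u v) (mult_dd a u v w)"
  using mult_L2[OF assms(2), of u v w] H2sD[OF assms(1)] bsmooth_smooth[OF assms(2)]
  unfolding H2s_def
  by (auto simp: mult_d_def mult_dd_def intro!: wderiv_add wderiv_mult smooth_dir_deriv)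

lemma H2s_mult_test:
  assumes "H2s S u v w" "a \<in> test_functions S" shows "H2s UNIV (\<lambda>x. a x * u x) (mult_d a u v) (mult_dd a u v w)"
  using mult_L2[OF test_bsmooth[OF assms(2)], of u v w] H2sD[OF assms(1)]
  unfolding H2s_def
  by (auto simp: mult_d_def mult_dd_def intro!: wderiv_add wderiv_mult_test[of S] test_dir_deriv assms(2))

lemma H2null_mult:
  assumes "H2null S u" "bsmooth a" shows "H2null S (\<lambda>n x. a x * u n x)"
proof -
  obtain v w where 1: "\<And>n. H2s S (u n) (v n) (w n)" "null2 u" "\<And>b. b \<in> Basis \<Longrightarrow> null2 (\<lambda>n. v n b)"
    "\<And>b c. b \<in> Basis \<Longrightarrow> c \<in> Basis \<Longrightarrow> null2 (\<lambda>n. w n b c)" using H2nullE[OF assms(1)] by metis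
  show ?thesis by (rule H2nullI[OF H2s_mult[OF 1(1) assms(2)] mult_null2[OF assms(2) 1(2-4)]])
qed

lemma H2null_mult_test:
  assumes "H2null S u" "a \<in> test_functions S" shows "H2null UNIV (\<lambda>n x. a x * u n x)"
proof -
  obtain v w where 1: "\<And>n. H2s S (u n) (v n) (w n)" "null2 u" "\<And>b. b \<in> Basis \<Longrightarrow> null2 (\<lambda>n. v n b)"
    "\<And>b c. b \<in> Basis \<Longrightarrow> c \<in> Basis \<Longrightarrow> null2 (\<lambda>n. w n b c)" using H2nullE[OF assms(1)] by metis
  show ?thesis by (rule H2nullI[OF H2s_mult_test[OF 1(1) assms(2)] mult_null2[OF test_bsmooth[OF assms(2)] 1(2-4)]])
qed

lemma H2null_Hk_norm:
  assumes "H2null S u" "open S" "\<And>n x. x \<in> S \<Longrightarrow> u' n x = u n x"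
  shows "(\<lambda>n. Hk_norm 2 S (u' n)) \<longlonglongrightarrow> 0" "u' n \<in> Hk 2 S"
proof -
  obtain v w where 1: "\<And>n. H2s S (u n) (v n) (w n)" "null2 u" "\<And>b. b \<in> Basis \<Longrightarrow> null2 (\<lambda>n. v n b)"
    "\<And>b c. b \<in> Basis \<Longrightarrow> c \<in> Basis \<Longrightarrow> null2 (\<lambda>n. w n b c)" using H2nullE[OF assms(1)] by metis
  note h = H2s_imp_Hk[OF assms(2) 1(1) assms(3)]
  show "u' n \<in> Hk 2 S" by (rule h(1))
  have "(\<lambda>n. H2n (u n) (v n) (w n)) \<longlonglongrightarrow> 0"
    unfolding H2n_def using 1(2-4) by (auto simp: null2_def intro!: tendsto_add_zero tendsto_null_sum)
  moreover have "0 \<le> Hk_norm 2 S (u' n)" for n by (simp add: Hk_norm_def sum_nonneg)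
  ultimately show "(\<lambda>n. Hk_norm 2 S (u' n)) \<longlonglongrightarrow> 0"
    using h(2) by (rule_tac Lim_null_comparison[of _ "\<lambda>n. H2n (u n) (v n) (w n)"]) auto
qed

lemma Hk_norm_H2null:
  assumes S: "open S" and u: "\<And>n. u n \<in> Hk 2 S" and l: "(\<lambda>n. Hk_norm 2 S (u n)) \<longlonglongrightarrow> 0"
  shows "H2null S (\<lambda>n. zext S (u n))"
proof -
  have "\<exists>v w. H2s S (zext S (u n)) v w \<and> n2 (zext S (u n)) \<le> Hk_norm 2 S (u n) \<and>
      (\<forall>b\<in>Basis. n2 (v b) \<le> Hk_norm 2 S (u n)) \<and> (\<forall>b\<in>Basis. \<forall>c\<in>Basis. n2 (w b c) \<le> Hk_norm 2 S (u n))" for n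
    by (rule Hk_imp_H2s[OF S u[of n]]) blast
  then obtain v w where vw: "\<And>n. H2s S (zext S (u n)) (v n) (w n)" "\<And>n. n2 (zext S (u n)) \<le> Hk_norm 2 S (u n)"
    "\<And>n b. b \<in> Basis \<Longrightarrow> n2 (v n b) \<le> Hk_norm 2 S (u n)" "\<And>n b c. b \<in> Basis \<Longrightarrow> c \<in> Basis \<Longrightarrow> n2 (w n b c) \<le> Hk_norm 2 S (u n)"
    by metis
  show ?thesis
    by (rule H2nullI[OF vw(1)]) (use H2sD[OF vw(1)] vw(2-4) l in \<open>auto intro!: null2_le[where h = "\<lambda>n. Hk_norm 2 S (u n)"]\<close>)
qed

lemma H2null_lap_norm:
  assumes "H2null UNIV u" shows "(\<lambda>n. lap_norm (u n)) \<longlonglongrightarrow> 0" "\<exists>L. wlap (u n) L"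
proof -
  obtain v w where 1: "\<And>n. H2s UNIV (u n) (v n) (w n)" "null2 u" "\<And>b. b \<in> Basis \<Longrightarrow> null2 (\<lambda>n. v n b)"
    "\<And>b c. b \<in> Basis \<Longrightarrow> c \<in> Basis \<Longrightarrow> null2 (\<lambda>n. w n b c)" using H2nullE[OF assms(1)] by metis
  show "\<exists>L. wlap (u n) L" using H2s_wlap[OF 1(1)] by blast
  have "(\<lambda>n. \<Sum>b\<in>Basis. n2 (w n b b)) \<longlonglongrightarrow> 0"
    using 1(4) by (auto simp: null2_def intro!: tendsto_null_sum)
  then show "(\<lambda>n. lap_norm (u n)) \<longlonglongrightarrow> 0"
    using H2s_lap_norm_le[OF 1(1)] by (rule_tac Lim_null_comparison[of _ "\<lambda>n. \<Sum>b\<in>Basis. n2 (w n b b)"]) auto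
qed

lemma null2_conv: "L2 f \<Longrightarrow> null2 (\<lambda>n x. conv f (moll n) x - f x)"
  unfolding null2_def using conv_moll_tendsto conv_n2_le(1)[OF _ moll(1,2,3)] L2_diff by blast

lemma H2s_conv:
  assumes "H2s UNIV u v w"
  shows "H2s UNIV (conv u (moll n)) (\<lambda>b. conv (v b) (moll n)) (\<lambda>b c. conv (w b c) (moll n))"
proof -
  note H = H2sD[OF assms]
  have "wderiv UNIV e (conv f (moll n)) (conv g (moll n))" if "wderiv UNIV e f g" for e f g
    using wderiv_smooth[OF smooth_conv[OF wderiv_locally_integrable(1)[OF that] moll(1)[of n]] open_UNIV, of e]
      conv_wderiv[OF that moll(1)] by simp
  then show ?thesis unfolding H2s_def using H conv_n2_le(1)[OF _ moll(1,2,3)] by blast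
qed

lemma H2null_conv:
  assumes "H2s UNIV u v w" shows "H2null UNIV (\<lambda>n x. conv u (moll n) x - u x)"
  by (rule H2nullI[OF H2s_diff[OF H2s_conv[OF assms] assms]])
     (use H2sD[OF assms] in \<open>auto intro!: null2_conv\<close>)

text \<open>Mollification commutes with the weak Laplacian, so convergence in the energy norm
  requires no control of the individual second derivatives.\<close>

lemma wlap_conv_tendsto:
  assumes "wlap F L" "L2 F"
  shows "(\<lambda>n. lap_norm (\<lambda>x. conv F (moll n) x - F x)) \<longlonglongrightarrow> 0" "wlap (conv F (moll n)) (conv L (moll n))"
proof -
  have L: "L2 L" using assms by (simp add: wlap_def)
  show w: "wlap (conv F (moll n)) (conv L (moll n))" for n
  proof -
    have Fl: "locally_integrable_on F UNIV" by (rule L2_locally_integrable[OF assms(2)])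
    have s: "smooth (conv F (moll n))" by (rule smooth_conv[OF Fl moll(1)])
    have l: "locally_integrable_on f UNIV" if "smooth f" for f :: "'a \<Rightarrow> real"
      by (rule locally_integrable_continuous[OF smooth_continuous[OF that]])
    have "(LINT x|lebesgue. conv F (moll n) x * laplacian \<phi> x) = (LINT x|lebesgue. laplacian (conv F (moll n)) x * \<phi> x)"
      if \<phi>: "\<phi> \<in> test_functions UNIV" for \<phi>
    proof -
      let ?f = "conv F (moll n)"
      have "(LINT x|lebesgue. ?f x * laplacian \<phi> x) = (\<Sum>b\<in>Basis. LINT x|lebesgue. ?f x * dir_deriv b (dir_deriv b \<phi>) x)"
        unfolding laplacian_eq sum_distrib_left
        by (intro Bochner_Integration.integral_sum locally_integrable_test_integrable[OF l[OF s]] test_dir_deriv \<phi>)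
      also have "\<dots> = (\<Sum>b\<in>Basis. LINT x|lebesgue. dir_deriv b (dir_deriv b ?f) x * \<phi> x)"
        using wderivD[OF wderiv_smooth[OF s open_UNIV] test_dir_deriv[OF \<phi>]]
          wderivD[OF wderiv_smooth[OF smooth_dir_deriv[OF s] open_UNIV] \<phi>] by (intro sum.cong refl) simp
      also have "\<dots> = (LINT x|lebesgue. laplacian ?f x * \<phi> x)"
        unfolding laplacian_eq sum_distrib_right
        by (intro Bochner_Integration.integral_sum[symmetric] locally_integrable_test_integrable[OF l _] smooth_dir_deriv s \<phi>)
      finally show ?thesis .
    qed
    then show ?thesis
      using laplacian_conv[OF assms(1) moll(1)[of n]] l[OF s] l[OF smooth_laplacian[OF s]] conv_n2_le(1)[OF L moll(1,2,3)[of n]]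
      by (simp add: wlap_def has_weak_laplacian_iff)
  qed
  show "(\<lambda>n. lap_norm (\<lambda>x. conv F (moll n) x - F x)) \<longlonglongrightarrow> 0"
    using conv_moll_tendsto[OF L] wlap_lap_norm(2)[OF wlap_diff[OF w assms(1)]] by simp
qed

section \<open>Reflection across a graph\<close>

text \<open>Compact support of \<open>g\<close> makes all its derivatives bounded, so that the
  reflection below acts boundedly on functions with square integrable second derivatives.\<close>

locale graph =
  fixes \<nu> :: "'a::euclidean_space" and g :: "'a \<Rightarrow> real"
  assumes nu: "norm \<nu> = 1" and g: "g \<in> test_functions UNIV"
begin

definition proj :: "'a \<Rightarrow> 'a" where "proj x = x - (x \<bullet> \<nu>) *\<^sub>R \<nu>"
text \<open>Height above the graph measured along \<nu>, not the distance to it; its derivative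
  along \<nu> is identically 1.\<close>

definition d :: "'a \<Rightarrow> real" where "d x = x \<bullet> \<nu> - g (proj x)"

text \<open>A reflection along \<open>\<nu>\<close> instead of the normal, which preserves Lebesgue measure.\<close>

definition \<sigma> :: "'a \<Rightarrow> 'a" where "\<sigma> x = x - (2 * d x) *\<^sub>R \<nu>"

lemma nu_inner: "\<nu> \<bullet> \<nu> = 1" using nu by (simp add: dot_square_norm)

lemma proj_shift: "proj (x + t *\<^sub>R \<nu>) = proj x"
  by (simp add: proj_def inner_add_left nu_inner algebra_simps)

lemma d_shift: "d (x + t *\<^sub>R \<nu>) = d x + t"
  by (simp add: d_def proj_shift inner_add_left nu_inner)

lemma sigma_eq: "\<sigma> x = x + (- 2 * d x) *\<^sub>R \<nu>" by (simp add: \<sigma>_def)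

lemma proj_sigma: "proj (\<sigma> x) = proj x" unfolding sigma_eq by (rule proj_shift)

lemma d_sigma: "d (\<sigma> x) = - d x" unfolding sigma_eq d_shift by simp

lemma sigma_sigma: "\<sigma> (\<sigma> x) = x" by (simp add: \<sigma>_def[of "\<sigma> x"] d_sigma) (simp add: \<sigma>_def)

lemma sigma_fix: "d x = 0 \<Longrightarrow> \<sigma> x = x" by (simp add: \<sigma>_def)

lemma proj_nu: "proj \<nu> = 0" by (simp add: proj_def nu_inner)

lemma bounded_linear_proj: "bounded_linear proj"
  unfolding proj_def by (intro bounded_linear_sub bounded_linear_ident bounded_linear_scaleR_const bounded_linear_inner_left)

lemma dir_deriv_proj:
  assumes "smooth f" shows "dir_deriv e (\<lambda>x. f (proj x)) x = dir_deriv (proj e) f (proj x)"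
  using dir_deriv_eqI[OF has_derivative_compose[OF bounded_linear_imp_has_derivative[OF bounded_linear_proj]
        has_derivative_dir_deriv[OF smooth_differentiable[OF assms]]]] .

lemma smooth_proj: assumes "smooth f" shows "smooth (\<lambda>x. f (proj x))"
proof (rule smooth_compose[OF _ assms])
  fix b :: 'a
  have "bounded_linear (\<lambda>x. proj x \<bullet> b)"
    using bounded_linear_compose[OF bounded_linear_inner_left bounded_linear_proj] .
  then show "smooth (\<lambda>x. proj x \<bullet> b)" by (rule smooth_linear)
qed

lemma g_smooth: "smooth g" by (rule test_smooth[OF g])

lemma smooth_d: "smooth d"
  unfolding d_def[abs_def] by (intro smooth_diff smooth_inner_left smooth_proj g_smooth)

lemma dir_deriv_0: assumes "smooth f" shows "dir_deriv 0 f x = 0"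
  using linear_0[OF has_derivative_linear[OF has_derivative_dir_deriv[OF smooth_differentiable[OF assms]]]] .

text \<open>The gradient of \<open>d\<close> depends only on \<open>proj x\<close>, so it is
  invariant under \<sigma> and constant along \<nu>. These two facts close the formulas for the
  derivatives of reflected functions.\<close>

lemma dir_deriv_d: "dir_deriv e d = (\<lambda>x. e \<bullet> \<nu> - dir_deriv (proj e) g (proj x))"
proof
  fix x
  have "dir_deriv e d x = dir_deriv e (\<lambda>x. x \<bullet> \<nu>) x - dir_deriv e (\<lambda>x. g (proj x)) x"
    unfolding d_def[abs_def]
    by (intro dir_deriv_diff smooth_differentiable smooth_inner_left smooth_proj g_smooth)
  then show "dir_deriv e d x = e \<bullet> \<nu> - dir_deriv (proj e) g (proj x)"
    by (simp add: dir_deriv_proj[OF g_smooth] dir_deriv_linear[OF bounded_linear_inner_left])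
qed

lemma dd_d_sigma: "dir_deriv e d (\<sigma> x) = dir_deriv e d x" by (simp add: dir_deriv_d proj_sigma)

lemma dd_d_nu: "dir_deriv \<nu> d x = 1"
  by (simp add: dir_deriv_d proj_nu nu_inner dir_deriv_0[OF g_smooth])

lemma smooth_dd_d: "smooth (dir_deriv e d)" by (rule smooth_dir_deriv[OF smooth_d])

lemma dir_deriv_dd_d: "dir_deriv c (dir_deriv e d) x = - dir_deriv (proj c) (dir_deriv (proj e) g) (proj x)"
proof -
  have "dir_deriv c (dir_deriv e d) x = dir_deriv c (\<lambda>x. e \<bullet> \<nu>) x - dir_deriv c (\<lambda>x. dir_deriv (proj e) g (proj x)) x"
    unfolding dir_deriv_d
    by (intro dir_deriv_diff smooth_differentiable smooth_const smooth_proj smooth_dir_deriv g_smooth)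
  then show ?thesis by (simp add: dir_deriv_proj[OF smooth_dir_deriv[OF g_smooth]])
qed

lemma dir_deriv_nu_dd_d: "dir_deriv \<nu> (dir_deriv e d) x = 0"
  by (simp add: dir_deriv_dd_d proj_nu dir_deriv_0[OF smooth_dir_deriv[OF g_smooth]])

lemma dd_d_bounded: "\<exists>B. \<forall>x. \<bar>dir_deriv e d x\<bar> \<le> B"
proof -
  obtain B where "\<And>x. \<bar>dir_deriv (proj e) g x\<bar> \<le> B" using test_bounded[OF test_dir_deriv[OF g]] by metis
  then have "\<bar>dir_deriv e d x\<bar> \<le> \<bar>e \<bullet> \<nu>\<bar> + B" for x
    unfolding dir_deriv_d using abs_triangle_ineq4[of "e \<bullet> \<nu>" "dir_deriv (proj e) g (proj x)"] by (smt (verit))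
  then show ?thesis by blast
qed

lemma ddd_d_bounded: "\<exists>B. \<forall>x. \<bar>dir_deriv c (dir_deriv e d) x\<bar> \<le> B"
  unfolding dir_deriv_dd_d using test_bounded[OF test_dir_deriv[OF test_dir_deriv[OF g]]] by (metis abs_minus_cancel)

lemma dir_deriv_sigma:
  assumes "smooth f"
  shows "dir_deriv e (\<lambda>x. f (\<sigma> x)) x = dir_deriv e f (\<sigma> x) - 2 * dir_deriv e d x * dir_deriv \<nu> f (\<sigma> x)"
proof -
  note f' = has_derivative_dir_deriv[OF smooth_differentiable[OF assms]]
  have "(\<sigma> has_derivative (\<lambda>h. h - (2 * dir_deriv h d x) *\<^sub>R \<nu>)) (at x)"
    unfolding \<sigma>_def[abs_def]
    by (auto intro!: derivative_eq_intros has_derivative_dir_deriv[OF smooth_differentiable[OF smooth_d]])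
  from dir_deriv_eqI[OF has_derivative_compose[OF this f']]
  have "dir_deriv e (\<lambda>x. f (\<sigma> x)) x = dir_deriv (e - (2 * dir_deriv e d x) *\<^sub>R \<nu>) f (\<sigma> x)" .
  then show ?thesis
    using linear_diff[OF has_derivative_linear[OF f'[of "\<sigma> x"]], of e "(2 * dir_deriv e d x) *\<^sub>R \<nu>"]
      linear_scale[OF has_derivative_linear[OF f'[of "\<sigma> x"]], of "2 * dir_deriv e d x" \<nu>] by simp
qed

lemma smooth_sigma: assumes "smooth f" shows "smooth (\<lambda>x. f (\<sigma> x))"
proof (rule smooth_compose[OF _ assms])
  fix b :: 'a
  have "smooth (\<lambda>x. x \<bullet> b - (2 * d x) * (\<nu> \<bullet> b))"
    by (intro smooth_diff smooth_mult smooth_const smooth_d smooth_inner_left)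
  then show "smooth (\<lambda>x. \<sigma> x \<bullet> b)" by (simp add: \<sigma>_def inner_diff_left)
qed

lemma continuous_sigma: "continuous_on UNIV \<sigma>"
  unfolding \<sigma>_def[abs_def] by (intro continuous_intros smooth_continuous smooth_d)

lemma test_sigma:
  assumes "\<phi> \<in> test_functions S" "\<And>x. x \<in> S \<Longrightarrow> \<sigma> x \<in> S" shows "(\<lambda>x. \<phi> (\<sigma> x)) \<in> test_functions S"
proof -
  obtain C where C: "compact C" "C \<subseteq> S" "\<And>x. x \<notin> C \<Longrightarrow> \<phi> x = 0" using test_functionsE[OF assms(1)] by metis
  show ?thesis
  proof (rule test_functionsI)
    show "smooth (\<lambda>x. \<phi> (\<sigma> x))" by (rule smooth_sigma[OF test_smooth[OF assms(1)]])
    show "compact (\<sigma> ` C)" by (rule compact_continuous_image[OF continuous_on_subset[OF continuous_sigma] C(1)]) simp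
    show "\<sigma> ` C \<subseteq> S" using C assms(2) by blast
    show "\<phi> (\<sigma> x) = 0" if "x \<notin> \<sigma> ` C" for x
      by (rule C(3)) (use that sigma_sigma in \<open>metis image_eqI\<close>)
  qed
qed

text \<open>Fubini along \<open>\<nu>\<close> without choosing coordinates: translates by \<open>s *\<^sub>R \<nu>\<close> are averaged over a slab of width 1.\<close>

lemma nn_integral_slices:
  fixes F :: "'a \<Rightarrow> ennreal"
  assumes F [measurable]: "F \<in> borel_measurable borel"
  shows "(\<integral>\<^sup>+y. F y \<partial>lborel) = (\<integral>\<^sup>+y. indicator {0..1} (y \<bullet> \<nu>) * (\<integral>\<^sup>+s. F (y - s *\<^sub>R \<nu>) \<partial>lborel) \<partial>lborel)"
proof -
  have one: "(\<integral>\<^sup>+s. indicator {0..1} (t + s) \<partial>lborel) = (1::ennreal)" for t :: real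
  proof -
    have "(\<lambda>s. indicator {0..1} (t + s) :: ennreal) = indicator {-t..1 - t}"
      by (auto simp: indicator_def fun_eq_iff)
    then show ?thesis by simp
  qed
  have "(\<integral>\<^sup>+y. F y \<partial>lborel) = (\<integral>\<^sup>+y. F y * (\<integral>\<^sup>+s. indicator {0..1} (y \<bullet> \<nu> + s) \<partial>lborel) \<partial>lborel)"
    by (simp add: one)
  also have "\<dots> = (\<integral>\<^sup>+y. (\<integral>\<^sup>+s. F y * indicator {0..1} (y \<bullet> \<nu> + s) \<partial>lborel) \<partial>lborel)"
    by (intro nn_integral_cong nn_integral_cmult[symmetric]) measurable
  also have "\<dots> = (\<integral>\<^sup>+s. (\<integral>\<^sup>+y. F y * indicator {0..1} (y \<bullet> \<nu> + s) \<partial>lborel) \<partial>lborel)"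
    by (rule lborel_pair.Fubini'[symmetric]) measurable
  also have "\<dots> = (\<integral>\<^sup>+s. (\<integral>\<^sup>+y. F (y - s *\<^sub>R \<nu>) * indicator {0..1} (y \<bullet> \<nu>) \<partial>lborel) \<partial>lborel)"
  proof (rule nn_integral_cong)
    fix s :: real
    have "(\<integral>\<^sup>+y. F y * indicator {0..1} (y \<bullet> \<nu> + s) \<partial>lborel)
        = (\<integral>\<^sup>+y. F y * indicator {0..1} (y \<bullet> \<nu> + s) \<partial>distr lborel borel ((+) (- s *\<^sub>R \<nu>)))"
      by (simp only: lborel_distr_plus)
    also have "\<dots> = (\<integral>\<^sup>+y. F (- s *\<^sub>R \<nu> + y) * indicator {0..1} ((- s *\<^sub>R \<nu> + y) \<bullet> \<nu> + s) \<partial>lborel)"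
      by (rule nn_integral_distr) measurable
    also have "\<dots> = (\<integral>\<^sup>+y. F (y - s *\<^sub>R \<nu>) * indicator {0..1} (y \<bullet> \<nu>) \<partial>lborel)"
      by (simp add: inner_add_left inner_diff_left nu_inner)
    finally show "(\<integral>\<^sup>+y. F y * indicator {0..1} (y \<bullet> \<nu> + s) \<partial>lborel)
        = (\<integral>\<^sup>+y. F (y - s *\<^sub>R \<nu>) * indicator {0..1} (y \<bullet> \<nu>) \<partial>lborel)" .
  qed
  also have "\<dots> = (\<integral>\<^sup>+y. (\<integral>\<^sup>+s. F (y - s *\<^sub>R \<nu>) * indicator {0..1} (y \<bullet> \<nu>) \<partial>lborel) \<partial>lborel)"
    by (rule lborel_pair.Fubini') measurable
  also have "\<dots> = (\<integral>\<^sup>+y. indicator {0..1} (y \<bullet> \<nu>) * (\<integral>\<^sup>+s. F (y - s *\<^sub>R \<nu>) \<partial>lborel) \<partial>lborel)"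
    by (intro nn_integral_cong) (subst nn_integral_multc, measurable, simp add: mult.commute)
  finally show ?thesis .
qed

text \<open>On each line parallel to \<nu> the map is a reflection of the real line about the point
  on the graph, and \<open>nn_integral_slices\<close> reduces the integral to such lines.\<close>

lemma measure_pres_sigma: "measure_pres \<sigma>"
proof -
  have sm [measurable]: "\<sigma> \<in> borel_measurable borel" by (rule borel_measurable_continuous_onI[OF continuous_sigma])
  have "(\<integral>\<^sup>+y. F (\<sigma> y) \<partial>lborel) = (\<integral>\<^sup>+y. F y \<partial>lborel)" if F [measurable]: "F \<in> borel_measurable borel" for F :: "'a \<Rightarrow> ennreal"
  proof -
    have "(\<integral>\<^sup>+s. F (\<sigma> (y - s *\<^sub>R \<nu>)) \<partial>lborel) = (\<integral>\<^sup>+s. F (y - s *\<^sub>R \<nu>) \<partial>lborel)" for y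
    proof -
      \<comment> \<open>The coordinate t along \<nu> is sent to \<open>2 * g (proj y) - t\<close>;
        for the point \<open>y - s *\<^sub>R \<nu>\<close> this is \<open>c + s\<close>.\<close>
      define c where "c = 2 * g (proj y) - y \<bullet> \<nu>"
      have 1: "\<sigma> (y - s *\<^sub>R \<nu>) = proj y + (c + 1 * s) *\<^sub>R \<nu>" for s
      proof -
        obtain G where G: "G = g (proj y)" by blast
        have D: "d (y - s *\<^sub>R \<nu>) = y \<bullet> \<nu> - G - s"
          using d_shift[of y "- s"] by (simp add: d_def[of y] G)
        show ?thesis
        proof -
          define a where "a = y \<bullet> \<nu>"
          have "\<sigma> (y - s *\<^sub>R \<nu>) = y + (- s - 2 * (a - G - s)) *\<^sub>R \<nu>"
          proof -
            have "y - s *\<^sub>R \<nu> - t *\<^sub>R \<nu> = y + (- s - t) *\<^sub>R \<nu>" for t by (simp add: scaleR_left_diff_distrib)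
            then show ?thesis unfolding \<sigma>_def D a_def[symmetric] by blast
          qed
          moreover have "proj y + (c + 1 * s) *\<^sub>R \<nu> = y + ((c + 1 * s) - a) *\<^sub>R \<nu>"
            unfolding proj_def a_def by (simp add: scaleR_left_diff_distrib)
          moreover have "(c + 1 * s) - a = - s - 2 * (a - G - s)" by (simp add: c_def G a_def)
          ultimately show ?thesis by simp
        qed
      qed
      have 2: "y - s *\<^sub>R \<nu> = proj y + (y \<bullet> \<nu> + (-1) * s) *\<^sub>R \<nu>" for s by (simp add: proj_def algebra_simps)
      have m: "(\<lambda>s. F (proj y + s *\<^sub>R \<nu>)) \<in> borel_measurable borel" by measurable
      show ?thesis unfolding 1 unfolding 2
        using nn_integral_real_affine[OF m, of 1 c] nn_integral_real_affine[OF m, of "-1" "y \<bullet> \<nu>"] by simp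
    qed
    then show ?thesis
      using nn_integral_slices[OF F] nn_integral_slices[of "\<lambda>y. F (\<sigma> y)"] by simp
  qed
  note * = this
  have "distr lborel borel \<sigma> = lborel"
  proof (rule measure_eqI)
    fix A assume "A \<in> sets (distr lborel borel \<sigma>)"
    then have A [measurable]: "A \<in> sets borel" by simp
    have "emeasure (distr lborel borel \<sigma>) A = (\<integral>\<^sup>+x. indicator A x \<partial>distr lborel borel \<sigma>)" by simp
    also have "\<dots> = (\<integral>\<^sup>+y. indicator A (\<sigma> y) \<partial>lborel)" by (rule nn_integral_distr) measurable
    also have "\<dots> = (\<integral>\<^sup>+y. indicator A y \<partial>lborel)" by (rule *) measurable
    also have "\<dots> = emeasure lborel A" by simp
    finally show "emeasure (distr lborel borel \<sigma>) A = emeasure lborel A" .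
  qed simp
  then show ?thesis using sm by (simp add: measure_pres_def)
qed

lemma L2_sigma: "L2 f \<Longrightarrow> L2 (\<lambda>x. f (\<sigma> x))"
  using measure_pres_compose_measurable[OF measure_pres_sigma, of f] measure_pres_integrable[OF measure_pres_sigma, of "\<lambda>x. (f x)\<^sup>2"]
  by (simp add: L2_def)

lemma integral_sigma:
  "f \<in> borel_measurable lebesgue \<Longrightarrow> (LINT x|lebesgue. f (\<sigma> x)) = (LINT x|lebesgue. f x)" for f :: "'a \<Rightarrow> real"
  by (rule measure_pres_integral[OF measure_pres_sigma])

lemma L2_mult_dd_d: "L2 f \<Longrightarrow> L2 (\<lambda>x. dir_deriv e d x * f x)"
  using dd_d_bounded[of e] L2_mult_bounded(1)[of f "dir_deriv e d"] continuous_lebesgue_measurable[OF smooth_continuous[OF smooth_dd_d]] by blast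

lemma L2_mult_ddd_d: "L2 f \<Longrightarrow> L2 (\<lambda>x. dir_deriv c (dir_deriv e d) x * f x)"
  using ddd_d_bounded[of c e] L2_mult_bounded(1)[of f "dir_deriv c (dir_deriv e d)"]
    continuous_lebesgue_measurable[OF smooth_continuous[OF smooth_dir_deriv[OF smooth_dd_d]]] by blast

lemma L2_test_integrable: "L2 f \<Longrightarrow> \<phi> \<in> test_functions S \<Longrightarrow> integrable lebesgue (\<lambda>x. f x * \<phi> x)"
  using L2_mult_integrable L2_test by blast

text \<open>After the change of variables the derivative of the transported test function contains a
  term with the factor \<open>dir_deriv e d\<close>. This factor is constant along \<nu>, so it can
  be taken under the derivative along \<nu>, and the weak derivatives of \<open>h\<close> in the
  directions \<open>e\<close> and \<nu> finish the computation.\<close>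

lemma wderiv_sigma:
  assumes S: "\<And>x. x \<in> S \<Longrightarrow> \<sigma> x \<in> S" and e: "wderiv S e h v" and n: "wderiv S \<nu> h vn"
    and L: "L2 h" "L2 v" "L2 vn"
  shows "wderiv S e (\<lambda>x. h (\<sigma> x)) (\<lambda>x. v (\<sigma> x) - 2 * (dir_deriv e d x * vn (\<sigma> x)))"
  unfolding wderiv_def
proof safe
  show "locally_integrable_on (\<lambda>x. h (\<sigma> x)) S" by (intro L2_locally_integrable L2_sigma L)
  show "locally_integrable_on (\<lambda>x. v (\<sigma> x) - 2 * (dir_deriv e d x * vn (\<sigma> x))) S"
    by (intro L2_locally_integrable L2_diff L2_cmult L2_mult_dd_d L2_sigma L)
  fix \<phi> assume \<phi>: "\<phi> \<in> test_functions S"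
  define \<psi> where "\<psi> = (\<lambda>x. \<phi> (\<sigma> x))"
  have \<psi>: "\<psi> \<in> test_functions S" unfolding \<psi>_def by (rule test_sigma[OF \<phi> S])
  have dpsi: "(\<lambda>x. dir_deriv e d x * \<psi> x) \<in> test_functions S" by (rule test_mult[OF smooth_dd_d \<psi>])
  have k: "dir_deriv e \<phi> (\<sigma> x) = dir_deriv e \<psi> x - 2 * dir_deriv \<nu> (\<lambda>x. dir_deriv e d x * \<psi> x) x" for x
  proof -
    have "dir_deriv e (\<lambda>x. \<psi> (\<sigma> x)) (\<sigma> x) = dir_deriv e \<psi> (\<sigma> (\<sigma> x)) - 2 * dir_deriv e d (\<sigma> x) * dir_deriv \<nu> \<psi> (\<sigma> (\<sigma> x))"
      by (rule dir_deriv_sigma[OF test_smooth[OF \<psi>]])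
    moreover have "(\<lambda>x. \<psi> (\<sigma> x)) = \<phi>" by (simp add: \<psi>_def sigma_sigma)
    moreover have "dir_deriv \<nu> (\<lambda>x. dir_deriv e d x * \<psi> x) x = dir_deriv e d x * dir_deriv \<nu> \<psi> x"
      by (subst dir_deriv_mult) (auto simp: dir_deriv_nu_dd_d intro!: smooth_differentiable smooth_dd_d test_smooth[OF \<psi>])
    ultimately show ?thesis by (simp add: sigma_sigma dd_d_sigma)
  qed
  have m: "(\<lambda>x. f x * \<eta> x) \<in> borel_measurable lebesgue" if "L2 f" "smooth \<eta>" for f \<eta>
    by (intro borel_measurable_times L2_measurable that continuous_lebesgue_measurable smooth_continuous)
  have "(LINT x|lebesgue. h (\<sigma> x) * dir_deriv e \<phi> x) = (LINT x|lebesgue. h (\<sigma> x) * dir_deriv e \<phi> (\<sigma> (\<sigma> x)))"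
    by (simp add: sigma_sigma)
  also have "\<dots> = (LINT x|lebesgue. h x * dir_deriv e \<phi> (\<sigma> x))"
    by (rule integral_sigma[of "\<lambda>x. h x * dir_deriv e \<phi> (\<sigma> x)"], rule m[OF L(1)])
       (intro smooth_sigma smooth_dir_deriv test_smooth[OF \<phi>])
  also have "\<dots> = (LINT x|lebesgue. h x * dir_deriv e \<psi> x) - 2 * (LINT x|lebesgue. h x * dir_deriv \<nu> (\<lambda>x. dir_deriv e d x * \<psi> x) x)"
  proof -
    have "h x * dir_deriv e \<phi> (\<sigma> x) = h x * dir_deriv e \<psi> x - 2 * (h x * dir_deriv \<nu> (\<lambda>x. dir_deriv e d x * \<psi> x) x)" for x
      unfolding k by (simp add: right_diff_distrib)
    then show ?thesis
      using L2_test_integrable[OF L(1) test_dir_deriv[OF \<psi>]] L2_test_integrable[OF L(1) test_dir_deriv[OF dpsi]] by simp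
  qed
  also have "\<dots> = - (LINT x|lebesgue. v x * \<psi> x) + 2 * (LINT x|lebesgue. vn x * (dir_deriv e d x * \<psi> x))"
    using wderivD[OF e \<psi>] wderivD[OF n dpsi] by simp
  also have "\<dots> = - (LINT x|lebesgue. (v x - 2 * (dir_deriv e d x * vn x)) * \<psi> x)"
  proof -
    have "(v x - 2 * (dir_deriv e d x * vn x)) * \<psi> x = v x * \<psi> x - 2 * (vn x * (dir_deriv e d x * \<psi> x))" for x
      by (simp add: left_diff_distrib)
    then show ?thesis
      using L2_test_integrable[OF L(2) \<psi>] L2_test_integrable[OF L(3) dpsi] by simp
  qed
  also have "\<dots> = - (LINT x|lebesgue. (v (\<sigma> x) - 2 * (dir_deriv e d (\<sigma> x) * vn (\<sigma> x))) * \<psi> (\<sigma> x))"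
    by (subst integral_sigma[of "\<lambda>x. (v x - 2 * (dir_deriv e d x * vn x)) * \<psi> x"])
       (auto intro!: m L2_diff L2_cmult L2_mult_dd_d L test_smooth[OF \<psi>])
  also have "\<dots> = - (LINT x|lebesgue. (v (\<sigma> x) - 2 * (dir_deriv e d x * vn (\<sigma> x))) * \<phi> x)"
    by (simp add: dd_d_sigma \<psi>_def sigma_sigma)
  finally show "(LINT x|lebesgue. h (\<sigma> x) * dir_deriv e \<phi> x) =
    - (LINT x|lebesgue. (v (\<sigma> x) - 2 * (dir_deriv e d x * vn (\<sigma> x))) * \<phi> x)" .
qed

text \<open>The derivative along \<nu>, assembled from the components in the basis
  directions.\<close>

definition sn :: "('a \<Rightarrow> 'a \<Rightarrow> real) \<Rightarrow> 'a \<Rightarrow> real" where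
  "sn v x = (\<Sum>j\<in>Basis. (\<nu> \<bullet> j) * v j x)"

definition refl_d :: "('a \<Rightarrow> 'a \<Rightarrow> real) \<Rightarrow> 'a \<Rightarrow> 'a \<Rightarrow> real" where
  "refl_d v b x = v b (\<sigma> x) - 2 * (dir_deriv b d x * sn v (\<sigma> x))"

text \<open>The chain rule applied once more to \<open>refl_d\<close>: the product of
  \<open>dir_deriv b d\<close> with the reflected derivative along \<nu> contributes reflected
  second derivatives as well as the second derivatives of \<open>d\<close>.\<close>

definition refl_dd :: "('a \<Rightarrow> 'a \<Rightarrow> real) \<Rightarrow> ('a \<Rightarrow> 'a \<Rightarrow> 'a \<Rightarrow> real) \<Rightarrow> 'a \<Rightarrow> 'a \<Rightarrow> 'a \<Rightarrow> real" where
  "refl_dd v w b c x = refl_d (w b) c x - 2 * (dir_deriv b d x * sn (\<lambda>j. refl_d (w j) c) x +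
     dir_deriv c (dir_deriv b d) x * sn v (\<sigma> x))"

lemma L2_sn: "(\<And>b. b \<in> Basis \<Longrightarrow> L2 (v b)) \<Longrightarrow> L2 (sn v)"
  unfolding sn_def[abs_def] by (intro L2_sum L2_cmult)

lemma L2_refl_d: "(\<And>b. b \<in> Basis \<Longrightarrow> L2 (v b)) \<Longrightarrow> b \<in> Basis \<Longrightarrow> L2 (refl_d v b)"
  unfolding refl_d_def[abs_def] using L2_sigma[OF L2_sn[of v]]
  by (intro L2_diff L2_cmult L2_mult_dd_d) (auto intro: L2_sigma)

lemma wderiv_refl:
  assumes S: "\<And>x. x \<in> S \<Longrightarrow> \<sigma> x \<in> S" and L: "L2 h" "\<And>b. b \<in> Basis \<Longrightarrow> L2 (v b)" "\<And>b. b \<in> Basis \<Longrightarrow> wderiv S b h (v b)"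
    and b: "b \<in> Basis"
  shows "wderiv S b (\<lambda>x. h (\<sigma> x)) (refl_d v b)"
proof -
  have "wderiv S \<nu> h (sn v)" unfolding sn_def[abs_def] by (rule wderiv_direction[OF L(3)])
  from wderiv_sigma[OF S L(3)[OF b] this L(1) L(2)[OF b] L2_sn[OF L(2)]]
  show ?thesis by (simp add: refl_d_def[abs_def])
qed

lemma H2s_sigma:
  assumes S: "\<And>x. x \<in> S \<Longrightarrow> \<sigma> x \<in> S" and H: "H2s S u v w"
  shows "H2s S (\<lambda>x. u (\<sigma> x)) (refl_d v) (refl_dd v w)"
proof -
  note h = H2sD[OF H]
  have wd: "wderiv S c (\<lambda>x. v b (\<sigma> x)) (refl_d (w b) c)" if "b \<in> Basis" "c \<in> Basis" for b c
    by (rule wderiv_refl[OF S h(2)[OF that(1)] h(4)[OF that(1)] h(5)[OF that(1)] that(2)])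
  have sd: "wderiv S c (\<lambda>x. sn v (\<sigma> x)) (sn (\<lambda>j. refl_d (w j) c))" if "c \<in> Basis" for c
    unfolding sn_def[abs_def] using wd that by (intro wderiv_sum wderiv_cmult) auto
  show ?thesis unfolding H2s_def
  proof (intro conjI ballI)
    show "L2 (\<lambda>x. u (\<sigma> x))" by (rule L2_sigma[OF h(1)])
    fix b :: 'a assume b: "b \<in> Basis"
    show "L2 (refl_d v b)" by (rule L2_refl_d[OF h(2) b])
    show "wderiv S b (\<lambda>x. u (\<sigma> x)) (refl_d v b)" by (rule wderiv_refl[OF S h(1-3) b])
    fix c :: 'a assume c: "c \<in> Basis"
    show "L2 (refl_dd v w b c)"
      unfolding refl_dd_def[abs_def] using b c h
      by (intro L2_diff L2_cmult L2_add L2_mult_dd_d L2_mult_ddd_d L2_refl_d L2_sn L2_sigma) auto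
    show "wderiv S c (refl_d v b) (refl_dd v w b c)"
      unfolding refl_d_def[of v b, abs_def] refl_dd_def[abs_def]
      by (intro wderiv_diff wd b c wderiv_cmult wderiv_mult sd smooth_dd_d)
  qed
qed

lemma null2_sn: "(\<And>b. b \<in> Basis \<Longrightarrow> null2 (\<lambda>n. v n b)) \<Longrightarrow> null2 (\<lambda>n. sn (v n))"
  unfolding sn_def[abs_def] by (intro null2_sum null2_cmult)

lemma null2_mult_dd_d: "null2 f \<Longrightarrow> null2 (\<lambda>n x. dir_deriv e d x * f n x)"
  using dd_d_bounded[of e] null2_mult_smooth[OF _ smooth_dd_d] by blast

lemma null2_mult_ddd_d: "null2 f \<Longrightarrow> null2 (\<lambda>n x. dir_deriv c (dir_deriv e d) x * f n x)"
  using ddd_d_bounded[of c e] null2_mult_smooth[OF _ smooth_dir_deriv[OF smooth_dd_d]] by blast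

lemma null2_refl_d: "(\<And>b. b \<in> Basis \<Longrightarrow> null2 (\<lambda>n. v n b)) \<Longrightarrow> b \<in> Basis \<Longrightarrow> null2 (\<lambda>n. refl_d (v n) b)"
  unfolding refl_d_def[abs_def] using null2_measure_pres[OF null2_sn[of v] measure_pres_sigma]
  by (intro null2_diff null2_cmult null2_mult_dd_d) (auto intro: null2_measure_pres[OF _ measure_pres_sigma])

lemma H2null_sigma:
  assumes S: "\<And>x. x \<in> S \<Longrightarrow> \<sigma> x \<in> S" and H: "H2null S u"
  shows "H2null S (\<lambda>n x. u n (\<sigma> x))"
proof -
  obtain v w where 1: "\<And>n. H2s S (u n) (v n) (w n)" "null2 u" "\<And>b. b \<in> Basis \<Longrightarrow> null2 (\<lambda>n. v n b)"
    "\<And>b c. b \<in> Basis \<Longrightarrow> c \<in> Basis \<Longrightarrow> null2 (\<lambda>n. w n b c)" using H2nullE[OF H] by metis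
  show ?thesis
  proof (rule H2nullI[OF H2s_sigma[OF S 1(1)]])
    show "null2 (\<lambda>n x. u n (\<sigma> x))" by (rule null2_measure_pres[OF 1(2) measure_pres_sigma])
    fix b :: 'a assume b: "b \<in> Basis"
    show "null2 (\<lambda>n. refl_d (v n) b)" by (rule null2_refl_d[OF 1(3) b])
    fix c :: 'a assume c: "c \<in> Basis"
    show "null2 (\<lambda>n. refl_dd (v n) (w n) b c)"
      unfolding refl_dd_def[abs_def] using b c 1
      by (intro null2_diff null2_cmult null2_add null2_mult_dd_d null2_mult_ddd_d null2_refl_d null2_sn
           null2_measure_pres[OF null2_sn measure_pres_sigma]) auto
  qed assumption
qed

end

subsection \<open>Odd reflection\<close>

text \<open>A function of \<open>t * t\<close>, hence even with an odd derivative. The oddness is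
  what later cancels the contribution of even functions across the graph.\<close>

definition line_cut :: "real \<Rightarrow> real" where "line_cut t = smooth_step (2 - 2 * (t * t))"

lemma smooth_line_cut: "smooth line_cut"
  unfolding line_cut_def[abs_def]
  by (intro smooth_step_compose smooth_diff smooth_mult smooth_const) (auto intro: smooth_linear)

lemma line_cut_1: "t * t \<le> 1/2 \<Longrightarrow> line_cut t = 1" by (simp add: line_cut_def smooth_step_1)
lemma line_cut_0: "t * t \<ge> 1 \<Longrightarrow> line_cut t = 0" by (simp add: line_cut_def smooth_step_0)
lemma line_cut_range: "0 \<le> line_cut t" "line_cut t \<le> 1" by (simp_all add: line_cut_def smooth_step_range)

lemma line_cut_test: "line_cut \<in> test_functions UNIV"
proof (rule test_functionsI[OF smooth_line_cut, of "cball 0 1"])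
  fix x :: real assume "x \<notin> cball 0 1"
  then have "1 \<le> \<bar>x\<bar>" by simp
  then have "1 * 1 \<le> \<bar>x\<bar> * \<bar>x\<bar>" by (intro mult_mono) auto
  then show "line_cut x = 0" by (intro line_cut_0) simp
qed auto

definition line_cut' :: "real \<Rightarrow> real" where "line_cut' = dir_deriv 1 line_cut"

lemma smooth_line_cut': "smooth line_cut'" unfolding line_cut'_def by (rule smooth_dir_deriv[OF smooth_line_cut])

lemma has_real_derivative_dir_deriv:
  fixes f :: "real \<Rightarrow> real"
  assumes "smooth f" shows "(f has_real_derivative dir_deriv 1 f t) (at t)"
proof -
  note h = has_derivative_dir_deriv[OF smooth_differentiable[OF assms], of t]
  have k: "dir_deriv e f t = dir_deriv 1 f t * e" for e
    using linear_scale[OF has_derivative_linear[OF h], of e 1] by simp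
  have "(\<lambda>e. dir_deriv e f t) = (*) (dir_deriv 1 f t)" by (rule ext) (rule k)
  then show ?thesis using h by (simp add: has_field_derivative_def)
qed

lemma line_cut'_odd: "line_cut' (- t) = - line_cut' t"
proof -
  have "(\<lambda>x. line_cut ((-1) *\<^sub>R x + 0)) = line_cut" by (simp add: line_cut_def fun_eq_iff)
  then show ?thesis
    using dir_deriv_affine[of line_cut "-1" t 0 1] smooth_differentiable[OF smooth_line_cut]
    by (simp add: line_cut'_def)
qed

lemma line_cut'_0: assumes "\<bar>t\<bar> > 1" shows "line_cut' t = 0"
proof -
  have "closure {x. line_cut x \<noteq> 0} \<subseteq> cball 0 1"
  proof (rule closure_minimal)
    show "{x. line_cut x \<noteq> 0} \<subseteq> cball 0 1"
    proof safe
      fix x assume x: "line_cut x \<noteq> 0"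
      show "x \<in> cball 0 1"
      proof (rule ccontr)
        assume "x \<notin> cball 0 1"
        then have "1 \<le> \<bar>x\<bar>" by simp
        then have "1 * 1 \<le> \<bar>x\<bar> * \<bar>x\<bar>" by (intro mult_mono) auto
        then show False using x line_cut_0[of x] by simp
      qed
    qed
  qed simp
  then have "t \<notin> closure {x. line_cut x \<noteq> 0}" using assms by auto
  then show ?thesis unfolding line_cut'_def by (rule dir_deriv_zero_outside)
qed

lemma smooth_compose_real: fixes f :: "real \<Rightarrow> real" shows "smooth f \<Longrightarrow> smooth q \<Longrightarrow> smooth (\<lambda>x. f (q x))"
  by (rule smooth_compose) auto

context graph
begin

text \<open>A layer around the graph whose width is of order 1/n; \<open>cut'\<close> is the
  derivative of \<open>cut\<close> along \<nu>, of size n.\<close>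

definition cut :: "nat \<Rightarrow> 'a \<Rightarrow> real" where "cut n x = line_cut (real n * d x)"
definition cut' :: "nat \<Rightarrow> 'a \<Rightarrow> real" where "cut' n x = real n * line_cut' (real n * d x)"

lemma smooth_compose_scaled_d: "smooth f \<Longrightarrow> smooth (\<lambda>x. f (real n * d x))" for f :: "real \<Rightarrow> real"
  by (rule smooth_compose_real[OF _ smooth_mult[OF smooth_const smooth_d]])

lemma smooth_cut: "smooth (cut n)"
  unfolding cut_def[abs_def] by (rule smooth_compose_scaled_d[OF smooth_line_cut])

lemma smooth_cut': "smooth (cut' n)"
  unfolding cut'_def[abs_def] by (rule smooth_mult[OF smooth_const smooth_compose_scaled_d[OF smooth_line_cut']])

lemma dir_deriv_compose_d:
  fixes f :: "real \<Rightarrow> real"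
  assumes "smooth f"
  shows "dir_deriv e (\<lambda>x. f (real n * d x)) x = real n * dir_deriv 1 f (real n * d x) * dir_deriv e d x"
proof (rule dir_deriv_compose_real)
  show "d differentiable (at x)" by (rule smooth_differentiable[OF smooth_d])
  have "((\<lambda>t. real n * t) has_real_derivative real n) (at (d x))" by (auto intro!: derivative_eq_intros)
  from DERIV_chain2[OF has_real_derivative_dir_deriv[OF assms] this]
  show "((\<lambda>t. f (real n * t)) has_real_derivative real n * dir_deriv 1 f (real n * d x)) (at (d x))"
    by (simp add: mult.commute)
qed

lemma dir_deriv_cut: "dir_deriv e (cut n) x = cut' n x * dir_deriv e d x"
  unfolding cut_def[abs_def] cut'_def line_cut'_def by (rule dir_deriv_compose_d[OF smooth_line_cut])

lemma dir_deriv_cut': "dir_deriv e (cut' n) x = dir_deriv e d x * dir_deriv \<nu> (cut' n) x"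
proof -
  have "dir_deriv e (cut' n) x = real n * (real n * dir_deriv 1 line_cut' (real n * d x) * dir_deriv e d x)" for e
    unfolding cut'_def[abs_def]
      dir_deriv_cmult[OF smooth_differentiable[OF smooth_compose_scaled_d[OF smooth_line_cut']]]
      dir_deriv_compose_d[OF smooth_line_cut'] ..
  from this[of e] this[of \<nu>] show ?thesis by (simp add: dd_d_nu)
qed

lemma cut'_sigma: "cut' n (\<sigma> x) = - cut' n x" by (simp add: cut'_def d_sigma line_cut'_odd)

lemma cut_eventually_0: assumes "d x \<noteq> 0" shows "\<forall>\<^sub>F n in sequentially. cut n x = 0 \<and> cut' n x = 0"
proof -
  obtain N where N: "1 / \<bar>d x\<bar> < real N" using reals_Archimedean2 by blast
  have "cut n x = 0 \<and> cut' n x = 0" if "n \<ge> N" for n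
  proof -
    have "1 / \<bar>d x\<bar> < real n" using N that by (meson less_le_trans of_nat_le_iff)
    then have b: "1 < \<bar>real n * d x\<bar>" using assms by (simp add: abs_mult field_simps)
    then have "1 * 1 \<le> \<bar>real n * d x\<bar> * \<bar>real n * d x\<bar>" by (intro mult_mono) auto
    then show ?thesis using b by (auto simp: cut_def cut'_def line_cut'_0 intro: line_cut_0)
  qed
  then show ?thesis by (auto simp: eventually_sequentially)
qed

text \<open>Off the graph \<open>cut n\<close> is eventually 0, and on the graph \<open>f\<close> is
  0 by hypothesis, so the integrands converge at every point.\<close>

lemma dct_cut:
  assumes f: "L2 f" "\<And>x. d x = 0 \<Longrightarrow> f x = 0" and \<xi>: "\<xi> \<in> test_functions UNIV"
  shows "(\<lambda>n. LINT x|lebesgue. f x * (\<xi> x * cut n x)) \<longlonglongrightarrow> 0"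
    and "(\<lambda>n. LINT x|lebesgue. f x * (\<xi> x * (1 - cut n x))) \<longlonglongrightarrow> (LINT x|lebesgue. f x * \<xi> x)"
proof -
  have i: "integrable lebesgue (\<lambda>x. f x * \<xi> x)" by (rule L2_test_integrable[OF f(1) \<xi>])
  have t: "(\<lambda>x. \<xi> x * cut n x) \<in> test_functions UNIV" for n
    using test_mult[OF smooth_cut \<xi>] by (simp add: mult.commute)
  have i2: "integrable lebesgue (\<lambda>x. f x * (\<xi> x * cut n x))" for n by (rule L2_test_integrable[OF f(1) t])
  have "(\<lambda>n. LINT x|lebesgue. f x * (\<xi> x * cut n x)) \<longlonglongrightarrow> (LINT x|(lebesgue::'a measure). (0::real))"
  proof (rule integral_dominated_convergence[where w = "\<lambda>x. \<bar>f x * \<xi> x\<bar>"])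
    show "AE x in lebesgue. (\<lambda>n. f x * (\<xi> x * cut n x)) \<longlonglongrightarrow> 0"
    proof (intro AE_I2)
      fix x
      show "(\<lambda>n. f x * (\<xi> x * cut n x)) \<longlonglongrightarrow> 0"
      proof (cases "d x = 0")
        case True then show ?thesis using f(2) by simp
      next
        case False
        show ?thesis by (rule tendsto_eventually) (use cut_eventually_0[OF False] in eventually_elim, simp)
      qed
    qed
    show "AE x in lebesgue. norm (f x * (\<xi> x * cut n x)) \<le> \<bar>f x * \<xi> x\<bar>" for n
    proof (intro AE_I2)
      fix x
      have "\<bar>f x * \<xi> x\<bar> * cut n x \<le> \<bar>f x * \<xi> x\<bar> * 1"
        by (rule mult_left_mono) (auto simp: cut_def line_cut_range)
      then show "norm (f x * (\<xi> x * cut n x)) \<le> \<bar>f x * \<xi> x\<bar>"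
        by (simp add: abs_mult cut_def line_cut_range mult.assoc)
    qed
  qed (use i i2 in auto)
  then show 1: "(\<lambda>n. LINT x|lebesgue. f x * (\<xi> x * cut n x)) \<longlonglongrightarrow> 0" by simp
  have "(LINT x|lebesgue. f x * (\<xi> x * (1 - cut n x))) = (LINT x|lebesgue. f x * \<xi> x) - (LINT x|lebesgue. f x * (\<xi> x * cut n x))" for n
    using i i2[of n] by (simp add: right_diff_distrib)
  then show "(\<lambda>n. LINT x|lebesgue. f x * (\<xi> x * (1 - cut n x))) \<longlonglongrightarrow> (LINT x|lebesgue. f x * \<xi> x)"
    using tendsto_diff[OF tendsto_const 1] by simp
qed

text \<open>The hypothesis \<open>J\<close> expresses that \<open>f\<close> has no jump across the graph, as \<open>cut n\<close> is supported within
  distance of order \<open>1 / n\<close> from it.\<close>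

lemma wderiv_across_graph:
  assumes f: "L2 f" "\<And>x. d x = 0 \<Longrightarrow> f x = 0" and h: "L2 h" "\<And>x. d x = 0 \<Longrightarrow> h x = 0"
    and w: "wderiv {x. d x \<noteq> 0} c f h"
    and J: "\<And>\<phi>. \<phi> \<in> test_functions UNIV \<Longrightarrow> (\<lambda>n. LINT x|lebesgue. f x * (\<phi> x * dir_deriv c (cut n) x)) \<longlonglongrightarrow> 0"
  shows "wderiv UNIV c f h"
  unfolding wderiv_def
proof safe
  show "locally_integrable_on f UNIV" "locally_integrable_on h UNIV" using f h by (auto intro: L2_locally_integrable)
  fix \<phi> :: "'a \<Rightarrow> real" assume \<phi>: "\<phi> \<in> test_functions UNIV"
  note s = test_smooth[OF \<phi>]
  \<comment> \<open>Where \<open>(real n * d x) * (real n * d x)\<close> is below 1/2 the factor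
    \<open>1 - cut n\<close> vanishes, so the support keeps away from the graph.\<close>
  have t: "(\<lambda>x. \<phi> x * (1 - cut n x)) \<in> test_functions {x. d x \<noteq> 0}" for n
  proof -
    obtain C where C: "compact C" "\<And>x. x \<notin> C \<Longrightarrow> \<phi> x = 0" using test_functionsE[OF \<phi>] by metis
    show ?thesis
    proof (rule test_functionsI)
      show "smooth (\<lambda>x. \<phi> x * (1 - cut n x))" by (intro smooth_mult smooth_diff smooth_const s smooth_cut)
      have "closed {x. 1/2 \<le> (real n * d x) * (real n * d x)}"
        by (intro closed_Collect_le continuous_intros smooth_continuous[OF smooth_d])
      then show "compact (C \<inter> {x. 1/2 \<le> (real n * d x) * (real n * d x)})" using C by (intro compact_Int_closed)
      show "\<phi> x * (1 - cut n x) = 0" if "x \<notin> C \<inter> {x. 1/2 \<le> (real n * d x) * (real n * d x)}" for x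
        using that C(2)[of x] line_cut_1[of "real n * d x"] by (cases "x \<in> C") (auto simp: cut_def)
    qed auto
  qed
  have "dir_deriv c (\<lambda>x. \<phi> x * (1 - cut n x)) x = dir_deriv c \<phi> x * (1 - cut n x) - \<phi> x * dir_deriv c (cut n) x" for n x
  proof -
    have "dir_deriv c (\<lambda>x. 1 - cut n x) x = - dir_deriv c (cut n) x"
      by (subst dir_deriv_diff) (auto intro!: smooth_differentiable smooth_cut)
    then show ?thesis
      by (subst dir_deriv_mult) (auto intro!: smooth_differentiable smooth_cut s smooth_diff)
  qed
  then have e: "(LINT x|lebesgue. f x * (dir_deriv c \<phi> x * (1 - cut n x)) - f x * (\<phi> x * dir_deriv c (cut n) x)) =
      - (LINT x|lebesgue. h x * (\<phi> x * (1 - cut n x)))" for n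
    using wderivD[OF w t[of n]] by (simp add: right_diff_distrib)
  have t1: "(\<lambda>x. dir_deriv c \<phi> x * (1 - cut n x)) \<in> test_functions UNIV" for n
    using test_mult[OF _ test_dir_deriv[OF \<phi>], of "\<lambda>x. 1 - cut n x" c] smooth_cut by (simp add: mult.commute smooth_diff)
  have t2: "(\<lambda>x. \<phi> x * dir_deriv c (cut n) x) \<in> test_functions UNIV" for n
    using test_mult[OF smooth_dir_deriv[OF smooth_cut] \<phi>] by (simp add: mult.commute)
  have e': "(LINT x|lebesgue. f x * (dir_deriv c \<phi> x * (1 - cut n x))) - (LINT x|lebesgue. f x * (\<phi> x * dir_deriv c (cut n) x)) =
      - (LINT x|lebesgue. h x * (\<phi> x * (1 - cut n x)))" for n
    using e[of n] L2_test_integrable[OF f(1) t1[of n]] L2_test_integrable[OF f(1) t2[of n]] by simp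
  have "(\<lambda>n. (LINT x|lebesgue. f x * (dir_deriv c \<phi> x * (1 - cut n x))) - (LINT x|lebesgue. f x * (\<phi> x * dir_deriv c (cut n) x)))
      \<longlonglongrightarrow> (LINT x|lebesgue. f x * dir_deriv c \<phi> x) - 0"
    by (intro tendsto_diff dct_cut(2) f test_dir_deriv \<phi> J)
  moreover have "(\<lambda>n. - (LINT x|lebesgue. h x * (\<phi> x * (1 - cut n x)))) \<longlonglongrightarrow> - (LINT x|lebesgue. h x * \<phi> x)"
    by (intro tendsto_minus dct_cut(2) h \<phi>)
  ultimately show "(LINT x|lebesgue. f x * dir_deriv c \<phi> x) = - (LINT x|lebesgue. h x * \<phi> x)"
    unfolding e' using LIMSEQ_unique by fastforce
qed

text \<open>The derivative along a tangential direction annihilates \<open>d\<close>, hence \<open>cut n\<close>, so that it can be moved away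
  from \<open>W\<close> without differentiating \<open>cut' n\<close>.\<close>

lemma cut_deriv_tangential:
  assumes W: "L2 W" "\<And>x. d x = 0 \<Longrightarrow> W x = 0" and z: "\<And>b. b \<in> Basis \<Longrightarrow> L2 (z b)" "\<And>b x. b \<in> Basis \<Longrightarrow> d x = 0 \<Longrightarrow> z b x = 0"
    "\<And>b. b \<in> Basis \<Longrightarrow> wderiv UNIV b W (z b)" and \<Xi>: "\<Xi> \<in> test_functions UNIV" and b: "b \<in> Basis"
  shows "(\<lambda>n. LINT x|lebesgue. (z b x - dir_deriv b d x * sn z x) * (\<Xi> x * cut' n x)) \<longlonglongrightarrow> 0"
proof -
  have zn: "L2 (sn z)" by (rule L2_sn[OF z(1)])
  have zn0: "sn z x = 0" if "d x = 0" for x unfolding sn_def using z(2) that by (intro sum.neutral) auto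
  have wn: "wderiv UNIV \<nu> W (sn z)" unfolding sn_def[abs_def] by (rule wderiv_direction[OF z(3)])
  define \<Xi>' where "\<Xi>' = (\<lambda>x. dir_deriv b \<Xi> x - dir_deriv b d x * dir_deriv \<nu> \<Xi> x)"
  have t': "\<Xi>' \<in> test_functions UNIV" unfolding \<Xi>'_def
    by (intro test_diff test_mult test_dir_deriv \<Xi> smooth_dd_d)
  have cm: "(\<lambda>x. f x * s x) \<in> test_functions UNIV" if "f \<in> test_functions UNIV" "smooth s" for f s :: "'a \<Rightarrow> real"
    using test_mult[OF that(2,1)] by (simp add: mult.commute)
  have main: "(LINT x|lebesgue. (z b x - dir_deriv b d x * sn z x) * (\<Xi> x * cut' n x)) =
      (LINT x|lebesgue. sn z x * (\<Xi>' x * cut n x)) + (LINT x|lebesgue. W x * (dir_deriv \<nu> \<Xi>' x * cut n x))" for n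
  proof -
    define \<Theta> where "\<Theta> = (\<lambda>x. \<Xi> x * cut' n x)"
    have T: "\<Theta> \<in> test_functions UNIV" unfolding \<Theta>_def by (rule cm[OF \<Xi> smooth_cut'])
    have dT: "(\<lambda>x. dir_deriv b d x * \<Theta> x) \<in> test_functions UNIV" by (rule test_mult[OF smooth_dd_d T])
    \<comment> \<open>The derivatives of \<open>cut' n\<close> in the directions \<open>b\<close>
      and \<nu> are proportional by \<open>dir_deriv_cut'\<close>, so they cancel.\<close>
    have key: "dir_deriv b \<Theta> x - dir_deriv \<nu> (\<lambda>x. dir_deriv b d x * \<Theta> x) x = \<Xi>' x * cut' n x" for x
    proof -
      have 1: "dir_deriv e \<Theta> x = \<Xi> x * dir_deriv e (cut' n) x + dir_deriv e \<Xi> x * cut' n x" for e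
        unfolding \<Theta>_def by (rule dir_deriv_mult) (auto intro!: smooth_differentiable smooth_cut' test_smooth[OF \<Xi>])
      have 2: "dir_deriv \<nu> (\<lambda>x. dir_deriv b d x * \<Theta> x) x = dir_deriv b d x * dir_deriv \<nu> \<Theta> x"
        by (subst dir_deriv_mult) (auto simp: dir_deriv_nu_dd_d intro!: smooth_differentiable smooth_dd_d test_smooth[OF T])
      show ?thesis unfolding 2 1 \<Xi>'_def dir_deriv_cut'[of b] by (simp add: algebra_simps)
    qed
    have I: "integrable lebesgue (\<lambda>x. f x * \<eta> x)" if "L2 f" "\<eta> \<in> test_functions UNIV" for f \<eta>
      by (rule L2_test_integrable[OF that])
    have "(LINT x|lebesgue. (z b x - dir_deriv b d x * sn z x) * \<Theta> x) =
        (LINT x|lebesgue. z b x * \<Theta> x) - (LINT x|lebesgue. sn z x * (dir_deriv b d x * \<Theta> x))"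
    proof -
      have "(z b x - dir_deriv b d x * sn z x) * \<Theta> x = z b x * \<Theta> x - sn z x * (dir_deriv b d x * \<Theta> x)" for x
        by (simp add: algebra_simps)
      then show ?thesis using I[OF z(1)[OF b] T] I[OF zn dT] by simp
    qed
    also have "\<dots> = - (LINT x|lebesgue. W x * dir_deriv b \<Theta> x) + (LINT x|lebesgue. W x * dir_deriv \<nu> (\<lambda>x. dir_deriv b d x * \<Theta> x) x)"
      using wderivD[OF z(3)[OF b] T] wderivD[OF wn dT] by simp
    also have "\<dots> = - (LINT x|lebesgue. W x * (\<Xi>' x * cut' n x))"
      unfolding key[symmetric] right_diff_distrib
      using I[OF W(1) test_dir_deriv[OF T, of b]] I[OF W(1) test_dir_deriv[OF dT, of \<nu>]] by simp
    also have "\<dots> = (LINT x|lebesgue. sn z x * (\<Xi>' x * cut n x)) + (LINT x|lebesgue. W x * (dir_deriv \<nu> \<Xi>' x * cut n x))"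
    proof -
      \<comment> \<open>As \<open>cut' n\<close> is the derivative of \<open>cut n\<close> along
        \<nu>, another integration by parts leaves only \<open>cut n\<close>, which is bounded and
        tends to 0 off the graph.\<close>
      have tc: "(\<lambda>x. \<Xi>' x * cut n x) \<in> test_functions UNIV" by (rule cm[OF t' smooth_cut])
      have "dir_deriv \<nu> (\<lambda>x. \<Xi>' x * cut n x) x = \<Xi>' x * cut' n x + dir_deriv \<nu> \<Xi>' x * cut n x" for x
        by (subst dir_deriv_mult) (auto simp: dir_deriv_cut dd_d_nu intro!: smooth_differentiable smooth_cut test_smooth[OF t'])
      then have "(LINT x|lebesgue. W x * (\<Xi>' x * cut' n x) + W x * (dir_deriv \<nu> \<Xi>' x * cut n x)) = - (LINT x|lebesgue. sn z x * (\<Xi>' x * cut n x))"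
        using wderivD[OF wn tc] by (simp add: distrib_left)
      then show ?thesis
        using I[OF W(1) cm[OF t' smooth_cut', of n]] I[OF W(1) cm[OF test_dir_deriv[OF t', of \<nu>] smooth_cut[of n]]] by simp
    qed
    finally show ?thesis by (simp add: \<Theta>_def)
  qed
  have "(\<lambda>n. (LINT x|lebesgue. sn z x * (\<Xi>' x * cut n x)) + (LINT x|lebesgue. W x * (dir_deriv \<nu> \<Xi>' x * cut n x))) \<longlonglongrightarrow> 0 + 0"
    by (intro tendsto_add dct_cut(1) zn zn0 W test_dir_deriv t')
  then show ?thesis unfolding main by simp
qed

text \<open>As \<open>f\<close> is even and \<open>cut' n\<close> is odd under the reflection, only \<open>\<phi> x - \<phi> (\<sigma> x)\<close> contributes, whose size
  on the support of \<open>cut' n\<close> compensates the factor \<open>n\<close>.\<close>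

lemma cut_deriv_normal:
  assumes f: "L2 f" "\<And>x. d x = 0 \<Longrightarrow> f x = 0" "\<And>x. f (\<sigma> x) = f x" and \<phi>: "\<phi> \<in> test_functions UNIV"
  shows "(\<lambda>n. LINT x|lebesgue. f x * (\<phi> x * cut' n x)) \<longlonglongrightarrow> 0"
proof -
  define \<psi> where "\<psi> = (\<lambda>x. \<phi> (\<sigma> x))"
  have \<psi>: "\<psi> \<in> test_functions UNIV" unfolding \<psi>_def by (rule test_sigma[OF \<phi>]) simp
  have cm: "(\<lambda>x. g x * cut' n x) \<in> test_functions UNIV" if "g \<in> test_functions UNIV" for g n
    using test_mult[OF smooth_cut' that] by (simp add: mult.commute)
  have I: "integrable lebesgue (\<lambda>x. f x * (\<phi> x * cut' n x))" "integrable lebesgue (\<lambda>x. f x * (\<psi> x * cut' n x))" for n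
    by (rule L2_test_integrable[OF f(1) cm[OF \<phi>]]) (rule L2_test_integrable[OF f(1) cm[OF \<psi>]])
  have "(LINT x|lebesgue. f x * (\<phi> x * cut' n x)) = (LINT x|lebesgue. f (\<sigma> x) * (\<phi> (\<sigma> x) * cut' n (\<sigma> x)))" for n
    by (rule integral_sigma[symmetric, of "\<lambda>x. f x * (\<phi> x * cut' n x)"]) (use I(1)[of n] in auto)
  then have s1: "(LINT x|lebesgue. f x * (\<phi> x * cut' n x)) = - (LINT x|lebesgue. f x * (\<psi> x * cut' n x))" for n
    by (simp add: f(3) cut'_sigma \<psi>_def)
  have s2: "(LINT x|lebesgue. f x * ((\<phi> x - \<psi> x) * cut' n x)) =
      (LINT x|lebesgue. f x * (\<phi> x * cut' n x)) - (LINT x|lebesgue. f x * (\<psi> x * cut' n x))" for n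
    using I[of n] by (simp add: algebra_simps)
  have e: "(LINT x|lebesgue. f x * (\<phi> x * cut' n x)) = 1/2 * (LINT x|lebesgue. f x * ((\<phi> x - \<psi> x) * cut' n x))" for n
    using s1[of n] s2[of n] by linarith
  obtain L where L: "L \<ge> 0" "\<And>x y. \<bar>\<phi> x - \<phi> y\<bar> \<le> L * norm (x - y)" using test_lipschitz[OF \<phi>] by metis
  obtain M where M: "\<And>t. \<bar>line_cut' t\<bar> \<le> M" using test_bounded[OF test_dir_deriv[OF line_cut_test, of 1]] unfolding line_cut'_def by metis
  have M0: "M \<ge> 0" using M[of 0] by simp
  obtain C where C: "compact C" "\<And>x. x \<notin> C \<Longrightarrow> \<phi> x = 0" using test_functionsE[OF \<phi>] by metis
  obtain C' where C': "compact C'" "\<And>x. x \<notin> C' \<Longrightarrow> \<psi> x = 0" using test_functionsE[OF \<psi>] by metis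
  define D where "D = C \<union> C'"
  have iD: "integrable lebesgue (\<lambda>x. indicator D x * f x)"
    using L2_locally_integrable[OF f(1), of UNIV] C C' unfolding locally_integrable_on_def set_integrable_def D_def by auto
  have bd: "\<bar>(\<phi> x - \<psi> x) * cut' n x\<bar> \<le> 2 * L * M" for n x
  proof (cases "\<bar>real n * d x\<bar> > 1")
    case True then show ?thesis using L M0 by (simp add: cut'_def line_cut'_0)
  next
    case False
    have "\<bar>\<phi> x - \<psi> x\<bar> \<le> L * norm (x - \<sigma> x)" unfolding \<psi>_def by (rule L(2))
    also have "norm (x - \<sigma> x) = 2 * \<bar>d x\<bar>" by (simp add: \<sigma>_def nu abs_mult)
    finally have 1: "\<bar>\<phi> x - \<psi> x\<bar> \<le> 2 * L * \<bar>d x\<bar>" by simp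
    have 2: "\<bar>cut' n x\<bar> \<le> real n * M" unfolding cut'_def abs_mult using M by (intro mult_mono) auto
    have "\<bar>(\<phi> x - \<psi> x) * cut' n x\<bar> \<le> (2 * L * \<bar>d x\<bar>) * (real n * M)"
      unfolding abs_mult by (rule mult_mono[OF 1 2]) (use L in auto)
    also have "\<dots> = (2 * L * M) * \<bar>real n * d x\<bar>" by (simp add: abs_mult)
    also have "\<dots> \<le> (2 * L * M) * 1" by (rule mult_left_mono) (use False L M0 in auto)
    finally show ?thesis by simp
  qed
  have "(\<lambda>n. LINT x|lebesgue. f x * ((\<phi> x - \<psi> x) * cut' n x)) \<longlonglongrightarrow> (LINT x|(lebesgue::'a measure). (0::real))"
  proof (rule integral_dominated_convergence[where w = "\<lambda>x. (2 * L * M) * \<bar>indicator D x * f x\<bar>"])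
    show "(\<lambda>x. f x * ((\<phi> x - \<psi> x) * cut' n x)) \<in> borel_measurable lebesgue" for n
      using L2_test_integrable[OF f(1) cm[OF test_diff[OF \<phi> \<psi>]]] by auto
    show "AE x in lebesgue. (\<lambda>n. f x * ((\<phi> x - \<psi> x) * cut' n x)) \<longlonglongrightarrow> 0"
    proof (intro AE_I2)
      fix x
      show "(\<lambda>n. f x * ((\<phi> x - \<psi> x) * cut' n x)) \<longlonglongrightarrow> 0"
      proof (cases "d x = 0")
        case True then show ?thesis using f(2) by simp
      next
        case False
        show ?thesis by (rule tendsto_eventually) (use cut_eventually_0[OF False] in eventually_elim, simp)
      qed
    qed
    show "AE x in lebesgue. norm (f x * ((\<phi> x - \<psi> x) * cut' n x)) \<le> (2 * L * M) * \<bar>indicator D x * f x\<bar>" for n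
    proof (intro AE_I2)
      fix x
      show "norm (f x * ((\<phi> x - \<psi> x) * cut' n x)) \<le> (2 * L * M) * \<bar>indicator D x * f x\<bar>"
      proof (cases "x \<in> D")
        case True
        then show ?thesis using mult_left_mono[OF bd[of x n], of "\<bar>f x\<bar>"] by (simp add: abs_mult mult_ac)
      next
        case False then show ?thesis using C(2)[of x] C'(2)[of x] by (simp add: D_def)
      qed
    qed
  qed (use iD in auto)
  then have "(\<lambda>n. 1/2 * (LINT x|lebesgue. f x * ((\<phi> x - \<psi> x) * cut' n x))) \<longlonglongrightarrow> 1/2 * 0"
    by (intro tendsto_mult_left) simp
  then show ?thesis unfolding e by simp
qed

text \<open>A test function whose support avoids the graph splits into a part above and a part below
  it. The part above is a test function of its own, and the part below meets only zeros of
  \<open>f\<close> and \<open>h\<close>.\<close>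

lemma wderiv_extend_by_zero:
  assumes f: "L2 f" "\<And>x. d x \<le> 0 \<Longrightarrow> f x = 0" and h: "L2 h" "\<And>x. d x \<le> 0 \<Longrightarrow> h x = 0"
    and w: "wderiv {x. d x > 0} c f h"
  shows "wderiv {x. d x \<noteq> 0} c f h"
  unfolding wderiv_def
proof safe
  show "locally_integrable_on f {x. d x \<noteq> 0}" "locally_integrable_on h {x. d x \<noteq> 0}" using f h by (auto intro: L2_locally_integrable)
  fix \<phi> assume \<phi>: "\<phi> \<in> test_functions {x. d x \<noteq> 0}"
  obtain C where C: "compact C" "C \<subseteq> {x. d x \<noteq> 0}" "\<And>x. x \<notin> C \<Longrightarrow> \<phi> x = 0" using test_functionsE[OF \<phi>] by metis
  have op: "open {x. d x > 0}" by (intro open_Collect_less continuous_intros smooth_continuous[OF smooth_d])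
  have "closed {x. d x \<ge> 0}" by (intro closed_Collect_le continuous_intros smooth_continuous[OF smooth_d])
  then have "compact (C \<inter> {x. d x \<ge> 0})" using C by (intro compact_Int_closed)
  moreover have "C \<inter> {x. d x \<ge> 0} \<subseteq> {x. d x > 0}" using C(2) by force
  ultimately obtain a V where a: "a \<in> test_functions {x. d x > 0}" "C \<inter> {x. d x \<ge> 0} \<subseteq> V" "\<And>x. x \<in> V \<Longrightarrow> a x = (1::real)"
    using smooth_urysohn[OF _ op] by metis
  define \<psi> where "\<psi> = (\<lambda>x. \<phi> x * a x)"
  have \<psi>: "\<psi> \<in> test_functions {x. d x > 0}" unfolding \<psi>_def by (rule test_mult[OF test_smooth[OF \<phi>] a(1)])
  have e: "\<psi> x = \<phi> x" if "d x > 0" for x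
    using a(2,3) C(3)[of x] that by (cases "x \<in> C") (force simp: \<psi>_def)+
  have de: "dir_deriv c \<psi> x = dir_deriv c \<phi> x" if "d x > 0" for x
    by (rule dir_deriv_cong_open[OF op]) (use that e in auto)
  have "f x * dir_deriv c \<phi> x = f x * dir_deriv c \<psi> x" for x using f(2)[of x] de[of x] by (cases "d x > 0") auto
  then have 1: "(\<lambda>x. f x * dir_deriv c \<phi> x) = (\<lambda>x. f x * dir_deriv c \<psi> x)" by (rule ext)
  have "h x * \<phi> x = h x * \<psi> x" for x using h(2)[of x] e[of x] by (cases "d x > 0") auto
  then have 2: "(\<lambda>x. h x * \<phi> x) = (\<lambda>x. h x * \<psi> x)" by (rule ext)
  show "(LINT x|lebesgue. f x * dir_deriv c \<phi> x) = - (LINT x|lebesgue. h x * \<phi> x)"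
    unfolding 1 2 by (rule wderivD[OF w \<psi>])
qed

text \<open>The hypotheses are asymmetric: first derivatives on the whole space encode that
  \<open>w\<close> vanishes on the graph, while second derivatives are known above the graph only.
  Off the graph the reflection rule applies. It remains to exclude a jump of the first derivatives
  of the odd function; their tangential parts vanish on the graph together with the function, and
  the derivative along \<nu> is even.\<close>

lemma H2s_odd_reflection:
  assumes w: "L2 w" "\<And>x. d x \<le> 0 \<Longrightarrow> w x = 0"
    and wb: "\<And>b. b \<in> Basis \<Longrightarrow> L2 (wb b)" "\<And>b x. b \<in> Basis \<Longrightarrow> d x \<le> 0 \<Longrightarrow> wb b x = 0"
      "\<And>b. b \<in> Basis \<Longrightarrow> wderiv UNIV b w (wb b)"
    and wbc: "\<And>b c. b \<in> Basis \<Longrightarrow> c \<in> Basis \<Longrightarrow> L2 (wbc b c)" "\<And>b c x. b \<in> Basis \<Longrightarrow> c \<in> Basis \<Longrightarrow> d x \<le> 0 \<Longrightarrow> wbc b c x = 0"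
      "\<And>b c. b \<in> Basis \<Longrightarrow> c \<in> Basis \<Longrightarrow> wderiv {x. d x > 0} c (wb b) (wbc b c)"
  shows "H2s UNIV (\<lambda>x. w x - w (\<sigma> x)) (\<lambda>b x. wb b x - refl_d wb b x) (\<lambda>b c x. wbc b c x - refl_dd wb wbc b c x)"
proof -
  define W where "W = (\<lambda>x. w x - w (\<sigma> x))"
  define z where "z = (\<lambda>b x. wb b x - refl_d wb b x)"
  define y where "y = (\<lambda>b c x. wbc b c x - refl_dd wb wbc b c x)"
  have S0: "\<sigma> x \<in> {x. d x \<noteq> 0}" if "x \<in> {x. d x \<noteq> 0}" for x using that by (simp add: d_sigma)
  have "H2s {x. d x \<noteq> 0} w wb wbc"
    unfolding H2s_def using w wb wbc wderiv_subset[OF wb(3)] wderiv_extend_by_zero[OF wb(1,2) wbc(1,2,3)] by auto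
  from H2s_diff[OF this H2s_sigma[OF S0 this]]
  have H: "H2s {x. d x \<noteq> 0} W z y" by (simp add: W_def z_def y_def)
  note h = H2sD[OF H]
  have zW: "wderiv UNIV b W (z b)" if "b \<in> Basis" for b
    unfolding W_def z_def by (intro wderiv_diff wb(3) wderiv_refl w(1) wb(1) that) auto
  have sn0: "sn wb x = 0" if "d x = 0" for x unfolding sn_def using wb(2) that by (intro sum.neutral) auto
  have rd0: "refl_d (wbc b) c x = 0" if "d x = 0" "b \<in> Basis" "c \<in> Basis" for b c x
    unfolding refl_d_def sn_def using wbc(2) that by (simp add: sigma_fix)
  have z0: "z b x = 0" if "d x = 0" "b \<in> Basis" for b x
    unfolding z_def refl_d_def using that wb(2) by (simp add: sigma_fix sn0)
  have y0: "y b c x = 0" if "d x = 0" "b \<in> Basis" "c \<in> Basis" for b c x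
    unfolding y_def refl_dd_def using that wbc(2) by (simp add: sigma_fix sn0 rd0) (simp add: sn_def rd0)
  have W0: "W x = 0" if "d x = 0" for x using that by (simp add: W_def sigma_fix)
  \<comment> \<open>The derivative of the odd function along \<nu> is even, because the derivative
    of \<open>d\<close> along \<nu> is 1.\<close>
  have snz: "sn z x = sn wb x + sn wb (\<sigma> x)" for x
  proof -
    have 1: "(\<Sum>j\<in>Basis. (\<nu> \<bullet> j) * dir_deriv j d x) = 1"
      using dir_deriv_expand[OF smooth_differentiable[OF smooth_d], of \<nu> x] dd_d_nu[of x] by simp
    have "sn z x = sn wb x - (\<Sum>j\<in>Basis. (\<nu> \<bullet> j) * refl_d wb j x)"
      by (simp add: sn_def z_def right_diff_distrib sum_subtractf)
    also have "(\<Sum>j\<in>Basis. (\<nu> \<bullet> j) * refl_d wb j x) = sn wb (\<sigma> x) - 2 * sn wb (\<sigma> x) * (\<Sum>j\<in>Basis. (\<nu> \<bullet> j) * dir_deriv j d x)"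
    proof -
      have "(\<nu> \<bullet> j) * refl_d wb j x = (\<nu> \<bullet> j) * wb j (\<sigma> x) - (2 * sn wb (\<sigma> x)) * ((\<nu> \<bullet> j) * dir_deriv j d x)" for j
        by (simp add: refl_d_def algebra_simps)
      then have "(\<Sum>j\<in>Basis. (\<nu> \<bullet> j) * refl_d wb j x) =
          (\<Sum>j\<in>Basis. (\<nu> \<bullet> j) * wb j (\<sigma> x)) - (\<Sum>j\<in>Basis. (2 * sn wb (\<sigma> x)) * ((\<nu> \<bullet> j) * dir_deriv j d x))"
        by (simp only: sum_subtractf)
      then show ?thesis by (simp only: sum_distrib_left[symmetric] sn_def[symmetric])
    qed
    finally show ?thesis using 1 by simp
  qed
  have wd: "wderiv UNIV c (z b) (y b c)" if b: "b \<in> Basis" and c: "c \<in> Basis" for b c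
  proof (rule wderiv_across_graph[OF h(2)[OF b] z0[OF _ b] h(4)[OF b c] y0[OF _ b c] h(5)[OF b c]])
    fix \<phi> :: "'a \<Rightarrow> real" assume \<phi>: "\<phi> \<in> test_functions UNIV"
    define \<Xi> where "\<Xi> = (\<lambda>x. dir_deriv c d x * \<phi> x)"
    have \<Xi>: "\<Xi> \<in> test_functions UNIV" unfolding \<Xi>_def by (rule test_mult[OF smooth_dd_d \<phi>])
    have d\<Xi>: "(\<lambda>x. dir_deriv b d x * \<Xi> x) \<in> test_functions UNIV" by (rule test_mult[OF smooth_dd_d \<Xi>])
    have cm: "(\<lambda>x. g x * cut' n x) \<in> test_functions UNIV" if "g \<in> test_functions UNIV" for g n
      using test_mult[OF smooth_cut' that] by (simp add: mult.commute)
    have p1: "(\<lambda>n. LINT x|lebesgue. (z b x - dir_deriv b d x * sn z x) * (\<Xi> x * cut' n x)) \<longlonglongrightarrow> 0"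
      by (rule cut_deriv_tangential[OF h(1) W0 h(2) z0 zW \<Xi> b])
    have p2: "(\<lambda>n. LINT x|lebesgue. sn z x * ((dir_deriv b d x * \<Xi> x) * cut' n x)) \<longlonglongrightarrow> 0"
    proof (rule cut_deriv_normal[OF L2_sn[OF h(2)] _ _ d\<Xi>])
      show "sn z x = 0" if "d x = 0" for x using that by (simp add: snz sn0 sigma_fix)
      show "sn z (\<sigma> x) = sn z x" for x by (simp add: snz sigma_sigma)
    qed
    \<comment> \<open>The first derivative is split into a tangential part, treated by
      \<open>cut_deriv_tangential\<close>, and a multiple of the derivative along \<nu>, treated by
      \<open>cut_deriv_normal\<close>.\<close>
    have "(LINT x|lebesgue. z b x * (\<phi> x * dir_deriv c (cut n) x)) =
        (LINT x|lebesgue. (z b x - dir_deriv b d x * sn z x) * (\<Xi> x * cut' n x)) +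
        (LINT x|lebesgue. sn z x * ((dir_deriv b d x * \<Xi> x) * cut' n x))" for n
    proof -
      have "z b x * (\<phi> x * dir_deriv c (cut n) x) = (z b x - dir_deriv b d x * sn z x) * (\<Xi> x * cut' n x) +
         sn z x * ((dir_deriv b d x * \<Xi> x) * cut' n x)" for x
        by (simp add: dir_deriv_cut \<Xi>_def algebra_simps)
      then show ?thesis
        using L2_test_integrable[OF L2_diff[OF h(2)[OF b] L2_mult_dd_d[where e = b, OF L2_sn[OF h(2)]]] cm[OF \<Xi>, of n]]
          L2_test_integrable[OF L2_sn[OF h(2)] cm[OF d\<Xi>, of n]] by simp
    qed
    then show "(\<lambda>n. LINT x|lebesgue. z b x * (\<phi> x * dir_deriv c (cut n) x)) \<longlonglongrightarrow> 0"
      using tendsto_add[OF p1 p2] by simp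
  qed
  have "H2s UNIV W z y" unfolding H2s_def using h zW wd by auto
  then show ?thesis by (simp add: W_def z_def y_def)
qed

end

section \<open>Approximation up to the boundary\<close>

lemma test_Int:
  assumes "\<phi> \<in> test_functions S" "\<psi> \<in> test_functions T" shows "(\<lambda>x. \<phi> x * \<psi> x) \<in> test_functions (S \<inter> T)"
proof -
  obtain C where C: "compact C" "C \<subseteq> S" "\<And>x. x \<notin> C \<Longrightarrow> \<phi> x = 0" using test_functionsE[OF assms(1)] by metis
  obtain D where D: "compact D" "D \<subseteq> T" "\<And>x. x \<notin> D \<Longrightarrow> \<psi> x = 0" using test_functionsE[OF assms(2)] by metis
  show ?thesis
  proof (rule test_functionsI[of _ "C \<inter> D"])
    show "smooth (\<lambda>x. \<phi> x * \<psi> x)" by (rule smooth_mult[OF test_smooth[OF assms(1)] test_smooth[OF assms(2)]])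
  qed (use C D in auto)
qed

lemma wderiv_mult_test_Int:
  assumes w: "wderiv (S \<inter> B) e f f'" and a: "a \<in> test_functions B" and L: "L2 f" "L2 f'"
  shows "wderiv S e (\<lambda>x. a x * f x) (\<lambda>x. a x * f' x + dir_deriv e a x * f x)"
  unfolding wderiv_def
proof safe
  show "locally_integrable_on (\<lambda>x. a x * f x) S" "locally_integrable_on (\<lambda>x. a x * f' x + dir_deriv e a x * f x) S"
    by (intro locally_integrable_add locally_integrable_mult_continuous L2_locally_integrable L smooth_continuous
        smooth_dir_deriv test_smooth[OF a])+
  fix \<psi> assume \<psi>: "\<psi> \<in> test_functions S"
  have t: "(\<lambda>x. b x * c x) \<in> test_functions (S \<inter> B)" if "c \<in> test_functions S" "b \<in> test_functions B" for b c
    using test_Int[OF that] by (simp add: mult.commute)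
  show "(LINT x|lebesgue. (a x * f x) * dir_deriv e \<psi> x) = - (LINT x|lebesgue. (a x * f' x + dir_deriv e a x * f x) * \<psi> x)"
    by (rule wderiv_mult_aux[OF w test_smooth[OF a] t[OF \<psi> a] test_smooth[OF \<psi>] t[OF \<psi> test_dir_deriv[OF a]] t[OF test_dir_deriv[OF \<psi>] a]])
qed

text \<open>Additive in \<open>f\<close>, so localised pieces can be approximated separately. The
  approximants are smooth on the whole space, which includes regularity up to the boundary.\<close>

definition bdry_approx :: "'a::euclidean_space set \<Rightarrow> ('a \<Rightarrow> real) \<Rightarrow> bool" where
  "bdry_approx \<Omega> f \<longleftrightarrow> (\<exists>v. (\<forall>n. smooth (v n)) \<and> (\<forall>n. \<forall>x\<in>frontier \<Omega>. v n x = 0) \<and>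
     H2null \<Omega> (\<lambda>n. zext \<Omega> (\<lambda>x. f x - v n x)))"

lemma bdry_approx_0: assumes "open \<Omega>" shows "bdry_approx \<Omega> (\<lambda>x. 0)"
proof -
  have "H2s \<Omega> (\<lambda>x. 0) (\<lambda>b x. 0) (\<lambda>b c x. 0)" by (simp add: H2s_def wderiv_0)
  then have "H2null \<Omega> (\<lambda>n x. 0)" by (intro H2nullI[where v = "\<lambda>n b x. 0" and w = "\<lambda>n b c x. 0"]) (auto simp: null2_zero)
  then show ?thesis unfolding bdry_approx_def by (intro exI[of _ "\<lambda>n x. 0"]) (simp add: zext_def)
qed

lemma bdry_approx_add:
  assumes "bdry_approx \<Omega> f" "bdry_approx \<Omega> f'" shows "bdry_approx \<Omega> (\<lambda>x. f x + f' x)"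
proof -
  obtain v where v: "\<And>n. smooth (v n)" "\<And>n x. x \<in> frontier \<Omega> \<Longrightarrow> v n x = 0" "H2null \<Omega> (\<lambda>n. zext \<Omega> (\<lambda>x. f x - v n x))"
    using assms(1) unfolding bdry_approx_def by blast
  obtain v' where v': "\<And>n. smooth (v' n)" "\<And>n x. x \<in> frontier \<Omega> \<Longrightarrow> v' n x = 0" "H2null \<Omega> (\<lambda>n. zext \<Omega> (\<lambda>x. f' x - v' n x))"
    using assms(2) unfolding bdry_approx_def by blast
  have e: "(\<lambda>n x. zext \<Omega> (\<lambda>x. f x - v n x) x + zext \<Omega> (\<lambda>x. f' x - v' n x) x) =
      (\<lambda>n. zext \<Omega> (\<lambda>x. (f x + f' x) - (v n x + v' n x)))"
    by (auto simp: fun_eq_iff zext_def algebra_simps)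
  show ?thesis unfolding bdry_approx_def
    by (rule exI[of _ "\<lambda>n x. v n x + v' n x"]) (use v v' H2null_add[OF v(3) v'(3)] in \<open>auto simp: e intro: smooth_add\<close>)
qed

lemma H2null_shift: "H2null S u \<Longrightarrow> H2null S (\<lambda>n. u (n + N))"
proof -
  assume a: "H2null S u"
  obtain v w where 1: "\<And>n. H2s S (u n) (v n) (w n)" "null2 u" "\<And>b. b \<in> Basis \<Longrightarrow> null2 (\<lambda>n. v n b)"
    "\<And>b c. b \<in> Basis \<Longrightarrow> c \<in> Basis \<Longrightarrow> null2 (\<lambda>n. w n b c)" using H2nullE[OF a] by metis
  have s: "null2 (\<lambda>n. f (n + N))" if "null2 f" for f :: "nat \<Rightarrow> 'a \<Rightarrow> real"
    using that LIMSEQ_ignore_initial_segment[of "\<lambda>n. n2 (f n)" 0 N] by (simp add: null2_def)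
  show ?thesis
  proof (rule H2nullI[of S _ "\<lambda>n. v (n + N)" "\<lambda>n. w (n + N)"])
    show "null2 (\<lambda>n. v (n + N) b)" if "b \<in> Basis" for b by (rule s[OF 1(3)[OF that]])
    show "null2 (\<lambda>n. w (n + N) b c)" if "b \<in> Basis" "c \<in> Basis" for b c by (rule s[OF 1(4)[OF that]])
  qed (use 1 s in auto)
qed

lemma bdry_approx_interior:
  assumes S: "open \<Omega>" and H: "H2s \<Omega> u v w" and a: "a \<in> test_functions \<Omega>"
  shows "bdry_approx \<Omega> (\<lambda>x. a x * u x)"
proof -
  define f where "f = (\<lambda>x. a x * u x)"
  have Hf: "H2s UNIV f (mult_d a u v) (mult_dd a u v w)" unfolding f_def by (rule H2s_mult_test[OF H a])
  obtain C where C: "compact C" "C \<subseteq> \<Omega>" "\<And>x. x \<notin> C \<Longrightarrow> a x = 0" using test_functionsE[OF a] by metis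
  have "\<forall>\<^sub>F n in sequentially. conv f (moll n) \<in> test_functions \<Omega>"
    by (rule conv_moll_test[OF L2_locally_integrable[OF H2sD(1)[OF Hf]] C(1) _ S C(2)]) (simp add: f_def C(3))
  \<comment> \<open>Finitely many of the mollifications may leave the domain; an index shift drops
    them.\<close>
  then obtain N where N: "\<And>n. n \<ge> N \<Longrightarrow> conv f (moll n) \<in> test_functions \<Omega>" by (auto simp: eventually_sequentially)
  define p where "p = (\<lambda>n. conv f (moll (n + N)))"
  have p: "p n \<in> test_functions \<Omega>" for n unfolding p_def by (rule N) simp
  have "H2null UNIV (\<lambda>n x. p n x - f x)" unfolding p_def by (rule H2null_shift[OF H2null_conv[OF Hf]])
  from H2null_zext[OF H2null_subset[OF H2null_cmult[OF this, of "-1"] subset_UNIV] S]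
  have "H2null \<Omega> (\<lambda>n. zext \<Omega> (\<lambda>x. f x - p n x))" by simp
  moreover have "p n x = 0" if "x \<in> frontier \<Omega>" for n x
  proof (rule test_zero_outside[OF p])
    show "x \<notin> \<Omega>" using that S by (simp add: frontier_def interior_open)
  qed
  ultimately show ?thesis unfolding bdry_approx_def f_def[symmetric]
    by (intro exI[of _ p]) (auto intro: test_smooth[OF p])
qed

text \<open>The localised function is extended oddly across the graph and mollified. As
  mollification does not commute with \<sigma>, the odd part is taken again; it vanishes on the
  graph, where \<sigma> is the identity.\<close>

lemma (in graph) bdry_approx_boundary:
  assumes S: "open \<Omega>" and H: "H2s \<Omega> u v w"
    and z: "\<And>x. x \<notin> \<Omega> \<Longrightarrow> u x = 0" "\<And>b x. x \<notin> \<Omega> \<Longrightarrow> v b x = 0" "\<And>b c x. x \<notin> \<Omega> \<Longrightarrow> w b c x = 0"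
    and D: "\<And>b. b \<in> Basis \<Longrightarrow> wderiv UNIV b u (v b)"
    and eq: "\<Omega> \<inter> ball p r = {x \<in> ball p r. d x > 0}" and a: "a \<in> test_functions (ball p r)"
  shows "bdry_approx \<Omega> (\<lambda>x. a x * u x)"
proof -
  note h = H2sD[OF H]
  note L = mult_L2[OF test_bsmooth[OF a], of u v w]
  have az: "a x = 0" "dir_deriv b a x = 0" "dir_deriv c (dir_deriv b a) x = 0" if "x \<notin> ball p r" for b c x
    using test_zero_outside[OF a that] test_zero_outside[OF test_dir_deriv[OF a] that]
      test_zero_outside[OF test_dir_deriv[OF test_dir_deriv[OF a]] that] by auto
  have neg: "x \<notin> ball p r \<or> x \<notin> \<Omega>" if "d x \<le> 0" for x
    using eq that by (metis (no_types, lifting) Int_iff mem_Collect_eq not_le)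
  have uz: "a x * u x = 0" "mult_d a u v b x = 0" "mult_dd a u v w b c x = 0" if "d x \<le> 0" for b c x
    using neg[OF that] az z unfolding mult_d_def mult_dd_def by (metis add_0 mult_zero_left mult_zero_right)+
  have I: "{x. d x > 0} \<inter> ball p r = \<Omega> \<inter> ball p r" unfolding eq by auto
  have wu: "wderiv ({x. d x > 0} \<inter> ball p r) b u (v b)" if "b \<in> Basis" for b
    unfolding I by (rule wderiv_subset[OF h(3)[OF that]]) simp
  have wv: "wderiv ({x. d x > 0} \<inter> ball p r) c (v b) (w b c)" if "b \<in> Basis" "c \<in> Basis" for b c
    unfolding I by (rule wderiv_subset[OF h(5)[OF that]]) simp
  define W where "W = (\<lambda>x. a x * u x - a (\<sigma> x) * u (\<sigma> x))"
  have HW: "H2s UNIV W (\<lambda>b x. mult_d a u v b x - refl_d (mult_d a u v) b x)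
      (\<lambda>b c x. mult_dd a u v w b c x - refl_dd (mult_d a u v) (mult_dd a u v w) b c x)"
    unfolding W_def
  proof (rule H2s_odd_reflection)
    show "L2 (\<lambda>x. a x * u x)" by (rule L(1)) (use h in auto)
    show "a x * u x = 0" if "d x \<le> 0" for x by (rule uz(1)[OF that])
    show "mult_d a u v b x = 0" if "d x \<le> 0" for b x by (rule uz(2)[OF that])
    show "mult_dd a u v w b c x = 0" if "d x \<le> 0" for b c x by (rule uz(3)[OF that])
    fix b :: 'a assume b: "b \<in> Basis"
    show "L2 (mult_d a u v b)" by (rule L(2)) (use h b in auto)
    show "wderiv UNIV b (\<lambda>x. a x * u x) (mult_d a u v b)"
      unfolding mult_d_def by (rule wderiv_mult[OF D[OF b] test_smooth[OF a]])
    fix c :: 'a assume c: "c \<in> Basis"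
    show "L2 (mult_dd a u v w b c)" by (rule L(3)) (use h b c in auto)
    show "wderiv {x. 0 < d x} c (mult_d a u v b) (mult_dd a u v w b c)"
      unfolding mult_d_def mult_dd_def using b c h
      by (intro wderiv_add wderiv_mult_test_Int[where B = "ball p r"] wv wu a test_dir_deriv) auto
  qed
  obtain C where C: "compact C" "C \<subseteq> ball p r" "\<And>x. x \<notin> C \<Longrightarrow> a x = 0" using test_functionsE[OF a] by metis
  obtain a' V where a': "a' \<in> test_functions (ball p r)" "C \<subseteq> V" "\<And>x. x \<in> V \<Longrightarrow> a' x = (1::real)"
    using smooth_urysohn[OF C(1) open_ball C(2)] by metis
  define q where "q = (\<lambda>n. conv W (moll n))"
  have qs: "smooth (q n)" for n
    unfolding q_def by (rule smooth_conv[OF L2_locally_integrable[OF H2sD(1)[OF HW]] moll(1)])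
  \<comment> \<open>The outer cutoff \<open>a'\<close> is 1 on the support of \<open>a\<close> and
    confines the approximant to the ball in which the boundary is the graph; on the rest of the
    frontier the approximant is 0.\<close>
  define y where "y = (\<lambda>n x. a' x * (1/2 * (q n x - q n (\<sigma> x))))"
  have ys: "smooth (y n)" for n unfolding y_def by (intro smooth_mult smooth_const smooth_diff qs smooth_sigma test_smooth[OF a'(1)])
  have yz: "y n x = 0" if "x \<in> frontier \<Omega>" for n x
  proof (cases "x \<in> ball p r")
    case False then show ?thesis using test_zero_outside[OF a'(1)] by (simp add: y_def)
  next
    case True
    have xn: "x \<notin> \<Omega>" and xc: "x \<in> closure \<Omega>" using that S by (auto simp: frontier_def interior_open)
    have "d x \<le> 0" using eq True xn by (metis (no_types, lifting) Int_iff mem_Collect_eq not_le)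
    \<comment> \<open>Inside the ball, the points below the graph form an open set disjoint from the
      domain, so no point of the closure lies there.\<close>
    moreover have "\<not> d x < 0"
    proof
      assume "d x < 0"
      have "open ({x. d x < 0} \<inter> ball p r)"
        by (intro open_Int open_ball open_Collect_less continuous_intros smooth_continuous[OF smooth_d])
      moreover have "{x. d x < 0} \<inter> ball p r \<inter> closure \<Omega> \<noteq> {}" using xc \<open>d x < 0\<close> True by auto
      ultimately have "{x. d x < 0} \<inter> ball p r \<inter> \<Omega> \<noteq> {}" using open_Int_closure_eq_empty by metis
      then obtain y where "y \<in> \<Omega>" "y \<in> {x. d x < 0} \<inter> ball p r" by blast
      then show False using neg[of y] by auto
    qed
    ultimately have "\<sigma> x = x" by (intro sigma_fix) simp
    then show ?thesis by (simp add: y_def)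
  qed
  have n1: "H2null UNIV (\<lambda>n x. q n x - W x)" unfolding q_def by (rule H2null_conv[OF HW])
  have "H2null UNIV (\<lambda>n x. a' x * (1/2 * ((q n x - W x) - (q n (\<sigma> x) - W (\<sigma> x)))))"
    by (intro H2null_mult H2null_cmult H2null_diff n1 H2null_sigma test_bsmooth[OF a'(1)]) (auto intro: H2null_sigma n1)
  from H2null_zext[OF H2null_subset[OF H2null_cmult[OF this, of "-1"] subset_UNIV] S]
  have n2: "H2null \<Omega> (\<lambda>n. zext \<Omega> (\<lambda>x. -1 * (a' x * (1/2 * ((q n x - W x) - (q n (\<sigma> x) - W (\<sigma> x)))))))" .
  \<comment> \<open>Since \<open>W\<close> is odd, half the difference of \<open>W\<close> and its
    reflection is \<open>W\<close> itself; on the domain the factor \<open>a'\<close> turns it into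
    the localised function.\<close>
  have key: "-1 * (a' x * (1/2 * ((q n x - W x) - (q n (\<sigma> x) - W (\<sigma> x))))) = a x * u x - y n x" if "x \<in> \<Omega>" for n x
  proof -
    have "W (\<sigma> x) = - W x" by (simp add: W_def sigma_sigma)
    moreover have "a' x * W x = a x * u x"
    proof (cases "x \<in> ball p r")
      case False then show ?thesis using test_zero_outside[OF a'(1)] az by simp
    next
      case True
      then have "d x > 0" using eq that by blast
      then have "a (\<sigma> x) * u (\<sigma> x) = 0" using uz(1)[of "\<sigma> x"] by (simp add: d_sigma)
      then have "W x = a x * u x" by (simp add: W_def)
      then show ?thesis using a'(2,3) C(3)[of x] by (cases "x \<in> C") auto
    qed
    ultimately show ?thesis by (simp add: y_def algebra_simps)
  qed
  have "(\<lambda>n. zext \<Omega> (\<lambda>x. -1 * (a' x * (1/2 * ((q n x - W x) - (q n (\<sigma> x) - W (\<sigma> x))))))) = (\<lambda>n. zext \<Omega> (\<lambda>x. a x * u x - y n x))"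
  proof (intro ext)
    fix n x show "zext \<Omega> (\<lambda>x. -1 * (a' x * (1/2 * ((q n x - W x) - (q n (\<sigma> x) - W (\<sigma> x)))))) x = zext \<Omega> (\<lambda>x. a x * u x - y n x) x"
      using key[of x n] by (cases "x \<in> \<Omega>") auto
  qed
  with n2 show ?thesis unfolding bdry_approx_def using ys yz by metis
qed

lemma H10_approx:
  assumes S: "open S" and u: "u \<in> H10 S"
  shows "\<exists>\<phi>. (\<forall>n. \<phi> n \<in> test_functions S) \<and> L2 (zext S u) \<and> (\<lambda>n. n2 (\<lambda>x. \<phi> n x - zext S u x)) \<longlonglongrightarrow> 0 \<and>
    (\<forall>b\<in>Basis. \<forall>v. wderiv S b u v \<longrightarrow> L2 (zext S v) \<longrightarrow> (\<lambda>n. n2 (\<lambda>x. dir_deriv b (\<phi> n) x - zext S v x)) \<longlonglongrightarrow> 0)"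
proof -
  have u1: "u \<in> Hk 1 S" using u by (simp add: H10_def)
  have uL: "L2 (zext S u)" using u1 by (simp add: Hk_def Lp2_iff[OF open_in_lebesgue[OF S]])
  have "\<exists>\<phi>\<in>test_functions S. Hk_norm 1 S (\<lambda>x. u x - \<phi> x) < inverse (real (Suc n))" for n
    using u by (simp add: H10_def)
  then obtain \<phi> where \<phi>: "\<And>n. \<phi> n \<in> test_functions S" "\<And>n. Hk_norm 1 S (\<lambda>x. u x - \<phi> n x) < inverse (real (Suc n))"
    by metis
  have wd: "wderiv S c (\<lambda>x. u x - \<phi> n x) (\<lambda>x. v' x - dir_deriv c (\<phi> n) x)" if "wderiv S c u v'" for c v' n
    by (intro wderiv_diff that wderiv_smooth test_smooth[OF \<phi>(1)] S)
  have zd: "zext S (\<lambda>x. f x - \<psi> x) = (\<lambda>x. zext S f x - \<psi> x)" if "\<psi> \<in> test_functions S" for f \<psi>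
    using test_zero_outside[OF that] by (auto simp: fun_eq_iff zext_def indicator_def)
  have Lt: "L2 (zext S (\<lambda>x. f x - \<psi> x))" if "L2 (zext S f)" "\<psi> \<in> test_functions S" for f \<psi>
    unfolding zd[OF that(2)] by (rule L2_diff[OF that(1) L2_test[OF that(2)]])
  have m: "(\<lambda>x. u x - \<phi> n x) \<in> Hk 1 S" for n
  proof -
    have "\<exists>v. L2 (zext S v) \<and> wderiv S c u v" if "c \<in> Basis" for c
      by (rule Hk1_imp_deriv[OF S u1 that]) blast
    then obtain V where V: "\<And>c. c \<in> Basis \<Longrightarrow> L2 (zext S (V c))" "\<And>c. c \<in> Basis \<Longrightarrow> wderiv S c u (V c)" by metis
    show ?thesis
      by (rule Hk1I(1)[OF S Lt[OF uL \<phi>(1)], of "\<lambda>c x. V c x - dir_deriv c (\<phi> n) x"])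
         (use V wd Lt test_dir_deriv[OF \<phi>(1)] in auto)
  qed
  have lim: "(\<lambda>n. n2 (\<lambda>x. g n x - f x)) \<longlonglongrightarrow> 0" if le: "\<And>n. n2 (\<lambda>x. f x - g n x) \<le> inverse (real (Suc n))" for f :: "'a \<Rightarrow> real" and g
  proof (rule Lim_null_comparison[OF _ LIMSEQ_inverse_real_of_nat])
    have "n2 (\<lambda>x. g n x - f x) = n2 (\<lambda>x. f x - g n x)" for n using n2_minus[of "\<lambda>x. f x - g n x"] by simp
    then show "\<forall>\<^sub>F n in sequentially. norm (n2 (\<lambda>x. g n x - f x)) \<le> inverse (real (Suc n))" using le by simp
  qed
  have n1: "n2 (\<lambda>x. zext S u x - \<phi> n x) \<le> inverse (real (Suc n))" for n
    using Hk1_norm_ge[OF S m[of n]] \<phi>(2)[of n] unfolding zd[OF \<phi>(1)] by simp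
  have n2: "n2 (\<lambda>x. zext S v x - dir_deriv b (\<phi> n) x) \<le> inverse (real (Suc n))"
    if b: "b \<in> Basis" and v: "wderiv S b u v" for b v n
  proof -
    obtain v' where v': "L2 (zext S v')" "wderiv S b (\<lambda>x. u x - \<phi> n x) v'" "n2 (zext S v') \<le> Hk_norm 1 S (\<lambda>x. u x - \<phi> n x)"
      by (rule Hk1_imp_deriv[OF S m[of n] b])
    \<comment> \<open>Membership in \<open>Hk 1\<close> yields just some weak derivative with the
      norm bound; uniqueness identifies it with the explicit one.\<close>
    have "AE x in lebesgue. x \<in> S \<longrightarrow> v x - dir_deriv b (\<phi> n) x = v' x"
      by (rule has_weak_deriv_unique[OF S, of "[b]"]) (use v'(2) wd[OF v] has_weak_deriv_single[OF S] in auto)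
    from L2_zext_cong_AE(2)[OF this v'(1)]
    have "n2 (zext S (\<lambda>x. v x - dir_deriv b (\<phi> n) x)) = n2 (zext S v')" .
    then show ?thesis using v'(3) \<phi>(2)[of n] unfolding zd[OF test_dir_deriv[OF \<phi>(1)]] by simp
  qed
  have l2: "(\<lambda>n. n2 (\<lambda>x. dir_deriv b (\<phi> n) x - zext S v x)) \<longlonglongrightarrow> 0" if "b \<in> Basis" "wderiv S b u v" for b v
    by (rule lim) (rule n2[OF that])
  show ?thesis using \<phi>(1) uL lim[OF n1] l2 by (intro exI[of _ \<phi>]) blast
qed

text \<open>Test functions on \<open>S\<close>, extended by zero, satisfy the identity on the whole
  space, and it survives the limit. In this form zero boundary values enter without traces.\<close>

lemma H10_wderiv_UNIV:
  assumes S: "open S" and u: "u \<in> H10 S" and b: "b \<in> Basis" and v: "wderiv S b u v" and L: "L2 (zext S v)"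
  shows "wderiv UNIV b (zext S u) (zext S v)"
proof -
  obtain \<phi> where \<phi>: "\<And>n. \<phi> n \<in> test_functions S" "L2 (zext S u)" "(\<lambda>n. n2 (\<lambda>x. \<phi> n x - zext S u x)) \<longlonglongrightarrow> 0"
    "\<And>b v. b \<in> Basis \<Longrightarrow> wderiv S b u v \<Longrightarrow> L2 (zext S v) \<Longrightarrow> (\<lambda>n. n2 (\<lambda>x. dir_deriv b (\<phi> n) x - zext S v x)) \<longlonglongrightarrow> 0"
    using H10_approx[OF S u] by blast
  show ?thesis unfolding wderiv_def
  proof (intro conjI ballI)
    show "locally_integrable_on (zext S u) UNIV" "locally_integrable_on (zext S v) UNIV" by (intro L2_locally_integrable \<phi>(2) L)+
    fix \<psi> :: "'a \<Rightarrow> real" assume \<psi>: "\<psi> \<in> test_functions UNIV"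
    have l1: "(\<lambda>n. LINT x|lebesgue. \<phi> n x * dir_deriv b \<psi> x) \<longlonglongrightarrow> (LINT x|lebesgue. zext S u x * dir_deriv b \<psi> x)"
      by (rule L2_tendsto_integral[OF L2_test[OF \<phi>(1)] \<phi>(2) L2_test[OF test_dir_deriv[OF \<psi>]] \<phi>(3)])
    have l2: "(\<lambda>n. - (LINT x|lebesgue. dir_deriv b (\<phi> n) x * \<psi> x)) \<longlonglongrightarrow> - (LINT x|lebesgue. zext S v x * \<psi> x)"
      by (rule tendsto_minus[OF L2_tendsto_integral[OF L2_test[OF test_dir_deriv[OF \<phi>(1)]] L L2_test[OF \<psi>] \<phi>(4)[OF b v L]]])
    have e: "(\<lambda>n. LINT x|lebesgue. \<phi> n x * dir_deriv b \<psi> x) = (\<lambda>n. - (LINT x|lebesgue. dir_deriv b (\<phi> n) x * \<psi> x))"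
      by (rule ext) (rule wderivD[OF wderiv_smooth[OF test_smooth[OF \<phi>(1)] open_UNIV] \<psi>])
    show "(LINT x|lebesgue. zext S u x * dir_deriv b \<psi> x) = - (LINT x|lebesgue. zext S v x * \<psi> x)"
      by (rule LIMSEQ_unique[OF l1]) (subst e, rule l2)
  qed
qed

lemma H2_theta_H2s:
  assumes S: "open S" and u: "u \<in> H2_theta S"
  obtains v w where "H2s S (zext S u) v w" "\<And>b x. x \<notin> S \<Longrightarrow> v b x = 0" "\<And>b c x. x \<notin> S \<Longrightarrow> w b c x = 0"
    "\<And>b. b \<in> Basis \<Longrightarrow> wderiv UNIV b (zext S u) (v b)"
proof -
  have "u \<in> Hk 2 S" using u by (simp add: H2_theta_def)
  then obtain v w where vw: "H2s S (zext S u) v w" "\<And>b x. x \<notin> S \<Longrightarrow> v b x = 0" "\<And>b c x. x \<notin> S \<Longrightarrow> w b c x = 0"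
    using Hk_imp_H2s[OF S] by metis
  have "wderiv UNIV b (zext S u) (v b)" if b: "b \<in> Basis" for b
  proof -
    have z: "zext S (v b) = v b" by (rule zext_id) (rule vw(2))
    have "wderiv S b u (v b) = wderiv S b (zext S u) (v b)" by (rule wderiv_cong) auto
    then have 1: "wderiv S b u (v b)" using H2sD(3)[OF vw(1) b] by simp
    have "L2 (zext S (v b))" using H2sD(2)[OF vw(1) b] z by simp
    from H10_wderiv_UNIV[OF S _ b 1 this] show ?thesis using u z by (simp add: H2_theta_def)
  qed
  then show ?thesis using that vw by blast
qed

lemma H2_theta_bdry_approx:
  assumes \<Omega>: "smooth_bounded_domain \<Omega>" and u: "u \<in> H2_theta \<Omega>"
  obtains v where "\<And>n. smooth (v n)" "\<And>n x. x \<in> frontier \<Omega> \<Longrightarrow> v n x = 0"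
    "H2null \<Omega> (\<lambda>n. zext \<Omega> (\<lambda>x. u x - v n x))"
proof -
  have S: "open \<Omega>" and bd: "bounded \<Omega>" using \<Omega> by (auto simp: smooth_bounded_domain_def)
  obtain v w where H: "H2s \<Omega> (zext \<Omega> u) v w" "\<And>b x. x \<notin> \<Omega> \<Longrightarrow> v b x = 0" "\<And>b c x. x \<notin> \<Omega> \<Longrightarrow> w b c x = 0"
    "\<And>b. b \<in> Basis \<Longrightarrow> wderiv UNIV b (zext \<Omega> u) (v b)" using H2_theta_H2s[OF S u] by metis
  let ?u = "zext \<Omega> u"
  have local: "\<exists>r>0. \<forall>a\<in>test_functions (ball p r). bdry_approx \<Omega> (\<lambda>x. a x * ?u x)" if p: "p \<in> closure \<Omega>" for p
  proof (cases "p \<in> \<Omega>")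
    case True
    then obtain r where r: "r > 0" "ball p r \<subseteq> \<Omega>" using S open_contains_ball by metis
    then show ?thesis using bdry_approx_interior[OF S H(1)] test_mono by metis
  next
    case False
    then have "p \<in> frontier \<Omega>" using p S by (simp add: frontier_def interior_open)
    then obtain r \<nu> g where r: "r > 0" "norm \<nu> = 1" "smooth_on UNIV g"
      "\<Omega> \<inter> ball p r = {x \<in> ball p r. x \<bullet> \<nu> > g (x - (x \<bullet> \<nu>) *\<^sub>R \<nu>)}"
      using \<Omega> unfolding smooth_bounded_domain_def by blast
    define P where "P = (\<lambda>x. x - (x \<bullet> \<nu>) *\<^sub>R \<nu>)"
    \<comment> \<open>Multiplication by \<open>\<kappa>\<close> makes \<open>g\<close> a test
      function and leaves the graph inside the ball unchanged: the projection does not increase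
      distances, so it maps the ball into \<open>cball (P p) r\<close>.\<close>
    obtain \<kappa> V where \<kappa>: "\<kappa> \<in> test_functions UNIV" "cball (P p) r \<subseteq> V" "\<And>x. x \<in> V \<Longrightarrow> \<kappa> x = (1::real)"
      using smooth_urysohn[OF compact_cball open_UNIV subset_UNIV] by metis
    define g' where "g' = (\<lambda>x. g x * \<kappa> x)"
    have g': "g' \<in> test_functions UNIV" unfolding g'_def
      using test_mult[of g \<kappa> UNIV] r(3) \<kappa>(1) by (simp add: smooth_on_UNIV_iff)
    interpret G: graph \<nu> g' by unfold_locales (use r g' in auto)
    have Pg: "g (P x) = g' (P x)" if "x \<in> ball p r" for x
    proof -
      have "(norm (P y))\<^sup>2 \<le> (norm y)\<^sup>2" for y
      proof -
        have "(norm (P y))\<^sup>2 = (norm y)\<^sup>2 - (y \<bullet> \<nu>)\<^sup>2"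
          unfolding P_def power2_norm_eq_inner using G.nu_inner
          by (simp add: inner_diff_left inner_diff_right inner_commute power2_eq_square)
        then show ?thesis by simp
      qed
      then have c: "norm (P y) \<le> norm y" for y by (rule power2_le_imp_le) simp
      have "P p - P x = P (p - x)" by (simp add: P_def inner_diff_left algebra_simps)
      then have "dist (P p) (P x) \<le> dist p x" using c[of "p - x"] by (simp add: dist_norm)
      then have "P x \<in> cball (P p) r" using that by simp
      then show ?thesis using \<kappa>(2,3) by (auto simp: g'_def)
    qed
    have eq: "\<Omega> \<inter> ball p r = {x \<in> ball p r. G.d x > 0}"
      unfolding r(4) G.d_def G.proj_def using Pg by (auto simp: P_def)
    show ?thesis
      using G.bdry_approx_boundary[OF S H(1) _ H(2,3,4) eq] r(1) by (intro exI[of _ r]) auto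
  qed
  then obtain r where r: "\<And>p. p \<in> closure \<Omega> \<Longrightarrow> r p > 0"
    "\<And>p a. p \<in> closure \<Omega> \<Longrightarrow> a \<in> test_functions (ball p (r p)) \<Longrightarrow> bdry_approx \<Omega> (\<lambda>x. a x * ?u x)" by metis
  have "\<exists>\<psi>. \<psi> \<in> test_functions (ball p (r p)) \<and> (\<forall>x\<in>ball p (r p / 2). \<psi> x = (1::real))" if p: "p \<in> closure \<Omega>" for p
  proof -
    have "cball p (r p / 2) \<subseteq> ball p (r p)" using r(1)[OF p] by auto
    then obtain \<psi> V where "\<psi> \<in> test_functions (ball p (r p))" "cball p (r p / 2) \<subseteq> V" "\<And>x. x \<in> V \<Longrightarrow> \<psi> x = (1::real)"
      using smooth_urysohn[OF compact_cball open_ball] by metis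
    then show ?thesis using ball_subset_cball[of p "r p / 2"] by (intro exI[of _ \<psi>]) blast
  qed
  then obtain \<psi> where \<psi>: "\<And>p. p \<in> closure \<Omega> \<Longrightarrow> \<psi> p \<in> test_functions (ball p (r p))"
    "\<And>p x. p \<in> closure \<Omega> \<Longrightarrow> x \<in> ball p (r p / 2) \<Longrightarrow> \<psi> p x = (1::real)" by metis
  have "compact (closure \<Omega>)" using bd by (simp add: compact_closure)
  then obtain D where D: "D \<subseteq> closure \<Omega>" "finite D" "closure \<Omega> \<subseteq> (\<Union>p\<in>D. ball p (r p / 2))"
  proof (rule compactE_image[of _ "closure \<Omega>" "\<lambda>p. ball p (r p / 2)"])
    show "closure \<Omega> \<subseteq> (\<Union>p\<in>closure \<Omega>. ball p (r p / 2))" using r(1) by force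
  qed auto
  \<comment> \<open>A telescoping product takes the place of a partition of unity: enlarging
    \<open>E\<close> by \<open>p\<close> adds the piece
    \<open>(\<Prod>p\<in>E. 1 - \<psi> p x) * \<psi> p x\<close>, which is supported in one ball,
    and the product over all of \<open>D\<close> vanishes on the domain.\<close>
  have "bdry_approx \<Omega> (\<lambda>x. (1 - (\<Prod>p\<in>E. 1 - \<psi> p x)) * ?u x)" if "E \<subseteq> D" for E
    using finite_subset[OF that D(2)] that
  proof (induction E)
    case empty then show ?case using bdry_approx_0[OF S] by simp
  next
    case (insert p E)
    have pc: "p \<in> closure \<Omega>" using insert.prems D(1) by auto
    have s: "smooth (\<lambda>x. \<Prod>p\<in>E. 1 - \<psi> p x)"
      using insert.prems D(1) \<psi>(1) by (intro smooth_prod smooth_diff smooth_const) (auto intro: test_smooth)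
    have 1: "bdry_approx \<Omega> (\<lambda>x. ((\<Prod>p\<in>E. 1 - \<psi> p x) * \<psi> p x) * ?u x)"
      by (rule r(2)[OF pc test_mult[OF s \<psi>(1)[OF pc]]])
    have 2: "bdry_approx \<Omega> (\<lambda>x. (1 - (\<Prod>p\<in>E. 1 - \<psi> p x)) * ?u x)" using insert by auto
    have "(\<lambda>x. (1 - (\<Prod>p\<in>E. 1 - \<psi> p x)) * ?u x + ((\<Prod>p\<in>E. 1 - \<psi> p x) * \<psi> p x) * ?u x) =
        (\<lambda>x. (1 - (\<Prod>p\<in>insert p E. 1 - \<psi> p x)) * ?u x)"
      using insert.hyps by (simp add: fun_eq_iff algebra_simps)
    then show ?case using bdry_approx_add[OF 2 1] by simp
  qed
  from this[of D] obtain y where y: "\<And>n. smooth (y n)" "\<And>n x. x \<in> frontier \<Omega> \<Longrightarrow> y n x = 0"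
    "H2null \<Omega> (\<lambda>n. zext \<Omega> (\<lambda>x. (1 - (\<Prod>p\<in>D. 1 - \<psi> p x)) * ?u x - y n x))"
    unfolding bdry_approx_def by blast
  have "(\<Prod>p\<in>D. 1 - \<psi> p x) = 0" if x: "x \<in> \<Omega>" for x
  proof -
    obtain p where "p \<in> D" "x \<in> ball p (r p / 2)" using D(3) x closure_subset[of \<Omega>] by blast
    then have "\<exists>p\<in>D. 1 - \<psi> p x = 0" using \<psi>(2) D(1) by fastforce
    then show ?thesis using D(2) by (simp add: prod_zero)
  qed
  then have "zext \<Omega> (\<lambda>x. (1 - (\<Prod>p\<in>D. 1 - \<psi> p x)) * ?u x - y n x) = zext \<Omega> (\<lambda>x. u x - y n x)" for n
    by (auto simp: fun_eq_iff zext_def indicator_def)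
  then show ?thesis using that[of y] y by simp
qed

lemma smooth_Ck_closure:
  assumes "smooth v" shows "Ck_closure k S v"
proof -
  have U: "Ck_on k UNIV v" using smooth_cdiff[OF assms] by (simp add: Ck_on_UNIV_iff)
  have c: "continuous_on T (partial_deriv bs v)" if "bs \<in> dirs k" for bs T
  proof (rule continuous_on_subset[OF _ subset_UNIV])
    show "continuous_on UNIV (partial_deriv bs v)" using U that unfolding Ck_on_def by simp
  qed
  have d: "partial_deriv bs v differentiable_on S" if "bs \<in> dirs k" "length bs < k" for bs
  proof (rule differentiable_on_subset[OF _ subset_UNIV])
    show "partial_deriv bs v differentiable_on UNIV" using U that unfolding Ck_on_def by simp
  qed
  show ?thesis unfolding Ck_closure_def Ck_on_def
  proof (intro conjI ballI impI)
    fix bs :: "'a list" assume bs: "bs \<in> dirs k"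
    show "continuous_on S (partial_deriv bs v)" by (rule c[OF bs])
    show "partial_deriv bs v differentiable_on S" if "length bs < k" by (rule d[OF bs that])
    show "\<exists>g. continuous_on (closure S) g \<and> (\<forall>x\<in>S. g x = partial_deriv bs v x)"
      using c[OF bs] by (intro exI[of _ "partial_deriv bs v"]) simp
  qed (rule smooth_continuous[OF assms])
qed

section \<open>The capacity in the whole space\<close>

lemma sq_le_nn: "L2 f \<Longrightarrow> (\<integral>\<^sup>+x. ennreal ((f x)\<^sup>2) \<partial>lebesgue) = ennreal ((n2 f)\<^sup>2)"
  unfolding n2_sq by (intro nn_integral_eq_integral L2_sq_integrable) auto

text \<open>Riesz-Fischer: a fast subsequence converges almost everywhere, and Fatou's lemma gives
  the norm estimate for the full sequence.\<close>

lemma L2_complete: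
  fixes f :: "nat \<Rightarrow> 'a::euclidean_space \<Rightarrow> real"
  assumes f: "\<And>n. L2 (f n)" and C: "\<And>e. e > 0 \<Longrightarrow> \<exists>M. \<forall>m\<ge>M. \<forall>n\<ge>M. n2 (\<lambda>x. f m x - f n x) < e"
  obtains g where "L2 g" "(\<lambda>n. n2 (\<lambda>x. f n x - g x)) \<longlonglongrightarrow> 0"
proof -
  have "\<exists>M. \<forall>m\<ge>M. \<forall>n\<ge>M. n2 (\<lambda>x. f m x - f n x) < (1/2) ^ k" for k :: nat by (rule C) simp
  then obtain M where M: "\<And>k m n. m \<ge> M k \<Longrightarrow> n \<ge> M k \<Longrightarrow> n2 (\<lambda>x. f m x - f n x) < (1/2) ^ k" by metis
  \<comment> \<open>The sum makes the indices monotone and at least \<open>M k\<close>; the summand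
    \<open>k\<close> makes them unbounded.\<close>
  define r where "r = (\<lambda>k. (\<Sum>j\<le>k. M j) + k)"
  have rM: "r k \<ge> M k" for k
  proof -
    have "M k \<le> (\<Sum>j\<le>k. M j)" by (rule member_le_sum) auto
    then show ?thesis by (simp add: r_def)
  qed
  have rS: "r (Suc k) \<ge> r k" for k by (simp add: r_def)
  have rk: "r k \<ge> k" for k by (simp add: r_def)
  define D where "D = (\<lambda>k x. f (r (Suc k)) x - f (r k) x)"
  have D2: "L2 (D k)" for k unfolding D_def by (intro L2_diff f)
  have Dn: "n2 (D k) \<le> (1/2) ^ k" for k
    unfolding D_def using M[of k "r (Suc k)" "r k"] rM[of k] rS[of k] by force
  \<comment> \<open>The weight \<open>2 ^ k\<close> leaves a summable bound for the integrals and
    still forces geometric decay of \<open>D k x\<close> at almost every point, with ratio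
    \<open>sqrt (1/2)\<close>.\<close>
  have bnd: "(\<integral>\<^sup>+x. ennreal (2 ^ k * (D k x)\<^sup>2) \<partial>lebesgue) \<le> ennreal ((1/2) ^ k)" for k
  proof -
    have "(\<integral>\<^sup>+x. ennreal (2 ^ k * (D k x)\<^sup>2) \<partial>lebesgue) = ennreal (LINT x|lebesgue. 2 ^ k * (D k x)\<^sup>2)"
      using L2_sq_integrable[OF D2[of k]] by (intro nn_integral_eq_integral) auto
    also have "(LINT x|lebesgue. 2 ^ k * (D k x)\<^sup>2) = 2 ^ k * (n2 (D k))\<^sup>2" by (simp add: n2_sq)
    also have "\<dots> \<le> 2 ^ k * ((1/2) ^ k)\<^sup>2" using Dn[of k] by (intro mult_left_mono power_mono) auto
    also have "\<dots> = (1/2) ^ k" by (simp add: power2_eq_square power_divide)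
    finally show ?thesis by (simp add: ennreal_leI)
  qed
  have Dm: "D k \<in> borel_measurable lebesgue" for k by (rule L2_measurable[OF D2])
  have m: "(\<lambda>x. ennreal (2 ^ k * (D k x)\<^sup>2)) \<in> borel_measurable lebesgue" for k
    by (intro measurable_compose[OF _ measurable_ennreal] borel_measurable_times borel_measurable_const borel_measurable_power Dm)
  have "(\<integral>\<^sup>+x. (\<Sum>k. ennreal (2 ^ k * (D k x)\<^sup>2)) \<partial>lebesgue) = (\<Sum>k. (\<integral>\<^sup>+x. ennreal (2 ^ k * (D k x)\<^sup>2) \<partial>lebesgue))"
    by (rule nn_integral_suminf[OF m])
  also have "\<dots> \<le> (\<Sum>k. ennreal ((1/2) ^ k))" by (intro suminf_le bnd) auto
  also have "\<dots> = ennreal (\<Sum>k. (1/2) ^ k)" by (intro suminf_ennreal2) (auto intro: summable_geometric)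
  finally have "(\<integral>\<^sup>+x. (\<Sum>k. ennreal (2 ^ k * (D k x)\<^sup>2)) \<partial>lebesgue) \<noteq> \<infinity>" by (auto simp: top_unique)
  then have "AE x in lebesgue. (\<Sum>k. ennreal (2 ^ k * (D k x)\<^sup>2)) \<noteq> \<infinity>"
    by (intro nn_integral_PInf_AE borel_measurable_suminf_order m)
  then have ae: "AE x in lebesgue. convergent (\<lambda>k. f (r k) x)"
  proof eventually_elim
    case (elim x)
    have sm: "summable (\<lambda>k. 2 ^ k * (D k x)\<^sup>2)"
      using elim by (intro summable_suminf_not_top) auto
    then have "(\<lambda>k. 2 ^ k * (D k x)\<^sup>2) \<longlonglongrightarrow> 0" by (rule summable_LIMSEQ_zero)
    then have "Bseq (\<lambda>k. 2 ^ k * (D k x)\<^sup>2)" by (intro convergent_imp_Bseq convergentI)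
    then obtain c where c: "c > 0" "\<And>k. norm (2 ^ k * (D k x)\<^sup>2) \<le> c" by (auto simp: Bseq_def)
    have Dk: "norm (D k x) \<le> sqrt c * (sqrt (1/2)) ^ k" for k
    proof -
      have "(D k x)\<^sup>2 \<le> c * (1/2) ^ k" using c(2)[of k] by (simp add: field_simps power_divide)
      then have "sqrt ((D k x)\<^sup>2) \<le> sqrt (c * (1/2) ^ k)" by (rule real_sqrt_le_mono)
      moreover have "sqrt (c * (1/2) ^ k) = sqrt c * (sqrt (1/2)) ^ k" by (simp only: real_sqrt_mult real_sqrt_power)
      ultimately show ?thesis by (simp only: real_sqrt_abs real_norm_def)
    qed
    have "summable (\<lambda>k. sqrt c * (sqrt (1/2)) ^ k)"
      by (intro summable_mult summable_geometric) (simp add: real_sqrt_divide)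
    then have "summable (\<lambda>k. D k x)" by (rule summable_comparison_test'[where N = 0]) (rule Dk)
    then have "convergent (\<lambda>n. \<Sum>k<n. D k x)" by (simp add: summable_iff_convergent)
    moreover have "(\<Sum>k<n. D k x) = f (r n) x - f (r 0) x" for n
      by (induction n) (auto simp: D_def)
    ultimately have "convergent (\<lambda>n. (f (r n) x - f (r 0) x) + f (r 0) x)"
      by (intro convergent_add convergent_const) simp
    then show ?case by simp
  qed
  define g where "g = (\<lambda>x. lim (\<lambda>k. f (r k) x))"
  have gm: "g \<in> borel_measurable lebesgue" unfolding g_def
    by (intro borel_measurable_lim_metric L2_measurable f)
  have gl: "AE x in lebesgue. (\<lambda>k. f (r k) x) \<longlonglongrightarrow> g x"
    using ae by eventually_elim (simp add: g_def convergent_LIMSEQ_iff)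
  have est: "L2 (\<lambda>x. f n x - g x) \<and> n2 (\<lambda>x. f n x - g x) \<le> e"
    if e: "e > 0" and n: "n \<ge> N" and N: "\<And>m n. m \<ge> N \<Longrightarrow> n \<ge> N \<Longrightarrow> n2 (\<lambda>x. f m x - f n x) < e" for e n N
  proof -
    have dm: "(\<lambda>x. f n x - g x) \<in> borel_measurable lebesgue" by (intro borel_measurable_diff L2_measurable f gm)
    have "(\<integral>\<^sup>+x. ennreal ((f n x - g x)\<^sup>2) \<partial>lebesgue) = (\<integral>\<^sup>+x. liminf (\<lambda>k. ennreal ((f n x - f (r k) x)\<^sup>2)) \<partial>lebesgue)"
    proof (rule nn_integral_cong_AE, use gl in eventually_elim)
      fix x assume "(\<lambda>k. f (r k) x) \<longlonglongrightarrow> g x"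
      then have "(\<lambda>k. ennreal ((f n x - f (r k) x)\<^sup>2)) \<longlonglongrightarrow> ennreal ((f n x - g x)\<^sup>2)"
        by (intro tendsto_ennrealI tendsto_intros)
      from lim_imp_Liminf[OF trivial_limit_sequentially this]
      show "ennreal ((f n x - g x)\<^sup>2) = liminf (\<lambda>k. ennreal ((f n x - f (r k) x)\<^sup>2))" ..
    qed
    also have "\<dots> \<le> liminf (\<lambda>k. \<integral>\<^sup>+x. ennreal ((f n x - f (r k) x)\<^sup>2) \<partial>lebesgue)"
      by (intro nn_integral_liminf measurable_compose[OF _ measurable_ennreal] borel_measurable_power borel_measurable_diff L2_measurable f)
    also have "\<dots> \<le> limsup (\<lambda>k. \<integral>\<^sup>+x. ennreal ((f n x - f (r k) x)\<^sup>2) \<partial>lebesgue)"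
      by (rule Liminf_le_Limsup) simp
    also have "\<dots> \<le> ennreal (e\<^sup>2)"
    proof (rule Limsup_bounded)
      show "\<forall>\<^sub>F k in sequentially. (\<integral>\<^sup>+x. ennreal ((f n x - f (r k) x)\<^sup>2) \<partial>lebesgue) \<le> ennreal (e\<^sup>2)"
        using eventually_ge_at_top[of N]
      proof eventually_elim
        case (elim k)
        then have "n2 (\<lambda>x. f n x - f (r k) x) < e" using n rk[of k] by (intro N) auto
        then have "(n2 (\<lambda>x. f n x - f (r k) x))\<^sup>2 \<le> e\<^sup>2" by (intro power_mono) auto
        then show ?case using sq_le_nn[OF L2_diff[OF f f]] by (simp add: ennreal_leI)
      qed
    qed
    finally have le: "(\<integral>\<^sup>+x. ennreal ((f n x - g x)\<^sup>2) \<partial>lebesgue) \<le> ennreal (e\<^sup>2)" .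
    have i: "integrable lebesgue (\<lambda>x. (f n x - g x)\<^sup>2)"
      unfolding integrable_iff_bounded using borel_measurable_power[OF dm] le by (auto intro: le_less_trans)
    then have L: "L2 (\<lambda>x. f n x - g x)" using dm by (simp add: L2_def)
    have "(n2 (\<lambda>x. f n x - g x))\<^sup>2 \<le> e\<^sup>2" using le sq_le_nn[OF L] by simp
    then show ?thesis using L e by (auto intro: power2_le_imp_le)
  qed
  obtain N1 where N1: "\<And>m n. m \<ge> N1 \<Longrightarrow> n \<ge> N1 \<Longrightarrow> n2 (\<lambda>x. f m x - f n x) < 1" using C[of 1] by auto
  have "L2 (\<lambda>x. f N1 x - (f N1 x - g x))" 
    using L2_diff[OF f, of "\<lambda>x. f N1 x - g x" N1] est[of 1 N1 N1] N1 by (simp add: less_imp_le)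
  then have g2: "L2 g" by simp
  have "(\<lambda>n. n2 (\<lambda>x. f n x - g x)) \<longlonglongrightarrow> 0"
  proof (rule LIMSEQ_I)
    fix e :: real assume e: "e > 0"
    obtain N where N: "\<And>m n. m \<ge> N \<Longrightarrow> n \<ge> N \<Longrightarrow> n2 (\<lambda>x. f m x - f n x) < e / 2" using C[of "e/2"] e by auto
    have "n2 (\<lambda>x. f n x - g x) < e" if "n \<ge> N" for n
      using est[of "e/2" N n] N e that by force
    then show "\<exists>no. \<forall>n\<ge>no. norm (n2 (\<lambda>x. f n x - g x) - 0) < e" by auto
  qed
  then show ?thesis using that g2 by blast
qed

section \<open>Elements of the completion and their weak Laplacian\<close>

text \<open>Splitting at the height \<open>t\<close> takes the place of Hoelder's inequality: below
  \<open>t\<close> the bound is trivial, and above it the p-th power dominates.\<close>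

lemma le_add_powr:
  fixes a p t :: real
  assumes "a \<ge> 0" "p \<ge> 1" "t > 0" shows "a \<le> t + a powr p * t powr (1 - p)"
proof (cases "a \<le> t")
  case True then show ?thesis by (smt (verit) powr_ge_zero mult_nonneg_nonneg)
next
  case False
  then have a: "a > t" by simp
  have "a powr 1 = a powr p * a powr (1 - p)" by (simp flip: powr_add)
  also have "a powr (1 - p) \<le> t powr (1 - p)" using a assms by (intro powr_mono2') auto
  finally have "a powr 1 \<le> a powr p * t powr (1 - p)" by (simp add: mult_left_mono)
  then show ?thesis using a assms by simp
qed

lemma powr_diff_le:
  fixes a b p :: real
  assumes "p \<ge> 1" shows "\<bar>a - b\<bar> powr p \<le> 2 powr p * (\<bar>a\<bar> powr p + \<bar>b\<bar> powr p)"
proof -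
  have "\<bar>a - b\<bar> powr p \<le> (2 * max \<bar>a\<bar> \<bar>b\<bar>) powr p" using assms by (intro powr_mono2) auto
  also have "\<dots> = 2 powr p * (max \<bar>a\<bar> \<bar>b\<bar>) powr p" by (simp add: powr_mult)
  also have "\<dots> \<le> 2 powr p * (\<bar>a\<bar> powr p + \<bar>b\<bar> powr p)" by (intro mult_left_mono) (auto simp: max_def)
  finally show ?thesis .
qed

lemma Lp_UNIV_iff: "u \<in> Lp p UNIV \<longleftrightarrow> u \<in> borel_measurable lebesgue \<and> integrable lebesgue (\<lambda>x. \<bar>u x\<bar> powr p)"
  by (simp add: Lp_def lebesgue_on_UNIV_eq)

lemma Lp_locally_integrable:
  fixes u :: "'a::euclidean_space \<Rightarrow> real"
  assumes "u \<in> Lp p UNIV" "p \<ge> 1" shows "locally_integrable_on u S"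
  unfolding locally_integrable_on_def set_integrable_def
proof safe
  fix C :: "'a set" assume C: "compact C"
  have Cm: "C \<in> sets lebesgue" using lmeasurable_compact[OF C] by auto
  have um: "u \<in> borel_measurable lebesgue" and i: "integrable lebesgue (\<lambda>x. \<bar>u x\<bar> powr p)" using assms by (auto simp: Lp_UNIV_iff)
  show "integrable lebesgue (\<lambda>x. indicat_real C x *\<^sub>R u x)"
  proof (rule Bochner_Integration.integrable_bound)
    show "integrable lebesgue (\<lambda>x. indicat_real C x + \<bar>u x\<bar> powr p)"
      using integrable_indicator_compact[OF C] i by auto
    show "(\<lambda>x. indicat_real C x *\<^sub>R u x) \<in> borel_measurable lebesgue"
      unfolding real_scaleR_def using Cm um by (intro borel_measurable_times borel_measurable_indicator)
    show "AE x in lebesgue. norm (indicat_real C x *\<^sub>R u x) \<le> norm (indicat_real C x + \<bar>u x\<bar> powr p)"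
      using le_add_powr[OF abs_ge_zero assms(2), of 1] by (intro AE_I2) (auto simp: indicator_def)
  qed
qed

lemma Lp_test: 
  assumes "\<phi> \<in> test_functions S" "p > 0" shows "\<phi> \<in> Lp p UNIV"
proof -
  obtain C where C: "compact C" "\<And>x. x \<notin> C \<Longrightarrow> \<phi> x = 0" using test_functionsE[OF assms(1)] by metis
  have c: "continuous_on UNIV \<phi>" by (rule smooth_continuous[OF test_smooth[OF assms(1)]])
  have "continuous_on UNIV (\<lambda>x. \<bar>\<phi> x\<bar> powr p)" using assms(2) by (intro continuous_on_powr' continuous_intros c) auto
  then show ?thesis unfolding Lp_UNIV_iff
    using continuous_lebesgue_measurable[OF c] integrable_continuous_compact_support[OF _ C(1), of "\<lambda>x. \<bar>\<phi> x\<bar> powr p"] C(2) assms(2)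
    by auto
qed

text \<open>On the support of \<open>\<xi>\<close> the error is at most a multiple of
  \<open>t\<close> plus a multiple, depending on \<open>t\<close>, of the integral of the p-th
  power; \<open>t\<close> is chosen small first and \<open>n\<close> large afterwards.\<close>

lemma Lp_tendsto_test:
  fixes u :: "'a::euclidean_space \<Rightarrow> real"
  assumes u: "u \<in> Lp p UNIV" and p: "p \<ge> 1" and \<phi>: "\<And>n. \<phi> n \<in> test_functions UNIV"
    and l: "(\<lambda>n. Lp_norm p UNIV (\<lambda>x. \<phi> n x - u x)) \<longlonglongrightarrow> 0" and \<xi>: "\<xi> \<in> test_functions UNIV"
  shows "(\<lambda>n. LINT x|lebesgue. \<phi> n x * \<xi> x) \<longlonglongrightarrow> (LINT x|lebesgue. u x * \<xi> x)"
proof -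
  define I where "I = (\<lambda>n. LINT x|lebesgue. \<bar>\<phi> n x - u x\<bar> powr p)"
  have I0: "I n \<ge> 0" for n by (simp add: I_def)
  have um: "u \<in> borel_measurable lebesgue" and ui: "integrable lebesgue (\<lambda>x. \<bar>u x\<bar> powr p)" using u by (auto simp: Lp_UNIV_iff)
  have \<phi>m: "\<phi> n \<in> borel_measurable lebesgue" and \<phi>i: "integrable lebesgue (\<lambda>x. \<bar>\<phi> n x\<bar> powr p)" for n
    using Lp_test[OF \<phi>[of n], of p] p by (auto simp: Lp_UNIV_iff)
  have di: "integrable lebesgue (\<lambda>x. \<bar>\<phi> n x - u x\<bar> powr p)" for n
  proof (rule Bochner_Integration.integrable_bound)
    show "integrable lebesgue (\<lambda>x. 2 powr p * (\<bar>\<phi> n x\<bar> powr p + \<bar>u x\<bar> powr p))" using ui \<phi>i[of n] by auto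
    show "(\<lambda>x. \<bar>\<phi> n x - u x\<bar> powr p) \<in> borel_measurable lebesgue" using um \<phi>m[of n] by measurable
    show "AE x in lebesgue. norm (\<bar>\<phi> n x - u x\<bar> powr p) \<le> norm (2 powr p * (\<bar>\<phi> n x\<bar> powr p + \<bar>u x\<bar> powr p))"
      using powr_diff_le[OF p] by (intro AE_I2) auto
  qed
  have "(\<lambda>n. I n powr (1/p)) \<longlonglongrightarrow> 0" using l by (simp add: Lp_norm_def lebesgue_on_UNIV_eq I_def)
  then have "(\<lambda>n. (I n powr (1/p)) powr p) \<longlonglongrightarrow> 0"
    using p by (intro tendsto_zero_powrI[of "\<lambda>n. I n powr (1/p)" _ "\<lambda>_. p" p]) auto
  moreover have "(I n powr (1/p)) powr p = I n" for n using I0[of n] p by (simp add: powr_powr)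
  ultimately have Il: "I \<longlonglongrightarrow> 0" by simp
  obtain C where C: "compact C" "\<And>x. x \<notin> C \<Longrightarrow> \<xi> x = 0" using test_functionsE[OF \<xi>] by metis
  obtain B where B: "B > 0" "\<And>x. \<bar>\<xi> x\<bar> \<le> B" using test_bounded[OF \<xi>] by metis
  have \<phi>\<xi>: "integrable lebesgue (\<lambda>x. \<phi> n x * \<xi> x)" for n
    by (rule L2_mult_integrable[OF L2_test[OF \<phi>] L2_test[OF \<xi>]])
  have u\<xi>: "integrable lebesgue (\<lambda>x. u x * \<xi> x)"
    by (rule locally_integrable_test_integrable[OF Lp_locally_integrable[OF u p] \<xi>])
  have est: "\<bar>(LINT x|lebesgue. \<phi> n x * \<xi> x) - (LINT x|lebesgue. u x * \<xi> x)\<bar> \<le> B * (t * measure lebesgue C + t powr (1 - p) * I n)"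
    if t: "t > 0" for t n
  proof -
    have iC: "integrable lebesgue (indicator C :: 'a \<Rightarrow> real)" by (rule integrable_indicator_compact[OF C(1)])
    have "(LINT x|lebesgue. \<phi> n x * \<xi> x) - (LINT x|lebesgue. u x * \<xi> x) = (LINT x|lebesgue. (\<phi> n x - u x) * \<xi> x)"
      using \<phi>\<xi>[of n] u\<xi> by (simp add: left_diff_distrib)
    then have "\<bar>(LINT x|lebesgue. \<phi> n x * \<xi> x) - (LINT x|lebesgue. u x * \<xi> x)\<bar> \<le> (LINT x|lebesgue. \<bar>(\<phi> n x - u x) * \<xi> x\<bar>)"
      by (simp only: integral_abs_bound)
    also have "\<dots> \<le> (LINT x|lebesgue. B * (t * indicator C x + t powr (1 - p) * \<bar>\<phi> n x - u x\<bar> powr p))"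
    proof (rule integral_mono)
      show "integrable lebesgue (\<lambda>x. \<bar>(\<phi> n x - u x) * \<xi> x\<bar>)"
        using \<phi>\<xi>[of n] u\<xi> by (auto simp: left_diff_distrib)
      show "integrable lebesgue (\<lambda>x. B * (t * indicator C x + t powr (1 - p) * \<bar>\<phi> n x - u x\<bar> powr p))"
        using iC di[of n] by auto
      fix x
      show "\<bar>(\<phi> n x - u x) * \<xi> x\<bar> \<le> B * (t * indicator C x + t powr (1 - p) * \<bar>\<phi> n x - u x\<bar> powr p)"
      proof (cases "x \<in> C")
        case True
        have "\<bar>(\<phi> n x - u x) * \<xi> x\<bar> \<le> (t + \<bar>\<phi> n x - u x\<bar> powr p * t powr (1 - p)) * B"
          unfolding abs_mult by (intro mult_mono le_add_powr B t p) (use t in auto)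
        then show ?thesis using True by (simp add: mult.commute)
      qed (use B C in auto)
    qed
    also have "\<dots> = B * (t * measure lebesgue C + t powr (1 - p) * I n)" using iC di[of n] by (simp add: I_def)
    finally show ?thesis .
  qed
  show ?thesis
  proof (rule LIMSEQ_I)
    fix e :: real assume e: "e > 0"
    define mC where "mC = measure lebesgue C"
    define t where "t = e / (2 * B * (mC + 1))"
    have mC: "mC \<ge> 0" by (simp add: mC_def)
    have t: "t > 0" using e B mC by (simp add: t_def)
    have "B * (t * mC) < e / 2 + 0" 
    proof -
      have "mC + 1 \<noteq> 0" "B \<noteq> 0" using B mC by auto
      then have "B * (t * mC) = e / 2 * (mC / (mC + 1))" unfolding t_def by (simp add: divide_simps)
      also have "\<dots> < e / 2 * 1" using e mC by (intro mult_strict_left_mono) auto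
      finally show ?thesis by simp
    qed
    have "(\<lambda>n. B * (t powr (1 - p) * I n)) \<longlonglongrightarrow> B * (t powr (1 - p) * 0)" by (intro tendsto_intros Il)
    then have "\<forall>\<^sub>F n in sequentially. B * (t powr (1 - p) * I n) < e / 2" using e by (intro order_tendstoD(2)) auto
    then obtain N where N: "\<And>n. n \<ge> N \<Longrightarrow> B * (t powr (1 - p) * I n) < e / 2" by (auto simp: eventually_sequentially)
    have "norm ((LINT x|lebesgue. \<phi> n x * \<xi> x) - (LINT x|lebesgue. u x * \<xi> x)) < e" if "n \<ge> N" for n
      using est[OF t, of n] N[OF that] \<open>B * (t * mC) < e / 2 + 0\<close> by (simp add: distrib_left mC_def)
    then show "\<exists>no. \<forall>n\<ge>no. norm ((LINT x|lebesgue. \<phi> n x * \<xi> x) - (LINT x|lebesgue. u x * \<xi> x)) < e" by blast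
  qed
qed

text \<open>The Laplacians of the approximating test functions converge in L^2 by completeness, and
  convergence of the functions in the other Lebesgue space identifies the limit as the weak
  Laplacian of \<open>f\<close>.\<close>

lemma D22_wlap:
  assumes f: "f \<in> (D22 :: ('a::euclidean_space \<Rightarrow> real) set)" and N: "DIM('a) > 4"
  obtains L where "wlap f L"
proof -
  define p where "p = 2 * real DIM('a) / (real DIM('a) - 4)"
  have p: "p \<ge> 1" using N by (simp add: p_def field_simps)
  obtain \<phi> where fL: "f \<in> Lp p UNIV" and \<phi>: "\<And>n. \<phi> n \<in> test_functions UNIV"
    and C: "\<And>e. e > 0 \<Longrightarrow> \<exists>M. \<forall>m\<ge>M. \<forall>n\<ge>M. Lp_norm 2 UNIV (laplacian (\<lambda>x. \<phi> m x - \<phi> n x)) < e"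
    and l: "(\<lambda>n. Lp_norm p UNIV (\<lambda>x. \<phi> n x - f x)) \<longlonglongrightarrow> 0"
    using f unfolding D22_def Let_def p_def[symmetric] mem_Collect_eq by blast
  have lapd: "laplacian (\<lambda>x. \<phi> m x - \<phi> n x) = (\<lambda>x. laplacian (\<phi> m) x - laplacian (\<phi> n) x)" for m n
  proof -
    note s = test_smooth[OF \<phi>]
    have 1: "dir_deriv b (\<lambda>x. \<phi> m x - \<phi> n x) = (\<lambda>x. dir_deriv b (\<phi> m) x - dir_deriv b (\<phi> n) x)" for b
      by (rule ext) (intro dir_deriv_diff smooth_differentiable s)
    have 2: "dir_deriv b (\<lambda>x. dir_deriv b (\<phi> m) x - dir_deriv b (\<phi> n) x) x = dir_deriv b (dir_deriv b (\<phi> m)) x - dir_deriv b (dir_deriv b (\<phi> n)) x" for b x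
      by (intro dir_deriv_diff smooth_differentiable smooth_dir_deriv s)
    show ?thesis unfolding laplacian_eq 1 2 by (simp add: sum_subtractf)
  qed
  have c: "\<exists>M. \<forall>m\<ge>M. \<forall>n\<ge>M. n2 (\<lambda>x. laplacian (\<phi> m) x - laplacian (\<phi> n) x) < e" if "e > 0" for e
    using C[OF that] unfolding Lp_norm_2 lapd .
  obtain L where L: "L2 L" "(\<lambda>n. n2 (\<lambda>x. laplacian (\<phi> n) x - L x)) \<longlonglongrightarrow> 0"
    by (rule L2_complete[of "\<lambda>n. laplacian (\<phi> n)", OF L2_test[OF test_laplacian[OF \<phi>]] c])
  have "(LINT x|lebesgue. f x * laplacian \<psi> x) = (LINT x|lebesgue. L x * \<psi> x)" if \<psi>: "\<psi> \<in> test_functions UNIV" for \<psi>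
  proof (rule LIMSEQ_unique)
    show "(\<lambda>n. LINT x|lebesgue. \<phi> n x * laplacian \<psi> x) \<longlonglongrightarrow> (LINT x|lebesgue. f x * laplacian \<psi> x)"
      by (rule Lp_tendsto_test[OF fL p \<phi> l test_laplacian[OF \<psi>]])
    have "(LINT x|lebesgue. \<phi> n x * laplacian \<psi> x) = (LINT x|lebesgue. laplacian (\<phi> n) x * \<psi> x)" for n
      using wlap_test[OF \<phi>[of n]] \<psi> by (simp add: wlap_def has_weak_laplacian_iff)
    then show "(\<lambda>n. LINT x|lebesgue. \<phi> n x * laplacian \<psi> x) \<longlonglongrightarrow> (LINT x|lebesgue. L x * \<psi> x)"
      using L2_tendsto_integral[OF L2_test[OF test_laplacian[OF \<phi>]] L(1) L2_test[OF \<psi>] L(2)] by simp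
  qed
  then have "wlap f L"
    using L Lp_locally_integrable[OF fL p] L2_locally_integrable[OF L(1)] by (simp add: wlap_def has_weak_laplacian_iff)
  then show ?thesis by (rule that)
qed

lemma lap_norm_zero: "lap_norm (\<lambda>x::'a::euclidean_space. 0) = 0"
proof -
  have "laplacian (\<lambda>x::'a. 0) = (\<lambda>x. 0)"
  proof -
    have "dir_deriv b (\<lambda>x. 0) = (\<lambda>x. 0)" for b :: 'a by (simp add: fun_eq_iff)
    then show ?thesis by (simp add: laplacian_eq)
  qed
  moreover have "wlap (\<lambda>x::'a. 0) (laplacian (\<lambda>x. 0))" by (rule wlap_test[OF test_zero])
  ultimately show ?thesis using wlap_lap_norm(2) by fastforce
qed

lemma D22_norm_eq: "D22_norm f = lap_norm f"
  by (simp add: D22_norm_def lap_norm_def Lp_norm_2)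

lemma test_D22:
  assumes "\<phi> \<in> test_functions UNIV" and N: "DIM('a::euclidean_space) > 4"
  shows "(\<phi> :: 'a \<Rightarrow> real) \<in> D22"
proof -
  define p where "p = 2 * real DIM('a) / (real DIM('a) - 4)"
  have p: "p > 0" using N by (simp add: p_def)
  have "laplacian (\<lambda>x::'a. 0) = (\<lambda>x. 0)"
  proof -
    have "dir_deriv b (\<lambda>x. 0) = (\<lambda>x. 0)" for b :: 'a by (simp add: fun_eq_iff)
    then show ?thesis by (simp add: laplacian_eq)
  qed
  then show ?thesis
    unfolding D22_def Let_def p_def[symmetric] mem_Collect_eq using assms Lp_test[OF assms(1) p]
    by (intro conjI exI[of _ "\<lambda>n. \<phi>"]) (auto simp: Lp_norm_2 Lp_norm_def)
qed

lemma test_D22_0: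
  assumes "\<phi> \<in> test_functions (- K)" and N: "DIM('a::euclidean_space) > 4"
  shows "(\<phi> :: 'a \<Rightarrow> real) \<in> D22_0 K"
  unfolding D22_0_def using assms test_D22[OF test_mono[OF assms(1)]]
  by (auto simp: D22_norm_eq lap_norm_zero intro!: bexI[of _ \<phi>])

lemma lap_energy: "(LINT x|lebesgue. (weak_laplacian UNIV f x)\<^sup>2) = (lap_norm f)\<^sup>2"
  by (simp add: lap_norm_def n2_sq)

lemma cap_space_le:
  fixes K :: "'a::euclidean_space set"
  assumes N: "DIM('a) > 4" and t: "(\<lambda>x. \<eta> x * U x) \<in> test_functions UNIV" and \<phi>: "\<phi> \<in> test_functions (- K)"
  shows "cap_space \<eta> K U \<le> (lap_norm (\<lambda>x. \<eta> x * U x + \<phi> x))\<^sup>2"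
  unfolding cap_space_def lap_energy
proof (rule cInf_lower)
  show "bdd_below {(lap_norm f)\<^sup>2 |f. f \<in> D22 \<and> (\<lambda>x. f x - \<eta> x * U x) \<in> D22_0 K}" by (rule bdd_belowI[of _ 0]) auto
  have "(\<lambda>x. \<eta> x * U x + \<phi> x) \<in> D22" by (intro test_D22 test_add t test_mono[OF \<phi>] N) auto
  moreover have "(\<lambda>x. (\<eta> x * U x + \<phi> x) - \<eta> x * U x) \<in> D22_0 K" using test_D22_0[OF \<phi> N] by simp
  ultimately show "(lap_norm (\<lambda>x. \<eta> x * U x + \<phi> x))\<^sup>2 \<in> {(lap_norm f)\<^sup>2 |f. f \<in> D22 \<and> (\<lambda>x. f x - \<eta> x * U x) \<in> D22_0 K}"
    by blast
qed

lemma cap_space_nonempty: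
  fixes K :: "'a::euclidean_space set"
  assumes N: "DIM('a) > 4" and t: "(\<lambda>x. \<eta> x * U x) \<in> test_functions UNIV"
  shows "{(lap_norm f)\<^sup>2 |f. f \<in> D22 \<and> (\<lambda>x. f x - \<eta> x * U x) \<in> D22_0 K} \<noteq> {}"
  using test_D22[OF t N] test_D22_0[OF test_zero N, of K] by (intro exI[of _ "\<lambda>x. \<eta> x * U x"] notI) auto

lemma cap_space_nonneg:
  fixes K :: "'a::euclidean_space set"
  assumes N: "DIM('a) > 4" and t: "(\<lambda>x. \<eta> x * U x) \<in> test_functions UNIV"
  shows "cap_space \<eta> K U \<ge> 0"
  unfolding cap_space_def lap_energy using cap_space_nonempty[OF N t] by (rule cInf_greatest) auto

text \<open>Test functions on the complement of \<open>K\<close> already compute the infimum, so the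
  later comparison concerns test functions only: \<open>f\<close> minus the small error made in
  approximating \<open>f - \<eta> U\<close> by \<open>\<phi>\<close> is
  \<open>\<eta> U + \<phi>\<close>.\<close>

lemma cap_space_approx:
  fixes K :: "'a::euclidean_space set"
  assumes N: "DIM('a) > 4" and t: "(\<lambda>x. \<eta> x * U x) \<in> test_functions UNIV" and e: "e > 0"
  obtains \<phi> where "\<phi> \<in> test_functions (- K)" "lap_norm (\<lambda>x. \<eta> x * U x + \<phi> x) \<le> sqrt (cap_space \<eta> K U) + e"
proof -
  let ?A = "{(lap_norm f)\<^sup>2 |f. f \<in> D22 \<and> (\<lambda>x. f x - \<eta> x * U x) \<in> D22_0 K}"
  let ?c = "sqrt (cap_space \<eta> K U)"
  have c0: "?c \<ge> 0" using cap_space_nonneg[OF N t, of K] by simp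
  have "Inf ?A < (?c + e / 2)\<^sup>2"
  proof -
    have "Inf ?A = ?c\<^sup>2" using cap_space_nonneg[OF N t, of K] by (simp add: cap_space_def lap_energy)
    also have "\<dots> < (?c + e / 2)\<^sup>2" using c0 e by (intro power_strict_mono) auto
    finally show ?thesis .
  qed
  then obtain f where f: "f \<in> D22" "(\<lambda>x. f x - \<eta> x * U x) \<in> D22_0 K" "(lap_norm f)\<^sup>2 < (?c + e / 2)\<^sup>2"
    using cInf_lessD[OF cap_space_nonempty[OF N t, of K]] by blast
  have fl: "lap_norm f < ?c + e / 2" using f(3) c0 e by (auto intro: power2_less_imp_less)
  have "\<exists>\<phi>\<in>test_functions (- K). D22_norm (\<lambda>x. (f x - \<eta> x * U x) - \<phi> x) < e / 2"
    using f(2) half_gt_zero[OF e] unfolding D22_0_def mem_Collect_eq by blast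
  then obtain \<phi> where \<phi>: "\<phi> \<in> test_functions (- K)" "lap_norm (\<lambda>x. (f x - \<eta> x * U x) - \<phi> x) < e / 2"
    by (auto simp: D22_norm_eq)
  obtain L where L: "wlap f L" by (rule D22_wlap[OF f(1) N])
  note w = wlap_diff[OF wlap_diff[OF L wlap_test[OF t]] wlap_test[OF \<phi>(1)]]
  have "lap_norm (\<lambda>x. f x - ((f x - \<eta> x * U x) - \<phi> x)) \<le> lap_norm f + lap_norm (\<lambda>x. (f x - \<eta> x * U x) - \<phi> x)"
    by (rule lap_norm_triangle(2)[OF L w])
  moreover have "(\<lambda>x. f x - ((f x - \<eta> x * U x) - \<phi> x)) = (\<lambda>x. \<eta> x * U x + \<phi> x)" by (simp add: fun_eq_iff)
  ultimately have "lap_norm (\<lambda>x. \<eta> x * U x + \<phi> x) \<le> ?c + e" using fl \<phi>(2) by simp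
  then show ?thesis using that \<phi>(1) by blast
qed

section \<open>Scaling\<close>

lemma lebesgue_scale:
  fixes f :: "'a::euclidean_space \<Rightarrow> real"
  assumes c: "c > 0" and f: "f \<in> borel_measurable lebesgue"
  shows "(\<lambda>x. f (c *\<^sub>R x)) \<in> borel_measurable lebesgue"
    and "integrable lebesgue (\<lambda>x. f (c *\<^sub>R x)) \<longleftrightarrow> integrable lebesgue f"
    and "(LINT x|lebesgue. f (c *\<^sub>R x)) = (LINT x|lebesgue. f x) / c ^ DIM('a)"
proof -
  have T: "(\<lambda>x::'a. c *\<^sub>R x) = (\<lambda>x. 0 + (\<Sum>j\<in>Basis. (c * (x \<bullet> j)) *\<^sub>R j))"
    by (simp add: fun_eq_iff euclidean_representation flip: scaleR_scaleR scaleR_sum_right)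
  have m: "(\<lambda>x::'a. c *\<^sub>R x) \<in> lebesgue \<rightarrow>\<^sub>M lebesgue"
    unfolding T using lebesgue_affine_measurable[of "\<lambda>_. c" 0] c by simp
  show fm: "(\<lambda>x. f (c *\<^sub>R x)) \<in> borel_measurable lebesgue" by (rule measurable_compose[OF m f])
  have d: "lebesgue = density (distr lebesgue lebesgue (\<lambda>x::'a. c *\<^sub>R x)) (\<lambda>_. ennreal (c ^ DIM('a)))"
    using lebesgue_affine_euclidean[of "\<lambda>_. c" "0::'a"] c unfolding T by (simp add: prod_constant)
  have fd: "f \<in> borel_measurable (distr lebesgue lebesgue (\<lambda>x::'a. c *\<^sub>R x))" using f by simp
  have "integrable lebesgue f = integrable (density (distr lebesgue lebesgue (\<lambda>x::'a. c *\<^sub>R x)) (\<lambda>_. ennreal (c ^ DIM('a)))) f"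
    by (subst d) simp
  also have "\<dots> = integrable (distr lebesgue lebesgue (\<lambda>x::'a. c *\<^sub>R x)) (\<lambda>x. c ^ DIM('a) * f x)"
    using c by (subst integrable_density[OF fd]) auto
  also have "\<dots> = integrable (distr lebesgue lebesgue (\<lambda>x::'a. c *\<^sub>R x)) f" using c by simp
  also have "\<dots> = integrable lebesgue (\<lambda>x. f (c *\<^sub>R x))" by (rule integrable_distr_eq[OF m f])
  finally show "integrable lebesgue (\<lambda>x. f (c *\<^sub>R x)) \<longleftrightarrow> integrable lebesgue f" by simp
  have "(LINT x|lebesgue. f x) = (LINT x|density (distr lebesgue lebesgue (\<lambda>x::'a. c *\<^sub>R x)) (\<lambda>_. ennreal (c ^ DIM('a))). f x)"
    by (subst d) simp
  also have "\<dots> = (LINT x|distr lebesgue lebesgue (\<lambda>x::'a. c *\<^sub>R x). c ^ DIM('a) * f x)"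
    using c by (subst integral_density[OF fd]) auto
  also have "\<dots> = c ^ DIM('a) * (LINT x|distr lebesgue lebesgue (\<lambda>x::'a. c *\<^sub>R x). f x)" by simp
  also have "\<dots> = c ^ DIM('a) * (LINT x|lebesgue. f (c *\<^sub>R x))" by (subst integral_distr[OF m f]) simp
  finally show "(LINT x|lebesgue. f (c *\<^sub>R x)) = (LINT x|lebesgue. f x) / c ^ DIM('a)" using c by simp
qed

lemma L2_scale:
  fixes f :: "'a::euclidean_space \<Rightarrow> real"
  assumes "c > 0" "L2 f"
  shows "L2 (\<lambda>x. f (c *\<^sub>R x))" "(n2 (\<lambda>x. f (c *\<^sub>R x)))\<^sup>2 = (n2 f)\<^sup>2 / c ^ DIM('a)"
proof -
  have m: "(\<lambda>x. (f x)\<^sup>2) \<in> borel_measurable lebesgue" using L2_sq_integrable[OF assms(2)] by auto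
  show "L2 (\<lambda>x. f (c *\<^sub>R x))"
    using lebesgue_scale(1)[OF assms(1) L2_measurable[OF assms(2)]] lebesgue_scale(2)[OF assms(1) m] L2_sq_integrable[OF assms(2)]
    by (simp add: L2_def)
  show "(n2 (\<lambda>x. f (c *\<^sub>R x)))\<^sup>2 = (n2 f)\<^sup>2 / c ^ DIM('a)"
    unfolding n2_sq by (rule lebesgue_scale(3)[OF assms(1) m])
qed

lemma test_scale:
  fixes \<phi> :: "'a::euclidean_space \<Rightarrow> real"
  assumes "\<phi> \<in> test_functions S" "c > 0" "\<And>x. x \<in> S \<Longrightarrow> (1/c) *\<^sub>R x \<in> T"
  shows "(\<lambda>x. \<phi> (c *\<^sub>R x)) \<in> test_functions T"
proof -
  obtain C where C: "compact C" "C \<subseteq> S" "\<And>x. x \<notin> C \<Longrightarrow> \<phi> x = 0" using test_functionsE[OF assms(1)] by metis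
  show ?thesis
  proof (rule test_functionsI)
    show "smooth (\<lambda>x. \<phi> (c *\<^sub>R x))" using smooth_compose_affine[OF test_smooth[OF assms(1)], of c 0] by simp
    show "compact ((\<lambda>x. (1/c) *\<^sub>R x) ` C)" by (rule compact_scaling[OF C(1)])
    show "(\<lambda>x. (1/c) *\<^sub>R x) ` C \<subseteq> T" using C assms(3) by blast
    show "\<phi> (c *\<^sub>R x) = 0" if "x \<notin> (\<lambda>x. (1/c) *\<^sub>R x) ` C" for x
    proof (rule C(3))
      show "c *\<^sub>R x \<notin> C"
      proof
        assume "c *\<^sub>R x \<in> C"
        then have "(1/c) *\<^sub>R (c *\<^sub>R x) \<in> (\<lambda>x. (1/c) *\<^sub>R x) ` C" by blast
        then show False using that assms(2) by simp
      qed
    qed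
  qed
qed

lemma dir_deriv_scale:
  fixes f :: "'a::euclidean_space \<Rightarrow> real"
  assumes "smooth f" shows "dir_deriv e (\<lambda>x. f (c *\<^sub>R x)) = (\<lambda>x. c * dir_deriv e f (c *\<^sub>R x))"
  using dir_deriv_affine[of f c _ 0 e] smooth_differentiable[OF assms] by (simp add: fun_eq_iff)

lemma smooth_scale: "smooth f \<Longrightarrow> smooth (\<lambda>x. f (c *\<^sub>R x))"
  using smooth_compose_affine[of f c 0] by simp

lemma dir_deriv2_scale:
  fixes f :: "'a::euclidean_space \<Rightarrow> real"
  assumes "smooth f" shows "dir_deriv e' (dir_deriv e (\<lambda>x. f (c *\<^sub>R x))) = (\<lambda>x. c\<^sup>2 * dir_deriv e' (dir_deriv e f) (c *\<^sub>R x))"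
proof
  fix x
  have "dir_deriv e' (\<lambda>x. c * dir_deriv e f (c *\<^sub>R x)) x = c * dir_deriv e' (\<lambda>x. dir_deriv e f (c *\<^sub>R x)) x"
    by (intro dir_deriv_cmult smooth_differentiable smooth_scale smooth_dir_deriv assms)
  then show "dir_deriv e' (dir_deriv e (\<lambda>x. f (c *\<^sub>R x))) x = c\<^sup>2 * dir_deriv e' (dir_deriv e f) (c *\<^sub>R x)"
    by (simp add: dir_deriv_scale assms smooth_dir_deriv power2_eq_square)
qed

lemma laplacian_scale:
  fixes f :: "'a::euclidean_space \<Rightarrow> real"
  assumes "smooth f" shows "laplacian (\<lambda>x. f (c *\<^sub>R x)) = (\<lambda>x. c\<^sup>2 * laplacian f (c *\<^sub>R x))"
  unfolding laplacian_eq dir_deriv2_scale[OF assms] by (simp add: sum_distrib_left)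

lemma wlap_scale:
  fixes F :: "'a::euclidean_space \<Rightarrow> real"
  assumes c: "c > 0" and w: "wlap F L" and F: "L2 F"
  shows "wlap (\<lambda>x. F (c *\<^sub>R x)) (\<lambda>x. c\<^sup>2 * L (c *\<^sub>R x))"
proof -
  have L: "L2 L" using w by (simp add: wlap_def)
  have "(LINT x|lebesgue. F (c *\<^sub>R x) * laplacian \<phi> x) = (LINT x|lebesgue. (c\<^sup>2 * L (c *\<^sub>R x)) * \<phi> x)"
    if \<phi>: "\<phi> \<in> test_functions UNIV" for \<phi>
  proof -
    define \<psi> where "\<psi> = (\<lambda>x. \<phi> ((1/c) *\<^sub>R x))"
    have \<psi>: "\<psi> \<in> test_functions UNIV" unfolding \<psi>_def by (rule test_scale[OF \<phi>]) (use c in auto)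
    have \<phi>e: "\<phi> = (\<lambda>x. \<psi> (c *\<^sub>R x))" using c by (simp add: \<psi>_def)
    have 1: "(LINT x|lebesgue. G (c *\<^sub>R x) * \<xi> (c *\<^sub>R x)) = (LINT x|lebesgue. G x * \<xi> x) / c ^ DIM('a)"
      if "L2 G" "\<xi> \<in> test_functions UNIV" for G \<xi> :: "'a \<Rightarrow> real"
      using lebesgue_scale(3)[OF c, of "\<lambda>x. G x * \<xi> x"] L2_mult_integrable[OF that(1) L2_test[OF that(2)]] by auto
    have "(LINT x|lebesgue. F (c *\<^sub>R x) * laplacian \<phi> x) = c\<^sup>2 * (LINT x|lebesgue. F (c *\<^sub>R x) * laplacian \<psi> (c *\<^sub>R x))"
      unfolding \<phi>e laplacian_scale[OF test_smooth[OF \<psi>]]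
      by (simp only: mult.left_commute[of _ "c\<^sup>2"] integral_mult_right_zero)
    also have "\<dots> = c\<^sup>2 * ((LINT x|lebesgue. F x * laplacian \<psi> x) / c ^ DIM('a))"
      by (simp add: 1[OF F test_laplacian[OF \<psi>]])
    also have "(LINT x|lebesgue. F x * laplacian \<psi> x) = (LINT x|lebesgue. L x * \<psi> x)"
      using w \<psi> by (simp add: wlap_def has_weak_laplacian_iff)
    also have "c\<^sup>2 * ((LINT x|lebesgue. L x * \<psi> x) / c ^ DIM('a)) = (LINT x|lebesgue. (c\<^sup>2 * L (c *\<^sub>R x)) * \<phi> x)"
      unfolding \<phi>e by (simp add: mult.assoc flip: 1[OF L \<psi>])
    finally show ?thesis .
  qed
  then show ?thesis
    using L2_locally_integrable[OF L2_scale(1)[OF c F]] L2_locally_integrable[OF L2_cmult[OF L2_scale(1)[OF c L]]] L2_cmult[OF L2_scale(1)[OF c L]]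
    by (simp add: wlap_def has_weak_laplacian_iff)
qed

text \<open>In the squared norm of the rescaled function two derivatives contribute
  \<open>c ^ 4\<close>, while the change of variables divides by \<open>c ^ DIM('a)\<close> and the
  normalisation by \<open>c ^ (2 * \<gamma>)\<close>.\<close>

lemma lap_norm_scale:
  fixes F :: "'a::euclidean_space \<Rightarrow> real"
  assumes c: "c > 0" and w: "wlap F L" and F: "L2 F" and N: "DIM('a) \<ge> 4"
  shows "(lap_norm F)\<^sup>2 = c ^ (DIM('a) - 4 + 2 * \<gamma>) * (lap_norm (\<lambda>x. F (c *\<^sub>R x) / c ^ \<gamma>))\<^sup>2"
    and "\<exists>M. wlap (\<lambda>x. F (c *\<^sub>R x) / c ^ \<gamma>) M"
proof -
  note s = wlap_cmult[OF wlap_scale[OF c w F], of "inverse (c ^ \<gamma>)"]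
  have e: "(\<lambda>x. inverse (c ^ \<gamma>) * F (c *\<^sub>R x)) = (\<lambda>x. F (c *\<^sub>R x) / c ^ \<gamma>)" by (simp add: divide_inverse mult.commute)
  show "\<exists>M. wlap (\<lambda>x. F (c *\<^sub>R x) / c ^ \<gamma>) M" using s unfolding e by blast
  have L: "L2 L" using w by (simp add: wlap_def)
  have "lap_norm (\<lambda>x. F (c *\<^sub>R x) / c ^ \<gamma>) = inverse (c ^ \<gamma>) * (c\<^sup>2 * n2 (\<lambda>x. L (c *\<^sub>R x)))"
    using wlap_lap_norm(2)[OF s] c unfolding e by (simp add: n2_cmult abs_mult)
  then have "(lap_norm (\<lambda>x. F (c *\<^sub>R x) / c ^ \<gamma>))\<^sup>2 = inverse (c ^ (2 * \<gamma>)) * (c ^ 4 * ((n2 L)\<^sup>2 / c ^ DIM('a)))"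
    using L2_scale(2)[OF c L] by (simp add: power_mult_distrib power_inverse flip: power_mult) (simp add: mult.commute)
  then have "c ^ (DIM('a) - 4 + 2 * \<gamma>) * (lap_norm (\<lambda>x. F (c *\<^sub>R x) / c ^ \<gamma>))\<^sup>2 =
      (c ^ (DIM('a) - 4) * c ^ 4 / c ^ DIM('a)) * (c ^ (2 * \<gamma>) * inverse (c ^ (2 * \<gamma>))) * (n2 L)\<^sup>2"
    by (simp add: power_add field_simps)
  also have "c ^ (DIM('a) - 4) * c ^ 4 = c ^ DIM('a)" using N by (simp flip: power_add)
  finally show "(lap_norm F)\<^sup>2 = c ^ (DIM('a) - 4 + 2 * \<gamma>) * (lap_norm (\<lambda>x. F (c *\<^sub>R x) / c ^ \<gamma>))\<^sup>2"
    using c wlap_lap_norm(2)[OF w] by simp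
qed

section \<open>A Hardy inequality under Navier boundary conditions\<close>

text \<open>A regularised inverse square of the norm. For positive \<delta> the weight and those of
  its derivatives that occur are bounded, so all products stay square integrable; the constants in
  the resulting inequality are independent of \<delta>.\<close>

locale hardy_weight =
  fixes \<delta> :: real and \<omega> :: "'a::euclidean_space \<Rightarrow> real"
  assumes pos: "\<delta> > 0" and omega: "\<omega> = (\<lambda>x. inverse (x \<bullet> x + \<delta>\<^sup>2))"
begin

definition s :: "'a \<Rightarrow> real" where "s x = x \<bullet> x + \<delta>\<^sup>2"

lemma s_pos: "s x > 0" and s_ge: "s x \<ge> \<delta>\<^sup>2" using pos by (auto simp: s_def add_nonneg_pos)

lemma smooth_s: "smooth s" unfolding s_def[abs_def] by (intro smooth_add smooth_norm_sq smooth_const)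

lemma omega_s: "\<omega> x = inverse (s x)" by (simp add: omega s_def)

lemma smooth_omega: "smooth \<omega>"
proof -
  have "\<omega> = (\<lambda>x. inverse (s x))" by (simp add: omega_s fun_eq_iff)
  moreover have "smooth (\<lambda>x. inverse (s x))"
    by (rule smooth_inverse[OF smooth_s]) (metis less_irrefl s_pos)
  ultimately show ?thesis by simp
qed

lemma omega_pos: "\<omega> x > 0" using s_pos by (simp add: omega_s)

lemma omega_le: "\<omega> x \<le> 1 / \<delta>\<^sup>2" unfolding omega_s using s_ge pos by (simp add: inverse_eq_divide frac_le)

lemma dir_deriv_s: "dir_deriv b s x = 2 * (x \<bullet> b)"
proof (rule dir_deriv_eqI)
  have "((\<lambda>x. x \<bullet> x + \<delta>\<^sup>2) has_derivative (\<lambda>h. x \<bullet> h + h \<bullet> x + 0)) (at x)"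
    by (auto intro!: derivative_eq_intros)
  moreover have "(\<lambda>h. x \<bullet> h + h \<bullet> x + 0) = (\<lambda>h. 2 * (x \<bullet> h))" by (simp add: inner_commute fun_eq_iff)
  ultimately show "(s has_derivative (\<lambda>h. 2 * (x \<bullet> h))) (at x)" by (simp add: s_def[abs_def])
qed

lemma dir_deriv_omega: "dir_deriv b \<omega> = (\<lambda>x. - 2 * ((x \<bullet> b) * (\<omega> x * \<omega> x)))"
proof
  fix x
  have "((\<lambda>t. inverse t) has_real_derivative - (inverse (s x) * inverse (s x))) (at (s x))"
    using s_pos[of x] by (auto intro!: derivative_eq_intros simp: power2_eq_square)
  from dir_deriv_compose_real[OF smooth_differentiable[OF smooth_s] this, of b]
  have "dir_deriv b (\<lambda>x. inverse (s x)) x = - (inverse (s x) * inverse (s x)) * dir_deriv b s x" .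
  moreover have "\<omega> = (\<lambda>x. inverse (s x))" by (simp add: omega_s fun_eq_iff)
  ultimately show "dir_deriv b \<omega> x = - 2 * ((x \<bullet> b) * (\<omega> x * \<omega> x))" by (simp add: dir_deriv_s)
qed

lemma dir_deriv2_omega:
  assumes "b \<in> Basis"
  shows "dir_deriv b (dir_deriv b \<omega>) x = - 2 * (\<omega> x)\<^sup>2 + 8 * ((x \<bullet> b)\<^sup>2 * (\<omega> x) ^ 3)"
proof -
  note so = smooth_differentiable[OF smooth_omega]
  have d0: "dir_deriv b (\<lambda>x. x \<bullet> b) x = 1"
    using dir_deriv_linear[OF bounded_linear_inner_left[of b], of b x] assms by (simp add: inner_Basis)
  have d1: "dir_deriv b (\<lambda>x. \<omega> x * \<omega> x) x = 2 * \<omega> x * dir_deriv b \<omega> x"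
    by (subst dir_deriv_mult[OF so so]) simp
  have d2: "dir_deriv b (\<lambda>x. (x \<bullet> b) * (\<omega> x * \<omega> x)) x = (x \<bullet> b) * (2 * \<omega> x * dir_deriv b \<omega> x) + 1 * (\<omega> x * \<omega> x)"
    by (subst dir_deriv_mult) (auto simp: d0 d1 intro!: smooth_differentiable smooth_inner_left smooth_mult smooth_omega)
  have "dir_deriv b (dir_deriv b \<omega>) x = -2 * dir_deriv b (\<lambda>x. (x \<bullet> b) * (\<omega> x * \<omega> x)) x"
    unfolding dir_deriv_omega[of b]
    by (rule dir_deriv_cmult) (intro smooth_differentiable smooth_inner_left smooth_mult smooth_omega)
  also have "\<dots> = - 2 * (\<omega> x)\<^sup>2 + 8 * ((x \<bullet> b)\<^sup>2 * (\<omega> x) ^ 3)"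
    unfolding d2 dir_deriv_omega by (simp add: power2_eq_square power3_eq_cube algebra_simps)
  finally show ?thesis .
qed

text \<open>With w = \<open>\<omega> x\<close> the Laplacian is -2 N w^2 + 8 |x|^2 w^3, and |x|^2 w
  is at most 1, which leaves -2 (N - 4) w^2 as an upper bound.\<close>

lemma laplacian_omega: "- (\<Sum>b\<in>Basis. dir_deriv b (dir_deriv b \<omega>) x) \<ge> 2 * (real DIM('a) - 4) * (\<omega> x)\<^sup>2"
proof -
  have "(\<Sum>b\<in>Basis. dir_deriv b (dir_deriv b \<omega>) x) = (\<Sum>b\<in>Basis. - 2 * (\<omega> x)\<^sup>2 + 8 * ((x \<bullet> b)\<^sup>2 * (\<omega> x) ^ 3))"
    by (intro sum.cong refl dir_deriv2_omega)
  also have "\<dots> = - 2 * real DIM('a) * (\<omega> x)\<^sup>2 + 8 * (\<omega> x) ^ 3 * (\<Sum>b\<in>Basis. (x \<bullet> b)\<^sup>2)"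
    by (simp add: sum.distrib sum_subtractf sum_distrib_left mult_ac)
  also have "(\<Sum>b\<in>Basis. (x \<bullet> b)\<^sup>2) = x \<bullet> x" by (simp add: euclidean_inner[of x x] power2_eq_square)
  finally have e: "(\<Sum>b\<in>Basis. dir_deriv b (dir_deriv b \<omega>) x) = - 2 * real DIM('a) * (\<omega> x)\<^sup>2 + 8 * (\<omega> x) ^ 3 * (x \<bullet> x)" .
  have "\<omega> x * (x \<bullet> x) \<le> 1"
    using s_pos[of x] by (simp add: omega_s s_def inverse_eq_divide divide_le_eq)
  then have "(\<omega> x)\<^sup>2 * (\<omega> x * (x \<bullet> x)) \<le> (\<omega> x)\<^sup>2 * 1" by (rule mult_left_mono) simp
  then have "(\<omega> x) ^ 3 * (x \<bullet> x) \<le> (\<omega> x)\<^sup>2" by (simp add: power2_eq_square power3_eq_cube mult_ac)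
  then show ?thesis unfolding e by (simp add: algebra_simps)
qed

lemma inner_sq_le: "b \<in> Basis \<Longrightarrow> (x \<bullet> b)\<^sup>2 * \<omega> x \<le> 1"
proof -
  assume b: "b \<in> Basis"
  have "(x \<bullet> b)\<^sup>2 \<le> x \<bullet> x"
    using power_mono[OF Basis_le_norm[OF b, of x], of 2] by (simp add: dot_square_norm)
  then have "(x \<bullet> b)\<^sup>2 \<le> s x" unfolding s_def using zero_le_power2[of \<delta>] by linarith
  then show "(x \<bullet> b)\<^sup>2 * \<omega> x \<le> 1" using s_pos[of x] by (simp add: omega_s inverse_eq_divide divide_le_eq)
qed

lemma dd_omega_bounded: "b \<in> Basis \<Longrightarrow> \<exists>B. \<forall>x. \<bar>dir_deriv b \<omega> x\<bar> \<le> B"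
proof -
  assume b: "b \<in> Basis"
  have "\<bar>dir_deriv b \<omega> x\<bar> \<le> 2 * ((1 / \<delta>\<^sup>2 + 1) * (1 / \<delta>\<^sup>2))" for x
  proof -
    have "\<bar>x \<bullet> b\<bar> \<le> 1 + (x \<bullet> b)\<^sup>2"
      using sum_squares_bound[of "\<bar>x \<bullet> b\<bar>" 1] by simp
    then have "\<bar>x \<bullet> b\<bar> * \<omega> x \<le> (1 + (x \<bullet> b)\<^sup>2) * \<omega> x" using omega_pos[of x] by (intro mult_right_mono) auto
    also have "\<dots> \<le> 1 / \<delta>\<^sup>2 + 1" using inner_sq_le[OF b, of x] omega_le[of x] by (simp add: distrib_right)
    finally have "(\<bar>x \<bullet> b\<bar> * \<omega> x) * \<omega> x \<le> (1 / \<delta>\<^sup>2 + 1) * (1 / \<delta>\<^sup>2)"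
      using omega_le[of x] omega_pos[of x] pos by (intro mult_mono) auto
    then have "2 * ((\<bar>x \<bullet> b\<bar> * \<omega> x) * \<omega> x) \<le> 2 * ((1 / \<delta>\<^sup>2 + 1) * (1 / \<delta>\<^sup>2))" by (rule mult_left_mono) simp
    moreover have "\<bar>dir_deriv b \<omega> x\<bar> = 2 * ((\<bar>x \<bullet> b\<bar> * \<omega> x) * \<omega> x)"
      unfolding dir_deriv_omega using omega_pos[of x] by (simp add: abs_mult mult.assoc)
    ultimately show ?thesis by (simp only:)
  qed
  then show ?thesis by blast
qed

lemma ddd_omega_bounded: "b \<in> Basis \<Longrightarrow> \<exists>B. \<forall>x. \<bar>dir_deriv b (dir_deriv b \<omega>) x\<bar> \<le> B"
proof -
  assume b: "b \<in> Basis"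
  have "\<bar>dir_deriv b (dir_deriv b \<omega>) x\<bar> \<le> 10 * (1 / \<delta>\<^sup>2)\<^sup>2" for x
  proof -
    have 1: "(\<omega> x)\<^sup>2 \<le> (1 / \<delta>\<^sup>2)\<^sup>2" using omega_le[of x] omega_pos[of x] by (intro power_mono) auto
    have "((x \<bullet> b)\<^sup>2 * \<omega> x) * (\<omega> x)\<^sup>2 \<le> 1 * (1 / \<delta>\<^sup>2)\<^sup>2" using inner_sq_le[OF b] 1 by (intro mult_mono) auto
    then have 2: "(x \<bullet> b)\<^sup>2 * (\<omega> x) ^ 3 \<le> (1 / \<delta>\<^sup>2)\<^sup>2" by (simp add: power3_eq_cube power2_eq_square mult_ac)
    have 3: "0 \<le> (x \<bullet> b)\<^sup>2 * (\<omega> x) ^ 3" using omega_pos[of x] by simp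
    show ?thesis unfolding dir_deriv2_omega[OF b] using 1 2 3 zero_le_power2[of "\<omega> x"] by linarith
  qed
  then show ?thesis by blast
qed

lemma L2_weights:
  assumes "L2 f"
  shows "L2 (\<lambda>x. \<omega> x * f x)" "b \<in> Basis \<Longrightarrow> L2 (\<lambda>x. dir_deriv b \<omega> x * f x)" "b \<in> Basis \<Longrightarrow> L2 (\<lambda>x. dir_deriv b (dir_deriv b \<omega>) x * f x)"
proof -
  have m: "L2 (\<lambda>x. g x * f x)" if "smooth g" "\<exists>B. \<forall>x. \<bar>g x\<bar> \<le> B" for g
    using L2_mult_bounded(1)[OF assms continuous_lebesgue_measurable[OF smooth_continuous[OF that(1)]]] that(2) by blast
  show "L2 (\<lambda>x. \<omega> x * f x)" using omega_le omega_pos by (intro m smooth_omega exI[of _ "1 / \<delta>\<^sup>2"]) (simp add: less_imp_le)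
  show "b \<in> Basis \<Longrightarrow> L2 (\<lambda>x. dir_deriv b \<omega> x * f x)" by (intro m smooth_dir_deriv smooth_omega dd_omega_bounded)
  show "b \<in> Basis \<Longrightarrow> L2 (\<lambda>x. dir_deriv b (dir_deriv b \<omega>) x * f x)"
    by (intro m smooth_dir_deriv smooth_omega ddd_omega_bounded)
qed

text \<open>Two integrations by parts in one direction. In both of them \<open>f\<close> is
  approximated by test functions, so there are no boundary terms although the derivatives of
  \<open>f\<close> need not vanish on the boundary.\<close>

lemma hardy_identity:
  assumes S: "open \<Omega>" and f: "f \<in> H10 \<Omega>" and H: "H2s \<Omega> (zext \<Omega> f) v w" and vz: "\<And>b x. x \<notin> \<Omega> \<Longrightarrow> v b x = 0" and b: "b \<in> Basis"
  shows "(LINT x|lebesgue. \<omega> x * (v b x)\<^sup>2) - 1/2 * (LINT x|lebesgue. dir_deriv b (dir_deriv b \<omega>) x * (zext \<Omega> f x)\<^sup>2) =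
    - (LINT x|lebesgue. \<omega> x * (w b b x * zext \<Omega> f x))"
proof -
  let ?F = "zext \<Omega> f"
  let ?o1 = "dir_deriv b \<omega>" and ?o2 = "dir_deriv b (dir_deriv b \<omega>)"
  note h = H2sD[OF H]
  obtain \<phi> where \<phi>: "\<And>n. \<phi> n \<in> test_functions \<Omega>" "(\<lambda>n. n2 (\<lambda>x. \<phi> n x - ?F x)) \<longlonglongrightarrow> 0"
    "\<And>v. wderiv \<Omega> b f v \<Longrightarrow> L2 (zext \<Omega> v) \<Longrightarrow> (\<lambda>n. n2 (\<lambda>x. dir_deriv b (\<phi> n) x - zext \<Omega> v x)) \<longlonglongrightarrow> 0"
    using H10_approx[OF S f] b by blast
  have zv: "zext \<Omega> (v b) = v b" by (rule zext_id) (rule vz)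
  have "wderiv \<Omega> b f (v b) = wderiv \<Omega> b ?F (v b)" by (rule wderiv_cong) auto
  then have \<phi>': "(\<lambda>n. n2 (\<lambda>x. dir_deriv b (\<phi> n) x - v b x)) \<longlonglongrightarrow> 0"
    using \<phi>(3)[of "v b"] h(2,3)[OF b] zv by simp
  have l0: "(\<lambda>n. LINT x|lebesgue. \<phi> n x * k x) \<longlonglongrightarrow> (LINT x|lebesgue. ?F x * k x)" if "L2 k" for k
    by (rule L2_tendsto_integral[OF L2_test[OF \<phi>(1)] h(1) that \<phi>(2)])
  have l1: "(\<lambda>n. LINT x|lebesgue. dir_deriv b (\<phi> n) x * k x) \<longlonglongrightarrow> (LINT x|lebesgue. v b x * k x)" if "L2 k" for k
    by (rule L2_tendsto_integral[OF L2_test[OF test_dir_deriv[OF \<phi>(1)]] h(2)[OF b] that \<phi>'])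
  \<comment> \<open>The weak derivative of \<open>g\<close> is tested with \<open>a\<close> times an
    approximant of \<open>f\<close>; square integrability of the three products permits the passage
    to the limit.\<close>
  have parts: "(LINT x|lebesgue. v b x * (a x * g x)) + (LINT x|lebesgue. ?F x * (dir_deriv b a x * g x)) = - (LINT x|lebesgue. ?F x * (a x * k x))"
    if a: "smooth a" and g: "wderiv \<Omega> b g k" and L: "L2 (\<lambda>x. a x * g x)" "L2 (\<lambda>x. dir_deriv b a x * g x)" "L2 (\<lambda>x. a x * k x)" for a g k
  proof (rule LIMSEQ_unique)
    show "(\<lambda>n. (LINT x|lebesgue. dir_deriv b (\<phi> n) x * (a x * g x)) + (LINT x|lebesgue. \<phi> n x * (dir_deriv b a x * g x)))
        \<longlonglongrightarrow> (LINT x|lebesgue. v b x * (a x * g x)) + (LINT x|lebesgue. ?F x * (dir_deriv b a x * g x))"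
      by (intro tendsto_add l0 l1 L)
    have "(LINT x|lebesgue. dir_deriv b (\<phi> n) x * (a x * g x)) + (LINT x|lebesgue. \<phi> n x * (dir_deriv b a x * g x)) = - (LINT x|lebesgue. \<phi> n x * (a x * k x))" for n
    proof -
      have d: "dir_deriv b (\<lambda>x. a x * \<phi> n x) x = a x * dir_deriv b (\<phi> n) x + dir_deriv b a x * \<phi> n x" for x
        by (intro dir_deriv_mult smooth_differentiable a test_smooth[OF \<phi>(1)])
      have "(LINT x|lebesgue. g x * dir_deriv b (\<lambda>x. a x * \<phi> n x) x) = - (LINT x|lebesgue. k x * (a x * \<phi> n x))"
        by (rule wderivD[OF g test_mult[OF a \<phi>(1)]])
      moreover have "(LINT x|lebesgue. g x * dir_deriv b (\<lambda>x. a x * \<phi> n x) x) =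
          (LINT x|lebesgue. dir_deriv b (\<phi> n) x * (a x * g x) + \<phi> n x * (dir_deriv b a x * g x))"
        unfolding d by (simp add: algebra_simps)
      ultimately show ?thesis
        using L2_mult_integrable[OF L2_test[OF test_dir_deriv[OF \<phi>(1)[of n], of b]] L(1)] L2_mult_integrable[OF L2_test[OF \<phi>(1)[of n]] L(2)]
        by (simp add: mult_ac)
    qed
    then show "(\<lambda>n. (LINT x|lebesgue. dir_deriv b (\<phi> n) x * (a x * g x)) + (LINT x|lebesgue. \<phi> n x * (dir_deriv b a x * g x)))
        \<longlonglongrightarrow> - (LINT x|lebesgue. ?F x * (a x * k x))"
      using tendsto_minus[OF l0[OF L(3)]] by simp
  qed
  note so = smooth_omega and so1 = smooth_dir_deriv[OF smooth_omega, of b] and hb = h(2)[OF b] and hbb = h(4)[OF b b]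
  have A: "(LINT x|lebesgue. v b x * (\<omega> x * v b x)) + (LINT x|lebesgue. ?F x * (?o1 x * v b x)) = - (LINT x|lebesgue. ?F x * (\<omega> x * w b b x))"
    by (rule parts[OF so h(5)[OF b b] L2_weights(1)[OF hb] L2_weights(2)[OF hb b] L2_weights(1)[OF hbb]])
  have B: "(LINT x|lebesgue. v b x * (?o1 x * ?F x)) + (LINT x|lebesgue. ?F x * (?o2 x * ?F x)) = - (LINT x|lebesgue. ?F x * (?o1 x * v b x))"
    by (rule parts[OF so1 h(3)[OF b] L2_weights(2)[OF h(1) b] L2_weights(3)[OF h(1) b] L2_weights(2)[OF hb b]])
  have e1: "(LINT x|lebesgue. v b x * (?o1 x * ?F x)) = (LINT x|lebesgue. ?F x * (?o1 x * v b x))"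
    by (simp add: mult_ac)
  have e2: "(LINT x|lebesgue. ?F x * (?o2 x * ?F x)) = (LINT x|lebesgue. ?o2 x * (?F x)\<^sup>2)"
    by (simp add: power2_eq_square mult_ac)
  have e3: "(LINT x|lebesgue. v b x * (\<omega> x * v b x)) = (LINT x|lebesgue. \<omega> x * (v b x)\<^sup>2)"
    by (simp add: power2_eq_square mult_ac)
  have e4: "(LINT x|lebesgue. ?F x * (\<omega> x * w b b x)) = (LINT x|lebesgue. \<omega> x * (w b b x * ?F x))"
    by (simp add: mult_ac)
  show ?thesis using A B unfolding e1 e2 e3 e4 by linarith
qed

text \<open>Summing the identities and applying Cauchy-Schwarz bounds (N - 4) \<open>A\<close>^2 +
  \<open>B\<close> by \<open>A\<close> times the norm of the Laplacian. As N is an integer, N - 4 is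
  at least 1; hence first \<open>A\<close> and then \<open>B\<close> is bounded with constant
  1.\<close>

lemma hardy_inequality:
  assumes S: "open \<Omega>" and f: "f \<in> H10 \<Omega>" and H: "H2s \<Omega> (zext \<Omega> f) v w" and vz: "\<And>b x. x \<notin> \<Omega> \<Longrightarrow> v b x = 0"
    and N: "DIM('a) > 4"
  defines "E \<equiv> (n2 (\<lambda>x. \<Sum>b\<in>Basis. w b b x))\<^sup>2"
  shows "(LINT x|lebesgue. (\<omega> x * zext \<Omega> f x)\<^sup>2) \<le> E" "(\<Sum>b\<in>Basis. LINT x|lebesgue. \<omega> x * (v b x)\<^sup>2) \<le> E"
proof -
  let ?F = "zext \<Omega> f"
  let ?L = "\<lambda>x. \<Sum>b\<in>Basis. w b b x"
  note h = H2sD[OF H]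
  have L2L: "L2 ?L" by (intro L2_sum h)
  have FW: "L2 (\<lambda>x. \<omega> x * ?F x)" by (rule L2_weights(1)[OF h(1)])
  define A where "A = n2 (\<lambda>x. \<omega> x * ?F x)"
  define B where "B = (\<Sum>b\<in>Basis. LINT x|lebesgue. \<omega> x * (v b x)\<^sup>2)"
  have I1: "integrable lebesgue (\<lambda>x. \<omega> x * (v b x)\<^sup>2)" if "b \<in> Basis" for b
    using L2_mult_integrable[OF L2_weights(1)[OF h(2)[OF that]] h(2)[OF that]] by (simp add: power2_eq_square mult_ac)
  have I2: "integrable lebesgue (\<lambda>x. dir_deriv b (dir_deriv b \<omega>) x * (?F x)\<^sup>2)" if "b \<in> Basis" for b
    using L2_mult_integrable[OF L2_weights(3)[OF h(1) that] h(1)] by (simp add: power2_eq_square mult_ac)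
  have I3: "integrable lebesgue (\<lambda>x. \<omega> x * (w b b x * ?F x))" if "b \<in> Basis" for b
    using L2_mult_integrable[OF FW h(4)[OF that that]] by (simp add: mult_ac)
  have I4: "integrable lebesgue (\<lambda>x. (\<omega> x * ?F x)\<^sup>2)" by (rule L2_sq_integrable[OF FW])
  have "(\<Sum>b\<in>Basis. (LINT x|lebesgue. \<omega> x * (v b x)\<^sup>2) - 1/2 * (LINT x|lebesgue. dir_deriv b (dir_deriv b \<omega>) x * (?F x)\<^sup>2)) =
      (\<Sum>b\<in>Basis. - (LINT x|lebesgue. \<omega> x * (w b b x * ?F x)))"
    by (intro sum.cong refl hardy_identity[OF S f H vz])
  then have e: "B - 1/2 * (\<Sum>b\<in>Basis. LINT x|lebesgue. dir_deriv b (dir_deriv b \<omega>) x * (?F x)\<^sup>2) =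
      - (\<Sum>b\<in>Basis. LINT x|lebesgue. \<omega> x * (w b b x * ?F x))"
    unfolding sum_subtractf sum_negf B_def sum_distrib_left[symmetric] .
  have "(\<Sum>b\<in>Basis. LINT x|lebesgue. \<omega> x * (w b b x * ?F x)) = (LINT x|lebesgue. (\<Sum>b\<in>Basis. \<omega> x * (w b b x * ?F x)))"
    by (rule Bochner_Integration.integral_sum[symmetric]) (rule I3)
  also have "\<dots> = (LINT x|lebesgue. ?L x * (\<omega> x * ?F x))" by (simp add: sum_distrib_left sum_distrib_right mult_ac)
  finally have "\<bar>\<Sum>b\<in>Basis. LINT x|lebesgue. \<omega> x * (w b b x * ?F x)\<bar> \<le> n2 ?L * A"
    using n2_cauchy_schwarz[OF L2L FW] by (simp add: A_def)
  then have r: "- (\<Sum>b\<in>Basis. LINT x|lebesgue. \<omega> x * (w b b x * ?F x)) \<le> n2 ?L * A" by linarith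
  have "(real DIM('a) - 4) * A\<^sup>2 = (LINT x|lebesgue. (real DIM('a) - 4) * (\<omega> x * ?F x)\<^sup>2)" by (simp add: A_def n2_sq)
  also have "\<dots> \<le> (LINT x|lebesgue. (- 1/2) * (\<Sum>b\<in>Basis. dir_deriv b (dir_deriv b \<omega>) x * (?F x)\<^sup>2))"
  proof (rule integral_mono)
    show "integrable lebesgue (\<lambda>x. (real DIM('a) - 4) * (\<omega> x * ?F x)\<^sup>2)" using I4 by simp
    show "integrable lebesgue (\<lambda>x. (- 1/2) * (\<Sum>b\<in>Basis. dir_deriv b (dir_deriv b \<omega>) x * (?F x)\<^sup>2))"
      by (intro integrable_mult_right Bochner_Integration.integrable_sum I2)
    fix x
    have "2 * (real DIM('a) - 4) * (\<omega> x)\<^sup>2 * (?F x)\<^sup>2 \<le> - (\<Sum>b\<in>Basis. dir_deriv b (dir_deriv b \<omega>) x) * (?F x)\<^sup>2"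
      by (rule mult_right_mono[OF laplacian_omega]) simp
    then show "(real DIM('a) - 4) * (\<omega> x * ?F x)\<^sup>2 \<le> (- 1/2) * (\<Sum>b\<in>Basis. dir_deriv b (dir_deriv b \<omega>) x * (?F x)\<^sup>2)"
      unfolding sum_distrib_right[symmetric] power_mult_distrib by argo
  qed
  also have "\<dots> = - 1/2 * (\<Sum>b\<in>Basis. LINT x|lebesgue. dir_deriv b (dir_deriv b \<omega>) x * (?F x)\<^sup>2)"
    using I2 by (simp add: Bochner_Integration.integral_sum)
  finally have m: "(real DIM('a) - 4) * A\<^sup>2 + B \<le> n2 ?L * A" using e r by linarith
  have A0: "A \<ge> 0" by (simp add: A_def)
  have B0: "B \<ge> 0" unfolding B_def using omega_pos by (intro sum_nonneg integral_nonneg_AE AE_I2) (simp add: less_imp_le)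
  have "1 * A\<^sup>2 \<le> (real DIM('a) - 4) * A\<^sup>2" using N by (intro mult_right_mono) auto
  moreover have A2: "A\<^sup>2 \<ge> 0" by simp
  ultimately have BA: "B \<le> n2 ?L * A" and "A\<^sup>2 \<le> n2 ?L * A" using m B0 by linarith+
  then have "A * A \<le> n2 ?L * A" by (simp add: power2_eq_square)
  then have AL: "A \<le> n2 ?L" using A0 by (cases "A = 0") auto
  then have "A\<^sup>2 \<le> E" unfolding E_def using A0 by (intro power_mono) auto
  then show "(LINT x|lebesgue. (\<omega> x * ?F x)\<^sup>2) \<le> E" by (simp add: A_def n2_sq)
  have "B \<le> n2 ?L * A" by (rule BA)
  also have "\<dots> \<le> n2 ?L * n2 ?L" by (intro mult_left_mono AL) simp
  finally show "(\<Sum>b\<in>Basis. LINT x|lebesgue. \<omega> x * (v b x)\<^sup>2) \<le> E" by (simp add: B_def E_def power2_eq_square)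
qed

end

section \<open>Cutting off at a good scale\<close>

text \<open>The smallest of \<open>m\<close> terms is at most their average, and disjointness of the
  sets bounds the sum of the terms by a single copy of the integral of \<open>G\<close>.\<close>

lemma pigeonhole_annuli:
  fixes G :: "'a::euclidean_space \<Rightarrow> real" and R :: "nat \<Rightarrow> 'a \<Rightarrow> real"
  assumes G: "integrable lebesgue G" "\<And>x. G x \<ge> 0" and R: "\<And>k. k < m \<Longrightarrow> L2 (R k)"
    and le: "\<And>k x. k < m \<Longrightarrow> (R k x)\<^sup>2 \<le> indicator (A k) x * G x" and dis: "\<And>j k. j < m \<Longrightarrow> k < m \<Longrightarrow> j \<noteq> k \<Longrightarrow> A j \<inter> A k = {}"
    and m: "m > 0"
  shows "\<exists>k<m. (n2 (R k))\<^sup>2 \<le> (LINT x|lebesgue. G x) / real m"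
proof (rule ccontr)
  assume "\<not> ?thesis"
  then have lt: "(n2 (R k))\<^sup>2 > (LINT x|lebesgue. G x) / real m" if "k < m" for k using that by auto
  have "(LINT x|lebesgue. G x) = (\<Sum>k<m. (LINT x|lebesgue. G x) / real m)" using m by simp
  also have "\<dots> < (\<Sum>k<m. (n2 (R k))\<^sup>2)" by (rule sum_strict_mono) (use lt m in auto)
  also have "\<dots> = (LINT x|lebesgue. (\<Sum>k<m. (R k x)\<^sup>2))"
    unfolding n2_sq using R by (intro Bochner_Integration.integral_sum[symmetric] L2_sq_integrable) auto
  also have "\<dots> \<le> (LINT x|lebesgue. G x)"
  proof (rule integral_mono)
    show "integrable lebesgue (\<lambda>x. \<Sum>k<m. (R k x)\<^sup>2)" using R by (intro Bochner_Integration.integrable_sum L2_sq_integrable) auto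
    fix x
    have "(\<Sum>k<m. indicator (A k) x) \<le> (1::real)"
    proof (cases "\<exists>k<m. x \<in> A k")
      case True
      then obtain k where k: "k < m" "x \<in> A k" by blast
      have "(\<Sum>j<m. indicator (A j) x) = (\<Sum>j<m. if j = k then 1 else (0::real))"
        by (intro sum.cong refl) (use dis k in \<open>auto simp: indicator_def\<close>)
      then show ?thesis using k by simp
    next
      case False
      then show ?thesis by (simp add: indicator_def)
    qed
    then have "(\<Sum>k<m. indicator (A k) x) * G x \<le> 1 * G x" by (rule mult_right_mono) (rule G(2))
    moreover have "(\<Sum>k<m. (R k x)\<^sup>2) \<le> (\<Sum>k<m. indicator (A k) x * G x)" by (intro sum_mono le) auto
    ultimately show "(\<Sum>k<m. (R k x)\<^sup>2) \<le> G x" by (simp add: sum_distrib_right)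
  qed (rule G(1))
  finally show False by simp
qed

lemma sum_power2_le:
  fixes a :: "'i \<Rightarrow> real"
  shows "(\<Sum>i\<in>I. a i)\<^sup>2 \<le> real (card I) * (\<Sum>i\<in>I. (a i)\<^sup>2)"
  using Cauchy_Schwarz_ineq_sum[of "\<lambda>_. 1" a I] by simp

text \<open>\<open>C\<close> depends on the dimension and the profile \<open>\<zeta>0\<close> alone,
  neither on the domain nor on \<rho> or \<open>m\<close>. All cutoffs equal 1 on the ball of radius
  \<rho>, which is where the obstacle will lie.\<close>

lemma cutoff_lap_norm:
  fixes \<zeta>0 :: "'a::euclidean_space \<Rightarrow> real"
  assumes \<zeta>0: "\<zeta>0 \<in> test_functions UNIV" "\<And>x. \<zeta>0 x \<in> {0..1}" "\<And>x. norm x \<le> 1 \<Longrightarrow> \<zeta>0 x = 1" "\<And>x. norm x \<ge> 2 \<Longrightarrow> \<zeta>0 x = 0"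
    and N: "DIM('a) > 4"
  obtains C where "C \<ge> 0"
    "\<And>\<Omega> f v w \<rho> m. open \<Omega> \<Longrightarrow> f \<in> H10 \<Omega> \<Longrightarrow> H2s \<Omega> (zext \<Omega> f) v w \<Longrightarrow> (\<And>b x. x \<notin> \<Omega> \<Longrightarrow> v b x = 0) \<Longrightarrow>
       \<rho> > 0 \<Longrightarrow> m > 0 \<Longrightarrow> cball 0 (2 * 4 ^ m * \<rho>) \<subseteq> \<Omega> \<Longrightarrow>
       \<exists>k<m. lap_norm (\<lambda>x. \<zeta>0 ((1 / (4 ^ k * \<rho>)) *\<^sub>R x) * zext \<Omega> f x) \<le> (1 + sqrt (C / real m)) * n2 (\<lambda>x. \<Sum>b\<in>Basis. w b b x)"
proof -
  obtain M1 where M1: "M1 \<ge> 0" "\<And>h x. \<bar>dir_deriv h \<zeta>0 x\<bar> \<le> M1 * norm h" using test_deriv_bounded[OF \<zeta>0(1)] by metis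
  obtain M2 where M2: "M2 > 0" "\<And>x. \<bar>laplacian \<zeta>0 x\<bar> \<le> M2" using test_bounded[OF test_laplacian[OF \<zeta>0(1)]] by metis
  define M where "M = M1 + M2"
  have M: "M \<ge> 0" "M1 \<le> M" "M2 \<le> M" using M1 M2 by (auto simp: M_def)
  define Nr where "Nr = real DIM('a)"
  \<comment> \<open>The integral of \<open>G\<close> is at most
    \<open>40 * Nr * M\<^sup>2 + 50 * M\<^sup>2\<close> times the energy; enlarging the second term
    by the factor \<open>Nr\<close>, which is at least 1, gives 90.\<close>
  define C where "C = 90 * Nr * M\<^sup>2"
  have Nr: "Nr \<ge> 1" using N by (simp add: Nr_def)
  have d1: "dir_deriv b \<zeta>0 x = 0" if "norm x < 1 \<or> norm x > 2" for b x
  proof (cases "norm x < 1")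
    case True
    have "dir_deriv b \<zeta>0 x = dir_deriv b (\<lambda>x. 1) x"
      by (rule dir_deriv_cong_open[of "ball 0 1"]) (use True \<zeta>0(3) in auto)
    then show ?thesis by simp
  next
    case False
    have "dir_deriv b \<zeta>0 x = dir_deriv b (\<lambda>x. 0) x"
      by (rule dir_deriv_cong_open[of "- cball 0 2"]) (use False that \<zeta>0(4) in auto)
    then show ?thesis by simp
  qed
  have d2: "laplacian \<zeta>0 x = 0" if "norm x < 1 \<or> norm x > 2" for x
  proof -
    have "dir_deriv b (dir_deriv b \<zeta>0) x = dir_deriv b (\<lambda>x. 0) x" for b
    proof (rule dir_deriv_cong_open[of "ball 0 1 \<union> - cball 0 2"])
      show "dir_deriv b \<zeta>0 y = 0" if "y \<in> ball 0 1 \<union> - cball 0 2" for y by (rule d1) (use that in auto)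
    qed (use that in auto)
    then show ?thesis by (simp add: laplacian_eq)
  qed
  show ?thesis
  proof (rule that[of C])
    show "C \<ge> 0" using Nr by (simp add: C_def)
    fix \<Omega> :: "'a set" and f v w and \<rho> :: real and m :: nat
    assume S: "open \<Omega>" and f: "f \<in> H10 \<Omega>" and H: "H2s \<Omega> (zext \<Omega> f) v w" and vz: "\<And>b x. x \<notin> \<Omega> \<Longrightarrow> v b x = 0"
      and \<rho>: "\<rho> > 0" and m: "m > 0" and sub: "cball 0 (2 * 4 ^ m * \<rho>) \<subseteq> \<Omega>"
    let ?F = "zext \<Omega> f"
    let ?L = "\<lambda>x. \<Sum>b\<in>Basis. w b b x"
    define E where "E = (n2 ?L)\<^sup>2"
    note h = H2sD[OF H]
    have L2L: "L2 ?L" by (intro L2_sum h)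
    define \<omega> where "\<omega> = (\<lambda>x::'a. inverse (x \<bullet> x + \<rho>\<^sup>2))"
    \<comment> \<open>The weight is regularised at the smallest of the radii, so on every annulus it
      stays comparable to the inverse square of the radius.\<close>
    interpret hardy_weight \<rho> \<omega> by unfold_locales (use \<rho> \<omega>_def in auto)
    have E1: "(LINT x|lebesgue. (\<omega> x * ?F x)\<^sup>2) \<le> E" "(\<Sum>b\<in>Basis. LINT x|lebesgue. \<omega> x * (v b x)\<^sup>2) \<le> E"
      using hardy_inequality[OF S f H vz N] by (auto simp: E_def)
    \<comment> \<open>Each cutoff drops from 1 to 0 between \<open>r k\<close> and
      \<open>2 * r k\<close>; the ratio 4 of consecutive radii keeps these annuli disjoint.\<close>
    define r where "r = (\<lambda>k. 4 ^ k * \<rho> :: real)"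
    define \<zeta> where "\<zeta> = (\<lambda>k x. \<zeta>0 ((1 / r k) *\<^sub>R x))"
    have rp: "r k > 0" "r k \<ge> \<rho>" for k using \<rho> by (auto simp: r_def)
    have "\<zeta>0 \<in> test_functions (cball 0 2)"
      by (rule test_functionsI[of _ "cball 0 2"]) (use \<zeta>0(4) test_smooth[OF \<zeta>0(1)] in auto)
    then have \<zeta>t: "\<zeta> k \<in> test_functions \<Omega>" if "k < m" for k
      unfolding \<zeta>_def
    proof (rule test_scale)
      show "1 / r k > 0" using rp by simp
      fix x :: 'a assume x: "x \<in> cball 0 2"
      have "r k \<le> 4 ^ m * \<rho>" unfolding r_def using \<open>k < m\<close> \<rho> by (intro mult_right_mono power_increasing) auto
      then have "r k * norm x \<le> (4 ^ m * \<rho>) * 2" using x rp(1)[of k] by (intro mult_mono) auto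
      then have "(1 / (1 / r k)) *\<^sub>R x \<in> cball 0 (2 * 4 ^ m * \<rho>)" using rp(1)[of k] by simp
      then show "(1 / (1 / r k)) *\<^sub>R x \<in> \<Omega>" by (rule subsetD[OF sub])
    qed
    have \<zeta>d: "dir_deriv b (\<zeta> k) x = (1 / r k) * dir_deriv b \<zeta>0 ((1 / r k) *\<^sub>R x)" for b k x
      unfolding \<zeta>_def dir_deriv_scale[OF test_smooth[OF \<zeta>0(1)]] ..
    have \<zeta>l: "laplacian (\<zeta> k) x = (1 / r k)\<^sup>2 * laplacian \<zeta>0 ((1 / r k) *\<^sub>R x)" for k x
      unfolding \<zeta>_def laplacian_scale[OF test_smooth[OF \<zeta>0(1)]] ..
    define R where "R = (\<lambda>k x. (\<Sum>b\<in>Basis. 2 * (dir_deriv b (\<zeta> k) x * v b x)) + laplacian (\<zeta> k) x * ?F x)"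
    define A where "A = (\<lambda>k. {x::'a. r k \<le> norm x \<and> norm x \<le> 2 * r k})"
    define G where "G = (\<lambda>x. 2 * Nr * (20 * M\<^sup>2 * (\<Sum>b\<in>Basis. \<omega> x * (v b x)\<^sup>2)) + 2 * (25 * M\<^sup>2 * (\<omega> x * ?F x)\<^sup>2))"
    have HC: "H2s UNIV (\<lambda>x. \<zeta> k x * ?F x) (mult_d (\<zeta> k) ?F v) (mult_dd (\<zeta> k) ?F v w)" if "k < m" for k
      by (rule H2s_mult_test[OF H \<zeta>t[OF that]])
    \<comment> \<open>\<open>R k\<close> collects the terms in which a derivative falls on the
      cutoff; they are confined to the annulus \<open>A k\<close>.\<close>
    have wl: "(\<Sum>b\<in>Basis. mult_dd (\<zeta> k) ?F v w b b x) = \<zeta> k x * ?L x + R k x" for k x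
      by (simp add: mult_dd_def R_def laplacian_eq sum.distrib sum_distrib_left sum_distrib_right algebra_simps)
    have \<zeta>L: "L2 (\<lambda>x. \<zeta> k x * ?L x)" "n2 (\<lambda>x. \<zeta> k x * ?L x) \<le> n2 ?L" for k
      using L2_mult_bounded[OF L2L continuous_lebesgue_measurable[OF smooth_continuous[OF smooth_scale[OF test_smooth[OF \<zeta>0(1)], of "1 / r k"]]], of 1]
        \<zeta>0(2) by (auto simp: \<zeta>_def)
    have RL: "L2 (R k)" if "k < m" for k
    proof -
      have "L2 (\<lambda>x. \<Sum>b\<in>Basis. mult_dd (\<zeta> k) ?F v w b b x)" using H2sD(4)[OF HC[OF that]] by (intro L2_sum)
      from L2_diff[OF this \<zeta>L(1)[of k]] show ?thesis by (simp add: wl)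
    qed
    have iv: "integrable lebesgue (\<lambda>x. \<omega> x * (v b x)\<^sup>2)" if "b \<in> Basis" for b
      using L2_mult_integrable[OF L2_weights(1)[OF h(2)[OF that]] h(2)[OF that]] by (simp add: power2_eq_square mult_ac)
    have iF: "integrable lebesgue (\<lambda>x. (\<omega> x * ?F x)\<^sup>2)" by (rule L2_sq_integrable[OF L2_weights(1)[OF h(1)]])
    have Gi: "integrable lebesgue G" unfolding G_def
      by (intro Bochner_Integration.integrable_add integrable_mult_right Bochner_Integration.integrable_sum iv iF)
    have G0: "G x \<ge> 0" for x unfolding G_def using Nr omega_pos[of x]
      by (intro add_nonneg_nonneg mult_nonneg_nonneg sum_nonneg) auto
    have IG: "(LINT x|lebesgue. G x) \<le> C * E"
    proof -
      have "(LINT x|lebesgue. G x) = 2 * Nr * (20 * M\<^sup>2 * (\<Sum>b\<in>Basis. LINT x|lebesgue. \<omega> x * (v b x)\<^sup>2)) + 2 * (25 * M\<^sup>2 * (LINT x|lebesgue. (\<omega> x * ?F x)\<^sup>2))"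
        unfolding G_def using iv iF by (simp add: Bochner_Integration.integral_sum)
      also have "\<dots> \<le> 2 * Nr * (20 * M\<^sup>2 * E) + 2 * (25 * M\<^sup>2 * E)"
        using E1 Nr by (intro add_mono mult_left_mono) auto
      also have "\<dots> \<le> 2 * Nr * (20 * M\<^sup>2 * E) + Nr * (2 * (25 * M\<^sup>2 * E))"
        using mult_right_mono[OF Nr, of "2 * (25 * M\<^sup>2 * E)"] by (simp add: E_def)
      also have "\<dots> = C * E" by (simp add: C_def)
      finally show ?thesis .
    qed
    have le: "(R k x)\<^sup>2 \<le> indicator (A k) x * G x" if k: "k < m" for k x
    proof (cases "x \<in> A k")
      case False
      then have "norm ((1 / r k) *\<^sub>R x) < 1 \<or> norm ((1 / r k) *\<^sub>R x) > 2"
        using rp(1)[of k] by (auto simp: A_def field_simps)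
      then show ?thesis using False by (simp add: R_def \<zeta>d \<zeta>l d1 d2)
    next
      case True
      have "x \<bullet> x \<le> (2 * r k)\<^sup>2" using True power_mono[of "norm x" "2 * r k" 2] by (simp add: A_def dot_square_norm)
      moreover have "\<rho>\<^sup>2 \<le> (r k)\<^sup>2" using rp(2)[of k] \<rho> by (intro power_mono) auto
      ultimately have "s x \<le> 5 * (r k)\<^sup>2" by (simp add: s_def power_mult_distrib)
      \<comment> \<open>The squared norm contributes \<open>4 * (r k)\<^sup>2\<close> and the
        regularisation at most \<open>(r k)\<^sup>2\<close>, together the factor 5. It enters once
        in 20 = 4 * 5, for the gradient terms, and squared in 25, for the term with the Laplacian of
        the cutoff.\<close>
      then have o: "(1 / r k)\<^sup>2 \<le> 5 * \<omega> x"
        using s_pos[of x] rp(1)[of k] by (simp add: omega_s field_simps)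
      have r2: "(1 / r k)\<^sup>2 \<ge> 0" by simp
      have a: "(2 * (dir_deriv b (\<zeta> k) x * v b x))\<^sup>2 \<le> 20 * M\<^sup>2 * (\<omega> x * (v b x)\<^sup>2)" if b: "b \<in> Basis" for b
      proof -
        have "\<bar>dir_deriv b \<zeta>0 ((1 / r k) *\<^sub>R x)\<bar> \<le> M" using M1(2)[of b "(1 / r k) *\<^sub>R x"] M b by simp
        then have "(dir_deriv b \<zeta>0 ((1 / r k) *\<^sub>R x))\<^sup>2 \<le> M\<^sup>2" using M(1) by (simp add: abs_le_square_iff[symmetric])
        then have "(1 / r k)\<^sup>2 * (dir_deriv b \<zeta>0 ((1 / r k) *\<^sub>R x))\<^sup>2 \<le> (5 * \<omega> x) * M\<^sup>2"
          using o by (intro mult_mono) (use omega_pos[of x] in auto)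
        then have "4 * ((1 / r k)\<^sup>2 * (dir_deriv b \<zeta>0 ((1 / r k) *\<^sub>R x))\<^sup>2) * (v b x)\<^sup>2 \<le> 4 * ((5 * \<omega> x) * M\<^sup>2) * (v b x)\<^sup>2"
          by (intro mult_right_mono mult_left_mono) auto
        moreover have "(2 * (dir_deriv b (\<zeta> k) x * v b x))\<^sup>2 = 4 * ((1 / r k)\<^sup>2 * (dir_deriv b \<zeta>0 ((1 / r k) *\<^sub>R x))\<^sup>2) * (v b x)\<^sup>2"
          unfolding \<zeta>d power_mult_distrib by (simp only: mult_ac) simp
        ultimately show ?thesis by (simp add: mult_ac)
      qed
      have c: "(laplacian (\<zeta> k) x * ?F x)\<^sup>2 \<le> 25 * M\<^sup>2 * (\<omega> x * ?F x)\<^sup>2"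
      proof -
        have "\<bar>laplacian \<zeta>0 ((1 / r k) *\<^sub>R x)\<bar> \<le> M" using M2(2)[of "(1 / r k) *\<^sub>R x"] M by linarith
        then have 1: "(laplacian \<zeta>0 ((1 / r k) *\<^sub>R x))\<^sup>2 \<le> M\<^sup>2" using M(1) by (simp add: abs_le_square_iff[symmetric])
        have "((1 / r k)\<^sup>2)\<^sup>2 \<le> (5 * \<omega> x)\<^sup>2" by (rule power_mono[OF o r2])
        then have "((1 / r k)\<^sup>2)\<^sup>2 * (laplacian \<zeta>0 ((1 / r k) *\<^sub>R x))\<^sup>2 \<le> (5 * \<omega> x)\<^sup>2 * M\<^sup>2"
          using 1 by (intro mult_mono) auto
        then have "((1 / r k)\<^sup>2)\<^sup>2 * (laplacian \<zeta>0 ((1 / r k) *\<^sub>R x))\<^sup>2 * (?F x)\<^sup>2 \<le> (5 * \<omega> x)\<^sup>2 * M\<^sup>2 * (?F x)\<^sup>2"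
          by (intro mult_right_mono) auto
        then show ?thesis unfolding \<zeta>l power_mult_distrib by (simp add: mult_ac)
      qed
      have "(R k x)\<^sup>2 \<le> 2 * (\<Sum>b\<in>Basis. 2 * (dir_deriv b (\<zeta> k) x * v b x))\<^sup>2 + 2 * (laplacian (\<zeta> k) x * ?F x)\<^sup>2"
        unfolding R_def by (smt (verit) power2_sum sum_squares_bound)
      also have "\<dots> \<le> 2 * (Nr * (\<Sum>b\<in>Basis. (2 * (dir_deriv b (\<zeta> k) x * v b x))\<^sup>2)) + 2 * (25 * M\<^sup>2 * (\<omega> x * ?F x)\<^sup>2)"
        unfolding Nr_def by (intro add_mono mult_left_mono sum_power2_le c) auto
      also have "\<dots> \<le> 2 * (Nr * (\<Sum>b\<in>Basis. 20 * M\<^sup>2 * (\<omega> x * (v b x)\<^sup>2))) + 2 * (25 * M\<^sup>2 * (\<omega> x * ?F x)\<^sup>2)"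
        using Nr by (intro add_mono mult_left_mono sum_mono a order_refl) auto
      also have "\<dots> = G x" by (simp add: G_def sum_distrib_left)
      finally show ?thesis using True by simp
    qed
    have dis: "A j \<inter> A k = {}" if "j \<noteq> k" for j k
    proof -
      have *: "A j \<inter> A k = {}" if "j < k" for j k
      proof -
        have "4 * r j \<le> r k"
        proof -
          have "(4::real) ^ Suc j \<le> 4 ^ k" using that by (intro power_increasing) auto
          then show ?thesis using \<rho> by (simp add: r_def)
        qed
        then have "2 * r j < r k" using rp(1)[of j] by linarith
        then show ?thesis by (auto simp: A_def)
      qed
      show ?thesis using *[of j k] *[of k j] that by (cases "j < k") auto
    qed
    obtain k where k: "k < m" "(n2 (R k))\<^sup>2 \<le> (LINT x|lebesgue. G x) / real m"
      using pigeonhole_annuli[of G m R A, OF Gi G0 RL le dis m] by blast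
    have "(n2 (R k))\<^sup>2 \<le> (sqrt (C / real m) * n2 ?L)\<^sup>2"
    proof -
      have "(n2 (R k))\<^sup>2 \<le> C * E / real m" using k(2) IG by (meson divide_right_mono of_nat_0_le_iff order_trans)
      also have "\<dots> = (sqrt (C / real m) * n2 ?L)\<^sup>2"
        using Nr by (simp add: power_mult_distrib E_def C_def)
      finally show ?thesis .
    qed
    then have Rk: "n2 (R k) \<le> sqrt (C / real m) * n2 ?L"
      using Nr by (intro power2_le_imp_le[of "n2 (R k)"]) (auto simp: C_def)
    have "lap_norm (\<lambda>x. \<zeta> k x * ?F x) = n2 (\<lambda>x. \<zeta> k x * ?L x + R k x)"
      using wlap_lap_norm(2)[OF H2s_wlap[OF HC[OF k(1)]]] by (simp add: wl)
    also have "\<dots> \<le> n2 (\<lambda>x. \<zeta> k x * ?L x) + n2 (R k)" by (rule n2_triangle[OF \<zeta>L(1) RL[OF k(1)]])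
    also have "\<dots> \<le> (1 + sqrt (C / real m)) * n2 ?L" using \<zeta>L(2)[of k] Rk by (simp add: distrib_right)
    finally show "\<exists>k<m. lap_norm (\<lambda>x. \<zeta>0 ((1 / (4 ^ k * \<rho>)) *\<^sub>R x) * ?F x) \<le> (1 + sqrt (C / real m)) * n2 ?L"
      using k(1) by (intro exI[of _ k]) (simp add: \<zeta>_def r_def)
  qed
qed

section \<open>Competitors for the capacity in a bounded domain\<close>

lemma L2_zext_continuous:
  fixes f g :: "'a::euclidean_space \<Rightarrow> real"
  assumes S: "open S" "bounded S" and g: "continuous_on (closure S) g" "\<And>x. x \<in> S \<Longrightarrow> g x = f x"
  shows "L2 (zext S f)"
proof -
  have C: "compact (closure S)" using S by simp
  have c: "continuous_on S f" by (rule continuous_on_eq[OF continuous_on_subset[OF g(1) closure_subset]]) (rule g(2))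
  have "(\<lambda>x. indicator S x *\<^sub>R f x) \<in> borel_measurable borel"
    by (rule borel_measurable_continuous_on_indicator[OF _ c]) (use S in simp)
  then have m: "zext S f \<in> borel_measurable lebesgue" unfolding zext_def by (simp add: measurable_completion)
  have "compact (g ` closure S)" by (rule compact_continuous_image[OF g(1) C])
  then obtain B where B: "\<And>x. x \<in> closure S \<Longrightarrow> \<bar>g x\<bar> \<le> B"
    using compact_imp_bounded[of "g ` closure S"] unfolding bounded_iff by (metis imageI real_norm_def)
  have "\<bar>zext S f x\<bar> \<le> \<bar>B\<bar>" for x
  proof (cases "x \<in> S")
    case True
    then show ?thesis using B[of x] g(2)[OF True] closure_subset[of S] by auto
  qed auto
  then have "\<bar>zext S f x\<bar>\<^sup>2 \<le> \<bar>B\<bar>\<^sup>2" for x by (intro power_mono) auto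
  then have "\<bar>(zext S f x)\<^sup>2\<bar> \<le> \<bar>B\<bar>\<^sup>2" for x by simp
  then have "integrable lebesgue (\<lambda>x. (zext S f x)\<^sup>2)"
    by (rule integrable_bounded_compact_support[OF borel_measurable_power[OF m] C, rotated]) (use closure_subset[of S] in \<open>auto simp: zext_def indicator_def\<close>)
  then show ?thesis using m by (simp add: L2_def)
qed

text \<open>Square integrability comes from the continuous extension of the derivatives to the
  compact closure.\<close>

lemma Ck_closure_H2s:
  assumes S: "open S" "bounded S" and v: "Ck_closure 2 S v"
  shows "H2s S (zext S v) (\<lambda>b. zext S (dir_deriv b v)) (\<lambda>b c. zext S (dir_deriv c (dir_deriv b v)))"
proof -
  have p: "partial_deriv [b] v = dir_deriv b v" "partial_deriv [c, b] v = dir_deriv c (dir_deriv b v)" for b c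
    by (simp_all only: partial_deriv_Cons partial_deriv.simps(1))
  have d: "[] \<in> dirs 2" "b \<in> Basis \<Longrightarrow> [b] \<in> dirs 2" "b \<in> Basis \<Longrightarrow> c \<in> Basis \<Longrightarrow> [c, b] \<in> dirs 2" for b c :: 'a
    by (auto simp: dirs_def)
  have co: "continuous_on S (partial_deriv bs v)" if "bs \<in> dirs 2" for bs
    using v that by (auto simp: Ck_closure_def Ck_on_def)
  have df: "partial_deriv bs v differentiable (at x)" if "bs \<in> dirs 2" "length bs < 2" "x \<in> S" for bs x
    using v that by (auto simp: Ck_closure_def Ck_on_def differentiable_on_eq_differentiable_at[OF S(1)])
  have L: "L2 (zext S (partial_deriv bs v))" if bs: "bs \<in> dirs 2" for bs
  proof -
    obtain g where "continuous_on (closure S) g" "\<And>x. x \<in> S \<Longrightarrow> g x = partial_deriv bs v x"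
      using v bs unfolding Ck_closure_def by blast
    then show ?thesis by (rule L2_zext_continuous[OF S])
  qed
  have w: "wderiv S c (zext S f) (zext S (dir_deriv c f))" if "\<And>x. x \<in> S \<Longrightarrow> f differentiable (at x)" "continuous_on S (dir_deriv c f)" for c f
    using wderiv_classical[OF S(1) that] wderiv_cong[of S f "zext S f" "dir_deriv c f" "zext S (dir_deriv c f)" c] by simp
  show ?thesis unfolding H2s_def
  proof (intro conjI ballI)
    show "L2 (zext S v)" using L[OF d(1)] by simp
    fix b :: 'a assume b: "b \<in> Basis"
    show "L2 (zext S (dir_deriv b v))" using L[OF d(2)[OF b]] by (simp only: p)
    show "wderiv S b (zext S v) (zext S (dir_deriv b v))"
      by (rule w) (use df[OF d(1)] co[OF d(2)[OF b], unfolded p] in simp_all)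
    fix c :: 'a assume c: "c \<in> Basis"
    show "L2 (zext S (dir_deriv c (dir_deriv b v)))" using L[OF d(3)[OF b c]] by (simp only: p)
    show "wderiv S c (zext S (dir_deriv b v)) (zext S (dir_deriv c (dir_deriv b v)))"
      by (rule w) (use df[OF d(2)[OF b], unfolded p] co[OF d(3)[OF b c], unfolded p] in simp_all)
  qed
qed

lemma H10I:
  assumes S: "open S" and \<phi>: "\<And>n::nat. \<phi> n \<in> test_functions S" and u: "L2 (zext S u)"
    and v: "\<And>b. b \<in> Basis \<Longrightarrow> L2 (zext S (v b))" "\<And>b. b \<in> Basis \<Longrightarrow> wderiv S b u (v b)"
    and l: "(\<lambda>n. n2 (\<lambda>x. \<phi> n x - zext S u x)) \<longlonglongrightarrow> 0"
      "\<And>b. b \<in> Basis \<Longrightarrow> (\<lambda>n. n2 (\<lambda>x. dir_deriv b (\<phi> n) x - zext S (v b) x)) \<longlonglongrightarrow> 0"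
  shows "u \<in> H10 S"
proof -
  have z: "zext S (\<lambda>x. f x - \<psi> x) = (\<lambda>x. - (\<psi> x - zext S f x))" if "\<psi> \<in> test_functions S" for f \<psi>
    using test_zero_outside[OF that] by (fastforce simp: zext_def indicator_def)
  have le: "Hk_norm 1 S (\<lambda>x. u x - \<phi> n x) \<le> n2 (\<lambda>x. \<phi> n x - zext S u x) + (\<Sum>b\<in>Basis. n2 (\<lambda>x. dir_deriv b (\<phi> n) x - zext S (v b) x))" for n
  proof -
    note t = \<phi>[of n] test_dir_deriv[OF \<phi>[of n]]
    have "L2 (zext S (\<lambda>x. u x - \<phi> n x))" unfolding z[OF t(1)] by (intro L2_minus L2_diff u L2_test[OF t(1)])
    moreover have "L2 (zext S (\<lambda>x. v b x - dir_deriv b (\<phi> n) x))" if "b \<in> Basis" for b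
      unfolding z[OF t(2)] by (intro L2_minus L2_diff v that L2_test[OF t(2)])
    moreover have "wderiv S b (\<lambda>x. u x - \<phi> n x) (\<lambda>x. v b x - dir_deriv b (\<phi> n) x)" if "b \<in> Basis" for b
      by (intro wderiv_diff v that wderiv_smooth test_smooth[OF t(1)] S)
    ultimately have "Hk_norm 1 S (\<lambda>x. u x - \<phi> n x) \<le> n2 (zext S (\<lambda>x. u x - \<phi> n x)) + (\<Sum>b\<in>Basis. n2 (zext S (\<lambda>x. v b x - dir_deriv b (\<phi> n) x)))"
      by (rule Hk1I(2)[OF S])
    then show ?thesis unfolding z[OF t(1)] z[OF t(2)] n2_minus .
  qed
  have lim: "(\<lambda>n. n2 (\<lambda>x. \<phi> n x - zext S u x) + (\<Sum>b\<in>Basis. n2 (\<lambda>x. dir_deriv b (\<phi> n) x - zext S (v b) x))) \<longlonglongrightarrow> 0 + (\<Sum>b\<in>(Basis::'a set). 0)"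
    by (intro tendsto_add tendsto_sum l)
  have "\<exists>\<psi>\<in>test_functions S. Hk_norm 1 S (\<lambda>x. u x - \<psi> x) < e" if "e > 0" for e
  proof -
    have "\<forall>\<^sub>F n in sequentially. n2 (\<lambda>x. \<phi> n x - zext S u x) + (\<Sum>b\<in>Basis. n2 (\<lambda>x. dir_deriv b (\<phi> n) x - zext S (v b) x)) < e"
      using lim that by (intro order_tendstoD(2)) auto
    then obtain n where "n2 (\<lambda>x. \<phi> n x - zext S u x) + (\<Sum>b\<in>Basis. n2 (\<lambda>x. dir_deriv b (\<phi> n) x - zext S (v b) x)) < e"
      using eventually_happens'[OF sequentially_bot] by blast
    then show ?thesis using le[of n] \<phi>[of n] by (intro bexI[of _ "\<phi> n"]) auto
  qed
  then show ?thesis using Hk1I(1)[OF S u v] by (simp add: H10_def)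
qed

text \<open>Multiplication by \<open>a\<close> and addition of \<open>\<psi>\<close> map
  approximating test functions to test functions, so zero boundary values are preserved.\<close>

lemma H2_theta_mult_add:
  assumes S: "open S" and u: "u \<in> H2_theta S" and a: "bsmooth a" and \<psi>: "\<psi> \<in> test_functions S"
  shows "(\<lambda>x. a x * u x + \<psi> x) \<in> H2_theta S"
proof -
  have uk: "u \<in> Hk 2 S" "u \<in> H10 S" using u by (auto simp: H2_theta_def)
  obtain v w where H: "H2s S (zext S u) v w" and vz: "\<And>b x. x \<notin> S \<Longrightarrow> v b x = 0" using Hk_imp_H2s[OF S uk(1)] by metis
  note h = H2sD[OF H]
  obtain B where B: "\<And>x. \<bar>a x\<bar> \<le> B" "\<And>b x. b \<in> Basis \<Longrightarrow> \<bar>dir_deriv b a x\<bar> \<le> B" using bsmooth_bounds[OF a] by metis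
  note as = bsmooth_smooth[OF a]
  obtain \<phi> where \<phi>: "\<And>n. \<phi> n \<in> test_functions S" "(\<lambda>n. n2 (\<lambda>x. \<phi> n x - zext S u x)) \<longlonglongrightarrow> 0"
    "\<And>b v. b \<in> Basis \<Longrightarrow> wderiv S b u v \<Longrightarrow> L2 (zext S v) \<Longrightarrow> (\<lambda>n. n2 (\<lambda>x. dir_deriv b (\<phi> n) x - zext S v x)) \<longlonglongrightarrow> 0"
    using H10_approx[OF S uk(2)] by blast
  have zv: "zext S (v b) = v b" for b by (rule zext_id) (rule vz)
  have wu: "wderiv S b u (v b)" if "b \<in> Basis" for b
    using h(3)[OF that] wderiv_cong[of S u "zext S u" "v b" "v b" b] by simp
  have N0: "null2 (\<lambda>n x. \<phi> n x - zext S u x)"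
    unfolding null2_def using \<phi>(2) L2_test[OF \<phi>(1)] h(1) by (auto intro: L2_diff)
  have N1: "null2 (\<lambda>n x. dir_deriv b (\<phi> n) x - v b x)" if b: "b \<in> Basis" for b
    unfolding null2_def using \<phi>(3)[OF b wu[OF b]] h(2)[OF b] L2_test[OF test_dir_deriv[OF \<phi>(1)]] by (auto simp: zv intro: L2_diff)
  let ?f = "\<lambda>x. a x * u x + \<psi> x" and ?fb = "\<lambda>b x. (a x * v b x + dir_deriv b a x * zext S u x) + dir_deriv b \<psi> x"
  have zf: "zext S ?f = (\<lambda>x. a x * zext S u x + \<psi> x)"
    using test_zero_outside[OF \<psi>] by (fastforce simp: zext_def indicator_def)
  have zfb: "zext S (?fb b) = ?fb b" for b
    by (rule zext_id) (simp add: vz test_zero_outside[OF test_dir_deriv[OF \<psi>]])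
  have Hm: "H2s S (\<lambda>x. a x * zext S u x + \<psi> x) (\<lambda>b x. mult_d a (zext S u) v b x + dir_deriv b \<psi> x)
      (\<lambda>b c x. mult_dd a (zext S u) v w b c x + dir_deriv c (dir_deriv b \<psi>) x)"
    by (rule H2s_add[OF H2s_mult[OF H a] H2s_test[OF \<psi> S]])
  note hm = H2sD[OF Hm, unfolded mult_d_def]
  have "?f \<in> H10 S"
  proof (rule H10I[OF S, where v = ?fb and \<phi> = "\<lambda>n x. a x * \<phi> n x + \<psi> x"])
    show "(\<lambda>x. a x * \<phi> n x + \<psi> x) \<in> test_functions S" for n by (intro test_add test_mult as \<phi>(1) \<psi>)
    show "L2 (zext S ?f)" unfolding zf by (rule hm(1))
    show "L2 (zext S (?fb b))" if "b \<in> Basis" for b unfolding zfb by (rule hm(2)[OF that])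
    show "wderiv S b ?f (?fb b)" if "b \<in> Basis" for b
      using hm(3)[OF that] by (subst wderiv_cong[of S ?f "\<lambda>x. a x * zext S u x + \<psi> x" _ "?fb b"]) auto
    have "null2 (\<lambda>n x. a x * (\<phi> n x - zext S u x))" by (rule null2_mult_smooth[OF N0 as B(1)])
    then show "(\<lambda>n. n2 (\<lambda>x. (a x * \<phi> n x + \<psi> x) - zext S ?f x)) \<longlonglongrightarrow> 0"
      unfolding zf null2_def by (simp add: algebra_simps)
    fix b :: 'a assume b: "b \<in> Basis"
    have d: "dir_deriv b (\<lambda>x. a x * \<phi> n x + \<psi> x) x = (a x * dir_deriv b (\<phi> n) x + dir_deriv b a x * \<phi> n x) + dir_deriv b \<psi> x" for n x
      by (simp only: dir_deriv_add dir_deriv_mult smooth_differentiable smooth_mult as test_smooth[OF \<phi>(1)] test_smooth[OF \<psi>])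
    have "null2 (\<lambda>n x. a x * (dir_deriv b (\<phi> n) x - v b x) + dir_deriv b a x * (\<phi> n x - zext S u x))"
      by (rule null2_add[OF null2_mult_smooth[OF N1[OF b] as B(1)] null2_mult_smooth[OF N0 smooth_dir_deriv[OF as] B(2)[OF b]]])
    then show "(\<lambda>n. n2 (\<lambda>x. dir_deriv b (\<lambda>x. a x * \<phi> n x + \<psi> x) x - zext S (?fb b) x)) \<longlonglongrightarrow> 0"
      unfolding d zfb null2_def by (simp add: algebra_simps)
  qed
  moreover have "?f \<in> Hk 2 S" by (rule H2s_imp_Hk(1)[OF S Hm]) simp
  ultimately show ?thesis by (simp add: H2_theta_def)
qed

text \<open>\<open>H2_theta_0\<close> is a closure of functions regular up to the boundary, which
  \<open>u\<close> need not be. Replacing \<open>u\<close> by smooth approximants that vanish on the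
  frontier gives functions of the required kind, since \<open>\<eta> - 1\<close> is zero near
  \<open>K\<close>.\<close>

lemma H2_theta_0_mult_add:
  assumes \<Omega>: "smooth_bounded_domain \<Omega>" and u: "u \<in> H2_theta \<Omega>" and \<eta>: "\<eta> \<in> test_functions \<Omega>"
    and V: "open V" "K \<subseteq> V" "\<And>x. x \<in> V \<Longrightarrow> \<eta> x = 1" and \<psi>: "\<psi> \<in> test_functions (\<Omega> \<inter> - K)"
  shows "(\<lambda>x. (\<eta> x - 1) * u x + \<psi> x) \<in> H2_theta_0 \<Omega> K"
proof -
  have S: "open \<Omega>" using \<Omega> by (simp add: smooth_bounded_domain_def)
  have a: "bsmooth (\<lambda>x. \<eta> x - 1)" by (rule bsmooth_diff[OF test_bsmooth[OF \<eta>] bsmooth_const])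
  have \<psi>1: "\<psi> \<in> test_functions \<Omega>" using test_mono[OF \<psi>] by simp
  obtain v where v: "\<And>n. smooth (v n)" "\<And>n x. x \<in> frontier \<Omega> \<Longrightarrow> v n x = 0" "H2null \<Omega> (\<lambda>n. zext \<Omega> (\<lambda>x. u x - v n x))"
    using H2_theta_bdry_approx[OF \<Omega> u] by metis
  define g where "g = (\<lambda>n x. (\<eta> x - 1) * v n x + \<psi> x)"
  \<comment> \<open>Near \<open>K\<close> both summands vanish: \<open>\<eta>\<close> is 1 there,
    and the closed support of \<open>\<psi>\<close> avoids \<open>K\<close>.\<close>
  define V' where "V' = V \<inter> - closure {x. \<psi> x \<noteq> 0}"
  have V': "open V'" "K \<subseteq> V'" "\<And>n x. x \<in> V' \<Longrightarrow> g n x = 0"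
  proof -
    show "open V'" unfolding V'_def using V(1) by (intro open_Int) auto
    show "K \<subseteq> V'" using V \<psi> by (auto simp: V'_def test_functions_iff)
    show "g n x = 0" if "x \<in> V'" for n x
      using that V(3)[of x] closure_subset[of "{x. \<psi> x \<noteq> 0}"] by (auto simp: V'_def g_def)
  qed
  have "H2null \<Omega> (\<lambda>n x. (\<eta> x - 1) * zext \<Omega> (\<lambda>x. u x - v n x) x)" by (rule H2null_mult[OF v(3) a])
  then have l: "(\<lambda>n. Hk_norm 2 \<Omega> (\<lambda>x. ((\<eta> x - 1) * u x + \<psi> x) - g n x)) \<longlonglongrightarrow> 0"
    by (rule H2null_Hk_norm(1)[OF _ S]) (simp add: g_def algebra_simps)
  have "\<exists>v. Ck_closure 2 \<Omega> v \<and> (\<forall>x\<in>frontier \<Omega>. v x = 0) \<and>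
        (\<exists>V. open V \<and> K \<subseteq> V \<and> closure {x \<in> closure \<Omega>. v x \<noteq> 0} \<inter> V = {}) \<and> Hk_norm 2 \<Omega> (\<lambda>x. ((\<eta> x - 1) * u x + \<psi> x) - v x) < e"
    if e: "e > 0" for e
  proof -
    have "\<forall>\<^sub>F n in sequentially. Hk_norm 2 \<Omega> (\<lambda>x. ((\<eta> x - 1) * u x + \<psi> x) - g n x) < e"
      using l e by (intro order_tendstoD(2)) auto
    then obtain n where n: "Hk_norm 2 \<Omega> (\<lambda>x. ((\<eta> x - 1) * u x + \<psi> x) - g n x) < e"
      using eventually_happens'[OF sequentially_bot] by blast
    have "smooth (g n)" unfolding g_def by (intro smooth_add smooth_mult smooth_diff smooth_const test_smooth[OF \<eta>] test_smooth[OF \<psi>] v)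
    then have 1: "Ck_closure 2 \<Omega> (g n)" by (rule smooth_Ck_closure)
    have 2: "g n x = 0" if "x \<in> frontier \<Omega>" for x
    proof -
      have "x \<notin> \<Omega>" using that S by (simp add: frontier_def interior_open)
      then show ?thesis using v(2)[OF that] test_zero_outside[OF \<psi>1] by (simp add: g_def)
    qed
    have "V' \<inter> {x \<in> closure \<Omega>. g n x \<noteq> 0} = {}" using V'(3) by auto
    then have 3: "closure {x \<in> closure \<Omega>. g n x \<noteq> 0} \<inter> V' = {}" using open_Int_closure_eq_empty[OF V'(1)] by blast
    show ?thesis using 1 2 3 n V'(1,2) by blast
  qed
  then show ?thesis using H2_theta_mult_add[OF S u a \<psi>1] by (simp add: H2_theta_0_def)
qed

lemma H2s_cutoff_add_test:
  assumes S: "open \<Omega>" and H: "H2s \<Omega> (zext \<Omega> u) v w" and \<eta>: "\<eta> \<in> test_functions \<Omega>" and \<psi>: "\<psi> \<in> test_functions T"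
  shows "H2s UNIV (\<lambda>x. \<eta> x * zext \<Omega> u x + \<psi> x) (\<lambda>b x. mult_d \<eta> (zext \<Omega> u) v b x + dir_deriv b \<psi> x)
      (\<lambda>b c x. mult_dd \<eta> (zext \<Omega> u) v w b c x + dir_deriv c (dir_deriv b \<psi>) x)"
  by (rule H2s_add[OF H2s_mult_test[OF H \<eta>] H2s_test[OF \<psi> open_UNIV]])

lemma bdd_below_energy: "bdd_below {LINT x|lebesgue_on S. (weak_laplacian S f x)\<^sup>2 | f. P f}"
  by (rule bdd_belowI[of _ 0]) auto

text \<open>The competitor has compact support in the domain, so its energy is a norm over the whole
  space; its difference from \<open>u\<close> is the function of
  \<open>H2_theta_0_mult_add\<close>.\<close>

lemma cap_theta_le:
  assumes \<Omega>: "smooth_bounded_domain \<Omega>" and u: "u \<in> H2_theta \<Omega>" and \<eta>: "\<eta> \<in> test_functions \<Omega>"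
    and V: "open V" "K \<subseteq> V" "\<And>x. x \<in> V \<Longrightarrow> \<eta> x = 1" and \<psi>: "\<psi> \<in> test_functions (\<Omega> \<inter> - K)"
  shows "cap_theta \<Omega> K u \<le> (lap_norm (\<lambda>x. \<eta> x * zext \<Omega> u x + \<psi> x))\<^sup>2"
proof -
  have S: "open \<Omega>" using \<Omega> by (simp add: smooth_bounded_domain_def)
  have \<psi>1: "\<psi> \<in> test_functions \<Omega>" using test_mono[OF \<psi>] by simp
  obtain v w where H: "H2s \<Omega> (zext \<Omega> u) v w" and vz: "\<And>b x. x \<notin> \<Omega> \<Longrightarrow> v b x = 0" "\<And>b c x. x \<notin> \<Omega> \<Longrightarrow> w b c x = 0"
    using H2_theta_H2s[OF S u] by metis
  note HF = H2s_cutoff_add_test[OF S H \<eta> \<psi>]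
  let ?f = "\<lambda>x. \<eta> x * u x + \<psi> x"
  have "(LINT x|lebesgue_on \<Omega>. (weak_laplacian \<Omega> ?f x)\<^sup>2) =
      (n2 (\<lambda>x. \<Sum>b\<in>Basis. mult_dd \<eta> (zext \<Omega> u) v w b b x + dir_deriv b (dir_deriv b \<psi>) x))\<^sup>2"
  proof (rule H2s_weak_laplacian_energy[OF S H2s_subset[OF HF subset_UNIV]])
    show "\<eta> x * u x + \<psi> x = \<eta> x * zext \<Omega> u x + \<psi> x" if "x \<in> \<Omega>" for x using that by simp
    show "mult_dd \<eta> (zext \<Omega> u) v w b b x + dir_deriv b (dir_deriv b \<psi>) x = 0" if "x \<notin> \<Omega>" for b x
      using that test_zero_outside[OF test_dir_deriv[OF test_dir_deriv[OF \<psi>1]]] by (simp add: mult_dd_def vz)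
  qed
  also have "\<dots> = (lap_norm (\<lambda>x. \<eta> x * zext \<Omega> u x + \<psi> x))\<^sup>2" by (simp only: wlap_lap_norm(2)[OF H2s_wlap[OF HF]])
  finally have e: "(LINT x|lebesgue_on \<Omega>. (weak_laplacian \<Omega> ?f x)\<^sup>2) = (lap_norm (\<lambda>x. \<eta> x * zext \<Omega> u x + \<psi> x))\<^sup>2" .
  have "(\<lambda>x. ?f x - u x) = (\<lambda>x. (\<eta> x - 1) * u x + \<psi> x)" by (simp add: algebra_simps)
  then have "(\<lambda>x. ?f x - u x) \<in> H2_theta_0 \<Omega> K" using H2_theta_0_mult_add[OF \<Omega> u \<eta> V \<psi>] by simp
  moreover have "?f \<in> H2_theta \<Omega>" by (rule H2_theta_mult_add[OF S u test_bsmooth[OF \<eta>] \<psi>1])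
  ultimately show ?thesis unfolding cap_theta_def e[symmetric] by (intro cInf_lower bdd_below_energy) blast
qed

lemma zero_in_H2_theta_0:
  assumes S: "open \<Omega>" and u: "u \<in> H2_theta \<Omega>"
  shows "(\<lambda>x. 0) \<in> H2_theta_0 \<Omega> K"
proof -
  have 0: "H2s \<Omega> (\<lambda>x. 0) (\<lambda>b x. 0) (\<lambda>b c x. 0)" by (simp add: H2s_def wderiv_0)
  have "H2null \<Omega> (\<lambda>n x. 0)" by (rule H2nullI[OF 0]) (rule null2_zero)+
  then have "(\<lambda>n. Hk_norm 2 \<Omega> (\<lambda>x. 0 - 0)) \<longlonglongrightarrow> 0" by (rule H2null_Hk_norm(1)[OF _ S]) simp
  then have k: "Hk_norm 2 \<Omega> (\<lambda>x. 0 - 0) = 0" by (simp add: LIMSEQ_const_iff)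
  show ?thesis unfolding H2_theta_0_def mem_Collect_eq
  proof (intro conjI allI impI exI[of _ "\<lambda>x. 0"] exI[of _ UNIV])
    show "(\<lambda>x. 0) \<in> H2_theta \<Omega>" using H2_theta_mult_add[OF S u bsmooth_const[of 0] test_zero] by simp
    show "Ck_closure 2 \<Omega> (\<lambda>x. 0)" by (rule smooth_Ck_closure) simp
  qed (use k in auto)
qed

text \<open>Formulated for any lower bound \<open>c\<close> of the norms over the whole space,
  because the bound available later is a perturbation of the capacity of the limit polynomial. One
  constant \<open>C\<close> serves all domains, obstacles and numbers of scales.\<close>

lemma cap_theta_ge:
  assumes N: "DIM('a::euclidean_space) > 4"
  obtains C where "C \<ge> 0"
    "\<And>(\<Omega> :: 'a set) K V u \<eta> \<rho> m c. open \<Omega> \<Longrightarrow> bounded \<Omega> \<Longrightarrow> u \<in> H2_theta \<Omega> \<Longrightarrow> compact K \<Longrightarrow> K \<subseteq> ball 0 \<rho> \<Longrightarrow>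
       \<eta> \<in> test_functions \<Omega> \<Longrightarrow> open V \<Longrightarrow> K \<subseteq> V \<Longrightarrow> (\<And>x. x \<in> V \<Longrightarrow> \<eta> x = 1) \<Longrightarrow>
       \<rho> > 0 \<Longrightarrow> m > 0 \<Longrightarrow> cball 0 (2 * 4 ^ m * \<rho>) \<subseteq> \<Omega> \<Longrightarrow>
       (\<And>\<psi>. \<psi> \<in> test_functions (- K) \<Longrightarrow> c \<le> lap_norm (\<lambda>x. \<eta> x * zext \<Omega> u x + \<psi> x)) \<Longrightarrow>
       c \<le> (1 + sqrt (C / real m)) * sqrt (cap_theta \<Omega> K u)"
proof -
  obtain \<zeta>0 :: "'a \<Rightarrow> real" where z: "smooth \<zeta>0" "\<And>x. \<zeta>0 x \<in> {0..1}" "\<And>x. norm x \<le> 1 \<Longrightarrow> \<zeta>0 x = 1" "\<And>x. norm x \<ge> 2 \<Longrightarrow> \<zeta>0 x = 0"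
    using ball_bump[of 1 2 "0::'a"] by (auto simp: dist_norm)
  have z2: "\<zeta>0 \<in> test_functions (cball 0 2)" by (rule test_functionsI[of _ "cball 0 2"]) (use z in auto)
  show ?thesis
  proof (rule cutoff_lap_norm[OF test_mono[OF z2 subset_UNIV] z(2-4) N])
    fix C :: real assume C: "C \<ge> 0"
      "\<And>(\<Omega> :: 'a set) f v w \<rho> m. open \<Omega> \<Longrightarrow> f \<in> H10 \<Omega> \<Longrightarrow> H2s \<Omega> (zext \<Omega> f) v w \<Longrightarrow> (\<And>b x. x \<notin> \<Omega> \<Longrightarrow> v b x = 0) \<Longrightarrow>
         \<rho> > 0 \<Longrightarrow> m > 0 \<Longrightarrow> cball 0 (2 * 4 ^ m * \<rho>) \<subseteq> \<Omega> \<Longrightarrow>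
         \<exists>k<m. lap_norm (\<lambda>x. \<zeta>0 ((1 / (4 ^ k * \<rho>)) *\<^sub>R x) * zext \<Omega> f x) \<le> (1 + sqrt (C / real m)) * n2 (\<lambda>x. \<Sum>b\<in>Basis. w b b x)"
    show ?thesis
    proof (rule that[OF C(1)])
      fix \<Omega> K V :: "'a set" and u \<eta> :: "'a \<Rightarrow> real" and \<rho> c :: real and m :: nat
      assume S: "open \<Omega>" "bounded \<Omega>" and u: "u \<in> H2_theta \<Omega>" and K: "compact K" "K \<subseteq> ball 0 \<rho>" and \<eta>: "\<eta> \<in> test_functions \<Omega>"
        and V: "open V" "K \<subseteq> V" "\<And>x. x \<in> V \<Longrightarrow> \<eta> x = 1" and \<rho>: "\<rho> > 0" and m: "m > 0" and sub: "cball 0 (2 * 4 ^ m * \<rho>) \<subseteq> \<Omega>"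
        and c: "\<And>\<psi>. \<psi> \<in> test_functions (- K) \<Longrightarrow> c \<le> lap_norm (\<lambda>x. \<eta> x * zext \<Omega> u x + \<psi> x)"
      define q where "q = 1 + sqrt (C / real m)"
      have q: "q > 0" using C(1) by (simp add: q_def add_pos_nonneg)
      obtain uv uw where Hu: "H2s \<Omega> (zext \<Omega> u) uv uw" using H2_theta_H2s[OF S(1) u] by metis
      have key: "c \<le> q * sqrt (LINT x|lebesgue_on \<Omega>. (weak_laplacian \<Omega> f x)\<^sup>2)"
        if f: "f \<in> H2_theta \<Omega>" and w: "(\<lambda>x. f x - u x) \<in> H2_theta_0 \<Omega> K" for f
      proof (rule field_le_epsilon)
        \<comment> \<open>The tolerance \<delta> is shared by two approximations: of
          \<open>f - u\<close> by functions that vanish near \<open>K\<close>, and of the resulting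
          function with compact support by a test function.\<close>
        fix \<delta> :: real assume \<delta>: "\<delta> > 0"
        obtain fv fw where Hf: "H2s \<Omega> (zext \<Omega> f) fv fw" and fz: "\<And>b x. x \<notin> \<Omega> \<Longrightarrow> fv b x = 0" "\<And>b c x. x \<notin> \<Omega> \<Longrightarrow> fw b c x = 0"
          using H2_theta_H2s[OF S(1) f] by metis
        have "(LINT x|lebesgue_on \<Omega>. (weak_laplacian \<Omega> f x)\<^sup>2) = (n2 (\<lambda>x. \<Sum>b\<in>Basis. fw b b x))\<^sup>2"
          by (rule H2s_weak_laplacian_energy[OF S(1) Hf]) (auto simp: fz)
        then have E: "sqrt (LINT x|lebesgue_on \<Omega>. (weak_laplacian \<Omega> f x)\<^sup>2) = n2 (\<lambda>x. \<Sum>b\<in>Basis. fw b b x)" by simp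
        have "f \<in> H10 \<Omega>" using f by (simp add: H2_theta_def)
        then obtain k where k: "k < m" "lap_norm (\<lambda>x. \<zeta>0 ((1 / (4 ^ k * \<rho>)) *\<^sub>R x) * zext \<Omega> f x) \<le> q * n2 (\<lambda>x. \<Sum>b\<in>Basis. fw b b x)"
          using C(2)[OF S(1) _ Hf fz(1) \<rho> m sub] unfolding q_def by blast
        define s where "s = 4 ^ k * \<rho>"
        define \<zeta> where "\<zeta> = (\<lambda>x. \<zeta>0 ((1 / s) *\<^sub>R x))"
        have s: "s > 0" "\<rho> \<le> s" "s \<le> 4 ^ m * \<rho>"
          using \<rho> k(1) by (auto simp: s_def intro!: mult_right_mono power_increasing)
        have \<zeta>t: "\<zeta> \<in> test_functions \<Omega>" unfolding \<zeta>_def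
        proof (rule test_scale[OF z2])
          show "1 / s > 0" using s by simp
          show "(1 / (1 / s)) *\<^sub>R x \<in> \<Omega>" if "x \<in> cball 0 2" for x
          proof -
            have "s * norm x \<le> (4 ^ m * \<rho>) * 2" using that s by (intro mult_mono) auto
            then show ?thesis using sub s by auto
          qed
        qed
        have \<zeta>1: "\<zeta> x = 1" if "x \<in> ball 0 \<rho>" for x
          unfolding \<zeta>_def by (rule z(3)) (use that s in \<open>simp add: divide_le_eq\<close>)
        let ?w = "\<lambda>x. f x - u x"
        obtain v where v: "\<And>n::nat. Ck_closure 2 \<Omega> (v n)"
          "\<And>n. \<exists>V. open V \<and> K \<subseteq> V \<and> closure {x \<in> closure \<Omega>. v n x \<noteq> 0} \<inter> V = {}"
          "\<And>n. Hk_norm 2 \<Omega> (\<lambda>x. ?w x - v n x) < inverse (real (Suc n))"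
        proof -
          let ?P = "\<lambda>n v. Ck_closure 2 \<Omega> v \<and> (\<exists>V. open V \<and> K \<subseteq> V \<and> closure {x \<in> closure \<Omega>. v x \<noteq> 0} \<inter> V = {}) \<and>
              Hk_norm 2 \<Omega> (\<lambda>x. ?w x - v x) < inverse (real (Suc n))"
          have "\<forall>n. \<exists>v. ?P n v"
          proof
            fix n :: nat
            have "inverse (real (Suc n)) > 0" by simp
            then show "\<exists>v. ?P n v" using w unfolding H2_theta_0_def mem_Collect_eq by blast
          qed
          from choice[OF this] obtain v where "\<forall>n. ?P n (v n)" ..
          then show ?thesis by (intro that[of v]) auto
        qed
        note Hv = Ck_closure_H2s[OF S v(1)]
        have Hwv: "(\<lambda>x. ?w x - v n x) \<in> Hk 2 \<Omega>" for n
          by (rule H2s_imp_Hk(1)[OF S(1) H2s_diff[OF H2s_diff[OF Hf Hu] Hv]]) simp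
        have "(\<lambda>n. Hk_norm 2 \<Omega> (\<lambda>x. ?w x - v n x)) \<longlonglongrightarrow> 0"
        proof (rule tendsto_sandwich[OF always_eventually always_eventually tendsto_const LIMSEQ_inverse_real_of_nat], safe)
          fix n
          show "Hk_norm 2 \<Omega> (\<lambda>x. ?w x - v n x) \<le> inverse (real (Suc n))" using v(3)[of n] by simp
          show "0 \<le> Hk_norm 2 \<Omega> (\<lambda>x. ?w x - v n x)" unfolding Hk_norm_def by (intro real_sqrt_ge_zero sum_nonneg) auto
        qed
        from H2null_mult_test[OF Hk_norm_H2null[OF S(1) Hwv this] \<zeta>t]
        have nul: "H2null UNIV (\<lambda>n x. \<zeta> x * zext \<Omega> (\<lambda>x. ?w x - v n x) x)" .
        have "\<forall>\<^sub>F n in sequentially. lap_norm (\<lambda>x. \<zeta> x * zext \<Omega> (\<lambda>x. ?w x - v n x) x) < \<delta> / 2"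
          using H2null_lap_norm(1)[OF nul] \<delta> by (intro order_tendstoD(2)) auto
        then obtain n where n: "lap_norm (\<lambda>x. \<zeta> x * zext \<Omega> (\<lambda>x. ?w x - v n x) x) < \<delta> / 2"
          using eventually_happens'[OF sequentially_bot] by blast
        \<comment> \<open>\<open>\<zeta> f - \<eta> u\<close> equals
          \<open>\<zeta> (f - u) + (\<zeta> - \<eta>) u\<close>. With \<open>v n\<close> in the
          place of \<open>f - u\<close> this vanishes near \<open>K\<close>, where both cutoffs are
          1, and its mollifications are test functions off \<open>K\<close>.\<close>
        define h where "h = (\<lambda>x. \<zeta> x * zext \<Omega> (v n) x + (\<zeta> x - \<eta> x) * zext \<Omega> u x)"
        obtain hv hw where Hh: "H2s UNIV h hv hw"
          unfolding h_def using H2s_add[OF H2s_mult_test[OF Hv \<zeta>t] H2s_mult_test[OF Hu test_diff[OF \<zeta>t \<eta>]]] by blast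
        obtain Vn where Vn: "open Vn" "K \<subseteq> Vn" "closure {x \<in> closure \<Omega>. v n x \<noteq> 0} \<inter> Vn = {}" using v(2) by blast
        define D where "D = closure \<Omega> - (Vn \<inter> V \<inter> ball 0 \<rho>)"
        have "compact D" unfolding D_def using S V Vn by (intro compact_diff) auto
        moreover have "h x = 0" if "x \<notin> D" for x
        proof (cases "x \<in> \<Omega>")
          case True
          then have x: "x \<in> Vn" "x \<in> V" "x \<in> ball 0 \<rho>" "x \<in> closure \<Omega>" using that closure_subset[of \<Omega>] by (auto simp: D_def)
          then have "v n x = 0" using Vn(3) closure_subset[of "{x \<in> closure \<Omega>. v n x \<noteq> 0}"] by blast
          then show ?thesis using True V(3)[OF x(2)] \<zeta>1[OF x(3)] by (simp add: h_def)
        qed (simp add: h_def)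
        moreover have "D \<subseteq> - K" using Vn V K by (auto simp: D_def)
        moreover have "open (- K)" using K by (simp add: compact_imp_closed open_Compl)
        ultimately have "\<forall>\<^sub>F j in sequentially. conv h (moll j) \<in> test_functions (- K)"
          using L2_locally_integrable[OF H2sD(1)[OF Hh]] by (intro conv_moll_test[of h D]) auto
        moreover have "\<forall>\<^sub>F j in sequentially. lap_norm (\<lambda>x. conv h (moll j) x - h x) < \<delta> / 2"
          using wlap_conv_tendsto(1)[OF H2s_wlap[OF Hh] H2sD(1)[OF Hh]] \<delta> by (intro order_tendstoD(2)) auto
        ultimately have "\<forall>\<^sub>F j in sequentially. conv h (moll j) \<in> test_functions (- K) \<and> lap_norm (\<lambda>x. conv h (moll j) x - h x) < \<delta> / 2"
          by (rule eventually_conj)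
        then obtain \<psi> where \<psi>: "\<psi> \<in> test_functions (- K)" "lap_norm (\<lambda>x. \<psi> x - h x) < \<delta> / 2"
          using eventually_happens'[OF sequentially_bot] by blast
        let ?A = "\<lambda>x. \<zeta> x * zext \<Omega> f x" and ?B = "\<lambda>x. \<zeta> x * zext \<Omega> (\<lambda>x. ?w x - v n x) x" and ?D = "\<lambda>x. \<psi> x - h x"
        obtain LB where LB: "wlap ?B LB" using H2null_lap_norm(2)[OF nul] by blast
        note LA = H2s_wlap[OF H2s_mult_test[OF Hf \<zeta>t]]
        note LD = wlap_diff[OF wlap_test[OF \<psi>(1)] H2s_wlap[OF Hh]]
        have "(\<lambda>x. \<eta> x * zext \<Omega> u x + \<psi> x) = (\<lambda>x. (?A x - ?B x) + ?D x)"
          by (rule ext) (simp add: h_def zext_def algebra_simps)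
        then have "lap_norm (\<lambda>x. \<eta> x * zext \<Omega> u x + \<psi> x) \<le> lap_norm (\<lambda>x. ?A x - ?B x) + lap_norm ?D"
          using lap_norm_triangle(1)[OF wlap_diff[OF LA LB] LD] by simp
        moreover have "lap_norm (\<lambda>x. ?A x - ?B x) \<le> lap_norm ?A + lap_norm ?B" by (rule lap_norm_triangle(2)[OF LA LB])
        moreover have "lap_norm ?A \<le> q * sqrt (LINT x|lebesgue_on \<Omega>. (weak_laplacian \<Omega> f x)\<^sup>2)"
          unfolding E \<zeta>_def s_def by (rule k(2))
        ultimately show "c \<le> q * sqrt (LINT x|lebesgue_on \<Omega>. (weak_laplacian \<Omega> f x)\<^sup>2) + \<delta>"
          using c[OF \<psi>(1)] \<psi>(2) n by linarith
      qed
      let ?X = "{LINT x|lebesgue_on \<Omega>. (weak_laplacian \<Omega> f x)\<^sup>2 | f. f \<in> H2_theta \<Omega> \<and> (\<lambda>x. f x - u x) \<in> H2_theta_0 \<Omega> K}"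
      have "(\<lambda>x. u x - u x) \<in> H2_theta_0 \<Omega> K" using zero_in_H2_theta_0[OF S(1) u] by simp
      then have ne: "?X \<noteq> {}" using u by blast
      \<comment> \<open>The infimum is taken over squares, and squaring preserves the inequality
        only for nonnegative \<open>c\<close>; for negative \<open>c\<close> the right side is
        nonnegative anyway.\<close>
      show "c \<le> (1 + sqrt (C / real m)) * sqrt (cap_theta \<Omega> K u)"
      proof (cases "c \<ge> 0")
        case True
        have "(c / q)\<^sup>2 \<le> cap_theta \<Omega> K u" unfolding cap_theta_def
        proof (rule cInf_greatest[OF ne])
          fix y assume "y \<in> ?X"
          then obtain f where f: "f \<in> H2_theta \<Omega>" "(\<lambda>x. f x - u x) \<in> H2_theta_0 \<Omega> K" "y = (LINT x|lebesgue_on \<Omega>. (weak_laplacian \<Omega> f x)\<^sup>2)" by blast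
          have y: "y \<ge> 0" using f(3) by simp
          have "c \<le> q * sqrt y" using key[OF f(1,2)] f(3) by simp
          then have "c / q \<le> sqrt y" using q by (simp add: divide_le_eq mult.commute)
          then have "(c / q)\<^sup>2 \<le> (sqrt y)\<^sup>2" using True q by (intro power_mono) auto
          then show "(c / q)\<^sup>2 \<le> y" using y by simp
        qed
        then have "c / q \<le> sqrt (cap_theta \<Omega> K u)" by (rule real_le_rsqrt)
        then show ?thesis using q by (simp add: q_def[symmetric] divide_le_eq mult.commute)
      next
        case False
        have "cap_theta \<Omega> K u \<ge> 0" unfolding cap_theta_def by (rule cInf_greatest[OF ne]) auto
        then have "0 \<le> q * sqrt (cap_theta \<Omega> K u)" using q by simp
        then show ?thesis using False by (simp add: q_def)
      qed
    qed
  qed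
qed

section \<open>Blow-up at the origin\<close>

text \<open>Along a sequence of scales the convergence on the ball is a null sequence, which the
  cutoff carries to the whole space. There \<open>u\<close> can be replaced by its extension by zero
  once the scaled ball lies inside the domain.\<close>

lemma blow_up_cutoff_tendsto:
  fixes u U \<eta> :: "'a::euclidean_space \<Rightarrow> real"
  assumes \<eta>: "\<eta> \<in> test_functions (ball 0 R)" and t: "tendsto_Hk 2 (ball 0 R) (\<lambda>\<epsilon> x. u (\<epsilon> *\<^sub>R x) / \<epsilon> ^ \<gamma>) U (at_right (0::real))"
    and S: "open \<Omega>" "0 \<in> \<Omega>"
  shows "((\<lambda>\<epsilon>. lap_norm (\<lambda>x. \<eta> x * (zext \<Omega> u (\<epsilon> *\<^sub>R x) / \<epsilon> ^ \<gamma> - U x))) \<longlongrightarrow> 0) (at_right (0::real))"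
  unfolding tendsto_at_iff_sequentially
proof (intro allI impI)
  fix X :: "nat \<Rightarrow> real"
  assume X: "\<forall>i. X i \<in> {0<..} - {0}" "X \<longlonglongrightarrow> 0"
  let ?B = "ball (0::'a) R" and ?v = "\<lambda>\<epsilon> x. u (\<epsilon> *\<^sub>R x) / \<epsilon> ^ \<gamma>"
  have Xp: "X n > 0" for n using X(1) by auto
  have F: "filterlim X (at_right 0) sequentially"
    unfolding filterlim_at using X(2) Xp less_imp_neq[OF Xp, symmetric] by (auto intro!: always_eventually)
  obtain r where r: "r > 0" "ball 0 r \<subseteq> \<Omega>" using S open_contains_ball by blast
  have e1: "\<forall>\<^sub>F n in sequentially. ?v (X n) \<in> Hk 2 ?B"
    using eventually_compose_filterlim[OF _ F] t unfolding tendsto_Hk_def by blast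
  have l: "(\<lambda>n. Hk_norm 2 ?B (\<lambda>x. ?v (X n) x - U x)) \<longlonglongrightarrow> 0"
    using filterlim_compose[OF _ F] t unfolding tendsto_Hk_def by blast
  have "(\<lambda>n. X n * R) \<longlonglongrightarrow> 0 * R" by (intro tendsto_intros X)
  then have e2: "\<forall>\<^sub>F n in sequentially. X n * R < r" using r by (intro order_tendstoD(2)) auto
  \<comment> \<open>Membership in the Sobolev space and the inclusion of the scaled ball hold only
    eventually; a shift by \<open>M\<close> makes them hold for every index.\<close>
  obtain M where M: "\<And>n. n \<ge> M \<Longrightarrow> ?v (X n) \<in> Hk 2 ?B \<and> X n * R < r"
    using eventually_conj[OF e1 e2] unfolding eventually_sequentially by blast
  have U: "U \<in> Hk 2 ?B" using t by (simp add: tendsto_Hk_def)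
  have k: "(\<lambda>x. ?v (X (n + M)) x - U x) \<in> Hk 2 ?B" for n
  proof -
    obtain v1 w1 where 1: "H2s ?B (zext ?B (?v (X (n + M)))) v1 w1" using M[of "n + M"] by (metis Hk_imp_H2s le_add2 open_ball)
    obtain v2 w2 where 2: "H2s ?B (zext ?B U) v2 w2" using U by (metis Hk_imp_H2s open_ball)
    show ?thesis by (rule H2s_imp_Hk(1)[OF open_ball H2s_diff[OF 1 2]]) simp
  qed
  have "H2null ?B (\<lambda>n. zext ?B (\<lambda>x. ?v (X (n + M)) x - U x))"
    by (rule Hk_norm_H2null[OF open_ball k LIMSEQ_ignore_initial_segment[OF l]])
  then have "(\<lambda>n. lap_norm (\<lambda>x. \<eta> x * zext ?B (\<lambda>x. ?v (X (n + M)) x - U x) x)) \<longlonglongrightarrow> 0"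
    by (rule H2null_lap_norm(1)[OF H2null_mult_test[OF _ \<eta>]])
  moreover have "(\<lambda>x. \<eta> x * zext ?B (\<lambda>x. ?v (X (n + M)) x - U x) x) = (\<lambda>x. \<eta> x * (zext \<Omega> u (X (n + M) *\<^sub>R x) / X (n + M) ^ \<gamma> - U x))" for n
  proof
    fix x
    show "\<eta> x * zext ?B (\<lambda>x. ?v (X (n + M)) x - U x) x = \<eta> x * (zext \<Omega> u (X (n + M) *\<^sub>R x) / X (n + M) ^ \<gamma> - U x)"
    proof (cases "x \<in> ?B")
      case True
      have "norm (X (n + M) *\<^sub>R x) \<le> X (n + M) * R" using True Xp[of "n + M"] by (simp add: mult_left_mono less_imp_le)
      then have "X (n + M) *\<^sub>R x \<in> \<Omega>" using M[of "n + M"] r(2) by auto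
      then show ?thesis using True by simp
    qed (simp add: test_zero_outside[OF \<eta>])
  qed
  ultimately have "(\<lambda>n. lap_norm (\<lambda>x. \<eta> x * (zext \<Omega> u (X (n + M) *\<^sub>R x) / X (n + M) ^ \<gamma> - U x))) \<longlonglongrightarrow> 0" by simp
  then have "(\<lambda>n. lap_norm (\<lambda>x. \<eta> x * (zext \<Omega> u (X n *\<^sub>R x) / X n ^ \<gamma> - U x))) \<longlonglongrightarrow> 0" by (rule LIMSEQ_offset)
  then show "((\<lambda>\<epsilon>. lap_norm (\<lambda>x. \<eta> x * (zext \<Omega> u (\<epsilon> *\<^sub>R x) / \<epsilon> ^ \<gamma> - U x))) \<circ> X) \<longlonglongrightarrow> 0" by (simp add: comp_def)
qed

lemma test_bounded_support:
  assumes "\<phi> \<in> test_functions S" obtains R where "R > 0" "\<phi> \<in> test_functions (S \<inter> ball 0 R)"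
proof -
  have "bounded (closure {x. \<phi> x \<noteq> 0})" using assms by (auto simp: test_functions_iff compact_imp_bounded)
  then obtain R where "R > 0" "closure {x. \<phi> x \<noteq> 0} \<subseteq> ball 0 R" using bounded_subset_ballD by blast
  then show ?thesis using assms that[of R] by (auto simp: test_functions_iff)
qed

section \<open>Two-sided bounds on the blow-up scale\<close>

locale blow_up =
  fixes \<Omega> K V :: "'a::euclidean_space set" and u U \<eta> :: "'a \<Rightarrow> real" and \<gamma> :: nat and R r :: real
  assumes N: "DIM('a) > 4" and \<Omega>: "smooth_bounded_domain \<Omega>" and u: "u \<in> H2_theta \<Omega>" and K: "compact K" "K \<subseteq> ball 0 R"
    and U: "smooth U" and \<eta>: "\<eta> \<in> test_functions (ball 0 R)" and V: "open V" "K \<subseteq> V" "\<And>x. x \<in> V \<Longrightarrow> \<eta> x = 1"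
    and R: "R > 0" and r: "r > 0" "ball 0 r \<subseteq> \<Omega>"
    and prof: "tendsto_Hk 2 (ball 0 R) (\<lambda>\<epsilon> x. u (\<epsilon> *\<^sub>R x) / \<epsilon> ^ \<gamma>) U (at_right (0::real))"
begin

definition p :: nat where "p = DIM('a) - 4 + 2 * \<gamma>"
definition c :: real where "c = sqrt (cap_space \<eta> K U)"
definition scaled_K :: "real \<Rightarrow> 'a set" where "scaled_K \<epsilon> = (\<lambda>x. \<epsilon> *\<^sub>R x) ` K"
definition G :: "real \<Rightarrow> 'a \<Rightarrow> real" where "G \<epsilon> x = \<eta> x * (zext \<Omega> u (\<epsilon> *\<^sub>R x) / \<epsilon> ^ \<gamma>)"
text \<open>Distance in the energy norm between the cut-off blow-up \<open>G\<close> and its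
  limit.\<close>

definition M :: "real \<Rightarrow> real" where "M \<epsilon> = lap_norm (\<lambda>x. \<eta> x * (zext \<Omega> u (\<epsilon> *\<^sub>R x) / \<epsilon> ^ \<gamma> - U x))"
definition scaled_cutoff :: "real \<Rightarrow> 'a \<Rightarrow> real" where "scaled_cutoff \<epsilon> x = \<eta> ((1 / \<epsilon>) *\<^sub>R x)"

lemma domain: "open \<Omega>" "bounded \<Omega>" "0 \<in> \<Omega>" using \<Omega> subsetD[OF r(2), of 0] r(1) by (auto simp: smooth_bounded_domain_def)

lemma M_tendsto: "(M \<longlongrightarrow> 0) (at_right 0)"
  unfolding M_def[abs_def] by (rule blow_up_cutoff_tendsto[OF \<eta> prof domain(1,3)])

lemma etaU: "(\<lambda>x. \<eta> x * U x) \<in> test_functions UNIV"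
  using test_mult[OF U test_mono[OF \<eta> subset_UNIV]] by (simp add: mult.commute)

lemma ce_test: assumes "\<epsilon> > 0" "\<epsilon> * R \<le> r" shows "scaled_cutoff \<epsilon> \<in> test_functions \<Omega>"
  unfolding scaled_cutoff_def[abs_def]
proof (rule test_scale[OF \<eta>])
  show "(1 / (1 / \<epsilon>)) *\<^sub>R x \<in> \<Omega>" if "x \<in> ball 0 R" for x
  proof -
    have "\<epsilon> * norm x < \<epsilon> * R" using that assms by simp
    then have "\<epsilon> * norm x < r" using assms(2) by (rule less_le_trans)
    then have "\<epsilon> *\<^sub>R x \<in> ball 0 r" using assms by simp
    then show ?thesis using subsetD[OF r(2)] by simp
  qed
qed (use assms in simp)

lemma
  assumes e: "\<epsilon> > 0"
  shows scaled_K: "compact (scaled_K \<epsilon>)" "scaled_K \<epsilon> \<subseteq> ball 0 (\<epsilon> * R)" and scaled_V: "open ((\<lambda>x. \<epsilon> *\<^sub>R x) ` V)" "scaled_K \<epsilon> \<subseteq> (\<lambda>x. \<epsilon> *\<^sub>R x) ` V"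
    "x \<in> (\<lambda>x. \<epsilon> *\<^sub>R x) ` V \<Longrightarrow> scaled_cutoff \<epsilon> x = 1"
proof -
  show "compact (scaled_K \<epsilon>)" unfolding scaled_K_def by (rule compact_scaling[OF K(1)])
  show "scaled_K \<epsilon> \<subseteq> ball 0 (\<epsilon> * R)" using K(2) e by (auto simp: scaled_K_def)
  show "open ((\<lambda>x. \<epsilon> *\<^sub>R x) ` V)" by (rule open_scaling[OF _ V(1)]) (use e in simp)
  show "scaled_K \<epsilon> \<subseteq> (\<lambda>x. \<epsilon> *\<^sub>R x) ` V" using V(2) by (auto simp: scaled_K_def)
  show "x \<in> (\<lambda>x. \<epsilon> *\<^sub>R x) ` V \<Longrightarrow> scaled_cutoff \<epsilon> x = 1" using V(3) e by (auto simp: scaled_cutoff_def)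
qed

lemma lap_norm_rescale:
  assumes e: "\<epsilon> > 0" "\<epsilon> * R \<le> r" and \<psi>: "\<psi> \<in> test_functions T"
  shows "lap_norm (\<lambda>x. scaled_cutoff \<epsilon> x * zext \<Omega> u x + \<psi> x) = sqrt (\<epsilon> ^ p) * lap_norm (\<lambda>x. G \<epsilon> x + \<psi> (\<epsilon> *\<^sub>R x) / \<epsilon> ^ \<gamma>)"
    and "\<exists>L. wlap (G \<epsilon>) L"
proof -
  obtain v w where H: "H2s \<Omega> (zext \<Omega> u) v w" using H2_theta_H2s[OF domain(1) u] by metis
  have sc: "(\<lambda>x. (scaled_cutoff \<epsilon> (\<epsilon> *\<^sub>R x) * zext \<Omega> u (\<epsilon> *\<^sub>R x) + f x) / \<epsilon> ^ \<gamma>) = (\<lambda>x. G \<epsilon> x + f x / \<epsilon> ^ \<gamma>)" for f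
    using e by (simp add: scaled_cutoff_def G_def add_divide_distrib)
  note h = H2s_cutoff_add_test[OF domain(1) H ce_test[OF e] \<psi>]
  have "(lap_norm (\<lambda>x. scaled_cutoff \<epsilon> x * zext \<Omega> u x + \<psi> x))\<^sup>2 = \<epsilon> ^ p * (lap_norm (\<lambda>x. G \<epsilon> x + \<psi> (\<epsilon> *\<^sub>R x) / \<epsilon> ^ \<gamma>))\<^sup>2"
    using lap_norm_scale(1)[OF e(1) H2s_wlap[OF h] H2sD(1)[OF h], of \<gamma>] N unfolding sc p_def by simp
  then have "sqrt ((lap_norm (\<lambda>x. scaled_cutoff \<epsilon> x * zext \<Omega> u x + \<psi> x))\<^sup>2) = sqrt (\<epsilon> ^ p * (lap_norm (\<lambda>x. G \<epsilon> x + \<psi> (\<epsilon> *\<^sub>R x) / \<epsilon> ^ \<gamma>))\<^sup>2)" by (simp only:)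
  then show "lap_norm (\<lambda>x. scaled_cutoff \<epsilon> x * zext \<Omega> u x + \<psi> x) = sqrt (\<epsilon> ^ p) * lap_norm (\<lambda>x. G \<epsilon> x + \<psi> (\<epsilon> *\<^sub>R x) / \<epsilon> ^ \<gamma>)"
    by (simp add: real_sqrt_mult)
  note h0 = H2s_cutoff_add_test[OF domain(1) H ce_test[OF e] test_zero]
  have "\<exists>L. wlap (\<lambda>x. (scaled_cutoff \<epsilon> (\<epsilon> *\<^sub>R x) * zext \<Omega> u (\<epsilon> *\<^sub>R x) + 0) / \<epsilon> ^ \<gamma>) L"
    by (rule lap_norm_scale(2)[OF e(1) H2s_wlap[OF h0] H2sD(1)[OF h0]]) (use N in simp)
  then show "\<exists>L. wlap (G \<epsilon>) L" unfolding sc by simp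
qed

text \<open>The error does not depend on \<open>\<phi>\<close>, so it is the same for all
  corrections and passes unchanged to their infimum.\<close>

lemma lap_norm_compare:
  assumes e: "\<epsilon> > 0" "\<epsilon> * R \<le> r" and \<phi>: "\<phi> \<in> test_functions T"
  shows "\<bar>lap_norm (\<lambda>x. G \<epsilon> x + \<phi> x) - lap_norm (\<lambda>x. \<eta> x * U x + \<phi> x)\<bar> \<le> M \<epsilon>"
proof -
  obtain L where L: "wlap (G \<epsilon>) L" using lap_norm_rescale(2)[OF e \<phi>] by blast
  note LU = wlap_test[OF etaU] and L\<phi> = wlap_test[OF \<phi>]
  have M: "M \<epsilon> = lap_norm (\<lambda>x. G \<epsilon> x - \<eta> x * U x)" by (simp add: M_def G_def right_diff_distrib)
  have "lap_norm (\<lambda>x. (G \<epsilon> x - \<eta> x * U x) + (\<eta> x * U x + \<phi> x)) \<le> lap_norm (\<lambda>x. G \<epsilon> x - \<eta> x * U x) + lap_norm (\<lambda>x. \<eta> x * U x + \<phi> x)"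
    by (rule lap_norm_triangle(1)[OF wlap_diff[OF L LU] wlap_add[OF LU L\<phi>]])
  moreover have "lap_norm (\<lambda>x. (G \<epsilon> x + \<phi> x) - (G \<epsilon> x - \<eta> x * U x)) \<le> lap_norm (\<lambda>x. G \<epsilon> x + \<phi> x) + lap_norm (\<lambda>x. G \<epsilon> x - \<eta> x * U x)"
    by (rule lap_norm_triangle(2)[OF wlap_add[OF L L\<phi>] wlap_diff[OF L LU]])
  ultimately show ?thesis unfolding M by (simp add: add.commute)
qed

text \<open>Square root of the capacity on the blow-up scale, to be compared with \<open>c\<close>:
  the errors are additive for norms, not for energies.\<close>

definition a :: "real \<Rightarrow> real" where "a \<epsilon> = sqrt (cap_theta \<Omega> (scaled_K \<epsilon>) u) / sqrt (\<epsilon> ^ p)"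

lemma eventually_mult_less: assumes "b > 0" shows "\<forall>\<^sub>F \<epsilon> in at_right 0. \<epsilon> * k < (b::real)"
proof -
  have "((\<lambda>\<epsilon>. \<epsilon> * k) \<longlongrightarrow> 0 * k) (at_right 0)" by (intro tendsto_intros)
  then show ?thesis using assms by (intro order_tendstoD(2)) auto
qed

lemma eventually_upper_bound: assumes d: "\<delta> > 0" shows "\<forall>\<^sub>F \<epsilon> in at_right 0. a \<epsilon> \<le> c + \<delta> + M \<epsilon>"
proof -
  obtain \<phi> where \<phi>: "\<phi> \<in> test_functions (- K)" "lap_norm (\<lambda>x. \<eta> x * U x + \<phi> x) \<le> c + \<delta>"
    using cap_space_approx[OF N etaU d] unfolding c_def by blast
  \<comment> \<open>The correction is fixed before \<epsilon>; its support, scaled by \<epsilon>,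
    lies in the domain as soon as \<open>\<epsilon> * R'\<close> is below \<open>r\<close>.\<close>
  obtain R' where R': "R' > 0" "\<phi> \<in> test_functions (- K \<inter> ball 0 R')" using test_bounded_support[OF \<phi>(1)] by blast
  show ?thesis
    using eventually_mult_less[OF r(1), of R] eventually_mult_less[OF r(1), of R'] eventually_at_right_less[of 0]
  proof eventually_elim
    case (elim \<epsilon>)
    then have e: "\<epsilon> > 0" "\<epsilon> * R \<le> r" by auto
    define \<psi> where "\<psi> x = \<epsilon> ^ \<gamma> * \<phi> ((1 / \<epsilon>) *\<^sub>R x)" for x
    have \<psi>: "\<psi> \<in> test_functions (\<Omega> \<inter> - scaled_K \<epsilon>)" unfolding \<psi>_def[abs_def]
    proof (intro test_cmult test_scale[OF R'(2)])
      fix x :: 'a assume x: "x \<in> - K \<inter> ball 0 R'"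
      have "\<epsilon> * norm x < \<epsilon> * R'" using x e by simp
      then have "\<epsilon> * norm x < r" using elim by linarith
      then have "\<epsilon> *\<^sub>R x \<in> ball 0 r" using e by simp
      then have "\<epsilon> *\<^sub>R x \<in> \<Omega>" by (rule subsetD[OF r(2)])
      moreover have "\<epsilon> *\<^sub>R x \<notin> scaled_K \<epsilon>" using x e by (auto simp: scaled_K_def)
      ultimately show "(1 / (1 / \<epsilon>)) *\<^sub>R x \<in> \<Omega> \<inter> - scaled_K \<epsilon>" by simp
    qed (use e in simp)
    have \<psi>\<phi>: "\<psi> (\<epsilon> *\<^sub>R x) / \<epsilon> ^ \<gamma> = \<phi> x" for x using e by (simp add: \<psi>_def)
    have "cap_theta \<Omega> (scaled_K \<epsilon>) u \<le> (lap_norm (\<lambda>x. scaled_cutoff \<epsilon> x * zext \<Omega> u x + \<psi> x))\<^sup>2"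
      by (rule cap_theta_le[OF \<Omega> u ce_test[OF e] scaled_V[OF e(1)] \<psi>])
    then have "sqrt (cap_theta \<Omega> (scaled_K \<epsilon>) u) \<le> sqrt ((lap_norm (\<lambda>x. scaled_cutoff \<epsilon> x * zext \<Omega> u x + \<psi> x))\<^sup>2)"
      by (rule real_sqrt_le_mono)
    then have "sqrt (cap_theta \<Omega> (scaled_K \<epsilon>) u) \<le> lap_norm (\<lambda>x. scaled_cutoff \<epsilon> x * zext \<Omega> u x + \<psi> x)"
      by (simp only: real_sqrt_abs abs_of_nonneg[OF lap_norm_nonneg])
    then have "sqrt (cap_theta \<Omega> (scaled_K \<epsilon>) u) \<le> lap_norm (\<lambda>x. G \<epsilon> x + \<phi> x) * sqrt (\<epsilon> ^ p)"
      using lap_norm_rescale(1)[OF e \<psi>] by (simp add: \<psi>\<phi> mult.commute)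
    then have "a \<epsilon> \<le> lap_norm (\<lambda>x. G \<epsilon> x + \<phi> x)" unfolding a_def using e by (simp add: divide_le_eq)
    then show ?case using lap_norm_compare[OF e \<phi>(1)] \<phi>(2) by linarith
  qed
qed

text \<open>\<open>m\<close> is fixed before \<epsilon> because the ball of radius
  \<open>2 * 4 ^ m * \<epsilon> * R\<close>, which contains all annuli, has to lie in the domain.
  The constant \<open>C\<close> is common to all \<open>m\<close>, so the loss can be made small
  afterwards.\<close>

lemma eventually_lower_bound: "\<exists>C\<ge>0. \<forall>m>0. \<forall>\<^sub>F \<epsilon> in at_right 0. c - M \<epsilon> \<le> (1 + sqrt (C / real m)) * a \<epsilon>"
proof (rule cap_theta_ge[OF N])
  fix C :: real assume C: "C \<ge> 0"
    "\<And>(\<Omega> :: 'a set) K V u \<eta> \<rho> m c. open \<Omega> \<Longrightarrow> bounded \<Omega> \<Longrightarrow> u \<in> H2_theta \<Omega> \<Longrightarrow> compact K \<Longrightarrow> K \<subseteq> ball 0 \<rho> \<Longrightarrow>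
       \<eta> \<in> test_functions \<Omega> \<Longrightarrow> open V \<Longrightarrow> K \<subseteq> V \<Longrightarrow> (\<And>x. x \<in> V \<Longrightarrow> \<eta> x = 1) \<Longrightarrow>
       \<rho> > 0 \<Longrightarrow> m > 0 \<Longrightarrow> cball 0 (2 * 4 ^ m * \<rho>) \<subseteq> \<Omega> \<Longrightarrow>
       (\<And>\<psi>. \<psi> \<in> test_functions (- K) \<Longrightarrow> c \<le> lap_norm (\<lambda>x. \<eta> x * zext \<Omega> u x + \<psi> x)) \<Longrightarrow>
       c \<le> (1 + sqrt (C / real m)) * sqrt (cap_theta \<Omega> K u)"
  show "\<exists>C\<ge>0. \<forall>m>0. \<forall>\<^sub>F \<epsilon> in at_right 0. c - M \<epsilon> \<le> (1 + sqrt (C / real m)) * a \<epsilon>"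
  proof (intro exI[of _ C] conjI allI impI C(1))
    fix m :: nat assume m: "m > 0"
    show "\<forall>\<^sub>F \<epsilon> in at_right 0. c - M \<epsilon> \<le> (1 + sqrt (C / real m)) * a \<epsilon>"
      using eventually_mult_less[OF r(1), of R] eventually_mult_less[OF r(1), of "2 * 4 ^ m * R"] eventually_at_right_less[of 0]
    proof eventually_elim
      case (elim \<epsilon>)
      then have e: "\<epsilon> > 0" "\<epsilon> * R \<le> r" by auto
      have s: "sqrt (\<epsilon> ^ p) > 0" using e by simp
      \<comment> \<open>Scaling a correction of the blown-down problem back gives a correction for
        the limit problem, whose norm is at least \<open>c\<close>. The bound passed on may be
        negative, which \<open>cap_theta_ge\<close> permits.\<close>
      have "sqrt (\<epsilon> ^ p) * (c - M \<epsilon>) \<le> (1 + sqrt (C / real m)) * sqrt (cap_theta \<Omega> (scaled_K \<epsilon>) u)"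
      proof (rule C(2)[OF domain(1,2) u scaled_K[OF e(1)] ce_test[OF e] scaled_V[OF e(1)] _ m])
        show "\<epsilon> * R > 0" using e R by simp
        show "cball 0 (2 * 4 ^ m * (\<epsilon> * R)) \<subseteq> \<Omega>" using elim r(2) by (auto simp: mult_ac)
        fix \<psi> assume \<psi>: "\<psi> \<in> test_functions (- scaled_K \<epsilon>)"
        have \<phi>: "(\<lambda>x. (1 / \<epsilon> ^ \<gamma>) * \<psi> (\<epsilon> *\<^sub>R x)) \<in> test_functions (- K)"
        proof (intro test_cmult test_scale[OF \<psi> e(1)])
          show "(1 / \<epsilon>) *\<^sub>R x \<in> - K" if "x \<in> - scaled_K \<epsilon>" for x
          proof
            assume "(1 / \<epsilon>) *\<^sub>R x \<in> K"
            then have "\<epsilon> *\<^sub>R ((1 / \<epsilon>) *\<^sub>R x) \<in> scaled_K \<epsilon>" unfolding scaled_K_def by (rule imageI)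
            then show False using that e by simp
          qed
        qed
        have "cap_space \<eta> K U \<le> (lap_norm (\<lambda>x. \<eta> x * U x + (1 / \<epsilon> ^ \<gamma>) * \<psi> (\<epsilon> *\<^sub>R x)))\<^sup>2" by (rule cap_space_le[OF N etaU \<phi>])
        then have "c \<le> lap_norm (\<lambda>x. \<eta> x * U x + (1 / \<epsilon> ^ \<gamma>) * \<psi> (\<epsilon> *\<^sub>R x))"
          unfolding c_def by (rule real_le_lsqrt[rotated]) simp
        then have "c - M \<epsilon> \<le> lap_norm (\<lambda>x. G \<epsilon> x + \<psi> (\<epsilon> *\<^sub>R x) / \<epsilon> ^ \<gamma>)"
          using lap_norm_compare[OF e \<phi>] by simp
        then show "sqrt (\<epsilon> ^ p) * (c - M \<epsilon>) \<le> lap_norm (\<lambda>x. scaled_cutoff \<epsilon> x * zext \<Omega> u x + \<psi> x)"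
          unfolding lap_norm_rescale(1)[OF e \<psi>] using s by (intro mult_left_mono) auto
      qed
      then show ?case using s by (simp add: a_def le_divide_eq mult_ac)
    qed
  qed
qed

lemma c_sq: "c\<^sup>2 = cap_space \<eta> K U"
  using cap_space_nonneg[OF N etaU] by (simp add: c_def)

lemma a_tendsto: "(a \<longlongrightarrow> c) (at_right 0)"
proof (rule tendstoI)
  fix e :: real assume e: "e > 0"
  obtain C where C: "C \<ge> 0" "\<And>m. m > 0 \<Longrightarrow> \<forall>\<^sub>F \<epsilon> in at_right 0. c - M \<epsilon> \<le> (1 + sqrt (C / real m)) * a \<epsilon>"
    using eventually_lower_bound by blast
  \<comment> \<open>The bound \<open>c + 2\<close> for \<open>a \<epsilon>\<close> comes from the
    upper estimate with tolerance 1 and from \<open>M \<epsilon> < 1\<close>. It converts the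
    relative loss in the lower estimate into an absolute one below \<open>e / 2\<close>.\<close>
  have "((\<lambda>m. sqrt (C / real m) * (c + 2)) \<longlonglongrightarrow> sqrt 0 * (c + 2))"
    by (intro tendsto_intros tendsto_divide_0[OF tendsto_const] filterlim_at_top_imp_at_infinity filterlim_real_sequentially)
  then have "\<forall>\<^sub>F m in sequentially. sqrt (C / real m) * (c + 2) < e / 2" using e by (intro order_tendstoD(2)) auto
  then have "\<forall>\<^sub>F m in sequentially. sqrt (C / real m) * (c + 2) < e / 2 \<and> m > 0" by (intro eventually_conj eventually_gt_at_top)
  then obtain m where m: "sqrt (C / real m) * (c + 2) < e / 2" "m > 0" using eventually_happens'[OF sequentially_bot] by blast
  have Me: "\<forall>\<^sub>F \<epsilon> in at_right 0. M \<epsilon> < min 1 (e / 2)" using M_tendsto e by (intro order_tendstoD(2)) auto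
  have "e / 2 > 0" using e by simp
  from Me eventually_upper_bound[OF this] eventually_upper_bound[of 1, OF zero_less_one] C(2)[OF m(2)]
  show "\<forall>\<^sub>F \<epsilon> in at_right 0. dist (a \<epsilon>) c < e"
  proof eventually_elim
    case (elim \<epsilon>)
    have "a \<epsilon> \<le> c + 2" using elim by auto
    then have "sqrt (C / real m) * a \<epsilon> \<le> sqrt (C / real m) * (c + 2)" using C(1) by (intro mult_left_mono) auto
    then show ?case using elim m(1) by (simp add: dist_real_def abs_less_iff distrib_right)
  qed
qed

lemma cap_theta_asymptotics:
  "\<exists>\<rho> \<in> o[at_right 0](\<lambda>_. 1). \<forall>\<^sub>F \<epsilon> in at_right (0::real). cap_theta \<Omega> (scaled_K \<epsilon>) u = \<epsilon> ^ p * (cap_space \<eta> K U + \<rho> \<epsilon>)"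
proof (rule bexI)
  have "((\<lambda>\<epsilon>. (a \<epsilon>)\<^sup>2 - cap_space \<eta> K U) \<longlongrightarrow> c\<^sup>2 - cap_space \<eta> K U) (at_right 0)" by (intro tendsto_intros a_tendsto)
  then show "(\<lambda>\<epsilon>. (a \<epsilon>)\<^sup>2 - cap_space \<eta> K U) \<in> o[at_right 0](\<lambda>_. 1)" by (intro smalloI_tendsto) (auto simp: c_sq)
  show "\<forall>\<^sub>F \<epsilon> in at_right 0. cap_theta \<Omega> (scaled_K \<epsilon>) u = \<epsilon> ^ p * (cap_space \<eta> K U + ((a \<epsilon>)\<^sup>2 - cap_space \<eta> K U))"
    using eventually_at_right_less[of 0]
  proof eventually_elim
    case (elim \<epsilon>)
    \<comment> \<open>Nonnegativity lets the square of \<open>a \<epsilon>\<close> recover the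
      capacity itself.\<close>
    have "cap_theta \<Omega> (scaled_K \<epsilon>) u \<ge> 0" unfolding cap_theta_def
    proof (rule cInf_greatest)
      show "{LINT x|lebesgue_on \<Omega>. (weak_laplacian \<Omega> f x)\<^sup>2 | f. f \<in> H2_theta \<Omega> \<and> (\<lambda>x. f x - u x) \<in> H2_theta_0 \<Omega> (scaled_K \<epsilon>)} \<noteq> {}"
        using zero_in_H2_theta_0[OF domain(1) u, of "scaled_K \<epsilon>"] u by (auto intro!: exI[of _ u])
    qed auto
    then show ?case using elim by (simp add: a_def power_divide)
  qed
qed

end

theorem theorem1p4:
  fixes \<Omega> \<K> :: "(real ^ 'n) set"
    and lam :: real
    and u U\<^sub>0 \<eta> :: "real ^ 'n \<Rightarrow> real"
    and \<gamma> :: nat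
  assumes "CARD('n) > 4"
    and "smooth_bounded_domain \<Omega>" and "0 \<in> \<Omega>"
    and "compact \<K>"
    and "navier_eigenpair \<Omega> lam u"
    and "Lp_norm 2 \<Omega> u = 1"
    and "vanishing_profile u \<gamma> U\<^sub>0"
    and "cutoff \<K> \<eta>"
  shows "\<exists>r \<in> o[at_right 0](\<lambda>_. 1). \<forall>\<^sub>F \<epsilon> in at_right (0::real).
           cap_theta \<Omega> ((\<lambda>x. \<epsilon> *\<^sub>R x) ` \<K>) u =
           \<epsilon> ^ (CARD('n) - 4 + 2 * \<gamma>) * (cap_space \<eta> \<K> U\<^sub>0 + r \<epsilon>)"
proof -
  have "open \<Omega>" using assms(2) by (simp add: smooth_bounded_domain_def)
  then obtain r where r: "r > 0" "ball 0 r \<subseteq> \<Omega>" using assms(3) open_contains_ball by blast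
  obtain V where V: "\<eta> \<in> test_functions UNIV" "open V" "\<K> \<subseteq> V" "\<And>x. x \<in> V \<Longrightarrow> \<eta> x = 1"
    using assms(8) unfolding cutoff_def by blast
  \<comment> \<open>A single ball must contain the obstacle and the support of the cutoff, since the
    blow-up converges on balls.\<close>
  have "bounded (\<K> \<union> closure {x. \<eta> x \<noteq> 0})"
    using assms(4) V(1) by (auto simp: test_functions_iff compact_imp_bounded)
  then obtain R where R: "R > 0" "\<K> \<union> closure {x. \<eta> x \<noteq> 0} \<subseteq> ball 0 R" using bounded_subset_ballD by blast
  have \<eta>: "\<eta> \<in> test_functions (ball 0 R)" using V(1) R(2) by (simp add: test_functions_iff)
  have U: "smooth U\<^sub>0" "tendsto_Hk 2 (ball 0 R) (\<lambda>\<epsilon> x. u (\<epsilon> *\<^sub>R x) / \<epsilon> ^ \<gamma>) U\<^sub>0 (at_right (0::real))"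
    using assms(7) R(1) by (auto simp: vanishing_profile_def homogeneous_polynomial_def intro: smooth_polynomial)
  interpret blow_up \<Omega> \<K> V u U\<^sub>0 \<eta> \<gamma> R r
    by unfold_locales (use assms r V R \<eta> U in \<open>auto simp: navier_eigenpair_def\<close>)
  show ?thesis using cap_theta_asymptotics unfolding scaled_K_def p_def by simp
qed

end
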